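(* Fix a base configuration $\bar u$, a degree $\ell\ge 0$ and $\epsilon>0$ as in the context, let $O$ be either $O_{\mathrm{VR}}$ (Vietoris-Rips case) or $O_{\mathrm{Alp}}$ (alpha case), and let $f: O\to\mathbb{R}^m$ be the persistence map described in the context. Then $f$ is of class $C^\infty$ on $O$. Moreover, the derivatives of $f$ are independent of the choice of algorithm up to permutations of the coordinates of $\mathbb{R}^m$, in the following sense: let $u\in O$ and let $$(\sigma_{i_1},\sigma_{j_1}),\dots,(\sigma_{i_s},\sigma_{j_s}),\ \sigma_{i_{s+1}},\dots,\sigma_{i_{s+t}}\quad\text{and}\quad(\sigma_{i'_1},\sigma_{j'_1}),\dots,(\sigma_{i'_s},\sigma_{j'_s}),\ \sigma_{i'_{s+1}},\dots,\sigma_{i'_{s+t}}$$ be two lists of simplices in $W$, produced by two algorithms computing the persistence data, so that for each list the truncated persistence diagram $T_\epsilon(D_\ell(\mathcal{X}_{P(u)}))$ equals, as a multiset, the collection of the pairs $(r_{\sigma_{i_k}}(u),r_{\sigma_{j_k}}(u))$, $1\le k\le s$, together with $(r_{\sigma_{i_k}}(u),\infty)$, $s+1\le k\le s+t$ (respectively the same with $i'_k,j'_k$). Then, after permuting the finite pairs and permuting the remaining entries of the second list, one has $$\frac{\partial r_{\sigma_{i_k}}}{\partial u}(u)=\frac{\partial r_{\sigma_{i'_k}}}{\partial u}(u)\ (1\le k\le s+t),\qquad \frac{\partial r_{\sigma_{j_k}}}{\partial u}(u)=\frac{\partial r_{\sigma_{j'_k}}}{\partial u}(u)\ (1\le k\le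 s).$$
   Context: **Configurations.** A point $u=(u_1,\dots,u_M)\in\mathbb{R}^n$, $n=LM$, with $u_i\in\mathbb{R}^L$, is identified with the (indexed) point cloud $P(u)=\{u_1,\dots,u_M\}\subset\mathbb{R}^L$. Simplices are regarded as subsets of the index set $\{1,\dots,M\}$. In the alpha case $L=3$. **Vietoris-Rips filtration.** $\mathrm{VR}(P,r)$ has as simplices the nonempty $\sigma\subset P$ such that the open balls of radius $r$ around any two points of $\sigma$ intersect. The birth radius of $\sigma=\{u_{i_0},\dots,u_{i_\ell}\}$ is $r_\sigma=\frac12\max_{a<b}\|u_{i_b}-u_{i_a}\|$ ($0$ for vertices); an edge attaining the maximum is an attaching edge of $\sigma$. $W$ is the set of all nonempty subsets of $\{1,\dots,M\}$. $U_{\mathrm{VR}}\subset\mathbb{R}^n$ (Vietoris-Rips general position) is the set of $u$ with (i) $u_i\ne u_j$ for $i\neq j$, (ii) $r_\tau\neq r_{\tau'}$ for any attaching edges $\tau\ne\tau'$. **Alpha filtration ($L=3$).** An open ball $B$ is $P$-empty if $B\cap P=\emptyset$. The Delaunay complex $\mathrm{Del}(P)$ consists of the simplices $\sigma\subset P$ with $1\le|\sigma|\le4$ for which there is a $P$-empty open ball $B$ with $\partial B\cap P=\sigma$. For such $\sigma$ with $|\sigma|\ge2$ let $B_\sigma$ be the smallest open ball with $\sigma\subset\partial B_\sigma$, and $\rho_\sigma$ its radius. $\sigma$ is an attaching simplex if it is a vertex, or if $B_\sigma$ is $P$-empty. $\mathrm{Alp}(P,\alpha)$ consists of all vertices, all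 attaching simplices $\sigma$ with $\rho_\sigma<\alpha$, and all faces of these. The birth radius $r_\sigma$ of $\sigma\in\mathrm{Del}(P)$ is the infimum of $\alpha$ with $\sigma\in\mathrm{Alp}(P,\alpha)$; thus $r_\sigma=0$ for vertices, $r_\sigma=\rho_\sigma$ if $\sigma$ is attaching with $|\sigma|\geq 2$, and otherwise $r_\sigma=r_\tau$ for some attaching $\tau\supset\sigma$. $U_{\mathrm{Alp}}\subset\mathbb{R}^n$ (alpha general position) is the set of $u$ such that (i) the points are distinct and in general position (no four points coplanar, no three collinear, no five points on a common sphere), (ii) $r_\tau\ne r_{\tau'}$ for any attaching simplices $\tau\neq\tau'$ that are not $0$-simplices. **Persistence diagrams.** For a filtration $\mathcal{X}$ (Vietoris-Rips or alpha) in which each simplex $\sigma$ enters at its birth radius $r_\sigma$, and a fixed coefficient field $k$, the $\ell$-th persistence diagram $D_\ell(\mathcal{X})$ is the finite multiset of birth-death pairs $(b,d)$, $b<d\le\infty$, from the interval decomposition of persistent homology $H_\ell(\mathcal{X})$. On $\bar{\mathbb{R}}^2$, $\bar{\mathbb{R}}=\mathbb{R}\cup\{\infty\}$, $d_\infty(p,q)=\max\{|p_1-q_1|,|p_2-q_2|\}$, $\Delta$ is the diagonal, and $T_\epsilon(D)=\{p\in D\mid d_\infty(p,\Delta)\ge\epsilon\}$ (as a multiset). **Domain.** Fix $\bar u\in\mathbb{R}^n$ (with $M$ distinct points), let $\delta=d_\infty(D_\ell(\mathcal{X}_{P(\bar u)}),\Delta)$ (infimum over points of the diagram), and $0<\epsilon<\delta/2$.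 Let $O^\epsilon_{\bar u}$ be the set of $u'\in\mathbb{R}^n$ with $d_{\mathrm{GH}}(P(\bar u),P(u'))<\epsilon$ (Gromov-Hausdorff distance, Vietoris-Rips case), respectively $d_{\mathrm{H}}(P(\bar u),P(u'))<\epsilon$ (Hausdorff distance, alpha case). Set $O_{\mathrm{VR}}=O^\epsilon_{\bar u}\cap U_{\mathrm{VR}}$. In the alpha case assume $\bar u\in U_{\mathrm{Alp}}$, let $\tilde O_{\bar u}$ be an open neighborhood of $\bar u$ on which $\mathrm{Del}(P(u'))=\mathrm{Del}(P(\bar u))$ (as complexes on the index set), set $W=\mathrm{Del}(P(\bar u))$ and $O_{\mathrm{Alp}}=O^\epsilon_{\bar u}\cap\tilde O_{\bar u}\cap U_{\mathrm{Alp}}$. For $u'\in O^\epsilon_{\bar u}$ one has $|T_\epsilon(D_\ell(\mathcal{X}_{P(u')}))|=|D_\ell(\mathcal{X}_{P(\bar u)})|$; the latter has $s$ finite pairs and $t$ pairs with $d=\infty$, and $m=2s+t$. **Persistence map.** For $u\in O$, order $W$ as $\sigma_1<\dots<\sigma_K$ by the lexicographic order of $(r_\sigma,\dim\sigma)$, ties broken by a fixed rule (a fixed total order on $W$). Let $B$ be the $K\times K$ matrix over $k$ of the boundary map in this ordered basis (the $j$-th column is $\partial\sigma_j$, each simplex oriented by increasing indices). For a nonzero column, its pivot is the largest row index of a nonzero entry. Using column operations adding multiples of a column to columns to its right, transform $B$ into a matrix $B'$ in which no two nonzero columns have the same pivot. Let $P_{B'}=\{(i,j)\mid B'_j\neq0,\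 i=\mathrm{pivot}(B'_j)\}$ and $E_{B'}$ the set of indices in $\{1,\dots,K\}$ occurring in no pair of $P_{B'}$. Then $$f(u)=(r_{\sigma_{i_1}},r_{\sigma_{j_1}},\dots,r_{\sigma_{i_s}},r_{\sigma_{j_s}},r_{\sigma_{i_{s+1}}},\dots,r_{\sigma_{i_{s+t}}})\in\mathbb{R}^m,$$ where $(i_1,j_1),\dots,(i_s,j_s)$ are the pairs $(i,j)\in P_{B'}$ with $\dim\sigma_i=\ell$ and $d_\infty((r_{\sigma_i},r_{\sigma_j}),\Delta)\ge\epsilon$, and $i_{s+1},\dots,i_{s+t}$ are the $i\in E_{B'}$ with $\dim\sigma_i=\ell$, each listed by increasing $i$. The entries of $f(u)$ are the finite coordinates of the points of $T_\epsilon(D_\ell(\mathcal{X}_{P(u)}))$. *)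

theory Defs
  imports "HOL-Analysis.Analysis" "HOL-Library.Multiset"
begin

text \<open>A configuration of \<open>M = CARD('m)\<close> points in \<open>R^L\<close>, \<open>L = CARD('l)\<close>, is a vector
  \<open>u :: real^'l^'m\<close>, so that the type \<open>real^'l^'m\<close> is the Euclidean space \<open>R^n\<close> with \<open>n = L * M\<close>.
  Simplices are sets of indices, i.e. elements of \<open>'m set\<close>; \<open>\<sigma>\<close> has dimension \<open>card \<sigma> - 1\<close>.\<close>

type_synonym ('l, 'm) config = "real^'l^'m"

definition cloud :: "('l::finite, 'm::finite) config \<Rightarrow> (real^'l) set" where
  "cloud u = range (\<lambda>i. u $ i)"

definition distinct_points :: "('l::finite, 'm::finite) config \<Rightarrow> bool" where
  "distinct_points u \<longleftrightarrow> inj (\<lambda>i. u $ i)"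


section \<open>Hausdorff and Gromov-Hausdorff distance\<close>

text \<open>The conditionally complete suprema and infima are the true ones for bounded nonempty sets,
  in particular for the nonempty finite sets to which the notion is applied.\<close>

definition hausdorff_dist :: "('a \<Rightarrow> 'a \<Rightarrow> real) \<Rightarrow> 'a set \<Rightarrow> 'a set \<Rightarrow> real" where
  "hausdorff_dist d A B = max (SUP a\<in>A. INF b\<in>B. d a b) (SUP b\<in>B. INF a\<in>A. d a b)"

definition isometric_embedding ::
  "'a::metric_space set \<Rightarrow> 'z set \<Rightarrow> ('z \<Rightarrow> 'z \<Rightarrow> real) \<Rightarrow> ('a \<Rightarrow> 'z) \<Rightarrow> bool" where
  "isometric_embedding P S d \<phi> \<longleftrightarrow>
     \<phi> ` P \<subseteq> S \<and> (\<forall>x\<in>P. \<forall>y\<in>P. d (\<phi> x) (\<phi> y) = dist x y)"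

text \<open>The ambient metric spaces \<open>(S, d)\<close> are taken with \<open>S\<close> a subset of the sum type. This is no
  restriction: the Hausdorff distance only depends on the metric on \<open>\<phi> ` P \<union> \<psi> ` Q\<close>, and this union
  can be relabelled by elements of \<open>Inl ` P \<union> Inr ` Q\<close>.\<close>

definition gromov_hausdorff_dist :: "'a::metric_space set \<Rightarrow> 'b::metric_space set \<Rightarrow> real" where
  "gromov_hausdorff_dist P Q =
     Inf {hausdorff_dist d (\<phi> ` P) (\<psi> ` Q) | (S :: ('a + 'b) set) d \<phi> \<psi>.
            Metric_space S d \<and> isometric_embedding P S d \<phi> \<and> isometric_embedding Q S d \<psi>}"


section \<open>Vietoris-Rips filtration\<close>

definition VR :: "('l::finite, 'm::finite) config \<Rightarrow> real \<Rightarrow> 'm set set" where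
  "VR u r = {\<sigma>. \<sigma> \<noteq> {} \<and> (\<forall>i\<in>\<sigma>. \<forall>j\<in>\<sigma>. ball (u $ i) r \<inter> ball (u $ j) r \<noteq> {})}"

definition VR_birth :: "('l::finite, 'm::finite) config \<Rightarrow> 'm set \<Rightarrow> real" where
  "VR_birth u \<sigma> = Max {dist (u $ i) (u $ j) | i j. i \<in> \<sigma> \<and> j \<in> \<sigma>} / 2"

definition attaching_edge :: "('l::finite, 'm::finite) config \<Rightarrow> 'm set \<Rightarrow> 'm set \<Rightarrow> bool" where
  "attaching_edge u \<sigma> \<tau> \<longleftrightarrow> card \<tau> = 2 \<and> \<tau> \<subseteq> \<sigma> \<and> VR_birth u \<tau> = VR_birth u \<sigma>"

definition U_VR :: "('l::finite, 'm::finite) config set" where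
  "U_VR = {u. distinct_points u \<and>
     (\<forall>\<tau> \<tau>'. (\<exists>\<sigma>. attaching_edge u \<sigma> \<tau>) \<longrightarrow> (\<exists>\<sigma>. attaching_edge u \<sigma> \<tau>') \<longrightarrow> \<tau> \<noteq> \<tau>' \<longrightarrow>
        VR_birth u \<tau> \<noteq> VR_birth u \<tau>')}"


section \<open>Alpha filtration\<close>

text \<open>These notions are meant for \<open>CARD('l) = 3\<close>.\<close>

definition Del :: "('l::finite, 'm::finite) config \<Rightarrow> 'm set set" where
  "Del u = {\<sigma>. 1 \<le> card \<sigma> \<and> card \<sigma> \<le> 4 \<and>
     (\<exists>c \<rho>. \<rho> > 0 \<and> ball c \<rho> \<inter> cloud u = {} \<and> {i. u $ i \<in> sphere c \<rho>} = \<sigma>)}"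

text \<open>Centre and radius of the smallest ball with the vertices of \<open>\<sigma>\<close> on its boundary.\<close>

definition min_circumball :: "('l::finite, 'm::finite) config \<Rightarrow> 'm set \<Rightarrow> (real^'l) \<times> real" where
  "min_circumball u \<sigma> = (THE (c, \<rho>). \<rho> > 0 \<and> (\<forall>i\<in>\<sigma>. u $ i \<in> sphere c \<rho>) \<and>
     (\<forall>c' \<rho>'. \<rho>' > 0 \<and> (\<forall>i\<in>\<sigma>. u $ i \<in> sphere c' \<rho>') \<longrightarrow> \<rho> \<le> \<rho>'))"

definition circumradius :: "('l::finite, 'm::finite) config \<Rightarrow> 'm set \<Rightarrow> real" where
  "circumradius u \<sigma> = snd (min_circumball u \<sigma>)"

definition circumball :: "('l::finite, 'm::finite) config \<Rightarrow> 'm set \<Rightarrow> (real^'l) set" where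
  "circumball u \<sigma> = ball (fst (min_circumball u \<sigma>)) (circumradius u \<sigma>)"

definition attaching_simplex :: "('l::finite, 'm::finite) config \<Rightarrow> 'm set \<Rightarrow> bool" where
  "attaching_simplex u \<sigma> \<longleftrightarrow>
     \<sigma> \<in> Del u \<and> (card \<sigma> = 1 \<or> circumball u \<sigma> \<inter> cloud u = {})"

definition Alp :: "('l::finite, 'm::finite) config \<Rightarrow> real \<Rightarrow> 'm set set" where
  "Alp u \<alpha> = {{i} | i. True} \<union>
     {\<sigma>. \<sigma> \<noteq> {} \<and> (\<exists>\<tau>. \<sigma> \<subseteq> \<tau> \<and> card \<tau> \<ge> 2 \<and> attaching_simplex u \<tau> \<and> circumradius u \<tau> < \<alpha>)}"

text \<open>The parameter of the filtration is a radius, hence positive.\<close>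

definition Alp_birth :: "('l::finite, 'm::finite) config \<Rightarrow> 'm set \<Rightarrow> real" where
  "Alp_birth u \<sigma> = Inf {\<alpha>. \<alpha> > 0 \<and> \<sigma> \<in> Alp u \<alpha>}"

definition U_Alp :: "('l::finite, 'm::finite) config set" where
  "U_Alp = {u. distinct_points u \<and>
     (\<forall>S. card S = 4 \<longrightarrow> \<not> coplanar ((\<lambda>i. u $ i) ` S)) \<and>
     (\<forall>S. card S = 3 \<longrightarrow> \<not> collinear ((\<lambda>i. u $ i) ` S)) \<and>
     (\<forall>S. card S = 5 \<longrightarrow> \<not> (\<exists>c \<rho>. (\<lambda>i. u $ i) ` S \<subseteq> sphere c \<rho>)) \<and>
     (\<forall>\<tau> \<tau>'. attaching_simplex u \<tau> \<longrightarrow> attaching_simplex u \<tau>' \<longrightarrow>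
        card \<tau> \<noteq> 1 \<longrightarrow> card \<tau>' \<noteq> 1 \<longrightarrow> \<tau> \<noteq> \<tau>' \<longrightarrow> Alp_birth u \<tau> \<noteq> Alp_birth u \<tau>')}"


section \<open>Simplicial homology over a field\<close>

text \<open>Coefficient of \<open>\<tau>\<close> in the boundary of \<open>\<sigma>\<close>, where \<open>\<sigma>\<close> is oriented by increasing indices:
  the face omitting \<open>v\<close> has the sign given by the number of vertices of \<open>\<sigma>\<close> before \<open>v\<close>.
  Vertices have zero boundary.\<close>

definition bd_coeff :: "'m::{finite, linorder} set \<Rightarrow> 'm set \<Rightarrow> 'k::field" where
  "bd_coeff \<sigma> \<tau> =
     (\<Sum>v\<in>\<sigma>. if \<tau> \<noteq> {} \<and> \<tau> = \<sigma> - {v} then (- 1) ^ card {w\<in>\<sigma>. w < v} else 0)"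

definition boundary :: "('m::{finite, linorder} set \<Rightarrow> 'k::field) \<Rightarrow> 'm set \<Rightarrow> 'k" where
  "boundary z = (\<lambda>\<tau>. \<Sum>\<sigma>\<in>UNIV. z \<sigma> * bd_coeff \<sigma> \<tau>)"

definition chains :: "'m set set \<Rightarrow> nat \<Rightarrow> ('m set \<Rightarrow> 'k::field) set" where
  "chains X l = {z. \<forall>\<sigma>. z \<sigma> \<noteq> 0 \<longrightarrow> \<sigma> \<in> X \<and> card \<sigma> = Suc l}"

definition cycles :: "'m::{finite, linorder} set set \<Rightarrow> nat \<Rightarrow> ('m set \<Rightarrow> 'k::field) set" where
  "cycles X l = {z \<in> chains X l. boundary z = (\<lambda>_. 0)}"

definition boundaries :: "'m::{finite, linorder} set set \<Rightarrow> nat \<Rightarrow> ('m set \<Rightarrow> 'k::field) set" where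
  "boundaries X l = boundary ` chains X (Suc l)"

text \<open>Equality of classes in \<open>H_l(X) = cycles X l / boundaries X l\<close>.\<close>

definition homologous ::
  "'m::{finite, linorder} set set \<Rightarrow> nat \<Rightarrow> ('m set \<Rightarrow> 'k::field) \<Rightarrow> ('m set \<Rightarrow> 'k) \<Rightarrow> bool" where
  "homologous X l z z' \<longleftrightarrow> (\<lambda>\<sigma>. z \<sigma> - z' \<sigma>) \<in> boundaries X l"


section \<open>Persistence diagrams\<close>

type_synonym diagram = "(ereal \<times> ereal) multiset"

text \<open>Let \<open>X r\<close> (\<open>r > 0\<close>) be a filtration. Since a simplex belongs to \<open>X r\<close> iff \<open>r\<close> is larger
  than its birth radius, the interval of \<open>(b, d)\<close> is \<open>{r > 0. b < r \<le> d}\<close>.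
  An isomorphism of persistence modules from the direct sum of the interval modules of the list
  \<open>ps\<close> to \<open>H_l(X)\<close> is given by the images of the generators. The generator of the \<open>j\<close>-th summand at
  parameter \<open>r\<close> goes to the class of a cycle \<open>e j r\<close>; at each \<open>r\<close> the classes of the active
  generators form a basis of \<open>H_l(X r)\<close>, and for \<open>r \<le> r'\<close> the map induced by the inclusion sends the
  class of \<open>e j r\<close> to that of \<open>e j r'\<close>, or to zero once the interval has ended.\<close>

definition active :: "(ereal \<times> ereal) list \<Rightarrow> real \<Rightarrow> nat set" where
  "active ps r = {j. j < length ps \<and> fst (ps ! j) < ereal r \<and> ereal r \<le> snd (ps ! j)}"

definition interval_decomposition ::
  "nat \<Rightarrow> (real \<Rightarrow> 'm::{finite, linorder} set set) \<Rightarrow> (ereal \<times> ereal) list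
     \<Rightarrow> (nat \<Rightarrow> real \<Rightarrow> 'm set \<Rightarrow> 'k::field) \<Rightarrow> bool" where
  "interval_decomposition l X ps e \<longleftrightarrow>
     (\<forall>p\<in>set ps. 0 \<le> fst p \<and> fst p < snd p) \<and>
     (\<forall>r>0. \<forall>j\<in>active ps r. e j r \<in> cycles (X r) l) \<and>
     (\<forall>r>0. \<forall>z\<in>cycles (X r) l. \<exists>!c. (\<forall>j. j \<notin> active ps r \<longrightarrow> c j = 0) \<and>
        homologous (X r) l z (\<lambda>\<sigma>. \<Sum>j\<in>active ps r. c j * e j r \<sigma>)) \<and>
     (\<forall>r>0. \<forall>r'\<ge>r. \<forall>j\<in>active ps r.
        homologous (X r') l (e j r) (if j \<in> active ps r' then e j r' else (\<lambda>_. 0)))"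

text \<open>The first argument only carries the coefficient field.\<close>

definition dgm ::
  "'k::field itself \<Rightarrow> nat \<Rightarrow> (real \<Rightarrow> 'm::{finite, linorder} set set) \<Rightarrow> diagram" where
  "dgm k l X = (THE D. \<exists>ps (e :: nat \<Rightarrow> real \<Rightarrow> 'm set \<Rightarrow> 'k).
     D = mset ps \<and> interval_decomposition l X ps e)"

text \<open>Points of the extended plane. The convention \<open>\<infinity> - \<infinity> = \<infinity>\<close> of \<open>ereal\<close> is harmless
  below, as the distance of a point \<open>(b, \<infinity>)\<close> with \<open>b\<close> finite to any diagonal point is \<open>\<infinity>\<close>.\<close>

definition d_inf :: "ereal \<times> ereal \<Rightarrow> ereal \<times> ereal \<Rightarrow> ereal" where
  "d_inf p q = max \<bar>fst p - fst q\<bar> \<bar>snd p - snd q\<bar>"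

definition diag_dist :: "ereal \<times> ereal \<Rightarrow> ereal" where
  "diag_dist p = (INF x\<in>{x. x \<noteq> -\<infinity>}. d_inf p (x, x))"

definition diagram_diag_dist :: "diagram \<Rightarrow> ereal" where
  "diagram_diag_dist D = (INF p\<in>set_mset D. diag_dist p)"

definition truncate :: "real \<Rightarrow> diagram \<Rightarrow> diagram" where
  "truncate \<epsilon> D = {#p \<in># D. diag_dist p \<ge> ereal \<epsilon>#}"

definition n_finite :: "diagram \<Rightarrow> nat" where
  "n_finite D = size {#p \<in># D. snd p \<noteq> \<infinity>#}"

definition n_infinite :: "diagram \<Rightarrow> nat" where
  "n_infinite D = size {#p \<in># D. snd p = \<infinity>#}"


section \<open>The persistence map\<close>

text \<open>Lexicographic order of (birth radius, dimension), ties broken by the total order \<open>tie\<close>.\<close>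

definition simplex_less :: "('m set \<Rightarrow> real) \<Rightarrow> 'm set rel \<Rightarrow> 'm set \<Rightarrow> 'm set \<Rightarrow> bool" where
  "simplex_less r tie \<sigma> \<tau> \<longleftrightarrow>
     r \<sigma> < r \<tau> \<or> (r \<sigma> = r \<tau> \<and>
       (card \<sigma> < card \<tau> \<or> (card \<sigma> = card \<tau> \<and> \<sigma> \<noteq> \<tau> \<and> (\<sigma>, \<tau>) \<in> tie)))"

text \<open>A \<open>K \<times> K\<close> matrix is a function of a row and a column index, both in \<open>{0..<K}\<close>.\<close>

type_synonym 'k matr = "nat \<Rightarrow> nat \<Rightarrow> 'k"

definition bd_matrix :: "'m::{finite, linorder} set list \<Rightarrow> 'k::field matr" where
  "bd_matrix xs = (\<lambda>i j. if i < length xs \<and> j < length xs then bd_coeff (xs ! j) (xs ! i) else 0)"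

definition column_operation :: "nat \<Rightarrow> 'k::field matr \<Rightarrow> 'k matr \<Rightarrow> bool" where
  "column_operation K B B' \<longleftrightarrow> (\<exists>a b c. a < b \<and> b < K \<and>
     B' = (\<lambda>i j. if j = b then B i b + c * B i a else B i j))"

definition nonzero_column :: "nat \<Rightarrow> 'k::field matr \<Rightarrow> nat \<Rightarrow> bool" where
  "nonzero_column K B j \<longleftrightarrow> (\<exists>i<K. B i j \<noteq> 0)"

definition pivot :: "nat \<Rightarrow> 'k::field matr \<Rightarrow> nat \<Rightarrow> nat" where
  "pivot K B j = Max {i. i < K \<and> B i j \<noteq> 0}"

definition reduced :: "nat \<Rightarrow> 'k::field matr \<Rightarrow> bool" where
  "reduced K B \<longleftrightarrow> (\<forall>j<K. \<forall>j'<K. j \<noteq> j' \<longrightarrow> nonzero_column K B j \<longrightarrow> nonzero_column K B j' \<longrightarrow>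
     pivot K B j \<noteq> pivot K B j')"

definition pivot_pairs :: "nat \<Rightarrow> 'k::field matr \<Rightarrow> (nat \<times> nat) set" where
  "pivot_pairs K B = {(i, j). j < K \<and> nonzero_column K B j \<and> i = pivot K B j}"

definition essential_indices :: "nat \<Rightarrow> 'k::field matr \<Rightarrow> nat set" where
  "essential_indices K B = {i. i < K \<and> (\<forall>(a, b)\<in>pivot_pairs K B. i \<noteq> a \<and> i \<noteq> b)}"

text \<open>\<open>ys\<close> is the vector obtained from the ordered simplices of \<open>W\<close> with birth radii \<open>r\<close> by some
  reduction \<open>B'\<close> of the boundary matrix; no particular reduction algorithm is fixed.\<close>

definition persistence_vector ::
  "'k::field itself \<Rightarrow> nat \<Rightarrow> real \<Rightarrow> 'm::{finite, linorder} set rel \<Rightarrow> 'm set set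
     \<Rightarrow> ('m set \<Rightarrow> real) \<Rightarrow> real list \<Rightarrow> bool" where
  "persistence_vector k l \<epsilon> tie W r ys \<longleftrightarrow>
     (\<exists>xs (B' :: 'k matr) ps es.
        set xs = W \<and> sorted_wrt (simplex_less r tie) xs \<and>
        (column_operation (length xs))\<^sup>*\<^sup>* (bd_matrix xs) B' \<and> reduced (length xs) B' \<and>
        set ps = {(i, j) \<in> pivot_pairs (length xs) B'. card (xs ! i) = Suc l \<and>
                    diag_dist (ereal (r (xs ! i)), ereal (r (xs ! j))) \<ge> ereal \<epsilon>} \<and>
        sorted_wrt (\<lambda>p q. fst p < fst q) ps \<and>
        set es = {i \<in> essential_indices (length xs) B'. card (xs ! i) = Suc l} \<and>
        sorted_wrt (<) es \<and>
        ys = concat (map (\<lambda>(i, j). [r (xs ! i), r (xs ! j)]) ps) @ map (\<lambda>i. r (xs ! i)) es)"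


section \<open>Smooth functions\<close>

text \<open>Functions of class \<open>C^n\<close> on an open subset of a Euclidean space: for fixed \<open>v\<close> the
  directional derivative is required to be of class \<open>C^(n-1)\<close>. For finite-dimensional domains this
  is the usual notion.\<close>

primrec C_on :: "nat \<Rightarrow> 'a::euclidean_space set \<Rightarrow> ('a \<Rightarrow> 'b::real_normed_vector) \<Rightarrow> bool" where
  "C_on 0 S g \<longleftrightarrow> continuous_on S g"
| "C_on (Suc n) S g \<longleftrightarrow> (\<forall>x\<in>S. g differentiable (at x)) \<and>
     (\<forall>v. C_on n S (\<lambda>x. frechet_derivative g (at x) v))"

definition smooth_on :: "'a::euclidean_space set \<Rightarrow> ('a \<Rightarrow> 'b::real_normed_vector) \<Rightarrow> bool" where
  "smooth_on S g \<longleftrightarrow> (\<forall>n. C_on n S g)"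

definition same_derivative_at ::
  "'a::real_normed_vector \<Rightarrow> ('a \<Rightarrow> real) \<Rightarrow> ('a \<Rightarrow> real) \<Rightarrow> bool" where
  "same_derivative_at x g h \<longleftrightarrow>
     (\<exists>D. (g has_derivative D) (at x) \<and> (h has_derivative D) (at x))"

end

theory Submission
  imports Defs
begin

text \<open>Near a configuration in general position every birth radius is a smooth function (half the
  length of an edge, or a circumradius), and two birth radii that agree at \<open>u\<close> come from the same
  attaching simplex and hence agree near \<open>u\<close>, derivatives included. So the order of the simplices is
  locally constant, and with it the pivots of the reduced boundary matrix: they are the new leading
  indices of boundaries of chains on growing initial segments, whatever reduction is used. The set of
  pivot pairs of persistence at least \<open>\<epsilon>\<close> can only shrink near \<open>u\<close> by continuity, and it does not
  shrink since its cardinality is constantly \<open>s\<close> by stability: as \<open>2 * \<epsilon> < \<delta>\<close>, it suffices to compare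
  numbers of long bars of interleaved filtrations. Therefore \<open>f\<close> is locally a fixed list of smooth
  birth radii.

  For stability, two filtrations on the points of \<open>u\<close> and of \<open>v\<close> are both included in a filtration
  on the disjoint union of the two index sets, in which every vertex of one cloud is dominated by a
  nearby vertex of the other. The alpha filtration is first replaced by the Cech filtration,
  requiring the points one at a time to lie outside the enclosing open balls.\<close>

section \<open>Simplicial homology\<close>

text \<open>The diagram is a definite description, so it must be shown to exist, which matrix
  reduction provides, and to be unique: multiplicities are alternating sums of ranks of transition
  maps.

  The constants fit as follows. A diagonal distance c is a bar length 2 c. The bars of the base
  diagram are longer than 4 \<epsilon>, an interleaving with shift a < \<epsilon> costs at most 2 a
  in length, and bars of length at least 2 \<epsilon> are kept at u. So the old bars stay above the
  threshold, and the kept bars are no more numerous than the old ones.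

  Comparing two clouds by maps between vertices would require chain maps and homotopies. On the
  disjoint union all maps are inclusions, and the isomorphisms come from a cone that contracts
  relative chains. Delaunay complexes resist such a comparison, since adding points destroys empty
  spheres; Cech complexes do not.

  Emptiness of a circumsphere is a closed condition. Near u it is stable because a further point on
  the sphere would yield a second attaching simplex of the same radius, which general position
  excludes.\<close>

definition face_sign :: "'v::linorder set \<Rightarrow> 'v \<Rightarrow> 'k::field" where
  "face_sign \<rho> v = (- 1) ^ card {w \<in> \<rho>. w < v}"

lemma face_sign_sq [simp]: "face_sign \<rho> v * face_sign \<rho> v = (1 :: 'k::field)"
  by (simp add: face_sign_def flip: power_mult_distrib)

lemma face_sign_insert:
  fixes \<rho> :: "'v::{finite, linorder} set"
  assumes "w \<notin> \<rho>"
  shows "face_sign (insert w \<rho>) v = (if w < v then - face_sign \<rho> v else (face_sign \<rho> v :: 'k::field))"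
proof -
  have *: "{x \<in> insert w \<rho>. x < v} = (if w < v then insert w {x \<in> \<rho>. x < v} else {x \<in> \<rho>. x < v})"
    by auto
  show ?thesis using assms unfolding face_sign_def * by (auto simp: card_insert_if)
qed

text \<open>Of \<open>v\<close> and \<open>w\<close> only the smaller one is counted in the sign of
  the larger one, so exactly one of the two products picks up a minus sign. This is the cancellation
  behind \<open>boundary_boundary\<close>.\<close>

lemma face_sign_swap:
  fixes \<rho> :: "'v::{finite, linorder} set"
  assumes "v \<notin> \<rho>" "w \<notin> \<rho>" "v \<noteq> w"
  shows "face_sign (insert v \<rho>) w * face_sign \<rho> v = - (face_sign (insert w \<rho>) v * face_sign \<rho> w :: 'k::field)"
  using assms by (auto simp: face_sign_insert not_less_iff_gr_or_eq)

text \<open>Exchanging the two sums leaves a sum over the vertices that can be added to the face,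
  with \<open>face_sign\<close> as incidence number. The value at \<open>{}\<close> is zero because
  the complex is not augmented.\<close>

lemma boundary_eq:
  fixes z :: "'v::{finite, linorder} set \<Rightarrow> 'k::field"
  shows "boundary z \<rho> =
    (if \<rho> = {} then 0 else \<Sum>v\<in>-\<rho>. z (insert v \<rho>) * face_sign \<rho> v)"
proof (cases "\<rho> = {}")
  case True
  then show ?thesis by (simp add: boundary_def bd_coeff_def)
next
  case False
  have "boundary z \<rho> = (\<Sum>\<sigma>\<in>UNIV. \<Sum>v\<in>UNIV.
      if v \<in> \<sigma> \<and> \<rho> = \<sigma> - {v} then z \<sigma> * (- 1) ^ card {w \<in> \<sigma>. w < v} else 0)"
    unfolding boundary_def bd_coeff_def sum_distrib_left
    using False by (intro sum.cong refl sum.mono_neutral_cong_left) auto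
  also have "\<dots> = (\<Sum>v\<in>UNIV. \<Sum>\<sigma>\<in>UNIV.
      if v \<in> \<sigma> \<and> \<rho> = \<sigma> - {v} then z \<sigma> * (- 1) ^ card {w \<in> \<sigma>. w < v} else 0)"
    by (rule sum.swap)
  also have "\<dots> = (\<Sum>v\<in>-\<rho>. z (insert v \<rho>) * face_sign \<rho> v)"
  proof (rule sum.mono_neutral_cong_right)
    show "\<forall>v\<in>UNIV - - \<rho>. (\<Sum>\<sigma>\<in>UNIV.
      if v \<in> \<sigma> \<and> \<rho> = \<sigma> - {v} then z \<sigma> * (- 1) ^ card {w \<in> \<sigma>. w < v} else 0) = 0"
      by (auto intro!: sum.neutral)
    fix v assume v: "v \<in> - \<rho>"
    have "(\<Sum>\<sigma>\<in>UNIV. if v \<in> \<sigma> \<and> \<rho> = \<sigma> - {v} then z \<sigma> * (- 1) ^ card {w \<in> \<sigma>. w < v} else 0)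
      = (\<Sum>\<sigma>\<in>UNIV. if \<sigma> = insert v \<rho> then z \<sigma> * (- 1) ^ card {w \<in> \<sigma>. w < v} else 0)"
      using v by (intro sum.cong refl if_cong) auto
    also have "\<dots> = z (insert v \<rho>) * (- 1) ^ card {w \<in> insert v \<rho>. w < v}"
      by simp
    also have "{w \<in> insert v \<rho>. w < v} = {w \<in> \<rho>. w < v}" by auto
    finally show "(\<Sum>\<sigma>\<in>UNIV. if v \<in> \<sigma> \<and> \<rho> = \<sigma> - {v} then z \<sigma> * (- 1) ^ card {w \<in> \<sigma>. w < v} else 0)
      = z (insert v \<rho>) * face_sign \<rho> v" by (simp add: face_sign_def)
  qed auto
  finally show ?thesis using False by simp
qed

text \<open>A coface of codimension two arises from two orders of adding its new vertices. Splitting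
  the ordered pairs by \<open>v < w\<close> and reflecting one half makes the terms cancel by
  \<open>face_sign_swap\<close>, in every characteristic.\<close>

lemma boundary_boundary:
  fixes z :: "'v::{finite, linorder} set \<Rightarrow> 'k::field"
  shows "boundary (boundary z) = (\<lambda>_. 0)"
proof
  fix \<rho> :: "'v set"
  define g where "g v w = z (insert w (insert v \<rho>)) * (face_sign (insert v \<rho>) w * face_sign \<rho> v)" for v w
  define P where "P = {(v, w). v \<notin> \<rho> \<and> w \<notin> \<rho> \<and> v < w}"
  have swap: "g w v = - g v w" if "v \<notin> \<rho>" "w \<notin> \<rho>" "v \<noteq> w" for v w
    unfolding g_def using face_sign_swap[OF that, where ?'k = 'k] by (simp add: insert_commute)
  show "boundary (boundary z) \<rho> = 0"
  proof (cases "\<rho> = {}")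
    case False
    have "boundary (boundary z) \<rho> = (\<Sum>v\<in>-\<rho>. \<Sum>w\<in>-insert v \<rho>. g v w)"
      using False by (simp add: boundary_eq g_def sum_distrib_right mult.assoc)
    also have "\<dots> = (\<Sum>(v, w)\<in>(SIGMA v:-\<rho>. -insert v \<rho>). g v w)"
      by (simp add: sum.Sigma)
    also have "(SIGMA v:-\<rho>. -insert v \<rho>) = P \<union> prod.swap ` P"
      unfolding P_def by (auto simp: image_iff neq_iff)
    also have "(\<Sum>(v, w)\<in>P \<union> prod.swap ` P. g v w)
        = (\<Sum>(v, w)\<in>P. g v w) + (\<Sum>(v, w)\<in>prod.swap ` P. g v w)"
      by (rule sum.union_disjoint) (auto simp: P_def)
    also have "(\<Sum>(v, w)\<in>prod.swap ` P. g v w) = (\<Sum>(v, w)\<in>P. g w v)"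
      by (subst sum.reindex) (auto intro!: sum.cong)
    also have "\<dots> = (\<Sum>(v, w)\<in>P. - g v w)"
      by (rule sum.cong) (auto simp: P_def intro!: swap)
    finally show ?thesis by (simp add: sum_negf case_prod_beta)
  qed (simp add: boundary_eq)
qed

lemma boundary_zero [simp]: "boundary (\<lambda>_. 0) = (\<lambda>_. 0)"
  by (simp add: boundary_def)

lemma boundary_add: "boundary (\<lambda>\<sigma>. y \<sigma> + z \<sigma>) = (\<lambda>\<tau>. boundary y \<tau> + boundary z \<tau>)"
  by (simp add: boundary_def sum.distrib distrib_right)

lemma boundary_diff: "boundary (\<lambda>\<sigma>. y \<sigma> - z \<sigma>) = (\<lambda>\<tau>. boundary y \<tau> - boundary z \<tau>)"
  by (simp add: boundary_def sum_subtractf left_diff_distrib)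

lemma boundary_scale: "boundary (\<lambda>\<sigma>. c * z \<sigma>) = (\<lambda>\<tau>. c * boundary z \<tau>)"
  by (simp add: boundary_def sum_distrib_left mult.assoc)

lemma boundary_sum: "boundary (\<lambda>\<sigma>. \<Sum>j\<in>J. z j \<sigma>) = (\<lambda>\<tau>. \<Sum>j\<in>J. boundary (z j) \<tau>)"
  by (induction J rule: infinite_finite_induct) (simp_all add: boundary_add)

definition face_closed :: "'v set set \<Rightarrow> bool" where
  "face_closed X \<longleftrightarrow> {} \<notin> X \<and> (\<forall>\<sigma>\<in>X. \<forall>\<tau>. \<tau> \<subseteq> \<sigma> \<longrightarrow> \<tau> \<noteq> {} \<longrightarrow> \<tau> \<in> X)"

lemma face_closedD: "face_closed X \<Longrightarrow> \<sigma> \<in> X \<Longrightarrow> \<tau> \<subseteq> \<sigma> \<Longrightarrow> \<tau> \<noteq> {} \<Longrightarrow> \<tau> \<in> X"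
  unfolding face_closed_def by blast

lemma boundary_nonzeroD:
  fixes z :: "'v::{finite, linorder} set \<Rightarrow> 'k::field"
  assumes "boundary z \<rho> \<noteq> 0"
  obtains v where "v \<notin> \<rho>" "z (insert v \<rho>) \<noteq> 0" "\<rho> \<noteq> {}"
  using assms sum.neutral[of "-\<rho>" "\<lambda>v. z (insert v \<rho>) * face_sign \<rho> v"]
  by (fastforce simp: boundary_eq split: if_splits)

lemma boundary_in_chains:
  fixes z :: "'v::{finite, linorder} set \<Rightarrow> 'k::field"
  assumes "face_closed X" "z \<in> chains X (Suc l)"
  shows "boundary z \<in> chains X l"
  unfolding chains_def
proof (clarify)
  fix \<rho> assume "boundary z \<rho> \<noteq> 0"
  then obtain v where v: "v \<notin> \<rho>" "z (insert v \<rho>) \<noteq> 0" "\<rho> \<noteq> {}" by (rule boundary_nonzeroD)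
  then have "insert v \<rho> \<in> X" "card (insert v \<rho>) = Suc (Suc l)"
    using assms(2) by (auto simp: chains_def)
  then show "\<rho> \<in> X \<and> card \<rho> = Suc l"
    using v face_closedD[OF assms(1)] by auto
qed

lemma chains_zero [simp]: "(\<lambda>_. 0) \<in> chains X l"
  by (simp add: chains_def)

lemma chains_add:
  assumes "y \<in> chains X l" "z \<in> chains X l"
  shows "(\<lambda>\<sigma>. y \<sigma> + z \<sigma>) \<in> chains X l"
  unfolding chains_def
proof (clarify)
  fix \<sigma> assume "y \<sigma> + z \<sigma> \<noteq> 0"
  then have "y \<sigma> \<noteq> 0 \<or> z \<sigma> \<noteq> 0" by auto
  then show "\<sigma> \<in> X \<and> card \<sigma> = Suc l" using assms by (auto simp: chains_def)
qed

lemma chains_scale: "z \<in> chains X l \<Longrightarrow> (\<lambda>\<sigma>. c * z \<sigma>) \<in> chains X l"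
  by (simp add: chains_def)

lemma chains_diff:
  "y \<in> chains X l \<Longrightarrow> z \<in> chains X l \<Longrightarrow> (\<lambda>\<sigma>. y \<sigma> - z \<sigma>) \<in> chains X l"
  using chains_add[of y X l "\<lambda>\<sigma>. - 1 * z \<sigma>"] chains_scale[of z X l "- 1"] by simp

lemma chains_mono: "X \<subseteq> Y \<Longrightarrow> chains X l \<subseteq> chains Y l"
  unfolding chains_def by blast

lemma boundaries_zero [simp]: "(\<lambda>_. 0) \<in> boundaries X l"
  unfolding boundaries_def by (rule image_eqI[of _ _ "\<lambda>_. 0"]) auto

lemma boundaries_add:
  "y \<in> boundaries X l \<Longrightarrow> z \<in> boundaries X l \<Longrightarrow> (\<lambda>\<sigma>. y \<sigma> + z \<sigma>) \<in> boundaries X l"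
  unfolding boundaries_def
  by (clarsimp simp flip: boundary_add) (blast intro: chains_add)

lemma boundaries_scale: "z \<in> boundaries X l \<Longrightarrow> (\<lambda>\<sigma>. c * z \<sigma>) \<in> boundaries X l"
  unfolding boundaries_def
  by (clarsimp simp flip: boundary_scale) (blast intro: chains_scale)

lemma boundaries_mono: "X \<subseteq> Y \<Longrightarrow> boundaries X l \<subseteq> boundaries Y l"
  unfolding boundaries_def using chains_mono by (intro image_mono)

lemma homologous_refl [simp]: "homologous X l z z"
  by (simp add: homologous_def)

lemma homologous_sym: "homologous X l y z \<Longrightarrow> homologous X l z y"
  unfolding homologous_def
  by (drule boundaries_scale[of _ _ _ "- 1"]) simp

lemma homologous_trans [trans]:
  "homologous X l x y \<Longrightarrow> homologous X l y z \<Longrightarrow> homologous X l x z"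
  unfolding homologous_def by (drule (1) boundaries_add) simp

lemma homologous_mono: "homologous X l y z \<Longrightarrow> X \<subseteq> Y \<Longrightarrow> homologous Y l y z"
  unfolding homologous_def by (rule subsetD[OF boundaries_mono])

lemma homologous_scale:
  "homologous X l y z \<Longrightarrow> homologous X l (\<lambda>\<sigma>. c * y \<sigma>) (\<lambda>\<sigma>. c * z \<sigma>)"
  unfolding homologous_def by (drule boundaries_scale[of _ _ _ c]) (simp add: right_diff_distrib)

lemma homologous_add:
  "homologous X l y z \<Longrightarrow> homologous X l y' z' \<Longrightarrow>
    homologous X l (\<lambda>\<sigma>. y \<sigma> + y' \<sigma>) (\<lambda>\<sigma>. z \<sigma> + z' \<sigma>)"
  unfolding homologous_def by (drule (1) boundaries_add) (simp add: algebra_simps)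

lemma homologous_sum:
  "(\<And>j. j \<in> J \<Longrightarrow> homologous X l (y j) (z j)) \<Longrightarrow>
    homologous X l (\<lambda>\<sigma>. \<Sum>j\<in>J. y j \<sigma>) (\<lambda>\<sigma>. \<Sum>j\<in>J. z j \<sigma>)"
  by (induction J rule: infinite_finite_induct) (auto intro: homologous_add)

lemma cycles_mono: "X \<subseteq> Y \<Longrightarrow> cycles X l \<subseteq> cycles Y l"
  unfolding cycles_def using chains_mono by blast

lemma cycles_zero [simp]: "(\<lambda>_. 0) \<in> cycles X l"
  by (simp add: cycles_def)

lemma cycles_add: "y \<in> cycles X l \<Longrightarrow> z \<in> cycles X l \<Longrightarrow> (\<lambda>\<sigma>. y \<sigma> + z \<sigma>) \<in> cycles X l"
  by (simp add: cycles_def chains_add boundary_add)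

lemma cycles_diff: "y \<in> cycles X l \<Longrightarrow> z \<in> cycles X l \<Longrightarrow> (\<lambda>\<sigma>. y \<sigma> - z \<sigma>) \<in> cycles X l"
  by (simp add: cycles_def chains_diff boundary_diff)

lemma cycles_scale: "z \<in> cycles X l \<Longrightarrow> (\<lambda>\<sigma>. c * z \<sigma>) \<in> cycles X l"
  by (simp add: cycles_def chains_scale boundary_scale)

lemma cycles_sum: "(\<And>j. j \<in> J \<Longrightarrow> z j \<in> cycles X l) \<Longrightarrow> (\<lambda>\<sigma>. \<Sum>j\<in>J. z j \<sigma>) \<in> cycles X l"
  by (induction J rule: infinite_finite_induct) (auto intro: cycles_add)

section \<open>Inclusions inducing isomorphisms in homology\<close>

text \<open>The two quantified clauses are surjectivity and injectivity of the map induced on each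
  homology group. Working with representing cycles avoids quotient spaces.\<close>

definition homology_iso :: "'k::field itself \<Rightarrow> 'v::{finite, linorder} set set \<Rightarrow> 'v set set \<Rightarrow> bool" where
  "homology_iso k X Y \<longleftrightarrow> X \<subseteq> Y \<and>
     (\<forall>l. \<forall>z \<in> cycles Y l. \<exists>z' \<in> cycles X l. homologous Y l z (z' :: 'v set \<Rightarrow> 'k)) \<and>
     (\<forall>l. \<forall>z \<in> cycles X l. (z :: 'v set \<Rightarrow> 'k) \<in> boundaries Y l \<longrightarrow> z \<in> boundaries X l)"

lemma homology_iso_refl: "homology_iso k X X"
  unfolding homology_iso_def using homologous_refl by blast

lemma homology_iso_trans:
  fixes X Y Z :: "'v::{finite, linorder} set set" and k :: "'k::field itself"
  assumes "homology_iso k X Y" "homology_iso k Y Z"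
  shows "homology_iso k X Z"
  unfolding homology_iso_def
proof (intro conjI allI ballI impI)
  show "X \<subseteq> Z" using assms by (auto simp: homology_iso_def)
next
  fix l z assume "z \<in> (cycles Z l :: ('v set \<Rightarrow> 'k) set)"
  then obtain z' where z': "z' \<in> cycles Y l" "homologous Z l z z'"
    using assms(2) unfolding homology_iso_def by blast
  then obtain z'' where z'': "z'' \<in> cycles X l" "homologous Y l z' z''"
    using assms(1) unfolding homology_iso_def by blast
  have "homologous Z l z' z''"
    using z''(2) assms(2) by (auto simp: homology_iso_def intro: homologous_mono)
  then show "\<exists>z'\<in>cycles X l. homologous Z l z z'"
    using z' z'' homologous_trans by blast
next
  fix l z assume z: "z \<in> (cycles X l :: ('v set \<Rightarrow> 'k) set)" "z \<in> boundaries Z l"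
  then have "z \<in> cycles Y l" using assms(1) cycles_mono unfolding homology_iso_def by blast
  then show "z \<in> boundaries X l" using z assms unfolding homology_iso_def by blast
qed

lemma homology_isoD_homologous:
  fixes y z :: "'v::{finite, linorder} set \<Rightarrow> 'k::field"
  assumes "homology_iso TYPE('k) X Y" "y \<in> cycles X l" "z \<in> cycles X l" "homologous Y l y z"
  shows "homologous X l y z"
  using assms cycles_diff[OF assms(2,3)] unfolding homology_iso_def homologous_def by blast

text \<open>The join with the apex \<open>x\<close>. Values of \<open>z\<close> on simplices that
  contain \<open>x\<close> are discarded, and the sign is the one for which the boundary of the cone
  returns \<open>z\<close> on the simplices without \<open>x\<close>.\<close>

definition cone :: "'v \<Rightarrow> ('v::linorder set \<Rightarrow> 'k::field) \<Rightarrow> 'v set \<Rightarrow> 'k" where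
  "cone x z \<sigma> = (if x \<in> \<sigma> then face_sign (\<sigma> - {x}) x * z (\<sigma> - {x}) else 0)"

definition restrict_chain :: "'v set set \<Rightarrow> ('v set \<Rightarrow> 'k::zero) \<Rightarrow> 'v set \<Rightarrow> 'k" where
  "restrict_chain A z \<sigma> = (if \<sigma> \<in> A then z \<sigma> else 0)"

text \<open>A relative cycle \<open>w\<close> of \<open>(K, L)\<close> agrees outside
  \<open>L\<close> with the boundary of the cone over its part outside \<open>L\<close>. At
  simplices without \<open>x\<close> this is the sign convention of \<open>cone\<close>; at a
  simplex \<open>insert x \<rho>0\<close> it is the relative cycle condition at
  \<open>\<rho>0\<close>, solved for the coface that contains \<open>x\<close>.\<close>

lemma cone_chain_contraction:
  fixes w :: "'v::{finite, linorder} set \<Rightarrow> 'k::field"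
  assumes K: "face_closed K" and L: "face_closed L" and LK: "L \<subseteq> K"
    and ins: "\<And>\<sigma>. \<sigma> \<in> K - L \<Longrightarrow> insert x \<sigma> \<in> K - L"
    and del: "\<And>\<sigma>. \<sigma> \<in> K - L \<Longrightarrow> \<sigma> - {x} \<in> K - L"
    and w: "w \<in> chains K l" and bd: "restrict_chain (K - L) (boundary w) = (\<lambda>_. 0)"
  shows "cone x (restrict_chain (K - L) w) \<in> chains K (Suc l)"
    and "(\<lambda>\<sigma>. w \<sigma> - boundary (cone x (restrict_chain (K - L) w)) \<sigma>) \<in> chains L l"
proof -
  define y where "y = restrict_chain (K - L) w"
  have y_nz: "\<sigma> \<in> K - L \<and> card \<sigma> = Suc l" if "y \<sigma> \<noteq> 0" for \<sigma>
    using that w by (auto simp: y_def restrict_chain_def chains_def split: if_splits)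
  show c: "cone x (restrict_chain (K - L) w) \<in> chains K (Suc l)"
    unfolding chains_def
  proof (clarify)
    fix \<sigma> assume "cone x (restrict_chain (K - L) w) \<sigma> \<noteq> 0"
    then have "x \<in> \<sigma>" "y (\<sigma> - {x}) \<noteq> 0" by (auto simp: cone_def y_def split: if_splits)
    then show "\<sigma> \<in> K \<and> card \<sigma> = Suc (Suc l)"
      using y_nz[of "\<sigma> - {x}"] ins[of "\<sigma> - {x}"]
      by (metis DiffD1 card.remove finite insert_Diff)
  qed
  have bdK: "boundary (cone x y) \<in> chains K l"
    using boundary_in_chains[OF K c] by (simp add: y_def)
  have key: "y \<rho> = boundary (cone x y) \<rho>" if \<rho>: "\<rho> \<in> K - L" for \<rho>
  proof (cases "x \<in> \<rho>")
    case False
    have ne: "\<rho> \<noteq> {}" using \<rho> K by (auto simp: face_closed_def)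
    have "boundary (cone x y) \<rho> = (\<Sum>v\<in>-\<rho>. cone x y (insert v \<rho>) * face_sign \<rho> v)"
      using ne by (simp add: boundary_eq)
    also have "\<dots> = (\<Sum>v\<in>{x}. cone x y (insert v \<rho>) * face_sign \<rho> v)"
      using False by (intro sum.mono_neutral_right) (auto simp: cone_def)
    also have "\<dots> = y \<rho>" using False by (simp add: cone_def mult_ac flip: mult.assoc)
    finally show ?thesis by simp
  next
    case True
    define \<rho>0 where "\<rho>0 = \<rho> - {x}"
    have \<rho>0: "\<rho>0 \<in> K - L" "x \<notin> \<rho>0" "\<rho> = insert x \<rho>0" using True del[OF \<rho>] by (auto simp: \<rho>0_def)
    have ne: "\<rho> \<noteq> {}" "\<rho>0 \<noteq> {}" using \<rho> \<rho>0 K by (auto simp: face_closed_def)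
    \<comment> \<open>The part of \<open>w\<close> on the face-closed \<open>L\<close> has its
      boundary in \<open>L\<close>. So at \<open>\<rho>0\<close>, which lies outside
      \<open>L\<close>, the boundary of \<open>w\<close> is that of \<open>y\<close>.\<close>
    have "boundary w = (\<lambda>\<tau>. boundary y \<tau> + boundary (\<lambda>\<sigma>. w \<sigma> - y \<sigma>) \<tau>)"
      by (simp flip: boundary_add)
    moreover have "(\<lambda>\<sigma>. w \<sigma> - y \<sigma>) \<in> {z. \<forall>\<sigma>. z \<sigma> \<noteq> 0 \<longrightarrow> \<sigma> \<in> L}"
      using w by (auto simp: y_def restrict_chain_def chains_def)
    then have "boundary (\<lambda>\<sigma>. w \<sigma> - y \<sigma>) \<rho>0 = 0"
      using boundary_nonzeroD[of "\<lambda>\<sigma>. w \<sigma> - y \<sigma>" \<rho>0] face_closedD[OF L] \<rho>0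
      by (metis (mono_tags, lifting) DiffD2 mem_Collect_eq subset_insertI)
    moreover have "boundary w \<rho>0 = 0" using fun_cong[OF bd, of \<rho>0] \<rho>0 by (auto simp: restrict_chain_def)
    ultimately have "boundary y \<rho>0 = 0" by (metis add.right_neutral)
    then have "0 = (\<Sum>v\<in>-\<rho>0. y (insert v \<rho>0) * face_sign \<rho>0 v)"
      using ne by (simp add: boundary_eq)
    also have "-\<rho>0 = insert x (-\<rho>)" using \<rho>0 by auto
    also have "(\<Sum>v\<in>insert x (-\<rho>). y (insert v \<rho>0) * face_sign \<rho>0 v)
       = y \<rho> * face_sign \<rho>0 x + (\<Sum>v\<in>-\<rho>. y (insert v \<rho>0) * face_sign \<rho>0 v)"
      using True \<rho>0 by simp
    finally have e1: "y \<rho> * face_sign \<rho>0 x = - (\<Sum>v\<in>-\<rho>. y (insert v \<rho>0) * face_sign \<rho>0 v)"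
      by (simp add: eq_neg_iff_add_eq_0)
    have "boundary (cone x y) \<rho> = (\<Sum>v\<in>-\<rho>. cone x y (insert v \<rho>) * face_sign \<rho> v)"
      using ne by (simp add: boundary_eq)
    also have "\<dots> = (\<Sum>v\<in>-\<rho>. - (face_sign \<rho>0 x * (y (insert v \<rho>0) * face_sign \<rho>0 v)))"
    proof (rule sum.cong, rule refl)
      fix v assume v: "v \<in> - \<rho>"
      have d: "insert v \<rho> - {x} = insert v \<rho>0" using v True by (auto simp: \<rho>0_def)
      have "cone x y (insert v \<rho>) * face_sign \<rho> v
        = (face_sign (insert v \<rho>0) x * face_sign (insert x \<rho>0) v) * y (insert v \<rho>0)"
        unfolding cone_def d using \<rho>0 True by simp
      also have "face_sign (insert v \<rho>0) x * face_sign (insert x \<rho>0) v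
           = (- (face_sign \<rho>0 x * face_sign \<rho>0 v) :: 'k)"
        using face_sign_insert[of v \<rho>0 x, where ?'k = 'k] face_sign_insert[of x \<rho>0 v, where ?'k = 'k] v \<rho>0
        by (auto simp: not_less_iff_gr_or_eq)
      finally show "cone x y (insert v \<rho>) * face_sign \<rho> v
          = - (face_sign \<rho>0 x * (y (insert v \<rho>0) * face_sign \<rho>0 v))" by simp
    qed
    also have "\<dots> = face_sign \<rho>0 x * - (\<Sum>v\<in>-\<rho>. y (insert v \<rho>0) * face_sign \<rho>0 v)"
      by (simp add: sum_negf sum_distrib_left)
    also have "\<dots> = y \<rho>" unfolding e1[symmetric] by (simp add: mult_ac flip: mult.assoc)
    finally show ?thesis by simp
  qed
  show "(\<lambda>\<sigma>. w \<sigma> - boundary (cone x (restrict_chain (K - L) w)) \<sigma>) \<in> chains L l"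
    unfolding chains_def
  proof (clarify)
    fix \<sigma> assume nz: "w \<sigma> - boundary (cone x (restrict_chain (K - L) w)) \<sigma> \<noteq> 0"
    have "(\<lambda>\<sigma>. w \<sigma> - boundary (cone x y) \<sigma>) \<in> chains K l" using w bdK by (rule chains_diff)
    then have "\<sigma> \<in> K" "card \<sigma> = Suc l" using nz by (auto simp: chains_def y_def)
    moreover have "\<sigma> \<notin> K - L"
    proof
      assume a: "\<sigma> \<in> K - L"
      then have "w \<sigma> = y \<sigma>" by (simp add: y_def restrict_chain_def)
      then show False using key[OF a] nz by (simp add: y_def)
    qed
    ultimately show "\<sigma> \<in> L \<and> card \<sigma> = Suc l" by blast
  qed
qed

text \<open>The cone with apex \<open>x\<close> contracts the chains of \<open>K\<close> relative to \<open>L\<close>.\<close>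

lemma homology_iso_toggle:
  fixes K L :: "'v::{finite, linorder} set set" and k :: "'k::field itself"
  assumes K: "face_closed K" and L: "face_closed L" and LK: "L \<subseteq> K"
    and ins: "\<And>\<sigma>. \<sigma> \<in> K - L \<Longrightarrow> insert x \<sigma> \<in> K - L"
    and del: "\<And>\<sigma>. \<sigma> \<in> K - L \<Longrightarrow> \<sigma> - {x} \<in> K - L"
  shows "homology_iso k L K"
  unfolding homology_iso_def
proof (intro conjI allI ballI impI)
  show "L \<subseteq> K" by (rule LK)
next
  fix l and z :: "'v set \<Rightarrow> 'k" assume z: "z \<in> cycles K l"
  define c where "c = cone x (restrict_chain (K - L) z)"
  have "z \<in> chains K l" "restrict_chain (K - L) (boundary z) = (\<lambda>_. 0)"
    using z by (auto simp: cycles_def restrict_chain_def fun_eq_iff)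
  note * = cone_chain_contraction[OF K L LK ins del this]
  have "(\<lambda>\<sigma>. z \<sigma> - boundary c \<sigma>) \<in> cycles L l"
    using *(2) z by (simp add: cycles_def c_def boundary_diff boundary_boundary)
  moreover have "homologous K l z (\<lambda>\<sigma>. z \<sigma> - boundary c \<sigma>)"
    using *(1) by (auto simp: homologous_def boundaries_def c_def)
  ultimately show "\<exists>z'\<in>cycles L l. homologous K l z z'" by blast
next
  fix l and z :: "'v set \<Rightarrow> 'k" assume z: "z \<in> cycles L l" "z \<in> boundaries K l"
  then obtain w where w: "w \<in> chains K (Suc l)" "z = boundary w" by (auto simp: boundaries_def)
  define c where "c = cone x (restrict_chain (K - L) w)"
  have "restrict_chain (K - L) (boundary w) = (\<lambda>_. 0)"
    using z(1) unfolding w(2)[symmetric] by (auto simp: cycles_def chains_def restrict_chain_def fun_eq_iff)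
  note * = cone_chain_contraction[OF K L LK ins del w(1) this]
  have "z = boundary (\<lambda>\<sigma>. w \<sigma> - boundary c \<sigma>)"
    by (simp add: boundary_diff boundary_boundary w(2))
  then show "z \<in> boundaries L l" using *(2) unfolding boundaries_def c_def by blast
qed

text \<open>The vertices of \<open>V\<close> are removed one at a time. The simplices lost with
  \<open>p\<close> are those containing \<open>p\<close>; they are stable under inserting and
  deleting \<open>f p\<close>, which can always be added next to \<open>p\<close> and, lying outside
  \<open>V\<close>, has not been removed before. So \<open>homology_iso_toggle\<close> applies with
  apex \<open>f p\<close>.\<close>

lemma homology_iso_dominated:
  fixes K :: "'v::{finite, linorder} set set"
  assumes K: "face_closed K"
    and f: "\<And>\<sigma> p. \<sigma> \<in> K \<Longrightarrow> p \<in> \<sigma> \<Longrightarrow> p \<in> V \<Longrightarrow> insert (f p) \<sigma> \<in> K"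
    and fV: "\<And>p. p \<in> V \<Longrightarrow> f p \<notin> V"
  shows "homology_iso k {\<sigma> \<in> K. \<sigma> \<inter> V = {}} K"
proof -
  have "homology_iso k {\<sigma> \<in> K. \<sigma> \<inter> V' = {}} K" if "V' \<subseteq> V" for V'
    using finite[of V'] that
  proof (induction V' rule: finite_induct)
    case empty
    then show ?case by (simp add: homology_iso_refl)
  next
    case (insert p V')
    have "homology_iso k {\<sigma> \<in> K. \<sigma> \<inter> insert p V' = {}} {\<sigma> \<in> K. \<sigma> \<inter> V' = {}}"
    proof (rule homology_iso_toggle[where x = "f p"])
      show "face_closed {\<sigma> \<in> K. \<sigma> \<inter> V' = {}}" for V'
        unfolding face_closed_def
      proof (intro conjI ballI allI impI)
        show "{} \<notin> {\<sigma> \<in> K. \<sigma> \<inter> V' = {}}" using K by (simp add: face_closed_def)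
        fix \<sigma> \<tau> assume "\<sigma> \<in> {\<sigma> \<in> K. \<sigma> \<inter> V' = {}}" "\<tau> \<subseteq> \<sigma>" "\<tau> \<noteq> {}"
        then show "\<tau> \<in> {\<sigma> \<in> K. \<sigma> \<inter> V' = {}}" using face_closedD[OF K] by blast
      qed
      then show "face_closed {\<sigma> \<in> K. \<sigma> \<inter> insert p V' = {}}" .
      show "{\<sigma> \<in> K. \<sigma> \<inter> insert p V' = {}} \<subseteq> {\<sigma> \<in> K. \<sigma> \<inter> V' = {}}" by auto
      fix \<sigma> assume \<sigma>: "\<sigma> \<in> {\<sigma> \<in> K. \<sigma> \<inter> V' = {}} - {\<sigma> \<in> K. \<sigma> \<inter> insert p V' = {}}"
      have p: "p \<in> V" "f p \<notin> V" using insert.prems fV by simp_all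
      then have p': "f p \<noteq> p" "f p \<notin> V'" using insert.prems by (metis, blast)
      show "insert (f p) \<sigma> \<in> {\<sigma> \<in> K. \<sigma> \<inter> V' = {}} - {\<sigma> \<in> K. \<sigma> \<inter> insert p V' = {}}"
        using \<sigma> p p' f[of \<sigma> p] by auto
      have "\<sigma> - {f p} \<noteq> {}" using \<sigma> p' by auto
      then show "\<sigma> - {f p} \<in> {\<sigma> \<in> K. \<sigma> \<inter> V' = {}} - {\<sigma> \<in> K. \<sigma> \<inter> insert p V' = {}}"
        using \<sigma> p' face_closedD[OF K, of \<sigma> "\<sigma> - {f p}"] by auto
    qed
    moreover have "homology_iso k {\<sigma> \<in> K. \<sigma> \<inter> V' = {}} K" using insert by simp
    ultimately show ?case by (rule homology_iso_trans)
  qed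
  from this[OF subset_refl] show ?thesis .
qed

section \<open>Barcodes\<close>

text \<open>Gaussian elimination, by induction on the equations: an unknown \<open>k0\<close> with
  nonzero coefficient in the new equation is eliminated from the others and recovered from that
  equation at the end.\<close>

lemma homogeneous_system_nontrivial:
  fixes a :: "'i \<Rightarrow> 'j \<Rightarrow> 'k::field"
  assumes "finite J" "finite K" "card J < card K"
  shows "\<exists>x. (\<exists>k\<in>K. x k \<noteq> 0) \<and> (\<forall>j\<in>J. (\<Sum>k\<in>K. x k * a k j) = 0)"
  using assms
proof (induction J arbitrary: K a rule: finite_induct)
  case empty
  then obtain k where "k \<in> K" by fastforce
  then show ?case by (intro exI[of _ "\<lambda>_. 1"]) auto
next
  case (insert j J)
  show ?case
  proof (cases "\<forall>k\<in>K. a k j = 0")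
    case True
    have "card J < card K" using insert by simp
    then obtain x where x: "\<exists>k\<in>K. x k \<noteq> 0" "\<forall>j\<in>J. (\<Sum>k\<in>K. x k * a k j) = 0"
      using insert.IH[OF insert.prems(1)] by blast
    have "(\<Sum>k\<in>K. x k * a k j) = 0" using True by (intro sum.neutral) simp
    with x show ?thesis by blast
  next
    case False
    then obtain k0 where k0: "k0 \<in> K" "a k0 j \<noteq> 0" by blast
    define K' where "K' = K - {k0}"
    have fK': "finite K'" "k0 \<notin> K'" "K = insert k0 K'" using insert.prems k0 by (auto simp: K'_def)
    have "card J < card K'" using insert k0 by (simp add: K'_def)
    then obtain x where x: "\<exists>k\<in>K'. x k \<noteq> 0"
        "\<forall>i\<in>J. (\<Sum>k\<in>K'. x k * (a k i - a k j / a k0 j * a k0 i)) = 0"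
      using insert.IH[OF fK'(1), of "\<lambda>k i. a k i - a k j / a k0 j * a k0 i"] by blast
    define y where "y k = (if k = k0 then - (\<Sum>k\<in>K'. x k * a k j) / a k0 j else x k)" for k
    have sum_y: "(\<Sum>k\<in>K. y k * a k i) = (\<Sum>k\<in>K'. x k * a k i) - (\<Sum>k\<in>K'. x k * a k j) / a k0 j * a k0 i" for i
    proof -
      have "(\<Sum>k\<in>K'. y k * a k i) = (\<Sum>k\<in>K'. x k * a k i)"
        using fK'(2) by (intro sum.cong) (auto simp: y_def)
      then show ?thesis unfolding fK'(3) using fK' by (simp add: y_def)
    qed
    have "(\<Sum>k\<in>K. y k * a k i) = 0" if "i \<in> insert j J" for i
    proof (cases "i = j")
      case True
      then show ?thesis using k0 by (simp add: sum_y)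
    next
      case False
      then have "(\<Sum>k\<in>K'. x k * (a k i - a k j / a k0 j * a k0 i)) = 0" using x that by blast
      moreover have "(\<Sum>k\<in>K'. x k * (a k i - a k j / a k0 j * a k0 i))
        = (\<Sum>k\<in>K'. x k * a k i) - (\<Sum>k\<in>K'. x k * a k j) / a k0 j * a k0 i"
        by (simp add: right_diff_distrib sum_subtractf sum_divide_distrib sum_distrib_left mult_ac)
      ultimately show ?thesis by (simp add: sum_y)
    qed
    moreover have "\<exists>k\<in>K. y k \<noteq> 0" using x(1) fK' by (metis insertCI y_def)
    ultimately show ?thesis by blast
  qed
qed

text \<open>If \<open>K\<close> were larger than \<open>J\<close>, some nontrivial combination
  \<open>x\<close> of the rows of \<open>a\<close> would vanish. Tested against the column of an
  index \<open>m\<close> in the support of \<open>x\<close> with \<open>f m\<close> maximal it gives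
  \<open>x m\<close>, since the entries left free by the hypothesis have \<open>f m < f k\<close>.
  Where \<open>f\<close> takes equal values, the product is required to be the identity.\<close>

lemma card_le_of_triangular_product:
  fixes a :: "'i \<Rightarrow> 'j \<Rightarrow> 'k::field" and f :: "'i \<Rightarrow> real"
  assumes fin: "finite K" "finite J"
    and tri: "\<And>k k'. k \<in> K \<Longrightarrow> k' \<in> K \<Longrightarrow>
      f k' < f k \<or> (\<Sum>j\<in>J. a k j * c j k') = (if k = k' then 1 else 0)"
  shows "card K \<le> card J"
proof (rule ccontr)
  assume "\<not> card K \<le> card J"
  then obtain x where x: "\<exists>k\<in>K. x k \<noteq> 0" "\<forall>j\<in>J. (\<Sum>k\<in>K. x k * a k j) = 0"
    using homogeneous_system_nontrivial[OF fin(2,1), of a] by force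
  define S where "S = {k \<in> K. x k \<noteq> 0}"
  have S: "finite S" "S \<noteq> {}" using x fin by (auto simp: S_def)
  then have "Max (f ` S) \<in> f ` S" by simp
  then obtain m where m: "m \<in> S" "f m = Max (f ` S)" by force
  then have mS: "f k \<le> f m" if "k \<in> S" for k using that S by simp
  have "(\<Sum>k\<in>K. x k * (\<Sum>j\<in>J. a k j * c j m)) = (\<Sum>k\<in>K. if k = m then x k else 0)"
  proof (rule sum.cong)
    fix k assume k: "k \<in> K"
    show "x k * (\<Sum>j\<in>J. a k j * c j m) = (if k = m then x k else 0)"
    proof (cases "x k = 0")
      case False
      then have "\<not> f m < f k" using mS k by (force simp: S_def)
      then show ?thesis using tri[OF k, of m] m by (auto simp: S_def)
    qed auto
  qed simp
  also have "\<dots> = x m" using m fin by (simp add: S_def)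
  also have "(\<Sum>k\<in>K. x k * (\<Sum>j\<in>J. a k j * c j m)) = (\<Sum>j\<in>J. (\<Sum>k\<in>K. x k * a k j) * c j m)"
    by (simp add: sum_distrib_left sum_distrib_right mult.assoc) (rule sum.swap)
  also have "\<dots> = 0" using x(2) by simp
  finally show False using m by (simp add: S_def)
qed

section \<open>Interval decompositions and the ranks of their transition maps\<close>

lemma finite_active [simp]: "finite (active ps r)"
  by (simp add: active_def)

lemma homologous_lincomb:
  "(\<And>j. j \<in> J \<Longrightarrow> homologous X l (y j) (z j)) \<Longrightarrow>
    homologous X l (\<lambda>\<sigma>. \<Sum>j\<in>J. c j * y j \<sigma>) (\<lambda>\<sigma>. \<Sum>j\<in>J. c j * z j \<sigma>)"
  by (intro homologous_sum homologous_scale)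

context
  fixes l X ps and e :: "nat \<Rightarrow> real \<Rightarrow> 'v::{finite, linorder} set \<Rightarrow> 'k::field"
  assumes dec: "interval_decomposition l X ps e"
begin

lemma interval_bounds: "p \<in> set ps \<Longrightarrow> 0 \<le> fst p \<and> fst p < snd p"
  using dec by (auto simp: interval_decomposition_def)

lemma generator_cycle: "0 < r \<Longrightarrow> j \<in> active ps r \<Longrightarrow> e j r \<in> cycles (X r) l"
  using dec unfolding interval_decomposition_def by blast

lemma lincomb_cycle: "0 < r \<Longrightarrow> (\<lambda>\<sigma>. \<Sum>j\<in>active ps r. c j * e j r \<sigma>) \<in> cycles (X r) l"
  by (intro cycles_sum cycles_scale generator_cycle)

lemma generators_span:
  assumes "0 < r" "z \<in> cycles (X r) l"
  shows "\<exists>c. (\<forall>j. j \<notin> active ps r \<longrightarrow> c j = 0) \<and>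
    homologous (X r) l z (\<lambda>\<sigma>. \<Sum>j\<in>active ps r. c j * e j r \<sigma>)"
proof -
  have "\<exists>!c. (\<forall>j. j \<notin> active ps r \<longrightarrow> c j = 0) \<and>
        homologous (X r) l z (\<lambda>\<sigma>. \<Sum>j\<in>active ps r. c j * e j r \<sigma>)"
    using dec assms unfolding interval_decomposition_def by blast
  then show ?thesis by (rule ex1_implies_ex)
qed

lemma generators_independent:
  assumes "0 < r" "homologous (X r) l (\<lambda>\<sigma>. \<Sum>j\<in>active ps r. c j * e j r \<sigma>)
    (\<lambda>\<sigma>. \<Sum>j\<in>active ps r. c' j * e j r \<sigma>)" "j \<in> active ps r"
  shows "c j = c' j"
proof -
  \<comment> \<open>Uniqueness in \<open>interval_decomposition\<close> concerns coefficient
    functions that vanish off the active set, so both given functions are first cut off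
    there.\<close>
  define d where "d c j = (if j \<in> active ps r then c j else 0)" for c :: "nat \<Rightarrow> 'k" and j
  define P where "P c' \<longleftrightarrow> (\<forall>j. j \<notin> active ps r \<longrightarrow> c' j = 0) \<and>
    homologous (X r) l (\<lambda>\<sigma>. \<Sum>j\<in>active ps r. c j * e j r \<sigma>)
      (\<lambda>\<sigma>. \<Sum>j\<in>active ps r. c' j * e j r \<sigma>)" for c'
  have d: "(\<lambda>\<sigma>. \<Sum>j\<in>active ps r. d c j * e j r \<sigma>) = (\<lambda>\<sigma>. \<Sum>j\<in>active ps r. c j * e j r \<sigma>)" for c
    by (intro ext sum.cong) (auto simp: d_def)
  have "\<exists>!c. P c"
    unfolding P_def using dec assms(1) lincomb_cycle[OF assms(1), of c]
    unfolding interval_decomposition_def by blast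
  moreover have "P (d c)" "P (d c')" unfolding P_def d using assms(2) by (simp_all add: d_def)
  ultimately have "d c = d c'" by blast
  then have "d c j = d c' j" by simp
  then show ?thesis using assms(3) by (simp add: d_def)
qed

lemma generator_transition:
  "0 < r \<Longrightarrow> r \<le> r' \<Longrightarrow> j \<in> active ps r \<Longrightarrow>
    homologous (X r') l (e j r) (if j \<in> active ps r' then e j r' else (\<lambda>_. 0))"
  using dec unfolding interval_decomposition_def by blast

text \<open>Bars that end between \<open>r\<close> and \<open>r'\<close> drop out because their
  generators become boundaries; bars that begin there contribute nothing because \<open>c\<close>
  vanishes on them. So one coefficient function serves at both parameters.\<close>

lemma lincomb_transition:
  assumes "0 < r" "r \<le> r'" and c: "\<And>j. j \<notin> active ps r \<Longrightarrow> c j = 0"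
  shows "homologous (X r') l (\<lambda>\<sigma>. \<Sum>j\<in>active ps r. c j * e j r \<sigma>)
    (\<lambda>\<sigma>. \<Sum>j\<in>active ps r'. c j * e j r' \<sigma>)"
proof -
  have "homologous (X r') l (\<lambda>\<sigma>. \<Sum>j\<in>active ps r. c j * e j r \<sigma>)
    (\<lambda>\<sigma>. \<Sum>j\<in>active ps r. c j * (if j \<in> active ps r' then e j r' else (\<lambda>_. 0)) \<sigma>)"
    using assms generator_transition by (intro homologous_lincomb)
  also have "(\<lambda>\<sigma>. \<Sum>j\<in>active ps r. c j * (if j \<in> active ps r' then e j r' else (\<lambda>_. 0)) \<sigma>)
      = (\<lambda>\<sigma>. \<Sum>j\<in>active ps r \<inter> active ps r'. c j * e j r' \<sigma>)"
    by (rule ext, rule sum.mono_neutral_cong_right) auto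
  also have "\<dots> = (\<lambda>\<sigma>. \<Sum>j\<in>active ps r'. c j * e j r' \<sigma>)"
    using c by (intro ext sum.mono_neutral_left) auto
  finally show ?thesis .
qed

end

text \<open>The bars active at both \<open>r\<close> and \<open>r'\<close> index a basis of the
  image of \<open>H_l(X r)\<close> in \<open>H_l(X r')\<close>, so both cardinalities are the rank
  of this map. The proof takes the changes of basis \<open>a\<close> and \<open>c\<close> at
  \<open>r\<close>; their product through the bars of \<open>qs\<close> that survive to
  \<open>r'\<close> is the identity.\<close>

lemma active_rank_le:
  fixes e g :: "nat \<Rightarrow> real \<Rightarrow> 'v::{finite, linorder} set \<Rightarrow> 'k::field"
  assumes ps: "interval_decomposition l X ps e" and qs: "interval_decomposition l X qs g"
    and r: "0 < r" "r \<le> r'" and mono: "X r \<subseteq> X r'"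
  shows "card (active ps r \<inter> active ps r') \<le> card (active qs r \<inter> active qs r')"
proof -
  have r': "0 < r'" using r by simp
  have "\<forall>k\<in>active ps r. \<exists>c. (\<forall>j. j \<notin> active qs r \<longrightarrow> c j = 0) \<and>
     homologous (X r) l (e k r) (\<lambda>\<sigma>. \<Sum>j\<in>active qs r. c j * g j r \<sigma>)"
    by (intro ballI generators_span[OF qs r(1)] generator_cycle[OF ps r(1)])
  from bchoice[OF this]
  obtain a where a: "\<And>k j. k \<in> active ps r \<Longrightarrow> j \<notin> active qs r \<Longrightarrow> a k j = 0"
     "\<And>k. k \<in> active ps r \<Longrightarrow> homologous (X r) l (e k r) (\<lambda>\<sigma>. \<Sum>j\<in>active qs r. a k j * g j r \<sigma>)"
    by blast
  have "\<forall>j\<in>active qs r. \<exists>c. (\<forall>k. k \<notin> active ps r \<longrightarrow> c k = 0) \<and>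
     homologous (X r) l (g j r) (\<lambda>\<sigma>. \<Sum>k\<in>active ps r. c k * e k r \<sigma>)"
    by (intro ballI generators_span[OF ps r(1)] generator_cycle[OF qs r(1)])
  from bchoice[OF this]
  obtain c where c: "\<And>k j. j \<in> active qs r \<Longrightarrow> k \<notin> active ps r \<Longrightarrow> c j k = 0"
     "\<And>j. j \<in> active qs r \<Longrightarrow> homologous (X r) l (g j r) (\<lambda>\<sigma>. \<Sum>k\<in>active ps r. c j k * e k r \<sigma>)"
    by blast
  define J where "J = active qs r \<inter> active qs r'"
  have g: "homologous (X r') l (g j r') (\<lambda>\<sigma>. \<Sum>k\<in>active ps r'. c j k * e k r' \<sigma>)" if "j \<in> J" for j
  proof -
    have j: "j \<in> active qs r" "j \<in> active qs r'" using that by (auto simp: J_def)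
    have "homologous (X r') l (g j r') (g j r)"
      using generator_transition[OF qs r j(1)] j by (auto intro: homologous_sym)
    also have "homologous (X r') l (g j r) (\<lambda>\<sigma>. \<Sum>k\<in>active ps r. c j k * e k r \<sigma>)"
      using c(2)[OF j(1)] mono by (rule homologous_mono)
    also have "homologous (X r') l (\<lambda>\<sigma>. \<Sum>k\<in>active ps r. c j k * e k r \<sigma>)
       (\<lambda>\<sigma>. \<Sum>k\<in>active ps r'. c j k * e k r' \<sigma>)"
      using c(1)[OF j(1)] by (intro lincomb_transition[OF ps r])
    finally show ?thesis .
  qed
  show ?thesis
  \<comment> \<open>With constant \<open>f\<close> the triangularity hypothesis asks for the full
    identity matrix.\<close>
  proof (rule card_le_of_triangular_product[where f = "\<lambda>_. 0" and a = a and c = c])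
    fix k k' assume k: "k \<in> active ps r \<inter> active ps r'" and k': "k' \<in> active ps r \<inter> active ps r'"
    have "homologous (X r') l (e k r') (e k r)"
      using generator_transition[OF ps r, of k] k by (auto intro: homologous_sym)
    also have "homologous (X r') l (e k r) (\<lambda>\<sigma>. \<Sum>j\<in>active qs r. a k j * g j r \<sigma>)"
      using a(2) k mono by (blast intro: homologous_mono)
    also have "homologous (X r') l (\<lambda>\<sigma>. \<Sum>j\<in>active qs r. a k j * g j r \<sigma>)
       (\<lambda>\<sigma>. \<Sum>j\<in>active qs r'. a k j * g j r' \<sigma>)"
      using a(1) k by (intro lincomb_transition[OF qs r]) auto
    also have "(\<lambda>\<sigma>. \<Sum>j\<in>active qs r'. a k j * g j r' \<sigma>) = (\<lambda>\<sigma>. \<Sum>j\<in>J. a k j * g j r' \<sigma>)"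
      using a(1) k by (intro ext sum.mono_neutral_right) (auto simp: J_def)
    also have "homologous (X r') l (\<lambda>\<sigma>. \<Sum>j\<in>J. a k j * g j r' \<sigma>)
      (\<lambda>\<sigma>. \<Sum>j\<in>J. a k j * (\<Sum>k\<in>active ps r'. c j k * e k r' \<sigma>))"
      using g by (intro homologous_lincomb)
    also have "(\<lambda>\<sigma>. \<Sum>j\<in>J. a k j * (\<Sum>k\<in>active ps r'. c j k * e k r' \<sigma>))
      = (\<lambda>\<sigma>. \<Sum>k'\<in>active ps r'. (\<Sum>j\<in>J. a k j * c j k') * e k' r' \<sigma>)"
      by (rule ext) (simp add: sum_distrib_left sum_distrib_right mult.assoc, rule sum.swap)
    finally have h: "homologous (X r') l (e k r') \<dots>" .
    have e_eq: "e k r' = (\<lambda>\<sigma>. \<Sum>k'\<in>active ps r'. (if k = k' then 1 else 0) * e k' r' \<sigma>)"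
    proof (rule ext)
      fix \<sigma>
      have "(\<Sum>k'\<in>active ps r'. (if k = k' then 1 else 0) * e k' r' \<sigma>)
        = (\<Sum>k'\<in>active ps r'. if k = k' then e k' r' \<sigma> else 0)"
        by (intro sum.cong) auto
      then show "e k r' \<sigma> = (\<Sum>k'\<in>active ps r'. (if k = k' then 1 else 0) * e k' r' \<sigma>)"
        using k by simp
    qed
    have "homologous (X r') l (\<lambda>\<sigma>. \<Sum>k'\<in>active ps r'. (if k = k' then 1 else 0) * e k' r' \<sigma>)
      (\<lambda>\<sigma>. \<Sum>k'\<in>active ps r'. (\<Sum>j\<in>J. a k j * c j k') * e k' r' \<sigma>)"
      by (subst e_eq[symmetric]) (rule h)
    from generators_independent[OF ps r' this, of k'] k'
    have "(if k = k' then 1 else 0) = (\<Sum>j\<in>J. a k j * c j k')" by simp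
    then show "0 < (0::real) \<or> (\<Sum>j\<in>active qs r \<inter> active qs r'. a k j * c j k') = (if k = k' then 1 else 0)"
      by (simp add: J_def)
  qed auto
qed

section \<open>Uniqueness of the diagram\<close>

lemma eventually_finite_thresholds:
  fixes A B :: "ereal set"
  assumes "finite A"
  shows "\<forall>\<^sub>F \<eta> in at_right (0::real). \<forall>x\<in>A. ereal c < x \<longrightarrow> ereal (c + \<eta>) < x"
proof -
  have "\<forall>\<^sub>F \<eta> in at_right (0::real). ereal c < x \<longrightarrow> ereal (c + \<eta>) < x" for x
  proof (cases "ereal c < x")
    case True
    then obtain d where d: "ereal c < ereal d" "ereal d < x" using ereal_dense2 by blast
    have "\<forall>\<^sub>F \<eta> in at_right (0::real). \<eta> \<in> {0<..<d - c}"
      using d by (intro eventually_at_right_real) simp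
    then show ?thesis
    proof eventually_elim
      case (elim \<eta>)
      then have "ereal (c + \<eta>) < ereal d" by simp
      then show ?case using d(2) by (meson less_trans)
    qed
  qed simp
  then show ?thesis by (intro eventually_ball_finite assms) blast
qed

text \<open>Expresses the rank of a transition map by the multiset of bars alone, the form in which
  \<open>diagram_eqI\<close> compares two decompositions.\<close>

lemma card_active_Int:
  assumes "r \<le> r'"
  shows "card (active ps r \<inter> active ps r') =
    size {#p \<in># mset ps. fst p < ereal r \<and> ereal r' \<le> snd p#}"
proof -
  have "active ps r \<inter> active ps r' = {j. j < length ps \<and> fst (ps ! j) < ereal r \<and> ereal r' \<le> snd (ps ! j)}"
    using assms unfolding active_def
    by (auto elim: less_le_trans order_trans[rotated] simp: ereal_less_eq(3)[symmetric] simp del: ereal_less_eq)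
  then show ?thesis
    by (simp add: length_filter_conv_card flip: mset_filter)
qed

lemma size_filter_split:
  "size {#p \<in># M. P p#} = size {#p \<in># M. P p \<and> Q p#} + size {#p \<in># M. P p \<and> \<not> Q p#}"
  by (subst multiset_partition[of "{#p \<in># M. P p#}" Q], subst size_union)
    (simp add: filter_filter_mset conj_commute)

text \<open>Inclusion-exclusion: the multiplicity of \<open>q\<close> is an alternating sum of the
  numbers of points in four quadrants at \<open>q\<close>, closed or open in each coordinate. Apart
  from trivially empty quadrants, each number is an instance of \<open>eq\<close> with
  \<open>r\<close> at the birth or just above it and \<open>r'\<close> at the death or just above
  it.\<close>

lemma diagram_eqI:
  fixes M N :: diagram
  assumes bounds: "\<And>p. p \<in># M + N \<Longrightarrow> 0 \<le> fst p \<and> fst p < snd p"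
    and eq: "\<And>r r'. 0 < r \<Longrightarrow> r \<le> r' \<Longrightarrow>
      size {#p \<in># M. fst p < ereal r \<and> ereal r' \<le> snd p#} = size {#p \<in># N. fst p < ereal r \<and> ereal r' \<le> snd p#}"
  shows "M = N"
proof (rule multiset_eqI)
  fix q :: "ereal \<times> ereal"
  define S where "S = set_mset (M + N)"
  have fS: "finite S" by (simp add: S_def)
  show "count M q = count N q"
  proof (cases "q \<in> S")
    case False
    then show ?thesis by (simp add: S_def not_in_iff)
  next
    case True
    then have q: "0 \<le> fst q" "fst q < snd q" using bounds by (auto simp: S_def)
    then obtain b where b: "fst q = ereal b" "0 \<le> b"
      by (cases "fst q") auto
    define T where "T = fst ` S \<union> snd ` S"
    have fT: "finite T" using fS by (simp add: T_def)
    have eqF: "size {#p \<in># M. P p#} = size {#p \<in># N. P p#}"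
      if "0 < r" "r \<le> r'" "\<And>p. p \<in> S \<Longrightarrow> P p \<longleftrightarrow> fst p < ereal r \<and> ereal r' \<le> snd p" for P r r'
    proof -
      have "{#p \<in># M. P p#} = {#p \<in># M. fst p < ereal r \<and> ereal r' \<le> snd p#}"
           "{#p \<in># N. P p#} = {#p \<in># N. fst p < ereal r \<and> ereal r' \<le> snd p#}"
        using that(3) by (intro filter_mset_cong refl; simp add: S_def)+
      then show ?thesis using eq[OF that(1,2)] by simp
    qed
    have eq0: "size {#p \<in># M. P p#} = size {#p \<in># N. P p#}" if "\<And>p. p \<in> S \<Longrightarrow> \<not> P p" for P
    proof -
      have "{#p \<in># M. P p#} = {#p \<in># M. False#}" "{#p \<in># N. P p#} = {#p \<in># N. False#}"
        using that by (intro filter_mset_cong refl; simp add: S_def)+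
      then show ?thesis by (simp only: filter_mset_False size_empty)
    qed
    \<comment> \<open>\<open>d\<close> is a finite stand-in for the death: an infinite death is
      replaced by a real number beyond all finite endpoints, so that \<open>ereal d \<le> x\<close>
      singles out the infinite endpoints.\<close>
    have "\<exists>d. b < d \<and> (snd q = ereal d \<or> snd q = \<infinity> \<and> (\<forall>x\<in>T. x < \<infinity> \<longrightarrow> x < ereal d))"
    proof (cases "snd q")
      case (real d)
      then show ?thesis using q b by (intro exI[of _ d]) auto
    next
      case PInf
      have "\<forall>\<^sub>F d in at_top. \<forall>x\<in>T. x < \<infinity> \<longrightarrow> x < ereal d"
      proof (intro eventually_ball_finite fT ballI)
        fix x
        show "\<forall>\<^sub>F d in at_top. x < \<infinity> \<longrightarrow> x < ereal d"
          by (cases x) (auto intro: eventually_gt_at_top)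
      qed
      then have "\<forall>\<^sub>F d in at_top. (\<forall>x\<in>T. x < \<infinity> \<longrightarrow> x < ereal d) \<and> b < d"
        by (intro eventually_conj eventually_gt_at_top)
      then obtain d where "(\<forall>x\<in>T. x < \<infinity> \<longrightarrow> x < ereal d) \<and> b < d"
        using eventually_happens'[OF trivial_limit_at_top_linorder] by blast
      then show ?thesis using PInf by blast
    qed (use q in auto)
    then obtain d where d: "b < d" "snd q = ereal d \<or> snd q = \<infinity> \<and> (\<forall>x\<in>T. x < \<infinity> \<longrightarrow> x < ereal d)"
      by blast
    have ge_d: "snd q \<le> x \<longleftrightarrow> ereal d \<le> x" if "x \<in> T" for x
      using d(2)
    proof
      assume "snd q = \<infinity> \<and> (\<forall>x\<in>T. x < \<infinity> \<longrightarrow> x < ereal d)"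
      then show ?thesis using that by (cases "x = \<infinity>") (auto simp: less_top not_le)
    qed simp
    have "\<forall>\<^sub>F \<eta> in at_right (0::real). (\<forall>x\<in>T. ereal b < x \<longrightarrow> ereal (b + \<eta>) < x) \<and>
        (\<forall>x\<in>T. ereal d < x \<longrightarrow> ereal (d + \<eta>) < x) \<and> \<eta> \<in> {0<..<d - b}"
      using d(1) by (intro eventually_conj eventually_finite_thresholds fT eventually_at_right_real) simp
    then obtain \<eta> where "(\<forall>x\<in>T. ereal b < x \<longrightarrow> ereal (b + \<eta>) < x) \<and>
        (\<forall>x\<in>T. ereal d < x \<longrightarrow> ereal (d + \<eta>) < x) \<and> \<eta> \<in> {0<..<d - b}"
      using eventually_happens'[OF trivial_limit_at_right_real] by blast
    \<comment> \<open>No endpoint lies in the half-open gaps of width \<open>\<eta>\<close> above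
      \<open>b\<close> and above \<open>d\<close>. So being below \<open>b + \<eta>\<close> means
      being at most \<open>b\<close>, and being at least \<open>d + \<eta>\<close> means being above
      \<open>d\<close>.\<close>
    then have \<eta>: "\<And>x. x \<in> T \<Longrightarrow> ereal b < x \<Longrightarrow> ereal (b + \<eta>) < x"
        "\<And>x. x \<in> T \<Longrightarrow> ereal d < x \<Longrightarrow> ereal (d + \<eta>) < x" "0 < \<eta>" "\<eta> < d - b"
      by auto
    have le_b: "x \<le> fst q \<longleftrightarrow> x < ereal (b + \<eta>)" if "x \<in> T" for x
    proof
      assume "x \<le> fst q"
      also have "fst q < ereal (b + \<eta>)" using b(1) \<eta>(3) by simp
      finally show "x < ereal (b + \<eta>)" .
    next
      assume "x < ereal (b + \<eta>)"
      then have "\<not> ereal b < x" using \<eta>(1)[OF that] by (metis less_asym)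
      then show "x \<le> fst q" using b(1) by simp
    qed
    have gt_d: "ereal d < x \<longleftrightarrow> ereal (d + \<eta>) \<le> x" if "x \<in> T" for x
    proof
      assume "ereal d < x"
      then show "ereal (d + \<eta>) \<le> x" using \<eta>(2)[OF that] by simp
    next
      have "ereal d < ereal (d + \<eta>)" using \<eta>(3) by simp
      also assume "ereal (d + \<eta>) \<le> x"
      finally show "ereal d < x" .
    qed
    have inT: "fst p \<in> T" "snd p \<in> T" if "p \<in> S" for p using that by (auto simp: T_def)
    \<comment> \<open>\<open>A\<close> is the quadrant closed in both coordinates, \<open>C\<close>
      is open in the death, \<open>B\<close> open in the birth, \<open>D\<close> open in
      both.\<close>
    have A: "size {#p \<in># M. fst p \<le> fst q \<and> snd q \<le> snd p#} = size {#p \<in># N. fst p \<le> fst q \<and> snd q \<le> snd p#}"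
      proof (rule eqF[of "b + \<eta>" d])
        show "0 < b + \<eta>" "b + \<eta> \<le> d" using b \<eta>(3,4) by auto
      qed (intro arg_cong2[where f = "(\<and>)"] le_b ge_d gt_d inT refl; assumption)
    have C: "size {#p \<in># M. fst p \<le> fst q \<and> snd q < snd p#} = size {#p \<in># N. fst p \<le> fst q \<and> snd q < snd p#}"
    proof (cases "snd q = \<infinity>")
      case True
      then show ?thesis by (intro eq0) simp
    next
      case False
      then have qd: "snd q = ereal d" using d(2) by simp
      show ?thesis unfolding qd
      proof (rule eqF[of "b + \<eta>" "d + \<eta>"])
        show "0 < b + \<eta>" "b + \<eta> \<le> d + \<eta>" using b d(1) \<eta>(3) by auto
      qed (intro arg_cong2[where f = "(\<and>)"] le_b ge_d gt_d inT refl; assumption)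
    qed
    \<comment> \<open>The parameter \<open>r = b\<close> is admissible only for
      \<open>b > 0\<close>; for \<open>b = 0\<close> the quadrant is empty because no birth is
      negative. Likewise nothing lies beyond an infinite death, which settles the remaining
      exceptions in \<open>C\<close> and \<open>D\<close>.\<close>
    have B: "size {#p \<in># M. fst p < fst q \<and> snd q \<le> snd p#} = size {#p \<in># N. fst p < fst q \<and> snd q \<le> snd p#}"
    proof (cases "b = 0")
      case True
      show ?thesis
      proof (rule eq0)
        fix p assume "p \<in> S"
        then have "0 \<le> fst p" using bounds by (simp add: S_def)
        then show "\<not> (fst p < fst q \<and> snd q \<le> snd p)" using True b by (auto simp: not_less zero_ereal_def)
      qed
    next
      case False
      show ?thesis unfolding b(1)
      proof (rule eqF[of b d])
        show "0 < b" "b \<le> d" using False b d(1) by auto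
      qed (intro arg_cong2[where f = "(\<and>)"] le_b ge_d gt_d inT refl; assumption)
    qed
    have D: "size {#p \<in># M. fst p < fst q \<and> snd q < snd p#} = size {#p \<in># N. fst p < fst q \<and> snd q < snd p#}"
    proof (cases "b = 0 \<or> snd q = \<infinity>")
      case True
      show ?thesis
      proof (rule eq0)
        fix p assume "p \<in> S"
        then have "0 \<le> fst p" using bounds by (simp add: S_def)
        then show "\<not> (fst p < fst q \<and> snd q < snd p)" using True b by (auto simp: not_less zero_ereal_def)
      qed
    next
      case False
      then have qd: "snd q = ereal d" using d(2) by simp
      show ?thesis unfolding b(1) qd
      proof (rule eqF[of b "d + \<eta>"])
        show "0 < b" "b \<le> d + \<eta>" using False b d(1) \<eta>(3) by auto
      qed (intro arg_cong2[where f = "(\<and>)"] le_b ge_d gt_d inT refl; assumption)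
    qed
    have cnt: "size {#p \<in># K. fst p \<le> fst q \<and> snd q \<le> snd p#} + size {#p \<in># K. fst p < fst q \<and> snd q < snd p#}
       = size {#p \<in># K. fst p < fst q \<and> snd q \<le> snd p#} + size {#p \<in># K. fst p \<le> fst q \<and> snd q < snd p#}
         + count K q" for K :: diagram
    proof -
      have 1: "size {#p \<in># K. fst p \<le> fst q \<and> snd q \<le> snd p#}
        = size {#p \<in># K. fst p < fst q \<and> snd q \<le> snd p#} + size {#p \<in># K. fst p = fst q \<and> snd q \<le> snd p#}"
        by (subst size_filter_split[where Q = "\<lambda>p. fst p < fst q"])
          (intro arg_cong2[where f = "(+)"] arg_cong[where f = size] filter_mset_cong refl; auto)
      have 2: "size {#p \<in># K. fst p \<le> fst q \<and> snd q < snd p#}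
        = size {#p \<in># K. fst p < fst q \<and> snd q < snd p#} + size {#p \<in># K. fst p = fst q \<and> snd q < snd p#}"
        by (subst size_filter_split[where Q = "\<lambda>p. fst p < fst q"])
          (intro arg_cong2[where f = "(+)"] arg_cong[where f = size] filter_mset_cong refl; auto)
      have 3: "size {#p \<in># K. fst p = fst q \<and> snd q \<le> snd p#}
        = size {#p \<in># K. fst p = fst q \<and> snd q < snd p#} + size {#p \<in># K. p = q#}"
        by (subst size_filter_split[where Q = "\<lambda>p. snd q < snd p"])
          (intro arg_cong2[where f = "(+)"] arg_cong[where f = size] filter_mset_cong refl; auto intro: prod_eqI)
      have 4: "size {#p \<in># K. p = q#} = count K q" by (simp add: filter_eq_replicate_mset)
      show ?thesis using 1 2 3 4 by simp
    qed
    show ?thesis using cnt[of M] cnt[of N] A B C D by simp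
  qed
qed

lemma interval_decomposition_unique:
  fixes e g :: "nat \<Rightarrow> real \<Rightarrow> 'v::{finite, linorder} set \<Rightarrow> 'k::field"
  assumes ps: "interval_decomposition l X ps e" and qs: "interval_decomposition l X qs g"
    and mono: "\<And>r r'. 0 < r \<Longrightarrow> r \<le> r' \<Longrightarrow> X r \<subseteq> X r'"
  shows "mset ps = mset qs"
proof (rule diagram_eqI)
  show "0 \<le> fst p \<and> fst p < snd p" if "p \<in># mset ps + mset qs" for p
    using that interval_bounds[OF ps, of p] interval_bounds[OF qs, of p] by auto
  fix r r' :: real assume r: "0 < r" "r \<le> r'"
  have "card (active ps r \<inter> active ps r') = card (active qs r \<inter> active qs r')"
    using active_rank_le[OF ps qs r mono[OF r]] active_rank_le[OF qs ps r mono[OF r]] by simp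
  then show "size {#p \<in># mset ps. fst p < ereal r \<and> ereal r' \<le> snd p#} =
      size {#p \<in># mset qs. fst p < ereal r \<and> ereal r' \<le> snd p#}"
    using r by (simp add: card_active_Int)
qed

text \<open>\<open>dgm\<close> is a definite description; uniqueness turns any single decomposition
  into its value.\<close>

lemma dgm_eq:
  fixes e :: "nat \<Rightarrow> real \<Rightarrow> 'v::{finite, linorder} set \<Rightarrow> 'k::field"
  assumes ps: "interval_decomposition l X ps e"
    and mono: "\<And>r r'. 0 < r \<Longrightarrow> r \<le> r' \<Longrightarrow> X r \<subseteq> X r'"
  shows "dgm TYPE('k) l X = mset ps"
  unfolding dgm_def
proof (rule the_equality)
  show "\<exists>qs (e :: nat \<Rightarrow> real \<Rightarrow> 'v set \<Rightarrow> 'k). mset ps = mset qs \<and> interval_decomposition l X qs e"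
    using ps by blast
qed (use interval_decomposition_unique[OF _ ps mono] in blast)

section \<open>Interleavings\<close>

definition long_bars :: "real \<Rightarrow> (ereal \<times> ereal) list \<Rightarrow> nat set" where
  "long_bars h ps = {k. k < length ps \<and> fst (ps ! k) + ereal h < snd (ps ! k)}"

lemma finite_long_bars [simp]: "finite (long_bars h ps)"
  by (simp add: long_bars_def)

lemma interval_start_finite:
  assumes "interval_decomposition l X ps e" "k < length ps"
  shows "\<exists>b\<ge>0. fst (ps ! k) = ereal b"
  using interval_bounds[OF assms(1), of "ps ! k"] assms(2)
  by (cases "fst (ps ! k)") auto

text \<open>Passing from the generators \<open>e k\<close> just after their birth to combinations of the \<open>g j\<close> and back
  gives, for increasing birth times, a triangular matrix with unit diagonal that factors through the
  bars of \<open>qs\<close> longer than \<open>h\<close>.\<close>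

lemma long_bars_le_of_interleaving:
  fixes e g :: "nat \<Rightarrow> real \<Rightarrow> 'v::{finite, linorder} set \<Rightarrow> 'k::field"
  assumes ps: "interval_decomposition l X ps e" and qs: "interval_decomposition l Y qs g"
    and a: "0 \<le> a" and h: "0 \<le> h"
    and monoY: "\<And>r r'. 0 < r \<Longrightarrow> r \<le> r' \<Longrightarrow> Y r \<subseteq> Y r'"
    and monoJ': "\<And>r r'. 0 < r \<Longrightarrow> r \<le> r' \<Longrightarrow> J' r \<subseteq> J' r'"
    and XJ: "\<And>r. 0 < r \<Longrightarrow> X r \<subseteq> J r"
    and YJ: "\<And>r. 0 < r \<Longrightarrow> homology_iso TYPE('k) (Y (r + a)) (J r)"
    and YJ': "\<And>r. 0 < r \<Longrightarrow> Y r \<subseteq> J' r"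
    and XJ': "\<And>r. 0 < r \<Longrightarrow> homology_iso TYPE('k) (X (r + a)) (J' r)"
    and JJ': "\<And>r. 0 < r \<Longrightarrow> J r \<subseteq> J' (r + a)"
  shows "card (long_bars (2 * a + h) ps) \<le> card (long_bars h qs)"
proof -
  obtain b where b: "\<And>k. k < length ps \<Longrightarrow> fst (ps ! k) = ereal (b k)" "\<And>k. k < length ps \<Longrightarrow> 0 \<le> b k"
    using interval_start_finite[OF ps] by metis
  obtain \<beta> where \<beta>: "\<And>j. j < length qs \<Longrightarrow> fst (qs ! j) = ereal (\<beta> j)" "\<And>j. j < length qs \<Longrightarrow> 0 \<le> \<beta> j"
    using interval_start_finite[OF qs] by metis
  define K where "K = long_bars (2 * a + h) ps"
  have K_len: "k < length ps" if "k \<in> K" for k using that by (simp add: K_def long_bars_def)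
  have "\<forall>\<^sub>F \<eta> in at_right (0::real).
     (\<forall>k\<in>{..<length ps}. \<forall>x\<in>{ereal (\<beta> j) |j. j < length qs}. ereal (b k + a) < x \<longrightarrow> ereal (b k + a + \<eta>) < x) \<and>
     (\<forall>k\<in>{..<length ps}. \<forall>x\<in>{snd (ps ! k)}. ereal (b k + (2 * a + h)) < x \<longrightarrow> ereal (b k + (2 * a + h) + \<eta>) < x) \<and>
     (\<forall>j\<in>{..<length qs}. \<forall>x\<in>{snd (qs ! j)}. ereal (\<beta> j) < x \<longrightarrow> ereal (\<beta> j + \<eta>) < x) \<and> \<eta> \<in> {0<..<1}"
    by (intro eventually_conj eventually_ball_finite ballI eventually_finite_thresholds eventually_at_right_real) auto
  \<comment> \<open>A bar is active only strictly after its birth, so births are delayed by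
    \<open>\<eta>\<close>. It is small enough that no bar of \<open>qs\<close> is born in the gap of
    width \<open>\<eta>\<close> above \<open>b k + a\<close>, that the bars in \<open>K\<close>
    remain longer than \<open>2 * a + h\<close> after the delay, and that every bar of
    \<open>qs\<close> is alive at its delayed birth.\<close>
  from eventually_happens'[OF trivial_limit_at_right_real this] obtain \<eta> where \<eta>: "0 < \<eta>"
    and \<eta>1: "\<And>k j. k < length ps \<Longrightarrow> j < length qs \<Longrightarrow> b k + a < \<beta> j \<Longrightarrow> b k + a + \<eta> < \<beta> j"
    and \<eta>2: "\<And>k. k \<in> K \<Longrightarrow> ereal (b k + (2 * a + h) + \<eta>) < snd (ps ! k)"
    and \<eta>3: "\<And>j. j < length qs \<Longrightarrow> ereal (\<beta> j + \<eta>) < snd (qs ! j)"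
  proof (rule exE, goal_cases)
    case (1 \<eta>)
    show ?case
    proof (rule 1(1))
      show "0 < \<eta>" using 1(2) by auto
      show "b k + a + \<eta> < \<beta> j" if "k < length ps" "j < length qs" "b k + a < \<beta> j" for k j
        using 1(2) that by force
      show "ereal (b k + (2 * a + h) + \<eta>) < snd (ps ! k)" if "k \<in> K" for k
        using 1(2) that b(1)[of k] by (auto simp: K_def long_bars_def)
      show "ereal (\<beta> j + \<eta>) < snd (qs ! j)" if "j < length qs" for j
        using 1(2) that interval_bounds[OF qs, of "qs ! j"] \<beta>(1)[of j] by auto
    qed
  qed
  define r where "r k = b k + \<eta>" for k
  define s where "s j = \<beta> j + \<eta>" for j
  have r_pos: "0 < r k" if "k < length ps" for k using b(2)[OF that] \<eta> by (simp add: r_def)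
  have s_pos: "0 < s j" if "j < length qs" for j using \<beta>(2)[OF that] \<eta> by (simp add: s_def)
  have act_r: "k \<in> active ps t" if "k \<in> K" "r k \<le> t" "t \<le> r k + (2 * a + h)" for k t
  proof -
    have "ereal t \<le> ereal (b k + (2 * a + h) + \<eta>)" using that(3) by (simp add: r_def)
    also have "\<dots> < snd (ps ! k)" using \<eta>2[OF that(1)] .
    finally show ?thesis
      using that b(1)[OF K_len] K_len \<eta> by (simp add: active_def r_def)
  qed
  have act_s: "j \<in> active qs (s j)" if "j < length qs" for j
    using \<eta>3[OF that] \<beta>(1)[OF that] that \<eta> by (simp add: active_def s_def)
  \<comment> \<open>The class of \<open>e k\<close> just after its birth is read in
    \<open>J (r k)\<close>, where it is represented by a cycle of \<open>Y (r k + a)\<close>;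
    \<open>A\<close> will hold the coordinates of that cycle.\<close>
  have "\<exists>c. (\<forall>j. j \<notin> active qs (r k + a) \<longrightarrow> c j = 0) \<and>
      homologous (J (r k)) l (e k (r k)) (\<lambda>\<sigma>. \<Sum>j\<in>active qs (r k + a). c j * g j (r k + a) \<sigma>)"
    if k: "k \<in> K" for k
  proof -
    have rk: "0 < r k" "0 < r k + a" using r_pos[OF K_len[OF k]] a by auto
    have "e k (r k) \<in> cycles (X (r k)) l" using act_r[OF k, of "r k"] a h rk by (intro generator_cycle[OF ps]) auto
    then have "e k (r k) \<in> cycles (J (r k)) l" using cycles_mono[OF XJ[OF rk(1)]] by blast
    then obtain z where z: "z \<in> cycles (Y (r k + a)) l" "homologous (J (r k)) l (e k (r k)) z"
      using YJ[OF rk(1)] unfolding homology_iso_def by blast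
    obtain c where c: "\<forall>j. j \<notin> active qs (r k + a) \<longrightarrow> c j = 0"
      "homologous (Y (r k + a)) l z (\<lambda>\<sigma>. \<Sum>j\<in>active qs (r k + a). c j * g j (r k + a) \<sigma>)"
      using generators_span[OF qs rk(2) z(1)] by blast
    have "homologous (J (r k)) l z (\<lambda>\<sigma>. \<Sum>j\<in>active qs (r k + a). c j * g j (r k + a) \<sigma>)"
      using c(2) YJ[OF rk(1)] homologous_mono unfolding homology_iso_def by blast
    then show ?thesis using c(1) homologous_trans[OF z(2)] by blast
  qed
  then have "\<forall>k\<in>K. \<exists>c. (\<forall>j. j \<notin> active qs (r k + a) \<longrightarrow> c j = 0) \<and>
      homologous (J (r k)) l (e k (r k)) (\<lambda>\<sigma>. \<Sum>j\<in>active qs (r k + a). c j * g j (r k + a) \<sigma>)" by blast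
  from bchoice[OF this] obtain A where A0: "\<And>k j. k \<in> K \<Longrightarrow> j \<notin> active qs (r k + a) \<Longrightarrow> A k j = 0"
    and A: "\<And>k. k \<in> K \<Longrightarrow>
      homologous (J (r k)) l (e k (r k)) (\<lambda>\<sigma>. \<Sum>j\<in>active qs (r k + a). A k j * g j (r k + a) \<sigma>)" by blast
  \<comment> \<open>On the way back \<open>g j\<close> is taken just after its own birth and not at
    the parameter where it is met, so that its coordinates \<open>C j\<close> do not depend on
    \<open>k\<close> and form a single matrix.\<close>
  have "\<exists>c. (\<forall>k. k \<notin> active ps (s j + a) \<longrightarrow> c k = 0) \<and>
      homologous (J' (s j)) l (g j (s j)) (\<lambda>\<sigma>. \<Sum>k\<in>active ps (s j + a). c k * e k (s j + a) \<sigma>)"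
    if j: "j < length qs" for j
  proof -
    have sj: "0 < s j" "0 < s j + a" using s_pos[OF j] a by auto
    have "g j (s j) \<in> cycles (Y (s j)) l" using act_s[OF j] sj by (intro generator_cycle[OF qs]) auto
    then have "g j (s j) \<in> cycles (J' (s j)) l" using cycles_mono[OF YJ'[OF sj(1)]] by blast
    then obtain z where z: "z \<in> cycles (X (s j + a)) l" "homologous (J' (s j)) l (g j (s j)) z"
      using XJ'[OF sj(1)] unfolding homology_iso_def by blast
    obtain c where c: "\<forall>k. k \<notin> active ps (s j + a) \<longrightarrow> c k = 0"
      "homologous (X (s j + a)) l z (\<lambda>\<sigma>. \<Sum>k\<in>active ps (s j + a). c k * e k (s j + a) \<sigma>)"
      using generators_span[OF ps sj(2) z(1)] by blast
    have "homologous (J' (s j)) l z (\<lambda>\<sigma>. \<Sum>k\<in>active ps (s j + a). c k * e k (s j + a) \<sigma>)"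
      using c(2) XJ'[OF sj(1)] homologous_mono unfolding homology_iso_def by blast
    then show ?thesis using c(1) homologous_trans[OF z(2)] by blast
  qed
  then have "\<forall>j\<in>{..<length qs}. \<exists>c. (\<forall>k. k \<notin> active ps (s j + a) \<longrightarrow> c k = 0) \<and>
      homologous (J' (s j)) l (g j (s j)) (\<lambda>\<sigma>. \<Sum>k\<in>active ps (s j + a). c k * e k (s j + a) \<sigma>)" by blast
  from bchoice[OF this] obtain C where C0: "\<And>j k. j < length qs \<Longrightarrow> k \<notin> active ps (s j + a) \<Longrightarrow> C j k = 0"
    and C: "\<And>j. j < length qs \<Longrightarrow>
      homologous (J' (s j)) l (g j (s j)) (\<lambda>\<sigma>. \<Sum>k\<in>active ps (s j + a). C j k * e k (s j + a) \<sigma>)" by blast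
  \<comment> \<open>The bars of \<open>qs\<close> present during the whole waiting time
    \<open>h\<close> in \<open>Y\<close>. Activity at \<open>r k + a\<close> means a birth strictly
    before that parameter, so these bars are longer than \<open>h\<close>.\<close>
  define I where "I k = active qs (r k + a) \<inter> active qs (r k + a + h)" for k
  have I_long: "I k \<subseteq> long_bars h qs" if "k \<in> K" for k
  proof
    fix j assume "j \<in> I k"
    then have j: "j < length qs" "\<beta> j < r k + a" "ereal (r k + a + h) \<le> snd (qs ! j)"
      using \<beta>(1)[of j] by (auto simp: I_def active_def)
    have "ereal (\<beta> j + h) < ereal (r k + a + h)" using j by simp
    also note j(3)
    finally show "j \<in> long_bars h qs" using j \<beta>(1) by (simp add: long_bars_def)
  qed
  \<comment> \<open>A bar in \<open>I k\<close> is born before \<open>b k + a + \<eta>\<close>,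
    hence by the choice of \<open>\<eta>\<close> not after \<open>b k + a\<close>; so even its
    delayed birth comes no later than \<open>r k + a\<close>.\<close>
  have s_le: "s j \<le> r k + a" if "k \<in> K" "j \<in> I k" for k j
  proof (rule ccontr)
    assume "\<not> s j \<le> r k + a"
    then have "b k + a < \<beta> j" by (simp add: r_def s_def)
    moreover have "j < length qs" "\<beta> j < r k + a" using that \<beta>(1)[of j] by (auto simp: I_def active_def)
    ultimately show False using \<eta>1[OF K_len[OF that(1)], of j] by (simp add: r_def)
  qed
  define A' where "A' k j = (if j \<in> I k then A k j else 0)" for k j
  show ?thesis unfolding K_def[symmetric]
  proof (rule card_le_of_triangular_product[where f = b and a = A' and c = C])
    fix k k' assume k: "k \<in> K" and k': "k' \<in> K"
    \<comment> \<open>The round trip shifts by \<open>a\<close>, waits for \<open>h\<close> and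
      shifts back by \<open>a\<close>. It ends at \<open>T\<close>, and in \<open>N\<close> its
      result is compared with the direct transition of \<open>e k\<close> to
      \<open>T\<close>.\<close>
    define T where "T = r k + (2 * a + h)"
    define N where "N = J' (r k + a + h)"
    have rk: "0 < r k" using r_pos[OF K_len[OF k]] .
    have T: "0 < T" "r k + a + h + a = T" "r k + a + h + a = T" using rk a h by (auto simp: T_def)
    have XN: "homology_iso TYPE('k) (X T) N" using XJ'[of "r k + a + h"] T rk a h by (simp add: N_def)
    then have XN': "X T \<subseteq> N" by (simp add: homology_iso_def)
    have J'N: "J' t \<subseteq> N" if "0 < t" "t \<le> r k + a + h" for t using monoJ' that by (simp add: N_def)
    have JN: "J (r k) \<subseteq> N" using JJ'[OF rk] J'N[of "r k + a"] rk a h by auto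
    have YN: "Y t \<subseteq> N" if "0 < t" "t \<le> r k + a + h" for t using YJ'[OF that(1)] J'N[OF that] by blast
    have Yt: "Y (r k + a + h) \<subseteq> N" using rk a h by (intro YN) auto
    have kT: "k \<in> active ps T" using k a h by (intro act_r) (auto simp: T_def)
    have *: "homologous N l (g j (r k + a + h)) (\<lambda>\<sigma>. \<Sum>k\<in>active ps T. C j k * e k T \<sigma>)" if j: "j \<in> I k" for j
    proof -
      have jl: "j < length qs" using j by (simp add: I_def active_def)
      have sj: "0 < s j" "s j \<le> r k + a + h" "s j + a \<le> T" using s_pos[OF jl] s_le[OF k j] h by (auto simp: T_def)
      have "homologous (Y (r k + a + h)) l (g j (s j)) (g j (r k + a + h))"
        using generator_transition[OF qs sj(1,2) act_s[OF jl]] j by (auto simp: I_def)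
      from homologous_sym[OF homologous_mono[OF this Yt]]
      have "homologous N l (g j (r k + a + h)) (g j (s j))" .
      also have "homologous N l (g j (s j)) (\<lambda>\<sigma>. \<Sum>k\<in>active ps (s j + a). C j k * e k (s j + a) \<sigma>)"
        using C[OF jl] J'N[OF sj(1,2)] by (rule homologous_mono)
      also have "homologous N l \<dots> (\<lambda>\<sigma>. \<Sum>k\<in>active ps T. C j k * e k T \<sigma>)"
        by (rule homologous_mono[OF lincomb_transition[OF ps] XN']) (use sj a C0[OF jl] in auto)
      finally show ?thesis .
    qed
    have "homologous (X T) l (e k (r k)) (e k T)"
      using generator_transition[OF ps rk, of T k] act_r[OF k, of "r k"] kT a h by (simp add: T_def)
    from homologous_sym[OF homologous_mono[OF this XN']] have "homologous N l (e k T) (e k (r k))" .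
    also have "homologous N l (e k (r k)) (\<lambda>\<sigma>. \<Sum>j\<in>active qs (r k + a). A k j * g j (r k + a) \<sigma>)"
      using A[OF k] JN by (rule homologous_mono)
    also have "homologous N l \<dots> (\<lambda>\<sigma>. \<Sum>j\<in>active qs (r k + a + h). A k j * g j (r k + a + h) \<sigma>)"
      by (rule homologous_mono[OF lincomb_transition[OF qs] Yt]) (use rk a h A0[OF k] in auto)
    also have "(\<lambda>\<sigma>. \<Sum>j\<in>active qs (r k + a + h). A k j * g j (r k + a + h) \<sigma>)
        = (\<lambda>\<sigma>. \<Sum>j\<in>I k. A' k j * g j (r k + a + h) \<sigma>)"
      using A0[OF k] by (intro ext sum.mono_neutral_cong_right) (auto simp: I_def A'_def)
    also have "homologous N l \<dots> (\<lambda>\<sigma>. \<Sum>j\<in>I k. A' k j * (\<Sum>k\<in>active ps T. C j k * e k T \<sigma>))"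
      using * by (intro homologous_lincomb)
    also have "(\<lambda>\<sigma>. \<Sum>j\<in>I k. A' k j * (\<Sum>k\<in>active ps T. C j k * e k T \<sigma>))
      = (\<lambda>\<sigma>. \<Sum>k'\<in>active ps T. (\<Sum>j\<in>I k. A' k j * C j k') * e k' T \<sigma>)"
      by (rule ext) (simp add: sum_distrib_left sum_distrib_right mult.assoc, rule sum.swap)
    finally have hN: "homologous N l (e k T) (\<lambda>\<sigma>. \<Sum>k'\<in>active ps T. (\<Sum>j\<in>I k. A' k j * C j k') * e k' T \<sigma>)" .
    have e_eq: "e k T = (\<lambda>\<sigma>. \<Sum>k'\<in>active ps T. (if k = k' then 1 else 0) * e k' T \<sigma>)"
    proof (rule ext)
      fix \<sigma>
      have "(\<Sum>k'\<in>active ps T. (if k = k' then 1 else 0) * e k' T \<sigma>)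
        = (\<Sum>k'\<in>active ps T. if k = k' then e k' T \<sigma> else 0)"
        by (intro sum.cong) auto
      then show "e k T \<sigma> = (\<Sum>k'\<in>active ps T. (if k = k' then 1 else 0) * e k' T \<sigma>)"
        using kT by simp
    qed
    have "homologous N l (\<lambda>\<sigma>. \<Sum>k'\<in>active ps T. (if k = k' then 1 else 0) * e k' T \<sigma>)
      (\<lambda>\<sigma>. \<Sum>k'\<in>active ps T. (\<Sum>j\<in>I k. A' k j * C j k') * e k' T \<sigma>)"
      by (subst e_eq[symmetric]) (rule hN)
    note XT = homology_isoD_homologous[OF XN lincomb_cycle[OF ps T(1)] lincomb_cycle[OF ps T(1)] this]
    have coeff: "(if k = k' then 1 else 0) = (\<Sum>j\<in>I k. A' k j * C j k')" if "k' \<in> active ps T" for k'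
      by (rule generators_independent[OF ps T(1) XT that])
    have sumI: "(\<Sum>j\<in>long_bars h qs. A' k j * C j k') = (\<Sum>j\<in>I k. A' k j * C j k')"
      using I_long[OF k] by (intro sum.mono_neutral_right) (auto simp: A'_def)
    show "b k' < b k \<or> (\<Sum>j\<in>long_bars h qs. A' k j * C j k') = (if k = k' then 1 else 0)"
    proof (cases "k' \<in> active ps T")
      case True
      then show ?thesis using coeff sumI by simp
    next
      case False
      show ?thesis
      \<comment> \<open>A nonzero coefficient shows that \<open>k'\<close> was active at
        \<open>s j + a\<close>, which is at most \<open>T\<close>; being inactive at
        \<open>T\<close>, it has ended before. As its length exceeds
        \<open>2 * a + h + \<eta>\<close>, it was born before \<open>b k\<close>, where
        triangularity leaves the entry free.\<close>
      proof (cases "\<exists>j\<in>I k. C j k' \<noteq> 0")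
        case True
        then obtain j where j: "j \<in> I k" "C j k' \<noteq> 0" by blast
        then have jl: "j < length qs" by (simp add: I_def active_def)
        have "k' \<in> active ps (s j + a)" using C0[OF jl] j by blast
        then have "b k' < s j + a" using b(1)[OF K_len[OF k']] by (simp add: active_def)
        also have "s j + a \<le> T" using s_le[OF k j(1)] a h by (simp add: T_def)
        finally have "\<not> ereal T \<le> snd (ps ! k')"
          using False b(1)[OF K_len[OF k']] K_len[OF k'] by (auto simp: active_def)
        then have "snd (ps ! k') < ereal T" by simp
        with \<eta>2[OF k'] have "ereal (b k' + (2 * a + h) + \<eta>) < ereal T" by (rule less_trans)
        then show ?thesis by (simp add: T_def r_def)
      next
        case False2: False
        then have "(\<Sum>j\<in>I k. A' k j * C j k') = 0" by (intro sum.neutral) auto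
        moreover have "k \<noteq> k'" using kT False by blast
        ultimately show ?thesis using sumI by simp
      qed
    qed
  qed (simp_all add: K_def)
qed

section \<open>Relabelling vertices\<close>

text \<open>For injective \<open>\<iota>\<close> this is the pushforward of chains; sets that leave
  the range get coefficient zero.\<close>

definition relabel :: "('m \<Rightarrow> 'v) \<Rightarrow> ('m set \<Rightarrow> 'k::zero) \<Rightarrow> 'v set \<Rightarrow> 'k" where
  "relabel \<iota> z \<sigma> = (if \<sigma> \<subseteq> range \<iota> then z (\<iota> -` \<sigma>) else 0)"

context
  fixes \<iota> :: "'m::{finite, linorder} \<Rightarrow> 'v::{finite, linorder}"
  assumes \<iota>: "strict_mono \<iota>"
begin

lemma relabel_inj: "inj \<iota>"
  using \<iota> by (rule strict_mono_imp_inj_on)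

lemma relabel_image [simp]: "relabel \<iota> z (\<iota> ` \<sigma>) = z \<sigma>"
  by (simp add: relabel_def inj_vimage_image_eq[OF relabel_inj] image_mono)

text \<open>Orientations come from the vertex order, so it is monotonicity of
  \<open>\<iota>\<close>, beyond injectivity, that makes \<open>relabel\<close> commute with
  boundaries.\<close>

lemma face_sign_image: "face_sign (\<iota> ` \<sigma>) (\<iota> v) = face_sign \<sigma> v"
proof -
  have "{w \<in> \<iota> ` \<sigma>. w < \<iota> v} = \<iota> ` {w \<in> \<sigma>. w < v}"
    using \<iota> by (auto simp: strict_mono_less)
  then show ?thesis
    by (simp add: face_sign_def card_image[OF inj_on_subset[OF relabel_inj]])
qed

lemma boundary_relabel:
  fixes z :: "'m set \<Rightarrow> 'k::field"
  shows "boundary (relabel \<iota> z) = relabel \<iota> (boundary z)"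
proof
  fix \<rho>
  show "boundary (relabel \<iota> z) \<rho> = relabel \<iota> (boundary z) \<rho>"
  proof (cases "\<rho> \<subseteq> range \<iota>")
    case True
    then obtain \<rho>0 where \<rho>: "\<rho> = \<iota> ` \<rho>0" by (auto simp: subset_image_iff)
    show ?thesis
    proof (cases "\<rho>0 = {}")
      case False
      have "boundary (relabel \<iota> z) \<rho> = (\<Sum>v\<in>-\<rho>. relabel \<iota> z (insert v \<rho>) * face_sign \<rho> v)"
        using False \<rho> by (simp add: boundary_eq)
      also have "\<dots> = (\<Sum>v\<in>\<iota> ` (-\<rho>0). relabel \<iota> z (insert v \<rho>) * face_sign \<rho> v)"
        using inj_image_mem_iff[OF relabel_inj]
        by (intro sum.mono_neutral_right) (auto simp: \<rho> relabel_def)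
      also have "\<dots> = (\<Sum>v\<in>-\<rho>0. relabel \<iota> z (insert (\<iota> v) \<rho>) * face_sign \<rho> (\<iota> v))"
        by (subst sum.reindex) (auto intro: inj_on_subset[OF relabel_inj])
      also have "\<dots> = (\<Sum>v\<in>-\<rho>0. z (insert v \<rho>0) * face_sign \<rho>0 v)"
        by (intro sum.cong refl) (simp add: \<rho> face_sign_image flip: image_insert)
      finally show ?thesis using False by (simp add: \<rho> boundary_eq)
    qed (simp add: \<rho> boundary_eq relabel_def)
  next
    case False
    then show ?thesis by (auto simp: boundary_eq relabel_def intro!: sum.neutral)
  qed
qed

lemma relabel_chains_iff: "relabel \<iota> z \<in> chains ((`) \<iota> ` X) l \<longleftrightarrow> z \<in> chains X l"
proof
  assume z: "relabel \<iota> z \<in> chains ((`) \<iota> ` X) l"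
  show "z \<in> chains X l"
    unfolding chains_def
  proof (clarify)
    fix \<sigma> assume "z \<sigma> \<noteq> 0"
    then have "relabel \<iota> z (\<iota> ` \<sigma>) \<noteq> 0" by simp
    then have "\<iota> ` \<sigma> \<in> (`) \<iota> ` X" "card (\<iota> ` \<sigma>) = Suc l" using z unfolding chains_def by blast+
    then show "\<sigma> \<in> X \<and> card \<sigma> = Suc l"
      using inj_image_eq_iff[OF relabel_inj] card_image[OF inj_on_subset[OF relabel_inj subset_UNIV]] by auto
  qed
next
  assume z: "z \<in> chains X l"
  show "relabel \<iota> z \<in> chains ((`) \<iota> ` X) l"
    unfolding chains_def
  proof (clarify)
    fix \<sigma> assume nz: "relabel \<iota> z \<sigma> \<noteq> 0"
    then obtain \<sigma>0 where \<sigma>: "\<sigma> = \<iota> ` \<sigma>0" by (auto simp: relabel_def subset_image_iff split: if_splits)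
    then have "\<sigma>0 \<in> X" "card \<sigma>0 = Suc l" using nz z by (auto simp: chains_def)
    then show "\<sigma> \<in> (`) \<iota> ` X \<and> card \<sigma> = Suc l"
      using card_image[OF inj_on_subset[OF relabel_inj subset_UNIV]] \<sigma> by auto
  qed
qed

lemma chains_image_eq: "z \<in> chains ((`) \<iota> ` X) l \<Longrightarrow> z = relabel \<iota> (\<lambda>\<sigma>. z (\<iota> ` \<sigma>))"
proof
  fix \<sigma> assume z: "z \<in> chains ((`) \<iota> ` X) l"
  show "z \<sigma> = relabel \<iota> (\<lambda>\<sigma>. z (\<iota> ` \<sigma>)) \<sigma>"
  proof (cases "\<sigma> \<subseteq> range \<iota>")
    case True
    then show ?thesis by (simp add: relabel_def image_vimage_eq inf.absorb1)
  next
    case False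
    then have "\<sigma> \<notin> (`) \<iota> ` X" by auto
    then show ?thesis using z False by (auto simp: relabel_def chains_def)
  qed
qed

lemma relabel_eq_iff: "relabel \<iota> y = relabel \<iota> z \<longleftrightarrow> y = z"
  by (metis ext relabel_image)

lemma relabel_zero: "relabel \<iota> (\<lambda>_. 0) = (\<lambda>_. 0)"
  by (simp add: relabel_def fun_eq_iff)

lemma relabel_cycles_iff:
  fixes z :: "'m set \<Rightarrow> 'k::field"
  shows "relabel \<iota> z \<in> cycles ((`) \<iota> ` X) l \<longleftrightarrow> z \<in> cycles X l"
  using relabel_eq_iff[of "boundary z" "\<lambda>_. 0"]
  by (simp add: cycles_def relabel_chains_iff boundary_relabel relabel_zero)

lemma relabel_boundaries_iff:
  fixes z :: "'m set \<Rightarrow> 'k::field"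
  shows "relabel \<iota> z \<in> boundaries ((`) \<iota> ` X) l \<longleftrightarrow> z \<in> boundaries X l"
proof
  assume "relabel \<iota> z \<in> boundaries ((`) \<iota> ` X) l"
  then obtain w where w: "w \<in> chains ((`) \<iota> ` X) (Suc l)" "relabel \<iota> z = boundary w"
    by (auto simp: boundaries_def)
  define w0 where "w0 = (\<lambda>\<sigma>. w (\<iota> ` \<sigma>))"
  have "w = relabel \<iota> w0" unfolding w0_def by (rule chains_image_eq[OF w(1)])
  then have "w0 \<in> chains X (Suc l)" "z = boundary w0"
    using w by (simp_all add: relabel_chains_iff boundary_relabel relabel_eq_iff)
  then show "z \<in> boundaries X l" by (simp add: boundaries_def)
next
  assume "z \<in> boundaries X l"
  then obtain w where w: "w \<in> chains X (Suc l)" "z = boundary w" by (auto simp: boundaries_def)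
  then have "relabel \<iota> z = boundary (relabel \<iota> w)" "relabel \<iota> w \<in> chains ((`) \<iota> ` X) (Suc l)"
    by (simp_all add: relabel_chains_iff boundary_relabel)
  then show "relabel \<iota> z \<in> boundaries ((`) \<iota> ` X) l" unfolding boundaries_def by blast
qed

lemma relabel_homologous_iff:
  fixes y z :: "'m set \<Rightarrow> 'k::field"
  shows "homologous ((`) \<iota> ` X) l (relabel \<iota> y) (relabel \<iota> z) \<longleftrightarrow> homologous X l y z"
proof -
  have "(\<lambda>\<sigma>. relabel \<iota> y \<sigma> - relabel \<iota> z \<sigma>) = relabel \<iota> (\<lambda>\<sigma>. y \<sigma> - z \<sigma>)"
    by (simp add: relabel_def fun_eq_iff)
  then show ?thesis by (simp add: homologous_def relabel_boundaries_iff)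
qed

lemma interval_decomposition_relabel:
  fixes e :: "nat \<Rightarrow> real \<Rightarrow> 'm set \<Rightarrow> 'k::field"
  assumes ps: "interval_decomposition l X ps e"
  shows "interval_decomposition l (\<lambda>r. (`) \<iota> ` X r) ps (\<lambda>j r. relabel \<iota> (e j r))"
  unfolding interval_decomposition_def
proof (intro conjI ballI allI impI)
  fix p assume "p \<in> set ps"
  then show "0 \<le> fst p" "fst p < snd p" using interval_bounds[OF ps] by auto
next
  fix r :: real and j assume "0 < r" "j \<in> active ps r"
  then show "relabel \<iota> (e j r) \<in> cycles ((`) \<iota> ` X r) l"
    using generator_cycle[OF ps] by (simp add: relabel_cycles_iff)
next
  fix r :: real and z :: "'v set \<Rightarrow> 'k" assume r: "0 < r" and z: "z \<in> cycles ((`) \<iota> ` X r) l"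
  define z0 where "z0 = (\<lambda>\<sigma>. z (\<iota> ` \<sigma>))"
  have zz: "z = relabel \<iota> z0" unfolding z0_def using z by (intro chains_image_eq) (auto simp: cycles_def)
  then have z0: "z0 \<in> cycles (X r) l" using z by (simp add: relabel_cycles_iff)
  have lin: "(\<lambda>\<sigma>. \<Sum>j\<in>active ps r. c j * relabel \<iota> (e j r) \<sigma>)
     = relabel \<iota> (\<lambda>\<sigma>. \<Sum>j\<in>active ps r. c j * e j r \<sigma>)" for c
    by (simp add: relabel_def fun_eq_iff)
  show "\<exists>!c. (\<forall>j. j \<notin> active ps r \<longrightarrow> c j = 0) \<and>
        homologous ((`) \<iota> ` X r) l z (\<lambda>\<sigma>. \<Sum>j\<in>active ps r. c j * relabel \<iota> (e j r) \<sigma>)"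
    unfolding lin zz relabel_homologous_iff
    using ps r z0 unfolding interval_decomposition_def by blast
next
  fix r r' :: real and j assume r: "0 < r" "r \<le> r'" "j \<in> active ps r"
  have "homologous ((`) \<iota> ` X r') l (relabel \<iota> (e j r)) (relabel \<iota> (if j \<in> active ps r' then e j r' else (\<lambda>_. 0)))"
    using generator_transition[OF ps r] by (simp only: relabel_homologous_iff)
  then show "homologous ((`) \<iota> ` X r') l (relabel \<iota> (e j r)) (if j \<in> active ps r' then relabel \<iota> (e j r') else (\<lambda>_. 0))"
    by (simp add: relabel_zero split: if_splits)
qed

end

text \<open>Chains on the disjoint union of two vertex sets need a linear order for their
  orientations. Putting all left vertices before the right ones makes both injections strictly
  monotone.\<close>

instantiation sum :: (linorder, linorder) linorder
begin

definition less_eq_sum :: "'a + 'b \<Rightarrow> 'a + 'b \<Rightarrow> bool" where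
  "less_eq_sum x y \<longleftrightarrow> (case (x, y) of (Inl a, Inl b) \<Rightarrow> a \<le> b | (Inl _, Inr _) \<Rightarrow> True
     | (Inr _, Inl _) \<Rightarrow> False | (Inr a, Inr b) \<Rightarrow> a \<le> b)"

definition less_sum :: "'a + 'b \<Rightarrow> 'a + 'b \<Rightarrow> bool" where
  "less_sum x y \<longleftrightarrow> x \<le> y \<and> \<not> y \<le> x"

instance
  by standard (auto simp: less_eq_sum_def less_sum_def split: sum.splits)

end

lemma strict_mono_Inl: "strict_mono (Inl :: 'a::linorder \<Rightarrow> 'a + 'b::linorder)"
  and strict_mono_Inr: "strict_mono (Inr :: 'b::linorder \<Rightarrow> 'a::linorder + 'b)"
  by (auto simp: strict_mono_def less_sum_def less_eq_sum_def)

text \<open>\<open>J p q\<close> carries \<open>X p\<close> on the left vertices and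
  \<open>Y q\<close> on the right ones. If the right parameter is ahead by \<open>a\<close>, every
  left vertex is dominated by a right one, so the inclusion of the right side is an isomorphism in
  homology; symmetrically for the left. The interleaving uses \<open>J r (r + a)\<close> and
  \<open>J (r + a) r\<close>, and the former is contained in
  \<open>J (r + 2 * a) (r + a)\<close>.\<close>

lemma long_bars_le_of_joint_filtration:
  fixes e g :: "nat \<Rightarrow> real \<Rightarrow> 'm::{finite, linorder} set \<Rightarrow> 'k::field"
    and J :: "real \<Rightarrow> real \<Rightarrow> ('m + 'm) set set"
  assumes ps: "interval_decomposition l X ps e" and qs: "interval_decomposition l Y qs g"
    and a: "0 \<le> a" and h: "0 \<le> h"
    and closed: "\<And>p q. 0 < p \<Longrightarrow> 0 < q \<Longrightarrow> face_closed (J p q)"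
    and mono: "\<And>p q p' q'. p \<le> p' \<Longrightarrow> q \<le> q' \<Longrightarrow> J p q \<subseteq> J p' q'"
    and X: "\<And>p q. 0 < p \<Longrightarrow> 0 < q \<Longrightarrow> {\<sigma> \<in> J p q. \<sigma> \<inter> range Inr = {}} = (`) Inl ` X p"
    and Y: "\<And>p q. 0 < p \<Longrightarrow> 0 < q \<Longrightarrow> {\<sigma> \<in> J p q. \<sigma> \<inter> range Inl = {}} = (`) Inr ` Y q"
    and f: "\<And>p \<sigma> i. 0 < p \<Longrightarrow> \<sigma> \<in> J p (p + a) \<Longrightarrow> Inl i \<in> \<sigma> \<Longrightarrow> insert (Inr (f i)) \<sigma> \<in> J p (p + a)"
    and f': "\<And>p \<sigma> i. 0 < p \<Longrightarrow> \<sigma> \<in> J (p + a) p \<Longrightarrow> Inr i \<in> \<sigma> \<Longrightarrow> insert (Inl (f' i)) \<sigma> \<in> J (p + a) p"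
  shows "card (long_bars (2 * a + h) ps) \<le> card (long_bars h qs)"
    and "card (long_bars (2 * a + h) qs) \<le> card (long_bars h ps)"
proof -
  have isoY: "homology_iso TYPE('k) ((`) Inr ` Y (p + a)) (J p (p + a))" if p: "0 < p" for p
  proof -
    have q: "0 < p + a" using p a by simp
    show ?thesis unfolding Y[OF p q, symmetric]
    proof (rule homology_iso_dominated[OF closed[OF p q], where f = "\<lambda>x. Inr (f (projl x))"])
      fix \<sigma> x assume "\<sigma> \<in> J p (p + a)" "x \<in> \<sigma>" "x \<in> (range Inl :: ('m + 'm) set)"
      then show "insert (Inr (f (projl x))) \<sigma> \<in> J p (p + a)" using f[OF p] by auto
    qed auto
  qed
  have isoX: "homology_iso TYPE('k) ((`) Inl ` X (p + a)) (J (p + a) p)" if p: "0 < p" for p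
  proof -
    have q: "0 < p + a" using p a by simp
    show ?thesis unfolding X[OF q p, symmetric]
    proof (rule homology_iso_dominated[OF closed[OF q p], where f = "\<lambda>x. Inl (f' (projr x))"])
      fix \<sigma> x assume "\<sigma> \<in> J (p + a) p" "x \<in> \<sigma>" "x \<in> (range Inr :: ('m + 'm) set)"
      then show "insert (Inl (f' (projr x))) \<sigma> \<in> J (p + a) p" using f'[OF p] by auto
    qed auto
  qed
  have XJ: "(`) Inl ` X p \<subseteq> J p q" if "0 < p" "0 < q" for p q using X[OF that] by blast
  have YJ: "(`) Inr ` Y q \<subseteq> J p q" if "0 < p" "0 < q" for p q using Y[OF that] by blast
  have monoX: "(`) Inl ` X p \<subseteq> ((`) Inl ` X p' :: ('m + 'm) set set)" if "0 < p" "p \<le> p'" for p p'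
  proof -
    have "(`) Inl ` X p = {\<sigma> \<in> J p 1. \<sigma> \<inter> range Inr = {}}" using X[of p 1] that by simp
    also have "\<dots> \<subseteq> {\<sigma> \<in> J p' 1. \<sigma> \<inter> range Inr = {}}" using mono[of p p' 1 1] that by auto
    also have "\<dots> = (`) Inl ` X p'" using X[of p' 1] that by simp
    finally show ?thesis .
  qed
  have monoY: "(`) Inr ` Y p \<subseteq> ((`) Inr ` Y p' :: ('m + 'm) set set)" if "0 < p" "p \<le> p'" for p p'
  proof -
    have "(`) Inr ` Y p = {\<sigma> \<in> J 1 p. \<sigma> \<inter> range Inl = {}}" using Y[of 1 p] that by simp
    also have "\<dots> \<subseteq> {\<sigma> \<in> J 1 p'. \<sigma> \<inter> range Inl = {}}" using mono[of 1 1 p p'] that by auto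
    also have "\<dots> = (`) Inr ` Y p'" using Y[of 1 p'] that by simp
    finally show ?thesis .
  qed
  note ps' = interval_decomposition_relabel[OF strict_mono_Inl ps]
  note qs' = interval_decomposition_relabel[OF strict_mono_Inr qs]
  show "card (long_bars (2 * a + h) ps) \<le> card (long_bars h qs)"
    by (rule long_bars_le_of_interleaving[OF ps' qs' a h,
          where J = "\<lambda>r. J r (r + a)" and J' = "\<lambda>r. J (r + a) r"])
      (use a in \<open>auto intro!: monoY mono XJ YJ isoX isoY del: subsetI\<close>)
  show "card (long_bars (2 * a + h) qs) \<le> card (long_bars h ps)"
    by (rule long_bars_le_of_interleaving[OF qs' ps' a h,
          where J' = "\<lambda>r. J r (r + a)" and J = "\<lambda>r. J (r + a) r"])
      (use a in \<open>auto intro!: monoX mono XJ YJ isoX isoY del: subsetI\<close>)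
qed

section \<open>Barcodes from matrix reduction\<close>

text \<open>The reduction rests on two features of the order: radii do not decrease along
  \<open>xs\<close>, and faces come before cofaces. How ties were resolved is hidden from here
  on.\<close>

locale ordered_complex =
  fixes W :: "'m::{finite, linorder} set set" and r :: "'m set \<Rightarrow> real" and xs :: "'m set list"
  assumes closed: "face_closed W" and set_xs: "set xs = W" and distinct_xs: "distinct xs"
    and sorted_xs: "sorted_wrt (\<lambda>\<sigma> \<tau>. r \<sigma> \<le> r \<tau> \<and> \<not> \<tau> \<subset> \<sigma>) xs"
    and nonneg: "\<sigma> \<in> W \<Longrightarrow> 0 \<le> r \<sigma>"
begin

definition initial :: "nat \<Rightarrow> ('m set \<Rightarrow> 'k::field) set" where
  "initial j = {z. \<forall>\<sigma>. z \<sigma> \<noteq> 0 \<longrightarrow> \<sigma> \<in> set (take j xs)}"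

text \<open>\<open>i\<close> is the pivot of \<open>z\<close>, its last nonzero position along
  \<open>xs\<close>, stated through initial segments instead of a maximum. Chains may mix dimensions
  here.\<close>

definition leads :: "('m set \<Rightarrow> 'k::field) \<Rightarrow> nat \<Rightarrow> bool" where
  "leads z i \<longleftrightarrow> i < length xs \<and> z (xs ! i) \<noteq> 0 \<and> z \<in> initial (Suc i)"

text \<open>For every reduction of the boundary matrix, \<open>lows k j\<close> turns out to be the set of pivots of the
  first \<open>j\<close> columns.\<close>

definition lows :: "'k::field itself \<Rightarrow> nat \<Rightarrow> nat set" where
  "lows k j = {i. \<exists>z :: 'm set \<Rightarrow> 'k. z \<in> initial j \<and> leads (boundary z) i}"

text \<open>In the usual terminology \<open>xs ! i\<close> is a positive simplex: its arrival
  completes a cycle.\<close>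

definition positive :: "'k::field itself \<Rightarrow> nat \<Rightarrow> bool" where
  "positive k i \<longleftrightarrow> (\<exists>z :: 'm set \<Rightarrow> 'k. boundary z = (\<lambda>_. 0) \<and> leads z i)"

lemma in_take_iff: "j \<le> length xs \<Longrightarrow> \<sigma> \<in> set (take j xs) \<longleftrightarrow> (\<exists>i<j. \<sigma> = xs ! i)"
  by (auto simp: in_set_conv_nth)

lemma nth_in_take_iff: "i < length xs \<Longrightarrow> xs ! i \<in> set (take j xs) \<longleftrightarrow> i < j"
  using distinct_xs by (auto simp: in_set_conv_nth nth_eq_iff_index_eq)

lemma initial_zero [simp]: "(\<lambda>_. 0) \<in> initial j"
  by (simp add: initial_def)

lemma initial_add:
  assumes "y \<in> initial j" "z \<in> initial j"
  shows "(\<lambda>\<sigma>. y \<sigma> + z \<sigma>) \<in> initial j"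
  unfolding initial_def
proof (clarify)
  fix \<sigma> assume "y \<sigma> + z \<sigma> \<noteq> 0"
  then have "y \<sigma> \<noteq> 0 \<or> z \<sigma> \<noteq> 0" by auto
  then show "\<sigma> \<in> set (take j xs)" using assms by (auto simp: initial_def)
qed

lemma initial_scale: "z \<in> initial j \<Longrightarrow> (\<lambda>\<sigma>. c * z \<sigma>) \<in> initial j"
  by (simp add: initial_def)

lemma initial_diff: "y \<in> initial j \<Longrightarrow> z \<in> initial j \<Longrightarrow> (\<lambda>\<sigma>. y \<sigma> - z \<sigma>) \<in> initial j"
  using initial_add[of y j "\<lambda>\<sigma>. - 1 * z \<sigma>"] initial_scale[of z j "- 1"] by simp

lemma initial_sum: "(\<And>a. a \<in> A \<Longrightarrow> z a \<in> initial j) \<Longrightarrow> (\<lambda>\<sigma>. \<Sum>a\<in>A. z a \<sigma>) \<in> initial j"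
  by (induction A rule: infinite_finite_induct) (auto intro: initial_add)

lemma initial_mono: "i \<le> j \<Longrightarrow> z \<in> initial i \<Longrightarrow> z \<in> initial j"
  unfolding initial_def using set_take_subset_set_take[of i j xs] by blast

lemma initial_0: "z \<in> initial 0 \<longleftrightarrow> z = (\<lambda>_. 0)"
  by (auto simp: initial_def)

lemma initial_SucD:
  assumes "z \<in> initial (Suc j)" "j < length xs" "z (xs ! j) = 0"
  shows "z \<in> initial j"
  using assms by (auto simp: initial_def take_Suc_conv_app_nth)

lemma leads_exists:
  assumes "z \<in> initial j" "z \<noteq> (\<lambda>_. 0)" "j \<le> length xs"
  shows "\<exists>i<j. leads z i"
  using assms
proof (induction j)
  case 0
  then show ?case using initial_0[of z] by blast
next
  case (Suc j)
  show ?case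
  proof (cases "z (xs ! j) = 0")
    case True
    then have "z \<in> initial j" using Suc.prems initial_SucD[of z j] by auto
    then obtain i where "i < j" "leads z i" using Suc.IH Suc.prems by auto
    then show ?thesis using less_SucI by blast
  next
    case False
    then show ?thesis using Suc.prems by (intro exI[of _ j]) (simp add: leads_def)
  qed
qed

lemma leads_initial: "leads z i \<Longrightarrow> i < j \<Longrightarrow> z \<in> initial j"
  using initial_mono[of "Suc i" j] by (auto simp: leads_def)

lemma leads_less: "leads z i \<Longrightarrow> z \<in> initial j \<Longrightarrow> i < j"
  by (auto simp: leads_def initial_def nth_in_take_iff)

lemma leads_unique: "leads z i \<Longrightarrow> leads z i' \<Longrightarrow> i = i'"
  using leads_less[of z i "Suc i'"] leads_less[of z i' "Suc i"] by (auto simp: leads_def)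

lemma leads_nonzero: "leads z i \<Longrightarrow> z \<noteq> (\<lambda>_. 0)"
  by (auto simp: leads_def)

lemma leads_eliminate:
  assumes "y \<in> initial (Suc i)" "leads z i"
  shows "(\<lambda>\<sigma>. y \<sigma> - y (xs ! i) / z (xs ! i) * z \<sigma>) \<in> initial i"
proof (rule initial_SucD)
  show "(\<lambda>\<sigma>. y \<sigma> - y (xs ! i) / z (xs ! i) * z \<sigma>) \<in> initial (Suc i)"
    using assms unfolding leads_def by (intro initial_diff initial_scale) auto
qed (use assms in \<open>auto simp: leads_def\<close>)

text \<open>Distinct pivots cannot cancel: at the largest of them only one summand is
  nonzero.\<close>

lemma leads_sum:
  assumes "finite A" "A \<noteq> {}" "\<And>a. a \<in> A \<Longrightarrow> leads (w a) (p a)" "\<And>a. a \<in> A \<Longrightarrow> c a \<noteq> 0" "inj_on p A"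
  shows "leads (\<lambda>\<sigma>. \<Sum>a\<in>A. c a * w a \<sigma>) (Max (p ` A))"
proof -
  have "Max (p ` A) \<in> p ` A" using assms by simp
  then obtain m where m: "m \<in> A" "p m = Max (p ` A)" by force
  then have le: "p a \<le> p m" if "a \<in> A" for a using that assms(1) by simp
  have "w a (xs ! p m) = 0" if "a \<in> A" "a \<noteq> m" for a
  proof (rule ccontr)
    assume nz: "w a (xs ! p m) \<noteq> 0"
    have "p a < p m" using le[OF that(1)] that inj_onD[OF assms(5)] m(1) by (metis le_neq_implies_less)
    moreover have "p m < length xs" using assms(3)[OF m(1)] by (simp add: leads_def)
    ultimately show False
      using nz assms(3)[OF that(1)] by (auto simp: leads_def initial_def nth_in_take_iff)
  qed
  then have "(\<Sum>a\<in>A. c a * w a (xs ! p m)) = c m * w m (xs ! p m)"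
    using assms(1) m(1) by (subst sum.mono_neutral_right[of A "{m}"]) auto
  moreover have "(\<lambda>\<sigma>. \<Sum>a\<in>A. c a * w a \<sigma>) \<in> initial (Suc (p m))"
    using assms(3) le by (intro initial_sum initial_scale leads_initial[of "w _" "p _"]) (auto simp: less_Suc_eq_le)
  ultimately show ?thesis
    using assms(3)[OF m(1)] assms(4)[OF m(1)] unfolding m(2)[symmetric] by (simp add: leads_def)
qed

lemma index_less_of_psubset:
  assumes "\<tau> \<subset> xs ! j" "\<tau> \<noteq> {}" "j < length xs"
  shows "\<tau> \<in> set (take j xs)"
proof -
  have "xs ! j \<in> W" using set_xs assms(3) by auto
  then have "\<tau> \<in> W" using face_closedD[OF closed, of "xs ! j" \<tau>] assms by auto
  then obtain i where i: "i < length xs" "xs ! i = \<tau>" using set_xs by (metis in_set_conv_nth)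
  have "i < j"
  proof (rule ccontr)
    assume "\<not> i < j"
    then have "j < i" using i assms by (metis linorder_neqE_nat psubset_eq)
    then show False using sorted_wrt_nth_less[OF sorted_xs, of j i] i assms by auto
  qed
  then show ?thesis using i by (auto simp: nth_in_take_iff)
qed

lemma face_closed_take: "face_closed (set (take j xs))"
  unfolding face_closed_def
proof (intro conjI ballI allI impI)
  show "{} \<notin> set (take j xs)"
    using closed set_xs set_take_subset[of j xs] by (auto simp: face_closed_def)
  fix \<sigma> \<tau> assume \<sigma>: "\<sigma> \<in> set (take j xs)" "\<tau> \<subseteq> \<sigma>" "\<tau> \<noteq> {}"
  then obtain i where "i < length (take j xs)" "take j xs ! i = \<sigma>" by (metis in_set_conv_nth)
  then have i: "i < j" "i < length xs" "\<sigma> = xs ! i" by auto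
  show "\<tau> \<in> set (take j xs)"
  proof (cases "\<tau> = \<sigma>")
    case False
    then have "\<tau> \<in> set (take i xs)" using i \<sigma> by (intro index_less_of_psubset) auto
    then show ?thesis using set_take_subset_set_take[of i j xs] i(1) by auto
  qed (use \<sigma> in simp)
qed

lemma boundary_initial:
  assumes "z \<in> initial j"
  shows "boundary z \<in> initial j"
  unfolding initial_def
proof (clarify)
  fix \<rho> assume "boundary z \<rho> \<noteq> 0"
  then obtain v where v: "z (insert v \<rho>) \<noteq> 0" "\<rho> \<noteq> {}" by (rule boundary_nonzeroD)
  then have "insert v \<rho> \<in> set (take j xs)" using assms by (auto simp: initial_def)
  then show "\<rho> \<in> set (take j xs)" using face_closedD[OF face_closed_take] v by blast
qed

lemma chains_take_initial: "z \<in> chains (set (take j xs)) l \<Longrightarrow> z \<in> initial j"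
  by (auto simp: chains_def initial_def)

lemma lows_mono: "i \<le> j \<Longrightarrow> lows k i \<subseteq> lows k j"
  unfolding lows_def using initial_mono by blast

lemma lows_0: "lows k 0 = {}"
  by (auto simp: lows_def initial_0 leads_def)

text \<open>Initial segments contain simplices of all dimensions, whereas homology is graded.
  Cutting out one size commutes with \<open>boundary\<close> up to a shift, so witnesses can be made
  homogeneous.\<close>

definition component :: "nat \<Rightarrow> ('m set \<Rightarrow> 'k::field) \<Rightarrow> 'm set \<Rightarrow> 'k" where
  "component q z \<sigma> = (if card \<sigma> = q then z \<sigma> else 0)"

lemma boundary_component: "boundary (component (Suc q) z) = component q (boundary z)"
proof
  fix \<rho>
  have "(\<Sum>v\<in>-\<rho>. component (Suc q) z (insert v \<rho>) * face_sign \<rho> v)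
     = (if card \<rho> = q then \<Sum>v\<in>-\<rho>. z (insert v \<rho>) * face_sign \<rho> v else 0)"
    by (auto simp: component_def intro!: sum.neutral sum.cong)
  then show "boundary (component (Suc q) z) \<rho> = component q (boundary z) \<rho>"
    by (simp add: boundary_eq component_def)
qed

lemma component_initial: "z \<in> initial j \<Longrightarrow> component q z \<in> initial j"
  by (auto simp: initial_def component_def)

lemma component_chains: "z \<in> initial j \<Longrightarrow> component (Suc q) z \<in> chains (set (take j xs)) q"
  by (auto simp: initial_def component_def chains_def)

lemma component_leads: "leads z i \<Longrightarrow> card (xs ! i) = q \<Longrightarrow> leads (component q z) i"
  by (auto simp: leads_def component_initial) (simp add: component_def)

text \<open>The component of a witness in the size one above that of \<open>xs ! i\<close> still has
  a boundary with pivot \<open>i\<close>. It must involve \<open>xs ! j\<close>, since otherwise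
  \<open>i\<close> would be a pivot at stage \<open>j\<close> already; this fixes the size of
  \<open>xs ! j\<close>.\<close>

lemma new_low_homogeneous:
  assumes j: "j < length xs" and i: "i \<in> lows TYPE('k::field) (Suc j) - lows TYPE('k) j"
  shows "card (xs ! j) = Suc (card (xs ! i))"
    and "\<exists>v :: 'm set \<Rightarrow> 'k. v \<in> chains (set (take (Suc j) xs)) (card (xs ! i)) \<and> leads (boundary v) i"
proof -
  obtain z :: "'m set \<Rightarrow> 'k" where z: "z \<in> initial (Suc j)" "leads (boundary z) i"
    using i by (auto simp: lows_def)
  define v where "v = component (Suc (card (xs ! i))) z"
  have v: "v \<in> chains (set (take (Suc j) xs)) (card (xs ! i))" "leads (boundary v) i" "v \<in> initial (Suc j)"
    using z by (auto simp: v_def component_chains boundary_component component_leads component_initial)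
  then show "\<exists>v :: 'm set \<Rightarrow> 'k. v \<in> chains (set (take (Suc j) xs)) (card (xs ! i)) \<and> leads (boundary v) i"
    by blast
  show "card (xs ! j) = Suc (card (xs ! i))"
  proof (rule ccontr)
    assume "card (xs ! j) \<noteq> Suc (card (xs ! i))"
    then have "v (xs ! j) = 0" by (simp add: v_def component_def)
    then have "v \<in> initial j" using initial_SucD[OF v(3) j] by blast
    then show False using v(2) i by (auto simp: lows_def)
  qed
qed

lemma low_is_new:
  assumes "i \<in> lows k j" "j \<le> length xs"
  shows "\<exists>j'<j. i \<in> lows k (Suc j') - lows k j'"
  using assms
proof (induction j)
  case (Suc j)
  show ?case
  proof (cases "i \<in> lows k j")
    case True
    then obtain j' where "j' < j" "i \<in> lows k (Suc j') - lows k j'" using Suc.IH Suc.prems by auto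
    then show ?thesis using less_SucI by blast
  next
    case False
    then show ?thesis using Suc.prems by blast
  qed
qed (simp add: lows_0)

lemma new_low_unique:
  assumes "i \<in> lows k (Suc j) - lows k j" "i \<in> lows k (Suc j') - lows k j'"
  shows "j = j'"
proof (rule ccontr)
  assume "j \<noteq> j'"
  then have "Suc j \<le> j' \<or> Suc j' \<le> j" by auto
  then show False using assms lows_mono[of "Suc j" j' k] lows_mono[of "Suc j'" j k] by blast
qed

lemma positive_homogeneous:
  assumes "positive TYPE('k::field) i" "card (xs ! i) = Suc l"
  shows "\<exists>z :: 'm set \<Rightarrow> 'k. z \<in> cycles (set (take (Suc i) xs)) l \<and> leads z i"
proof -
  obtain z :: "'m set \<Rightarrow> 'k" where z: "boundary z = (\<lambda>_. 0)" "leads z i"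
    using assms(1) by (auto simp: positive_def)
  have "component (Suc l) z \<in> chains (set (take (Suc i) xs)) l"
    using z(2) by (intro component_chains) (simp add: leads_def)
  moreover have "boundary (component (Suc l) z) = (\<lambda>_. 0)"
    unfolding boundary_component z(1) by (simp add: component_def fun_eq_iff)
  ultimately show ?thesis using component_leads[OF z(2) assms(2)] by (auto simp: cycles_def)
qed

lemma positive_of_low: "i \<in> lows k j \<Longrightarrow> positive k i"
  unfolding lows_def positive_def using boundary_boundary by blast

text \<open>\<open>lows\<close> grows with \<open>j\<close>, so at most one stage makes
  \<open>i\<close> a pivot for the first time; the simplex added there ends the class born at
  \<open>i\<close>.\<close>

definition death :: "'k::field itself \<Rightarrow> nat \<Rightarrow> ereal" where
  "death k i = (if i \<in> lows k (length xs)
     then ereal (r (xs ! (THE j. j < length xs \<and> i \<in> lows k (Suc j) - lows k j))) else \<infinity>)"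

lemma death_eq:
  assumes "j < length xs" "i \<in> lows k (Suc j) - lows k j"
  shows "death k i = ereal (r (xs ! j))"
proof -
  have "(THE j. j < length xs \<and> i \<in> lows k (Suc j) - lows k j) = j"
    using assms new_low_unique by (intro the_equality) blast+
  moreover have "i \<in> lows k (length xs)" using assms lows_mono[of "Suc j" "length xs" k] by auto
  ultimately show ?thesis by (simp add: death_def)
qed

lemma death_less_imp_low:
  assumes "death k i < ereal t"
  obtains j where "j < length xs" "i \<in> lows k (Suc j) - lows k j" "r (xs ! j) < t"
proof -
  have "i \<in> lows k (length xs)" using assms by (auto simp: death_def split: if_splits)
  then obtain j where j: "j < length xs" "i \<in> lows k (Suc j) - lows k j" using low_is_new by blast
  then have "r (xs ! j) < t" using assms death_eq[OF j] by simp
  then show thesis using that j by blast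
qed

text \<open>If \<open>i\<close> becomes a pivot at stage \<open>j\<close>, the boundary that shows
  this is itself taken as generator: it is a cycle with pivot \<open>i\<close>, and it bounds as
  soon as \<open>xs ! j\<close> is present. If \<open>i\<close> never becomes a pivot, any
  homogeneous cycle with pivot \<open>i\<close> serves.\<close>

lemma exists_generator:
  assumes "positive TYPE('k::field) i" "card (xs ! i) = Suc l"
  shows "\<exists>z :: 'm set \<Rightarrow> 'k. z \<in> cycles (set (take (Suc i) xs)) l \<and> leads z i \<and>
    (\<forall>j<length xs. i \<in> lows TYPE('k) (Suc j) - lows TYPE('k) j \<longrightarrow> z \<in> boundaries (set (take (Suc j) xs)) l)"
proof (cases "i \<in> lows TYPE('k) (length xs)")
  case True
  then obtain j where j: "j < length xs" "i \<in> lows TYPE('k) (Suc j) - lows TYPE('k) j"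
    using low_is_new by blast
  obtain v :: "'m set \<Rightarrow> 'k" where v: "v \<in> chains (set (take (Suc j) xs)) (Suc l)" "leads (boundary v) i"
    using new_low_homogeneous(2)[OF j] assms(2) by auto
  have "boundary v \<in> chains (set (take (Suc j) xs)) l"
    by (rule boundary_in_chains[OF face_closed_take v(1)])
  moreover have "boundary v \<in> initial (Suc i)" using v(2) by (simp add: leads_def)
  ultimately have "boundary v \<in> chains (set (take (Suc i) xs)) l"
    by (auto simp: chains_def initial_def)
  then have "boundary v \<in> cycles (set (take (Suc i) xs)) l" by (simp add: cycles_def boundary_boundary)
  moreover have "boundary v \<in> boundaries (set (take (Suc j) xs)) l" using v(1) by (simp add: boundaries_def)
  ultimately show ?thesis using v(2) new_low_unique[OF j(2)] by blast
next
  case False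
  have "i \<notin> lows TYPE('k) (Suc j)" if "j < length xs" for j
    using False lows_mono[of "Suc j" "length xs" "TYPE('k)"] that by auto
  then show ?thesis using positive_homogeneous[OF assms] by blast
qed

section \<open>An interval decomposition of the sublevel homology\<close>

definition births :: "'k::field itself \<Rightarrow> nat \<Rightarrow> nat set" where
  "births k l = {i. i < length xs \<and> positive k i \<and> card (xs ! i) = Suc l}"

text \<open>Radii do not decrease along \<open>xs\<close>, so every sublevel complex is an initial
  segment; this connects the filtration with the columns of the matrix.\<close>

lemma sublevel_eq_take:
  "\<exists>n\<le>length xs. {\<sigma> \<in> W. r \<sigma> < t} = set (take n xs) \<and>
    (\<forall>i<length xs. i < n \<longleftrightarrow> r (xs ! i) < t)"
proof -
  define n where "n = length (takeWhile (\<lambda>\<sigma>. r \<sigma> < t) xs)"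
  have n: "n \<le> length xs" by (simp add: n_def length_takeWhile_le)
  have iff: "i < n \<longleftrightarrow> r (xs ! i) < t" if i: "i < length xs" for i
  proof
    assume "i < n"
    then show "r (xs ! i) < t"
      using set_takeWhileD[of "takeWhile (\<lambda>\<sigma>. r \<sigma> < t) xs ! i" "\<lambda>\<sigma>. r \<sigma> < t" xs]
      by (metis n_def nth_mem takeWhile_nth)
  next
    assume ri: "r (xs ! i) < t"
    show "i < n"
    proof (rule ccontr)
      assume "\<not> i < n"
      then have "n < length xs" "n \<le> i" using i by auto
      then have "\<not> r (xs ! n) < t" using nth_length_takeWhile[of "\<lambda>\<sigma>. r \<sigma> < t" xs] by (simp add: n_def)
      moreover have "r (xs ! n) \<le> r (xs ! i)"
        using sorted_wrt_nth_less[OF sorted_xs, of n i] \<open>n \<le> i\<close> i by (cases "n = i") auto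
      ultimately show False using ri by simp
    qed
  qed
  have "{\<sigma> \<in> W. r \<sigma> < t} = set (take n xs)"
  proof (intro set_eqI iffI)
    fix \<sigma> assume "\<sigma> \<in> {\<sigma> \<in> W. r \<sigma> < t}"
    then obtain i where "i < length xs" "\<sigma> = xs ! i" "r \<sigma> < t" using set_xs by (metis in_set_conv_nth mem_Collect_eq)
    then show "\<sigma> \<in> set (take n xs)" using iff by (auto simp: nth_in_take_iff)
  next
    fix \<sigma> assume \<sigma>: "\<sigma> \<in> set (take n xs)"
    then obtain i where "i < n" "\<sigma> = xs ! i" using n by (auto simp: in_take_iff)
    then show "\<sigma> \<in> {\<sigma> \<in> W. r \<sigma> < t}" using iff[of i] n set_xs by auto
  qed
  then show ?thesis using n iff by blast
qed

context
  fixes g :: "nat \<Rightarrow> 'm set \<Rightarrow> 'k::field" and l :: nat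
  assumes g_cycle: "\<And>i. i \<in> births TYPE('k) l \<Longrightarrow> g i \<in> cycles (set (take (Suc i) xs)) l"
    and g_leads: "\<And>i. i \<in> births TYPE('k) l \<Longrightarrow> leads (g i) i"
    and g_dies: "\<And>i j. i \<in> births TYPE('k) l \<Longrightarrow> j < length xs \<Longrightarrow> i \<in> lows TYPE('k) (Suc j) - lows TYPE('k) j \<Longrightarrow>
       g i \<in> boundaries (set (take (Suc j) xs)) l"
begin

text \<open>The pivot of a nonzero cycle belongs to \<open>births\<close>, and subtracting a
  multiple of the generator with this pivot leaves a cycle on a shorter initial segment.\<close>

lemma cycle_lincomb_generators:
  assumes "z \<in> cycles (set (take n xs)) l" "n \<le> length xs"
  shows "\<exists>d. z = (\<lambda>\<sigma>. \<Sum>i\<in>{i \<in> births TYPE('k) l. i < n}. d i * g i \<sigma>)"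
  using assms
proof (induction n arbitrary: z)
  case 0
  then show ?case by (auto simp: cycles_def chains_def)
next
  case (Suc n)
  have n: "n < length xs" using Suc.prems by simp
  have zi: "z \<in> initial (Suc n)" using Suc.prems(1) chains_take_initial by (auto simp: cycles_def)
  show ?case
  proof (cases "z (xs ! n) = 0")
    case True
    then have "z \<in> initial n" using initial_SucD[OF zi n] by blast
    then have "z \<in> cycles (set (take n xs)) l" using Suc.prems(1) by (auto simp: cycles_def chains_def initial_def)
    then obtain d where d: "z = (\<lambda>\<sigma>. \<Sum>i\<in>{i \<in> births TYPE('k) l. i < n}. d i * g i \<sigma>)"
      using Suc.IH Suc.prems by auto
    define d' where "d' i = (if i < n then d i else 0)" for i
    have "z = (\<lambda>\<sigma>. \<Sum>i\<in>{i \<in> births TYPE('k) l. i < Suc n}. d' i * g i \<sigma>)"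
      unfolding d by (intro ext sum.mono_neutral_cong_left) (auto simp: d'_def births_def)
    then show ?thesis by blast
  next
    case False
    then have "leads z n" using zi n by (simp add: leads_def)
    then have nb: "n \<in> births TYPE('k) l"
      using Suc.prems(1) False n by (auto simp: births_def positive_def cycles_def chains_def)
    define c where "c = z (xs ! n) / g n (xs ! n)"
    define z' where "z' = (\<lambda>\<sigma>. z \<sigma> - c * g n \<sigma>)"
    have "z' \<in> initial n" unfolding z'_def c_def using zi g_leads[OF nb] by (rule leads_eliminate)
    moreover have "z' \<in> cycles (set (take (Suc n) xs)) l"
      unfolding z'_def using Suc.prems(1) g_cycle[OF nb] by (intro cycles_diff cycles_scale)
    ultimately have "z' \<in> cycles (set (take n xs)) l" by (auto simp: cycles_def chains_def initial_def)
    then obtain d where d: "z' = (\<lambda>\<sigma>. \<Sum>i\<in>{i \<in> births TYPE('k) l. i < n}. d i * g i \<sigma>)"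
      using Suc.IH Suc.prems by auto
    have eq: "{i \<in> births TYPE('k) l. i < Suc n} = insert n {i \<in> births TYPE('k) l. i < n}"
      using nb by auto
    have "z = (\<lambda>\<sigma>. \<Sum>i\<in>{i \<in> births TYPE('k) l. i < Suc n}. (d(n := c)) i * g i \<sigma>)"
    proof
      fix \<sigma>
      have "(\<Sum>i\<in>{i \<in> births TYPE('k) l. i < n}. (d(n := c)) i * g i \<sigma>) = z' \<sigma>"
        unfolding d by (intro sum.cong) auto
      then show "z \<sigma> = (\<Sum>i\<in>{i \<in> births TYPE('k) l. i < Suc n}. (d(n := c)) i * g i \<sigma>)"
        unfolding eq by (simp add: z'_def)
    qed
    then show ?thesis by blast
  qed
qed

lemma generator_dead:
  assumes "i \<in> births TYPE('k) l" "death TYPE('k) i < ereal t"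
  shows "g i \<in> boundaries {\<sigma> \<in> W. r \<sigma> < t} l"
proof -
  obtain n where n: "n \<le> length xs" "{\<sigma> \<in> W. r \<sigma> < t} = set (take n xs)"
    "\<And>i. i < length xs \<Longrightarrow> i < n \<longleftrightarrow> r (xs ! i) < t"
    using sublevel_eq_take[of t] by blast
  obtain j where j: "j < length xs" "i \<in> lows TYPE('k) (Suc j) - lows TYPE('k) j" "r (xs ! j) < t"
    by (rule death_less_imp_low[OF assms(2)])
  have "set (take (Suc j) xs) \<subseteq> set (take n xs)"
    using n(3)[OF j(1)] j(3) by (intro set_take_subset_set_take) simp
  then show ?thesis unfolding n(2) using g_dies[OF assms(1) j(1,2)] boundaries_mono by blast
qed

lemma generator_in_cycles:
  assumes "i \<in> births TYPE('k) l" "r (xs ! i) < t"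
  shows "g i \<in> cycles {\<sigma> \<in> W. r \<sigma> < t} l"
proof -
  obtain n where n: "n \<le> length xs" "{\<sigma> \<in> W. r \<sigma> < t} = set (take n xs)"
    "\<And>i. i < length xs \<Longrightarrow> i < n \<longleftrightarrow> r (xs ! i) < t"
    using sublevel_eq_take[of t] by blast
  have "set (take (Suc i) xs) \<subseteq> set (take n xs)"
    using n(3)[of i] assms by (intro set_take_subset_set_take) (simp add: births_def)
  then show ?thesis unfolding n(2) using g_cycle[OF assms(1)] cycles_mono by blast
qed

text \<open>A boundary comes from a chain on an initial segment, so its pivot has already entered
  \<open>lows\<close>. This is the source of independence: the pivots of living generators cannot
  occur here.\<close>

lemma boundary_low:
  assumes "y \<in> boundaries {\<sigma> \<in> W. r \<sigma> < t} l" "leads (y :: 'm set \<Rightarrow> 'k) i"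
  shows "death TYPE('k) i < ereal t"
proof -
  obtain n where n: "n \<le> length xs" "{\<sigma> \<in> W. r \<sigma> < t} = set (take n xs)"
    "\<And>i. i < length xs \<Longrightarrow> i < n \<longleftrightarrow> r (xs ! i) < t"
    using sublevel_eq_take[of t] by blast
  obtain v where v: "v \<in> chains (set (take n xs)) (Suc l)" "y = boundary v"
    using assms(1) unfolding n(2) by (auto simp: boundaries_def)
  then have "i \<in> lows TYPE('k) n" using assms(2) chains_take_initial unfolding lows_def by blast
  then obtain j where j: "j < n" "i \<in> lows TYPE('k) (Suc j) - lows TYPE('k) j" using low_is_new[OF _ n(1)] by blast
  then show ?thesis using death_eq[OF _ j(2)] n(1) n(3)[of j] by simp
qed

text \<open>Spanning: cycles at \<open>t\<close> are combinations of the generators born before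
  \<open>t\<close>, and the dead ones among these bound. Independence: the pivot of a combination of
  living generators is one of their pivots, which \<open>boundary_low\<close> excludes for
  boundaries. Indices whose birth equals their death would never be active and are left out of
  \<open>gs\<close>.\<close>

lemma interval_decomposition_generators:
  assumes X: "\<And>t. 0 < t \<Longrightarrow> X t = {\<sigma> \<in> W. r \<sigma> < t}"
    and gs: "set gs = {i \<in> births TYPE('k) l. ereal (r (xs ! i)) < death TYPE('k) i}" "distinct gs"
  shows "interval_decomposition l X (map (\<lambda>i. (ereal (r (xs ! i)), death TYPE('k) i)) gs) (\<lambda>p t. g (gs ! p))"
proof -
  define ps where "ps = map (\<lambda>i. (ereal (r (xs ! i)), death TYPE('k) i)) gs"
  have active: "active ps t = {p. p < length gs \<and> r (xs ! (gs ! p)) < t \<and> ereal t \<le> death TYPE('k) (gs ! p)}" for t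
    by (auto simp: active_def ps_def)
  have gsb: "gs ! p \<in> births TYPE('k) l" if "p < length gs" for p
    using that gs(1) nth_mem by blast
  have indep: "c p = 0" if t: "0 < t" and p: "p \<in> active ps t"
    and bd: "(\<lambda>\<sigma>. \<Sum>p\<in>active ps t. c p * g (gs ! p) \<sigma>) \<in> boundaries (X t) l" for c t p
  proof (rule ccontr)
    assume "c p \<noteq> 0"
    define A where "A = {p \<in> active ps t. c p \<noteq> 0}"
    have A: "finite A" "A \<noteq> {}" using \<open>c p \<noteq> 0\<close> p by (auto simp: A_def)
    have inj: "inj_on (\<lambda>p. gs ! p) A"
      using gs(2) by (auto simp: inj_on_def A_def active nth_eq_iff_index_eq)
    have lead: "leads (\<lambda>\<sigma>. \<Sum>p\<in>A. c p * g (gs ! p) \<sigma>) (Max ((\<lambda>p. gs ! p) ` A))"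
      using A inj gsb g_leads by (intro leads_sum) (auto simp: A_def active)
    have "(\<lambda>\<sigma>. \<Sum>p\<in>active ps t. c p * g (gs ! p) \<sigma>) = (\<lambda>\<sigma>. \<Sum>p\<in>A. c p * g (gs ! p) \<sigma>)"
      by (intro ext sum.mono_neutral_right) (auto simp: A_def)
    with bd have "(\<lambda>\<sigma>. \<Sum>p\<in>A. c p * g (gs ! p) \<sigma>) \<in> boundaries {\<sigma> \<in> W. r \<sigma> < t} l"
      unfolding X[OF t] by simp
    from boundary_low[OF this lead] have "death TYPE('k) (Max ((\<lambda>p. gs ! p) ` A)) < ereal t" .
    moreover have "Max ((\<lambda>p. gs ! p) ` A) \<in> (\<lambda>p. gs ! p) ` A" using A by (intro Max_in) auto
    ultimately show False by (auto simp: A_def active)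
  qed
  have cyc: "g (gs ! p) \<in> cycles (X t) l" if "0 < t" "p \<in> active ps t" for p t
    using that generator_in_cycles[OF gsb] X by (auto simp: active)
  show ?thesis
    unfolding interval_decomposition_def ps_def[symmetric]
  proof (intro conjI ballI allI impI)
    fix p assume "p \<in> set ps"
    then obtain i where i: "i \<in> set gs" "p = (ereal (r (xs ! i)), death TYPE('k) i)" by (auto simp: ps_def)
    from i(1) have "i < length xs" "ereal (r (xs ! i)) < death TYPE('k) i"
      unfolding gs(1) births_def by simp_all
    moreover from this(1) have "0 \<le> r (xs ! i)" using nonneg nth_mem set_xs by blast
    ultimately show "0 \<le> fst p" "fst p < snd p" unfolding i(2) by simp_all
  next
    fix t :: real and p assume "0 < t" "p \<in> active ps t"
    then show "g (gs ! p) \<in> cycles (X t) l" by (rule cyc)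
  next
    fix t :: real and z :: "'m set \<Rightarrow> 'k" assume t: "0 < t" and z: "z \<in> cycles (X t) l"
    obtain n where n: "n \<le> length xs" "{\<sigma> \<in> W. r \<sigma> < t} = set (take n xs)"
      "\<And>i. i < length xs \<Longrightarrow> i < n \<longleftrightarrow> r (xs ! i) < t"
      using sublevel_eq_take[of t] by blast
    obtain d where d: "z = (\<lambda>\<sigma>. \<Sum>i\<in>{i \<in> births TYPE('k) l. i < n}. d i * g i \<sigma>)"
      using cycle_lincomb_generators[OF _ n(1)] z unfolding X[OF t] n(2) by blast
    define c where "c p = (if p \<in> active ps t then d (gs ! p) else 0)" for p
    define I where "I = (\<lambda>p. gs ! p) ` active ps t"
    have I_sub: "I \<subseteq> {i \<in> births TYPE('k) l. i < n}"
      using gsb n(3) by (auto simp: I_def active births_def)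
    \<comment> \<open>A generator born before \<open>t\<close> and not yet dead has positive length,
      so it is listed in \<open>gs\<close> and active.\<close>
    have dead: "death TYPE('k) i < ereal t" if i: "i \<in> births TYPE('k) l" "i < n" "i \<notin> I" for i
    proof (rule ccontr)
      assume "\<not> death TYPE('k) i < ereal t"
      moreover have ri: "r (xs ! i) < t" using i n(3)[of i] by (simp add: births_def)
      ultimately have "ereal (r (xs ! i)) < death TYPE('k) i"
        by (metis ereal_less(2) less_ereal.simps(1) not_less order.strict_trans1 order.strict_trans2)
      then have "i \<in> set gs" using i gs(1) by simp
      then obtain p where p: "p < length gs" "gs ! p = i" by (metis in_set_conv_nth)
      then have "p \<in> active ps t" using ri \<open>\<not> death TYPE('k) i < ereal t\<close> by (simp add: active not_less)
      then show False using i(3) p by (auto simp: I_def)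
    qed
    have "homologous (X t) l z (\<lambda>\<sigma>. \<Sum>i\<in>{i \<in> births TYPE('k) l. i < n}. d i * (if i \<in> I then g i else (\<lambda>_. 0)) \<sigma>)"
      unfolding d
    proof (rule homologous_lincomb)
      fix i assume i: "i \<in> {i \<in> births TYPE('k) l. i < n}"
      show "homologous (X t) l (g i) (if i \<in> I then g i else (\<lambda>_. 0))"
        using i dead[of i] generator_dead[of i t] X[OF t] by (auto simp: homologous_def)
    qed
    also have "(\<lambda>\<sigma>. \<Sum>i\<in>{i \<in> births TYPE('k) l. i < n}. d i * (if i \<in> I then g i else (\<lambda>_. 0)) \<sigma>)
      = (\<lambda>\<sigma>. \<Sum>i\<in>I. d i * g i \<sigma>)"
      using I_sub by (intro ext sum.mono_neutral_cong_right) auto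
    also have "\<dots> = (\<lambda>\<sigma>. \<Sum>p\<in>active ps t. c p * g (gs ! p) \<sigma>)"
      unfolding I_def using gs(2)
      by (subst sum.reindex) (auto simp: inj_on_def active nth_eq_iff_index_eq c_def intro!: ext sum.cong)
    finally have hz: "homologous (X t) l z (\<lambda>\<sigma>. \<Sum>p\<in>active ps t. c p * g (gs ! p) \<sigma>)" .
    show "\<exists>!c. (\<forall>p. p \<notin> active ps t \<longrightarrow> c p = 0) \<and>
        homologous (X t) l z (\<lambda>\<sigma>. \<Sum>p\<in>active ps t. c p * g (gs ! p) \<sigma>)"
    proof (rule ex1I[of _ c])
      show "(\<forall>p. p \<notin> active ps t \<longrightarrow> c p = 0) \<and>
        homologous (X t) l z (\<lambda>\<sigma>. \<Sum>p\<in>active ps t. c p * g (gs ! p) \<sigma>)"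
        using hz by (simp add: c_def)
      fix c' assume c': "(\<forall>p. p \<notin> active ps t \<longrightarrow> c' p = 0) \<and>
        homologous (X t) l z (\<lambda>\<sigma>. \<Sum>p\<in>active ps t. c' p * g (gs ! p) \<sigma>)"
      have "homologous (X t) l (\<lambda>\<sigma>. \<Sum>p\<in>active ps t. c' p * g (gs ! p) \<sigma>)
          (\<lambda>\<sigma>. \<Sum>p\<in>active ps t. c p * g (gs ! p) \<sigma>)"
        using homologous_trans[OF homologous_sym hz] c' by blast
      then have "(\<lambda>\<sigma>. \<Sum>p\<in>active ps t. (c' p - c p) * g (gs ! p) \<sigma>) \<in> boundaries (X t) l"
        by (simp add: homologous_def left_diff_distrib sum_subtractf)
      then have "c' p - c p = 0" if "p \<in> active ps t" for p
        using indep[OF t that, of "\<lambda>p. c' p - c p"] by blast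
      then show "c' = c" using c' by (auto simp: c_def fun_eq_iff)
    qed
  next
    fix t t' :: real and p assume t: "0 < t" "t \<le> t'" and p: "p \<in> active ps t"
    show "homologous (X t') l (g (gs ! p)) (if p \<in> active ps t' then g (gs ! p) else (\<lambda>_. 0))"
    proof (cases "p \<in> active ps t'")
      case False
      then have "death TYPE('k) (gs ! p) < ereal t'" using p t by (auto simp: active)
      then show ?thesis using False generator_dead[OF gsb] p X[of t'] t by (simp add: active homologous_def)
    qed simp
  qed
qed

end

theorem barcode:
  assumes X: "\<And>t. 0 < t \<Longrightarrow> X t = {\<sigma> \<in> W. r \<sigma> < t}"
  obtains ps and e :: "nat \<Rightarrow> real \<Rightarrow> 'm set \<Rightarrow> 'k::field"
  where "interval_decomposition l X ps e"
    "mset ps = image_mset (\<lambda>i. (ereal (r (xs ! i)), death TYPE('k) i))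
      (mset_set {i \<in> births TYPE('k) l. ereal (r (xs ! i)) < death TYPE('k) i})"
proof -
  have "\<forall>i\<in>births TYPE('k) l. \<exists>z :: 'm set \<Rightarrow> 'k. z \<in> cycles (set (take (Suc i) xs)) l \<and> leads z i \<and>
    (\<forall>j<length xs. i \<in> lows TYPE('k) (Suc j) - lows TYPE('k) j \<longrightarrow> z \<in> boundaries (set (take (Suc j) xs)) l)"
    by (intro ballI exists_generator) (simp_all add: births_def)
  from bchoice[OF this] obtain g :: "nat \<Rightarrow> 'm set \<Rightarrow> 'k" where
    g: "\<forall>i\<in>births TYPE('k) l. g i \<in> cycles (set (take (Suc i) xs)) l \<and> leads (g i) i \<and>
    (\<forall>j<length xs. i \<in> lows TYPE('k) (Suc j) - lows TYPE('k) j \<longrightarrow> g i \<in> boundaries (set (take (Suc j) xs)) l)"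
    by blast
  have fin: "finite {i \<in> births TYPE('k) l. ereal (r (xs ! i)) < death TYPE('k) i}"
    by (simp add: births_def)
  define gs where "gs = sorted_list_of_set {i \<in> births TYPE('k) l. ereal (r (xs ! i)) < death TYPE('k) i}"
  have gs: "set gs = {i \<in> births TYPE('k) l. ereal (r (xs ! i)) < death TYPE('k) i}" "distinct gs"
    unfolding gs_def using fin by simp_all
  have "interval_decomposition l X (map (\<lambda>i. (ereal (r (xs ! i)), death TYPE('k) i)) gs) (\<lambda>p t. g (gs ! p))"
    by (rule interval_decomposition_generators[OF _ _ _ X gs]) (use g in blast)+
  then show thesis
  proof (rule that)
    have "mset gs = mset_set (set gs)" using gs(2) by (simp add: mset_set_set)
    then show "mset (map (\<lambda>i. (ereal (r (xs ! i)), death TYPE('k) i)) gs) =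
      image_mset (\<lambda>i. (ereal (r (xs ! i)), death TYPE('k) i))
        (mset_set {i \<in> births TYPE('k) l. ereal (r (xs ! i)) < death TYPE('k) i})"
      by (simp add: gs(1))
  qed
qed

end

section \<open>Pivots of a reduced boundary matrix\<close>

context ordered_complex
begin

text \<open>The factorisation of \<open>B\<close> as the boundary matrix times an upper
  unitriangular matrix with columns \<open>V j\<close>. It is the invariant of column operations to
  the right.\<close>

definition column_chains :: "'k::field matr \<Rightarrow> (nat \<Rightarrow> 'm set \<Rightarrow> 'k) \<Rightarrow> bool" where
  "column_chains B V \<longleftrightarrow> (\<forall>j<length xs. V j \<in> initial (Suc j) \<and> V j (xs ! j) = 1 \<and>
     (\<forall>i<length xs. B i j = boundary (V j) (xs ! i)))"

lemma column_chains_bd_matrix: "\<exists>V. column_chains (bd_matrix xs :: 'k::field matr) V"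
proof
  define V where "V j \<sigma> = (if \<sigma> = xs ! j then 1 else 0 :: 'k)" for j \<sigma>
  have "boundary (V j) \<tau> = bd_coeff (xs ! j) \<tau>" for j \<tau>
    by (simp add: boundary_def V_def if_distrib[of "\<lambda>x. x * _"] cong: if_cong)
  then show "column_chains (bd_matrix xs :: 'k matr) V"
    by (auto simp: column_chains_def V_def initial_def bd_matrix_def nth_in_take_iff)
qed

lemma column_chains_operation:
  assumes "column_chains B V" "column_operation (length xs) B B'"
  shows "\<exists>V'. column_chains B' V'"
proof -
  obtain a b c where ab: "a < b" "b < length xs" and B': "B' = (\<lambda>i j. if j = b then B i b + c * B i a else B i j)"
    using assms(2) by (auto simp: column_operation_def)
  define V' where "V' j = (if j = b then (\<lambda>\<sigma>. V b \<sigma> + c * V a \<sigma>) else V j)" for j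
  have V: "V j \<in> initial (Suc j)" "V j (xs ! j) = 1" "\<And>i. i < length xs \<Longrightarrow> B i j = boundary (V j) (xs ! i)"
    if "j < length xs" for j
    using assms(1) that by (auto simp: column_chains_def)
  have Va: "V a \<in> initial b" using V(1)[of a] initial_mono[of "Suc a" b] ab by auto
  then have "V a (xs ! b) = 0" using ab(2) by (auto simp: initial_def nth_in_take_iff)
  moreover have "(\<lambda>\<sigma>. V b \<sigma> + c * V a \<sigma>) \<in> initial (Suc b)"
    using V(1)[OF ab(2)] initial_mono[OF _ Va, of "Suc b"] by (intro initial_add initial_scale) auto
  ultimately have "column_chains B' V'"
    using V ab by (auto simp: column_chains_def V'_def B' boundary_add boundary_scale)
  then show ?thesis by blast
qed

lemma column_chains_operations:
  "(column_operation (length xs))\<^sup>*\<^sup>* (bd_matrix xs) (B' :: 'k::field matr) \<Longrightarrow> \<exists>V. column_chains B' V"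
proof (induction rule: rtranclp_induct)
  case base
  show ?case by (rule column_chains_bd_matrix)
next
  case (step B B')
  then show ?case using column_chains_operation by blast
qed

context
  fixes B' :: "'k::field matr" and V
  assumes V: "column_chains B' V" and red: "reduced (length xs) B'"
begin

lemma V_initial: "j < length xs \<Longrightarrow> V j \<in> initial (Suc j)"
  and V_diag: "j < length xs \<Longrightarrow> V j (xs ! j) = 1"
  and B'_eq: "j < length xs \<Longrightarrow> i < length xs \<Longrightarrow> B' i j = boundary (V j) (xs ! i)"
  using V by (auto simp: column_chains_def)

lemma nonzero_column_iff:
  assumes "j < length xs"
  shows "nonzero_column (length xs) B' j \<longleftrightarrow> boundary (V j) \<noteq> (\<lambda>_. 0)"
proof
  assume "nonzero_column (length xs) B' j"
  then obtain i where "i < length xs" "boundary (V j) (xs ! i) \<noteq> 0"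
    using B'_eq[OF assms] by (auto simp: nonzero_column_def)
  then show "boundary (V j) \<noteq> (\<lambda>_. 0)" by auto
next
  assume "boundary (V j) \<noteq> (\<lambda>_. 0)"
  then obtain i where "leads (boundary (V j)) i"
    using leads_exists[OF boundary_initial[OF V_initial[OF assms]]] assms by auto
  then have "i < length xs" "B' i j \<noteq> 0" using B'_eq[OF assms] by (auto simp: leads_def)
  then show "nonzero_column (length xs) B' j" by (auto simp: nonzero_column_def)
qed

lemma pivot_leads:
  assumes "j < length xs" "nonzero_column (length xs) B' j"
  shows "leads (boundary (V j)) (pivot (length xs) B' j)"
proof -
  obtain i where i: "leads (boundary (V j)) i"
    using assms nonzero_column_iff leads_exists[OF boundary_initial[OF V_initial[OF assms(1)]]] by auto
  have "pivot (length xs) B' j = i"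
    unfolding pivot_def
  proof (rule Max_eqI)
    show "i \<in> {i. i < length xs \<and> B' i j \<noteq> 0}" using i B'_eq[OF assms(1)] by (auto simp: leads_def)
    fix i' assume "i' \<in> {i. i < length xs \<and> B' i j \<noteq> 0}"
    then have "i' < length xs" "boundary (V j) (xs ! i') \<noteq> 0" using B'_eq[OF assms(1)] by auto
    then have "i' < Suc i" using i by (auto simp: leads_def initial_def nth_in_take_iff)
    then show "i' \<le> i" by simp
  qed simp
  then show ?thesis using i by simp
qed

text \<open>Unitriangularity of \<open>V\<close>: the multiple of \<open>V j\<close> that matches
  the last entry shortens the chain.\<close>

lemma initial_lincomb_columns:
  assumes "z \<in> initial j" "j \<le> length xs"
  shows "\<exists>c. z = (\<lambda>\<sigma>. \<Sum>a<j. c a * V a \<sigma>)"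
  using assms
proof (induction j arbitrary: z)
  case 0
  then show ?case using initial_0[of z] by simp
next
  case (Suc j)
  then have j: "j < length xs" by simp
  have "leads (V j) j" using j V_initial[OF j] V_diag[OF j] by (simp add: leads_def)
  from leads_eliminate[OF Suc.prems(1) this]
  have "(\<lambda>\<sigma>. z \<sigma> - z (xs ! j) * V j \<sigma>) \<in> initial j" using V_diag[OF j] by simp
  from Suc.IH[OF this] j obtain c where c: "(\<lambda>\<sigma>. z \<sigma> - z (xs ! j) * V j \<sigma>) = (\<lambda>\<sigma>. \<Sum>a<j. c a * V a \<sigma>)"
    by auto
  have "z = (\<lambda>\<sigma>. \<Sum>a<Suc j. (c(j := z (xs ! j))) a * V a \<sigma>)"
  proof
    fix \<sigma>
    have "(\<Sum>a<j. (c(j := z (xs ! j))) a * V a \<sigma>) = (\<Sum>a<j. c a * V a \<sigma>)" by (intro sum.cong) auto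
    also have "\<dots> = z \<sigma> - z (xs ! j) * V j \<sigma>" using fun_cong[OF c, of \<sigma>] by simp
    finally show "z \<sigma> = (\<Sum>a<Suc j. (c(j := z (xs ! j))) a * V a \<sigma>)" by simp
  qed
  then show ?case by blast
qed

text \<open>The boundary of an initial chain is a combination of reduced columns, whose pivots are
  distinct, so by \<open>leads_sum\<close> its pivot is one of theirs. Since \<open>lows\<close>
  does not mention the matrix, the pivots are the same for every reduction.\<close>

lemma lows_eq_pivots:
  assumes "j \<le> length xs"
  shows "lows TYPE('k) j = pivot (length xs) B' ` {a. a < j \<and> nonzero_column (length xs) B' a}"
proof
  show "pivot (length xs) B' ` {a. a < j \<and> nonzero_column (length xs) B' a} \<subseteq> lows TYPE('k) j"
  proof
    fix i assume "i \<in> pivot (length xs) B' ` {a. a < j \<and> nonzero_column (length xs) B' a}"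
    then obtain a where a: "a < j" "nonzero_column (length xs) B' a" "i = pivot (length xs) B' a" by auto
    have "V a \<in> initial j" using V_initial[of a] initial_mono[of "Suc a" j] a(1) assms by auto
    then show "i \<in> lows TYPE('k) j" using pivot_leads[of a] a assms by (auto simp: lows_def)
  qed
  show "lows TYPE('k) j \<subseteq> pivot (length xs) B' ` {a. a < j \<and> nonzero_column (length xs) B' a}"
  proof
    fix i assume "i \<in> lows TYPE('k) j"
    then obtain z :: "'m set \<Rightarrow> 'k" where z: "z \<in> initial j" "leads (boundary z) i" by (auto simp: lows_def)
    obtain c where c: "z = (\<lambda>\<sigma>. \<Sum>a<j. c a * V a \<sigma>)" using initial_lincomb_columns[OF z(1) assms] by blast
    define A where "A = {a. a < j \<and> c a \<noteq> 0 \<and> nonzero_column (length xs) B' a}"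
    have bz: "boundary z = (\<lambda>\<sigma>. \<Sum>a<j. c a * boundary (V a) \<sigma>)"
      unfolding c by (simp add: boundary_sum boundary_scale)
    also have "\<dots> = (\<lambda>\<sigma>. \<Sum>a\<in>A. c a * boundary (V a) \<sigma>)"
    proof (intro ext sum.mono_neutral_right ballI)
      fix \<sigma> a assume a: "a \<in> {..<j} - A"
      then have "c a = 0 \<or> boundary (V a) = (\<lambda>_. 0)" using assms nonzero_column_iff[of a] by (auto simp: A_def)
      then show "c a * boundary (V a) \<sigma> = 0" by auto
    qed (auto simp: A_def)
    finally have bzA: "boundary z = (\<lambda>\<sigma>. \<Sum>a\<in>A. c a * boundary (V a) \<sigma>)" .
    have fin: "finite A" by (simp add: A_def)
    have ne: "A \<noteq> {}" using bzA leads_nonzero[OF z(2)] by auto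
    have "inj_on (pivot (length xs) B') A"
      using red assms unfolding reduced_def inj_on_def A_def by (metis (no_types, lifting) mem_Collect_eq order_less_le_trans)
    then have "leads (boundary z) (Max (pivot (length xs) B' ` A))"
      unfolding bzA using fin ne assms by (intro leads_sum) (auto simp: A_def intro!: pivot_leads)
    then have "i = Max (pivot (length xs) B' ` A)" using z(2) leads_unique by blast
    then have "i \<in> pivot (length xs) B' ` A" using Max_in[of "pivot (length xs) B' ` A"] fin ne by auto
    then show "i \<in> pivot (length xs) B' ` {a. a < j \<and> nonzero_column (length xs) B' a}"
      by (auto simp: A_def)
  qed
qed

lemma pivot_new_low:
  assumes "j < length xs" "nonzero_column (length xs) B' j"
  shows "pivot (length xs) B' j \<in> lows TYPE('k) (Suc j) - lows TYPE('k) j"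
proof -
  have "pivot (length xs) B' j \<in> lows TYPE('k) (Suc j)"
    using assms lows_eq_pivots[of "Suc j"] by auto
  moreover have "pivot (length xs) B' j \<notin> lows TYPE('k) j"
  proof
    assume "pivot (length xs) B' j \<in> lows TYPE('k) j"
    then obtain a where a: "a < j" "nonzero_column (length xs) B' a" "pivot (length xs) B' a = pivot (length xs) B' j"
      using lows_eq_pivots[of j] assms by auto
    have "a < length xs" "a \<noteq> j" using a(1) assms(1) by auto
    with red a(2,3) assms show False unfolding reduced_def by blast
  qed
  ultimately show ?thesis by blast
qed

lemma pivot_pairs_eq_aux:
  "pivot_pairs (length xs) B' = {(i, j). j < length xs \<and> i \<in> lows TYPE('k) (Suc j) - lows TYPE('k) j}"
proof (intro set_eqI iffI; clarify)
  fix i j assume "(i, j) \<in> pivot_pairs (length xs) B'"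
  then have "j < length xs" "nonzero_column (length xs) B' j" "i = pivot (length xs) B' j"
    by (auto simp: pivot_pairs_def)
  then show "j < length xs \<and> i \<in> lows TYPE('k) (Suc j) - lows TYPE('k) j" using pivot_new_low by blast
next
  fix i j assume ij: "j < length xs" "i \<in> lows TYPE('k) (Suc j)" "i \<notin> lows TYPE('k) j"
  then obtain a where a: "a < Suc j" "nonzero_column (length xs) B' a" "i = pivot (length xs) B' a"
    using lows_eq_pivots[of "Suc j"] by auto
  have "a = j"
  proof (rule ccontr)
    assume "a \<noteq> j"
    then have "a < j" using a(1) by simp
    then show False using a ij lows_eq_pivots[of j] by auto
  qed
  then show "(i, j) \<in> pivot_pairs (length xs) B'" using a ij by (auto simp: pivot_pairs_def)
qed

text \<open>A cycle with pivot \<open>j\<close> serves to remove \<open>xs ! j\<close> from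
  \<open>V j\<close> without changing its boundary. If column \<open>j\<close> were nonzero, its
  pivot would then have been a low before stage \<open>j\<close>, contrary to
  \<open>pivot_new_low\<close>.\<close>

lemma positive_iff_zero_column:
  assumes "j < length xs"
  shows "positive TYPE('k) j \<longleftrightarrow> \<not> nonzero_column (length xs) B' j"
proof
  assume "positive TYPE('k) j"
  then obtain z :: "'m set \<Rightarrow> 'k" where z: "boundary z = (\<lambda>_. 0)" "leads z j" by (auto simp: positive_def)
  define c where "c = V j (xs ! j) / z (xs ! j)"
  define y where "y = (\<lambda>\<sigma>. V j \<sigma> - c * z \<sigma>)"
  have y: "y \<in> initial j" unfolding y_def c_def by (rule leads_eliminate[OF V_initial[OF assms] z(2)])
  have "boundary y = boundary (V j)" unfolding y_def by (simp add: boundary_diff boundary_scale z(1))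
  then have "pivot (length xs) B' j \<in> lows TYPE('k) j" if "nonzero_column (length xs) B' j"
    using pivot_leads[OF assms that] y unfolding lows_def by (metis (mono_tags, lifting) mem_Collect_eq)
  then show "\<not> nonzero_column (length xs) B' j" using pivot_new_low[OF assms] by blast
next
  assume "\<not> nonzero_column (length xs) B' j"
  then have "boundary (V j) = (\<lambda>_. 0)" using nonzero_column_iff[OF assms] by blast
  moreover have "leads (V j) j" using V_initial[OF assms] V_diag[OF assms] assms by (simp add: leads_def)
  ultimately show "positive TYPE('k) j" unfolding positive_def by blast
qed

lemma essential_indices_eq_aux:
  "essential_indices (length xs) B' = {i. i < length xs \<and> positive TYPE('k) i \<and> i \<notin> lows TYPE('k) (length xs)}"
proof -
  have "(\<forall>(a, b)\<in>pivot_pairs (length xs) B'. i \<noteq> a \<and> i \<noteq> b) \<longleftrightarrow>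
      \<not> nonzero_column (length xs) B' i \<and> i \<notin> lows TYPE('k) (length xs)" if "i < length xs" for i
    using that unfolding lows_eq_pivots[OF order_refl] by (auto simp: pivot_pairs_def)
  then show ?thesis unfolding essential_indices_def using positive_iff_zero_column by blast
qed

end

theorem reduced_matrix:
  assumes "(column_operation (length xs))\<^sup>*\<^sup>* (bd_matrix xs) (B' :: 'k::field matr)" "reduced (length xs) B'"
  shows "pivot_pairs (length xs) B' = {(i, j). j < length xs \<and> i \<in> lows TYPE('k) (Suc j) - lows TYPE('k) j}"
    and "essential_indices (length xs) B' = {i. i < length xs \<and> positive TYPE('k) i \<and> i \<notin> lows TYPE('k) (length xs)}"
proof -
  obtain V where V: "column_chains B' V" using column_chains_operations[OF assms(1)] by blast
  show "pivot_pairs (length xs) B' = {(i, j). j < length xs \<and> i \<in> lows TYPE('k) (Suc j) - lows TYPE('k) j}"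
    by (rule pivot_pairs_eq_aux[OF V assms(2)])
  show "essential_indices (length xs) B' = {i. i < length xs \<and> positive TYPE('k) i \<and> i \<notin> lows TYPE('k) (length xs)}"
    by (rule essential_indices_eq_aux[OF V assms(2)])
qed

end

section \<open>Distances to the diagonal and the order on simplices\<close>

lemma diag_dist_finite:
  assumes "b \<le> d"
  shows "diag_dist (ereal b, ereal d) = ereal ((d - b) / 2)"
  unfolding diag_dist_def d_inf_def
proof (rule antisym)
  \<comment> \<open>The infimum is attained at the midpoint of \<open>b\<close> and
    \<open>d\<close>, hence the factor two between bar lengths and distances to the
    diagonal.\<close>
  have "(INF x\<in>{x. x \<noteq> -\<infinity>}. max \<bar>fst (ereal b, ereal d) - fst (x, x)\<bar> \<bar>snd (ereal b, ereal d) - snd (x, x)\<bar>)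
    \<le> max \<bar>ereal b - ereal ((b + d) / 2)\<bar> \<bar>ereal d - ereal ((b + d) / 2)\<bar>"
    by (rule INF_lower2[of "ereal ((b + d) / 2)"]) auto
  also have "\<dots> = ereal (max \<bar>b - (b + d) / 2\<bar> \<bar>d - (b + d) / 2\<bar>)" by (simp add: max_def)
  also have "max \<bar>b - (b + d) / 2\<bar> \<bar>d - (b + d) / 2\<bar> = (d - b) / 2"
    using assms by (auto simp: max_def abs_if field_simps)
  finally show "(INF x\<in>{x. x \<noteq> -\<infinity>}. max \<bar>fst (ereal b, ereal d) - fst (x, x)\<bar> \<bar>snd (ereal b, ereal d) - snd (x, x)\<bar>)
    \<le> ereal ((d - b) / 2)" .
next
  show "ereal ((d - b) / 2) \<le>
    (INF x\<in>{x. x \<noteq> -\<infinity>}. max \<bar>fst (ereal b, ereal d) - fst (x, x)\<bar> \<bar>snd (ereal b, ereal d) - snd (x, x)\<bar>)"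
  proof (rule INF_greatest)
    fix x :: ereal assume "x \<in> {x. x \<noteq> -\<infinity>}"
    then show "ereal ((d - b) / 2) \<le> max \<bar>fst (ereal b, ereal d) - fst (x, x)\<bar> \<bar>snd (ereal b, ereal d) - snd (x, x)\<bar>"
      by (cases x) (auto simp: max_def abs_if field_simps)
  qed
qed

lemma diag_dist_infinite: "diag_dist (ereal b, \<infinity>) = \<infinity>"
proof -
  have "max \<bar>ereal b - x\<bar> \<bar>\<infinity> - x\<bar> = \<infinity>" if "x \<noteq> -\<infinity>" for x
    using that by (cases x) (auto simp: max_def)
  then have "diag_dist (ereal b, \<infinity>) = (INF x\<in>{x::ereal. x \<noteq> -\<infinity>}. \<infinity>)"
    unfolding diag_dist_def d_inf_def by (intro INF_cong) auto
  also have "\<dots> = \<infinity>" by (rule INF_const) (auto intro: exI[of _ 0])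
  finally show ?thesis .
qed

lemma diag_dist_ge_iff:
  assumes "fst p = ereal b" "ereal b < snd p"
  shows "ereal c \<le> diag_dist p \<longleftrightarrow> ereal (b + 2 * c) \<le> snd p"
proof (cases p)
  case (Pair x y)
  then show ?thesis
    using assms by (cases y) (auto simp: diag_dist_finite diag_dist_infinite field_simps)
qed

text \<open>Two different heads would each have to precede the other. The lists in
  \<open>persistence_vector\<close> are given only by their sets and orders, and this pins them
  down.\<close>

lemma sorted_wrt_unique:
  assumes "\<And>x y. x \<in> set xs \<Longrightarrow> y \<in> set xs \<Longrightarrow> R x y \<Longrightarrow> \<not> R y x"
    and "sorted_wrt R xs" "sorted_wrt R ys" "set xs = set ys"
  shows "xs = ys"
  using assms
proof (induction xs arbitrary: ys)
  case Nil
  then show ?case by simp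
next
  case (Cons x xs)
  obtain y ys' where ys: "ys = y # ys'" using Cons.prems(4) by (cases ys) auto
  have irr: "\<not> R z z" if "z \<in> set (x # xs)" for z using Cons.prems(1)[OF that that] by blast
  have "x = y"
  proof (rule ccontr)
    assume "x \<noteq> y"
    then have "y \<in> set xs" "x \<in> set ys'" using Cons.prems(4) ys by auto
    then have "R x y" "R y x" using Cons.prems(2,3) ys by auto
    then show False using Cons.prems(1)[of x y] \<open>y \<in> set xs\<close> by simp
  qed
  moreover have "x \<notin> set xs" using Cons.prems(2) irr[of x] by auto
  moreover have "y \<notin> set ys'" using Cons.prems(3) irr[of y] Cons.prems(4) ys by auto
  ultimately have "set xs = set ys'" using Cons.prems(4) ys insert_ident[of x "set xs" "set ys'"] by simp
  moreover have "sorted_wrt R xs" "sorted_wrt R ys'" using Cons.prems(2,3) ys by simp_all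
  moreover have "\<not> R b a" if "a \<in> set xs" "b \<in> set xs" "R a b" for a b
    using Cons.prems(1)[of a b] that by simp
  ultimately have "xs = ys'" by (intro Cons.IH)
  then show ?case using \<open>x = y\<close> ys by simp
qed

lemma exists_sorted_wrt:
  assumes "finite A" "\<And>x y. x \<in> A \<Longrightarrow> y \<in> A \<Longrightarrow> x \<noteq> y \<Longrightarrow> R x y \<or> R y x"
    and "\<And>x y z. x \<in> A \<Longrightarrow> y \<in> A \<Longrightarrow> z \<in> A \<Longrightarrow> R x y \<Longrightarrow> R y z \<Longrightarrow> R x z"
  shows "\<exists>xs. set xs = A \<and> sorted_wrt R xs"
  using assms
proof (induction A rule: finite_induct)
  case empty
  show ?case by simp
next
  case (insert x A)
  have "\<exists>xs. set xs = A \<and> sorted_wrt R xs"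
  proof (rule insert.IH)
    show "R x y \<or> R y x" if "x \<in> A" "y \<in> A" "x \<noteq> y" for x y
      using insert.prems(1)[of x y] that by simp
    show "R x z" if "x \<in> A" "y \<in> A" "z \<in> A" "R x y" "R y z" for x y z
      using insert.prems(2)[of x y z] that by simp
  qed
  then obtain xs where xs: "set xs = A" "sorted_wrt R xs" by blast
  define ys where "ys = filter (\<lambda>y. R y x) xs @ x # filter (\<lambda>y. \<not> R y x) xs"
  have "R x z" if "z \<in> A" "\<not> R z x" for z using insert.prems(1)[of x z] insert.hyps(2) that by auto
  moreover have "R y z" if "y \<in> A" "z \<in> A" "R y x" "R x z" for y z
    using insert.prems(2)[of y x z] that by simp
  ultimately have "sorted_wrt R ys"
    using xs by (auto simp: ys_def sorted_wrt_append intro: sorted_wrt_filter)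
  moreover have "set ys = insert x A" using xs by (auto simp: ys_def)
  ultimately show ?case by blast
qed

lemma simplex_less_asym:
  assumes "linear_order_on W tie" "\<sigma> \<in> W" "\<tau> \<in> W" "simplex_less r tie \<sigma> \<tau>"
  shows "\<not> simplex_less r tie \<tau> \<sigma>"
  using assms unfolding simplex_less_def linear_order_on_def partial_order_on_def antisym_def by auto

lemma simplex_less_total:
  assumes "linear_order_on W tie" "\<sigma> \<in> W" "\<tau> \<in> W" "\<sigma> \<noteq> \<tau>"
  shows "simplex_less r tie \<sigma> \<tau> \<or> simplex_less r tie \<tau> \<sigma>"
  using assms unfolding simplex_less_def linear_order_on_def total_on_def by force

lemma simplex_less_trans:
  assumes tie: "linear_order_on W tie" and "\<sigma> \<in> W" "\<tau> \<in> W" "\<rho> \<in> W"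
    and 1: "simplex_less r tie \<sigma> \<tau>" and 2: "simplex_less r tie \<tau> \<rho>"
  shows "simplex_less r tie \<sigma> \<rho>"
proof -
  have tr: "trans tie" and as: "antisym tie"
    using tie by (auto simp: linear_order_on_def partial_order_on_def preorder_on_def)
  have "(\<sigma>, \<rho>) \<in> tie \<and> \<sigma> \<noteq> \<rho>" if "(\<sigma>, \<tau>) \<in> tie" "(\<tau>, \<rho>) \<in> tie" "\<sigma> \<noteq> \<tau>"
    using transD[OF tr that(1,2)] antisymD[OF as that(1)] that by blast
  then show ?thesis using 1 2 unfolding simplex_less_def by (elim disjE conjE) auto
qed

lemma exists_simplex_order:
  fixes W :: "'m::finite set set"
  assumes "linear_order_on W tie"
  shows "\<exists>xs. set xs = W \<and> sorted_wrt (simplex_less r tie) xs"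
  by (rule exists_sorted_wrt)
    (rule finite, erule (2) simplex_less_total[OF assms], erule (4) simplex_less_trans[OF assms])

text \<open>A proper face has no larger radius and strictly fewer vertices, so the lexicographic
  order puts it first even when the radii agree.\<close>

lemma ordered_complexI:
  fixes W :: "'m::{finite, linorder} set set"
  assumes "face_closed W" "\<And>\<sigma>. \<sigma> \<in> W \<Longrightarrow> 0 \<le> r \<sigma>"
    and mono: "\<And>\<sigma> \<tau>. \<sigma> \<in> W \<Longrightarrow> \<tau> \<in> W \<Longrightarrow> \<tau> \<subset> \<sigma> \<Longrightarrow> r \<tau> \<le> r \<sigma>"
    and tie: "linear_order_on W tie" and xs: "set xs = W" "sorted_wrt (simplex_less r tie) xs"
  shows "ordered_complex W r xs"
proof
  have "sorted_wrt (\<noteq>) xs"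
    by (rule sorted_wrt_mono_rel[OF _ xs(2)]) (auto simp: simplex_less_def)
  then show "distinct xs" by (induction xs) auto
  show "sorted_wrt (\<lambda>\<sigma> \<tau>. r \<sigma> \<le> r \<tau> \<and> \<not> \<tau> \<subset> \<sigma>) xs"
  proof (rule sorted_wrt_mono_rel[OF _ xs(2)])
    fix \<sigma> \<tau> assume "\<sigma> \<in> set xs" "\<tau> \<in> set xs" and less: "simplex_less r tie \<sigma> \<tau>"
    then have W: "\<sigma> \<in> W" "\<tau> \<in> W" using xs by auto
    have "\<not> \<tau> \<subset> \<sigma>"
    proof
      assume "\<tau> \<subset> \<sigma>"
      then have "r \<tau> \<le> r \<sigma>" "card \<tau> < card \<sigma>" using mono[OF W] by (auto intro: psubset_card_mono)
      then show False using less by (auto simp: simplex_less_def)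
    qed
    then show "r \<sigma> \<le> r \<tau> \<and> \<not> \<tau> \<subset> \<sigma>" using less by (auto simp: simplex_less_def)
  qed
qed (use assms in auto)

section \<open>Index sets of the persistence vector\<close>

context ordered_complex
begin

text \<open>\<open>long_pairs\<close> and \<open>essentials\<close> are the index sets of
  \<open>persistence_vector\<close> as rewritten by \<open>reduced_matrix\<close>, so that the
  reduced matrix has disappeared from them.\<close>

definition long_pairs :: "'k::field itself \<Rightarrow> nat \<Rightarrow> real \<Rightarrow> (nat \<times> nat) set" where
  "long_pairs k l \<epsilon> = {(i, j). j < length xs \<and> i \<in> lows k (Suc j) - lows k j \<and> card (xs ! i) = Suc l \<and>
     diag_dist (ereal (r (xs ! i)), ereal (r (xs ! j))) \<ge> ereal \<epsilon>}"

definition essentials :: "'k::field itself \<Rightarrow> nat \<Rightarrow> nat set" where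
  "essentials k l = {i. i < length xs \<and> positive k i \<and> i \<notin> lows k (length xs) \<and> card (xs ! i) = Suc l}"

lemma low_less:
  fixes k :: "'k::field itself"
  assumes "i \<in> lows k (Suc j)"
  shows "i < length xs" "i \<le> j"
proof -
  obtain z :: "'m set \<Rightarrow> 'k" where z: "z \<in> initial (Suc j)" "leads (boundary z) i" using assms by (auto simp: lows_def)
  show "i < length xs" using z by (simp add: leads_def)
  show "i \<le> j" using leads_less[OF z(2) boundary_initial[OF z(1)]] by simp
qed

lemma r_nth_mono: "i \<le> j \<Longrightarrow> j < length xs \<Longrightarrow> r (xs ! i) \<le> r (xs ! j)"
  using sorted_wrt_nth_less[OF sorted_xs, of i j] by (cases "i = j") auto

text \<open>An index enters \<open>lows\<close> at one stage only, so the first projection is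
  injective. A positive \<open>\<epsilon>\<close> excludes the pairs of equal radii, which have no
  bar.\<close>

lemma card_long_pairs:
  assumes "0 < \<epsilon>"
  shows "card (long_pairs k l \<epsilon>) = card {i \<in> births k l. ereal (r (xs ! i)) < death k i \<and>
    death k i \<noteq> \<infinity> \<and> ereal \<epsilon> \<le> diag_dist (ereal (r (xs ! i)), death k i)}" (is "_ = card ?R")
proof (rule bij_betw_same_card[of fst], unfold bij_betw_def, intro conjI)
  show "inj_on fst (long_pairs k l \<epsilon>)"
  proof (rule inj_onI)
    fix p q assume "p \<in> long_pairs k l \<epsilon>" "q \<in> long_pairs k l \<epsilon>" "fst p = fst q"
    then have "fst p \<in> lows k (Suc (snd p)) - lows k (snd p)" "fst p \<in> lows k (Suc (snd q)) - lows k (snd q)"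
      by (auto simp: long_pairs_def)
    then have "snd p = snd q" by (rule new_low_unique)
    then show "p = q" using \<open>fst p = fst q\<close> by (simp add: prod_eq_iff)
  qed
  show "fst ` long_pairs k l \<epsilon> = ?R"
  proof (intro set_eqI iffI)
    fix i assume "i \<in> fst ` long_pairs k l \<epsilon>"
    then obtain j where j: "j < length xs" "i \<in> lows k (Suc j) - lows k j" "card (xs ! i) = Suc l"
      "diag_dist (ereal (r (xs ! i)), ereal (r (xs ! j))) \<ge> ereal \<epsilon>"
      by (auto simp: long_pairs_def)
    have i: "i \<in> lows k (Suc j)" using j(2) by simp
    have b: "i \<in> births k l" using low_less[OF i] positive_of_low[OF i] j(3) by (simp add: births_def)
    have le: "r (xs ! i) \<le> r (xs ! j)" using low_less[OF i] j(1) by (intro r_nth_mono) auto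
    then have "\<epsilon> \<le> (r (xs ! j) - r (xs ! i)) / 2" using j(4) by (simp add: diag_dist_finite)
    then have "r (xs ! i) < r (xs ! j)" using assms by simp
    then show "i \<in> ?R" using b j death_eq[OF j(1,2)] by simp
  next
    fix i assume i: "i \<in> ?R"
    then have "death k i \<noteq> \<infinity>" by blast
    then have "i \<in> lows k (length xs)" unfolding death_def by metis
    then obtain j where j: "j < length xs" "i \<in> lows k (Suc j) - lows k j" using low_is_new by blast
    then have "(i, j) \<in> long_pairs k l \<epsilon>"
      using i death_eq[OF j] by (simp add: long_pairs_def births_def)
    then show "i \<in> fst ` long_pairs k l \<epsilon>" by force
  qed
qed

lemma card_essentials: "card (essentials k l) = card {i \<in> births k l. ereal (r (xs ! i)) < death k i \<and> death k i = \<infinity>}"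
  by (intro arg_cong[where f = card]) (auto simp: essentials_def births_def death_def)

text \<open>By uniqueness any decomposition has the bars found in \<open>barcode\<close>, so its
  bars can be counted by indices of \<open>xs\<close>.\<close>

lemma barcode_counts:
  fixes e :: "nat \<Rightarrow> real \<Rightarrow> 'm set \<Rightarrow> 'k::field"
  assumes X: "\<And>t. 0 < t \<Longrightarrow> X t = {\<sigma> \<in> W. r \<sigma> < t}" and qs: "interval_decomposition l X qs e"
  shows "0 < \<epsilon> \<Longrightarrow> card (long_pairs TYPE('k) l \<epsilon>) = size {#p \<in># mset qs. snd p \<noteq> \<infinity> \<and> ereal \<epsilon> \<le> diag_dist p#}"
    and "card (essentials TYPE('k) l) = size {#p \<in># mset qs. snd p = \<infinity>#}"
proof -
  obtain qs' and e' :: "nat \<Rightarrow> real \<Rightarrow> 'm set \<Rightarrow> 'k" where qs': "interval_decomposition l X qs' e'"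
    "mset qs' = image_mset (\<lambda>i. (ereal (r (xs ! i)), death TYPE('k) i))
      (mset_set {i \<in> births TYPE('k) l. ereal (r (xs ! i)) < death TYPE('k) i})"
    using barcode[OF X] by blast
  have eq: "mset qs = mset qs'"
    by (rule interval_decomposition_unique[OF qs qs'(1)]) (auto simp: X)
  have fin: "finite {i \<in> births TYPE('k) l. ereal (r (xs ! i)) < death TYPE('k) i}"
    by (simp add: births_def)
  have sz: "size {#p \<in># mset qs. P p#} = card {i \<in> births TYPE('k) l. ereal (r (xs ! i)) < death TYPE('k) i \<and>
      P (ereal (r (xs ! i)), death TYPE('k) i)}" for P
    unfolding eq qs'(2) using fin
    by (auto simp: filter_mset_image_mset intro!: arg_cong[where f = card])
  show "0 < \<epsilon> \<Longrightarrow> card (long_pairs TYPE('k) l \<epsilon>) = size {#p \<in># mset qs. snd p \<noteq> \<infinity> \<and> ereal \<epsilon> \<le> diag_dist p#}"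
    by (simp add: card_long_pairs sz)
  show "card (essentials TYPE('k) l) = size {#p \<in># mset qs. snd p = \<infinity>#}"
    by (simp add: card_essentials sz)
qed

end

text \<open>Presents the vector as the radii of a list of simplices from which the chosen reduction
  has disappeared; smoothness will follow from local constancy of this list.\<close>

lemma persistence_vector_unfold:
  fixes W :: "'m::{finite, linorder} set set"
  assumes pv: "persistence_vector TYPE('k::field) l \<epsilon> tie W r ys"
    and W: "face_closed W" "\<And>\<sigma>. \<sigma> \<in> W \<Longrightarrow> 0 \<le> r \<sigma>"
      "\<And>\<sigma> \<tau>. \<sigma> \<in> W \<Longrightarrow> \<tau> \<in> W \<Longrightarrow> \<tau> \<subset> \<sigma> \<Longrightarrow> r \<tau> \<le> r \<sigma>" "linear_order_on W tie"
  obtains xs ps es where "set xs = W" "sorted_wrt (simplex_less r tie) xs" "ordered_complex W r xs"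
    "set ps = ordered_complex.long_pairs r xs TYPE('k) l \<epsilon>" "sorted_wrt (\<lambda>p q. fst p < fst q) ps"
    "set es = ordered_complex.essentials xs TYPE('k) l" "sorted_wrt (<) es"
    "ys = map r (concat (map (\<lambda>(i, j). [xs ! i, xs ! j]) ps) @ map ((!) xs) es)"
proof -
  obtain xs ps es and B' :: "'k matr" where xs: "set xs = W" "sorted_wrt (simplex_less r tie) xs"
    and B': "(column_operation (length xs))\<^sup>*\<^sup>* (bd_matrix xs) B'" "reduced (length xs) B'"
    and ps: "set ps = {(i, j) \<in> pivot_pairs (length xs) B'. card (xs ! i) = Suc l \<and>
                    diag_dist (ereal (r (xs ! i)), ereal (r (xs ! j))) \<ge> ereal \<epsilon>}"
        "sorted_wrt (\<lambda>p q. fst p < fst q) ps"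
    and es: "set es = {i \<in> essential_indices (length xs) B'. card (xs ! i) = Suc l}" "sorted_wrt (<) es"
    and ys: "ys = concat (map (\<lambda>(i, j). [r (xs ! i), r (xs ! j)]) ps) @ map (\<lambda>i. r (xs ! i)) es"
    using pv unfolding persistence_vector_def by blast
  have oc: "ordered_complex W r xs" by (rule ordered_complexI[OF W xs])
  then interpret ordered_complex W r xs .
  show thesis
  proof (rule that[OF xs oc _ ps(2) _ es(2)])
    show "set ps = long_pairs TYPE('k) l \<epsilon>"
      unfolding ps(1) reduced_matrix(1)[OF B'] by (auto simp: long_pairs_def)
    show "set es = essentials TYPE('k) l"
      unfolding es(1) reduced_matrix(2)[OF B'] by (auto simp: essentials_def)
    show "ys = map r (concat (map (\<lambda>(i, j). [xs ! i, xs ! j]) ps) @ map ((!) xs) es)"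
    proof -
      have "concat (map (\<lambda>(i, j). [r (xs ! i), r (xs ! j)]) ps)
        = map r (concat (map (\<lambda>(i, j). [xs ! i, xs ! j]) ps))"
        by (induction ps) auto
      then show ?thesis unfolding ys by simp
    qed
  qed
qed

section \<open>Stability of the number of long bars\<close>

lemma card_long_bars: "card (long_bars h ps) = size {#p \<in># mset ps. fst p + ereal h < snd p#}"
  by (simp add: long_bars_def length_filter_conv_card flip: mset_filter)

lemma size_filter_mono: "(\<And>p. p \<in># M \<Longrightarrow> P p \<Longrightarrow> Q p) \<Longrightarrow> size {#p \<in># M. P p#} \<le> size {#p \<in># M. Q p#}"
  by (intro size_mset_mono filter_mset_mono_strong) auto

text \<open>Beyond the longest finite bar only infinite bars are counted; this lets
  \<open>stable_bar_counts\<close> compare the infinite bars separately.\<close>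

lemma eventually_long_bars_infinite:
  assumes "\<And>p. p \<in># M \<Longrightarrow> \<exists>b. fst p = ereal b"
  shows "\<forall>\<^sub>F h in at_top. \<forall>p\<in>set_mset M. fst p + ereal h < snd p \<longleftrightarrow> snd p = \<infinity>"
proof (intro eventually_ball_finite ballI)
  fix p assume "p \<in> set_mset M"
  then obtain b where b: "fst p = ereal b" using assms by blast
  show "\<forall>\<^sub>F h in at_top. fst p + ereal h < snd p \<longleftrightarrow> snd p = \<infinity>"
  proof (cases "snd p")
    case (real d)
    have "\<forall>\<^sub>F h in at_top. d - b < h" by (rule eventually_gt_at_top)
    then show ?thesis by eventually_elim (simp add: real b)
  qed (simp_all add: b)
qed simp

text \<open>\<open>long_bars\<close> compares strictly while truncation compares weakly. Among
  finitely many bars, those longer than an \<open>h\<close> slightly below \<open>c\<close> already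
  have length at least \<open>c\<close>.\<close>

lemma eventually_long_bars_at_left:
  assumes "\<And>p. p \<in># M \<Longrightarrow> \<exists>b. fst p = ereal b"
  shows "\<forall>\<^sub>F h in at_left c. \<forall>p\<in>set_mset M. fst p + ereal h < snd p \<longrightarrow> fst p + ereal c \<le> snd p"
proof (intro eventually_ball_finite ballI)
  fix p assume "p \<in> set_mset M"
  then obtain b where b: "fst p = ereal b" using assms by blast
  show "\<forall>\<^sub>F h in at_left c. fst p + ereal h < snd p \<longrightarrow> fst p + ereal c \<le> snd p"
  proof (cases "snd p")
    case (real d)
    show ?thesis
    proof (cases "d - b < c")
      case True
      then have "\<forall>\<^sub>F h in at_left c. h \<in> {d - b<..<c}" by (rule eventually_at_left_real)
      then show ?thesis by eventually_elim (simp add: real b)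
    next
      case False
      then show ?thesis by (simp add: real b)
    qed
  qed (simp_all add: b)
qed simp

text \<open>A distance to the diagonal is half a length, so bars of \<open>ps\<close> have length at
  least \<open>4 * \<epsilon>\<close>, which exceeds \<open>2 * a + h\<close> for
  \<open>h < 2 * \<epsilon>\<close>; with \<open>h\<close> just below \<open>2 * \<epsilon>\<close>,
  at least as many bars of \<open>qs\<close> have length at least \<open>2 * \<epsilon>\<close>.
  Conversely those are longer than \<open>2 * a\<close>, so there are at most as many as bars of
  \<open>ps\<close>. For large \<open>h\<close> both inequalities concern infinite bars only, and
  the finite ones follow by subtraction.\<close>

lemma stable_bar_counts:
  assumes ps: "interval_decomposition l X ps e" and qs: "interval_decomposition l Y qs g"
    and a: "0 \<le> a" "a < \<epsilon>"
    and le1: "\<And>h. 0 \<le> h \<Longrightarrow> card (long_bars (2 * a + h) ps) \<le> card (long_bars h qs)"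
    and le2: "\<And>h. 0 \<le> h \<Longrightarrow> card (long_bars (2 * a + h) qs) \<le> card (long_bars h ps)"
    and long: "\<And>p. p \<in> set ps \<Longrightarrow> ereal (2 * \<epsilon>) < diag_dist p"
  shows "size {#p \<in># mset qs. snd p \<noteq> \<infinity> \<and> ereal \<epsilon> \<le> diag_dist p#} = n_finite (mset ps)"
    and "size {#p \<in># mset qs. snd p = \<infinity>#} = n_infinite (mset ps)"
proof -
  have start: "\<exists>b. fst p = ereal b \<and> ereal b < snd p" if "p \<in># mset ps + mset qs" for p
    using interval_bounds[OF ps, of p] interval_bounds[OF qs, of p] that by (cases "fst p") auto
  have dd: "ereal c \<le> diag_dist p \<longleftrightarrow> fst p + ereal (2 * c) \<le> snd p" if "p \<in># mset ps + mset qs" for p c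
    using start[OF that] diag_dist_ge_iff[of p] by auto
  have eqT: "size {#p \<in># mset qs. ereal \<epsilon> \<le> diag_dist p#} = size (mset ps)"
  proof (rule antisym)
    have "size {#p \<in># mset qs. ereal \<epsilon> \<le> diag_dist p#} \<le> size {#p \<in># mset qs. fst p + ereal (2 * a + 0) < snd p#}"
    proof (rule size_filter_mono)
      fix p assume p: "p \<in># mset qs" "ereal \<epsilon> \<le> diag_dist p"
      obtain b where b: "fst p = ereal b" using start[of p] p by auto
      have "fst p + ereal (2 * \<epsilon>) \<le> snd p" using dd[of p \<epsilon>] p by simp
      moreover have "fst p + ereal (2 * a + 0) < fst p + ereal (2 * \<epsilon>)" using a b by simp
      ultimately show "fst p + ereal (2 * a + 0) < snd p" by (rule order.strict_trans2[rotated])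
    qed
    also have "\<dots> \<le> size {#p \<in># mset ps. fst p + ereal 0 < snd p#}"
      using le2[of 0] by (simp add: card_long_bars)
    also have "\<dots> \<le> size (mset ps)" by (simp add: size_filter_mset_lesseq del: size_mset)
    finally show "size {#p \<in># mset qs. ereal \<epsilon> \<le> diag_dist p#} \<le> size (mset ps)" .
  next
    have "\<forall>\<^sub>F h in at_left (2 * \<epsilon>). (\<forall>p\<in>set_mset (mset qs). fst p + ereal h < snd p \<longrightarrow> fst p + ereal (2 * \<epsilon>) \<le> snd p)
        \<and> h \<in> {0<..<2 * \<epsilon>}"
      using start a by (intro eventually_conj eventually_long_bars_at_left eventually_at_left_real) auto
    from eventually_happens'[OF trivial_limit_at_left_real this] obtain h where
      h: "\<And>p. p \<in># mset qs \<Longrightarrow> fst p + ereal h < snd p \<Longrightarrow> fst p + ereal (2 * \<epsilon>) \<le> snd p" "0 < h" "h < 2 * \<epsilon>"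
      by auto
    have "size (mset ps) = size {#p \<in># mset ps. True#}" by simp
    also have "\<dots> \<le> size {#p \<in># mset ps. fst p + ereal (2 * a + h) < snd p#}"
    proof (rule size_filter_mono)
      fix p assume p: "p \<in># mset ps"
      obtain b where b: "fst p = ereal b" using start[of p] p by auto
      have "fst p + ereal (2 * (2 * \<epsilon>)) \<le> snd p" using less_imp_le[OF long[of p]] dd[of p "2 * \<epsilon>"] p by simp
      moreover have "fst p + ereal (2 * a + h) < fst p + ereal (2 * (2 * \<epsilon>))" using a b h by simp
      ultimately show "fst p + ereal (2 * a + h) < snd p" by (rule order.strict_trans2[rotated])
    qed
    also have "\<dots> \<le> size {#p \<in># mset qs. fst p + ereal h < snd p#}"
      using le1[of h] h by (simp add: card_long_bars)
    also have "\<dots> \<le> size {#p \<in># mset qs. ereal \<epsilon> \<le> diag_dist p#}"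
      using h(1) dd[of _ \<epsilon>] by (intro size_filter_mono) simp
    finally show "size (mset ps) \<le> size {#p \<in># mset qs. ereal \<epsilon> \<le> diag_dist p#}" .
  qed
  have "\<forall>\<^sub>F h in at_top. (\<forall>p\<in>set_mset (mset ps + mset qs). fst p + ereal h < snd p \<longleftrightarrow> snd p = \<infinity>) \<and> 0 \<le> h"
    using start by (intro eventually_conj eventually_long_bars_infinite eventually_ge_at_top) blast
  then obtain H where H: "\<And>h. H \<le> h \<Longrightarrow>
      (\<forall>p\<in>set_mset (mset ps + mset qs). fst p + ereal h < snd p \<longleftrightarrow> snd p = \<infinity>) \<and> 0 \<le> h"
    unfolding eventually_at_top_linorder by blast
  have inf: "card (long_bars h rs) = size {#p \<in># mset rs. snd p = \<infinity>#}"
    if "H \<le> h" "mset rs \<subseteq># mset ps + mset qs" for h rs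
    unfolding card_long_bars using H[OF that(1)] mset_subset_eqD[OF that(2)]
    by (intro arg_cong[where f = size] filter_mset_cong) auto
  have H0: "0 \<le> H" "H \<le> 2 * a + H" using H[of H] a by auto
  show eqI: "size {#p \<in># mset qs. snd p = \<infinity>#} = n_infinite (mset ps)"
    using le1[OF H0(1)] le2[OF H0(1)] inf[of H ps] inf[of H qs] inf[OF H0(2), of ps] inf[OF H0(2), of qs]
    by (simp add: n_infinite_def)
  have "{#p \<in># mset qs. ereal \<epsilon> \<le> diag_dist p \<and> snd p = \<infinity>#} = {#p \<in># mset qs. snd p = \<infinity>#}"
    using dd[of _ \<epsilon>] by (intro filter_mset_cong) auto
  then have "size {#p \<in># mset qs. snd p \<noteq> \<infinity> \<and> ereal \<epsilon> \<le> diag_dist p#} + n_infinite (mset ps) = size (mset ps)"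
    using size_filter_split[of "\<lambda>p. ereal \<epsilon> \<le> diag_dist p" "mset qs" "\<lambda>p. snd p = \<infinity>"] eqT eqI
    by (simp add: conj_commute)
  moreover have "size (mset ps) = n_finite (mset ps) + n_infinite (mset ps)"
    using size_filter_split[of "\<lambda>_. True" "mset ps" "\<lambda>p. snd p = \<infinity>"] by (simp add: n_finite_def n_infinite_def)
  ultimately show "size {#p \<in># mset qs. snd p \<noteq> \<infinity> \<and> ereal \<epsilon> \<le> diag_dist p#} = n_finite (mset ps)" by simp
qed

section \<open>Gromov-Hausdorff distance of finite configurations\<close>

lemma hausdorff_dist_less_iff:
  assumes "finite A" "A \<noteq> {}" "finite B" "B \<noteq> {}"
  shows "hausdorff_dist d A B < \<epsilon> \<longleftrightarrow> (\<forall>x\<in>A. \<exists>y\<in>B. d x y < \<epsilon>) \<and> (\<forall>y\<in>B. \<exists>x\<in>A. d x y < \<epsilon>)"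
  using assms by (simp add: hausdorff_dist_def cSup_eq_Max cInf_eq_Min Min_less_iff)

lemma hausdorff_dist_nonneg:
  assumes "finite A" "A \<noteq> {}" "finite B" "B \<noteq> {}" "\<And>x y. 0 \<le> d x y"
  shows "0 \<le> hausdorff_dist d A B"
proof (rule ccontr)
  assume "\<not> 0 \<le> hausdorff_dist d A B"
  then have "hausdorff_dist d A B < 0" by simp
  then have "\<forall>x\<in>A. \<exists>y\<in>B. d x y < 0" using hausdorff_dist_less_iff[OF assms(1-4)] by blast
  then show False using assms(2,5) by (meson equals0I not_less)
qed

lemma finite_cloud [simp]: "finite (cloud u)" and cloud_nonempty [simp]: "cloud u \<noteq> {}"
  by (simp_all add: cloud_def)

text \<open>A correspondence of distortion less than \<open>2 * \<epsilon>\<close>. In contrast to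
  an infimum over ambient metrics this is a finite system of strict inequalities in
  \<open>v\<close>, from which openness of Gromov-Hausdorff balls can be read off.\<close>

definition correspondence :: "('l::finite, 'm::finite) config \<Rightarrow> ('l, 'm) config \<Rightarrow> real \<Rightarrow> ('m \<times> 'm) set \<Rightarrow> bool" where
  "correspondence u v \<epsilon> R \<longleftrightarrow> (\<forall>i. \<exists>j. (i, j) \<in> R) \<and> (\<forall>j. \<exists>i. (i, j) \<in> R) \<and>
     (\<forall>(i, j)\<in>R. \<forall>(i', j')\<in>R. \<bar>dist (u $ i) (u $ i') - dist (v $ j) (v $ j')\<bar> < 2 * \<epsilon>)"

definition ambient :: "('l::finite, 'm::finite) config \<Rightarrow> ('l, 'm) config \<Rightarrow>
    ('a::metric_space + 'b::metric_space) set \<Rightarrow> ('a + 'b \<Rightarrow> 'a + 'b \<Rightarrow> real) \<Rightarrow>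
    (real^'l \<Rightarrow> 'a + 'b) \<Rightarrow> (real^'l \<Rightarrow> 'a + 'b) \<Rightarrow> bool" where
  "ambient u v S d \<phi> \<psi> \<longleftrightarrow> Metric_space S d \<and> isometric_embedding (cloud u) S d \<phi> \<and>
     isometric_embedding (cloud v) S d \<psi>"

text \<open>Each pair in \<open>R\<close> is joined by a bridge of length \<open>a\<close>, and
  \<open>m\<close> is the shortest way across. A detour through the other cloud uses two bridges,
  whose length \<open>2 * a\<close> compensates the distortion, so old distances are not shortened;
  \<open>a > 0\<close> keeps the two copies apart.\<close>

lemma gluing_metric:
  fixes u v :: "('l::finite, 'm::finite) config"
  assumes a: "0 < a" and R: "\<And>i. \<exists>j. (i, j) \<in> R" "\<And>j. \<exists>i. (i, j) \<in> R"
    and dis: "\<And>i j i' j'. (i, j) \<in> R \<Longrightarrow> (i', j') \<in> R \<Longrightarrow>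
      \<bar>dist (u $ i) (u $ i') - dist (v $ j) (v $ j')\<bar> \<le> 2 * a"
  shows "\<exists>d. ambient u v UNIV d (Inl :: _ \<Rightarrow> real^'l + real^'l) Inr \<and> (\<forall>i j. (i, j) \<in> R \<longrightarrow> d (Inl (u $ i)) (Inr (v $ j)) \<le> a)"
proof -
  define m where "m x y = Min ((\<lambda>(i, j). dist x (u $ i) + a + dist (v $ j) y) ` R)" for x y
  have finR: "finite R" "R \<noteq> {}" using R by auto
  have m_le: "m x y \<le> dist x (u $ i) + a + dist (v $ j) y" if "(i, j) \<in> R" for x y i j
    unfolding m_def using finR that by (intro Min_le) auto
  have m_ex: "\<exists>i j. (i, j) \<in> R \<and> m x y = dist x (u $ i) + a + dist (v $ j) y" for x y
  proof -
    have "m x y \<in> (\<lambda>(i, j). dist x (u $ i) + a + dist (v $ j) y) ` R"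
      unfolding m_def using finR by (intro Min_in) auto
    then show ?thesis by auto
  qed
  have m_pos: "0 < m x y" for x y
  proof -
    obtain i j where "m x y = dist x (u $ i) + a + dist (v $ j) y" using m_ex by blast
    then show ?thesis using zero_le_dist[of x "u $ i"] zero_le_dist[of "v $ j" y] a by linarith
  qed
  have t1: "dist x x' \<le> m x y + m x' y" for x x' y
  proof -
    obtain i j i' j' where *: "(i, j) \<in> R" "m x y = dist x (u $ i) + a + dist (v $ j) y"
      "(i', j') \<in> R" "m x' y = dist x' (u $ i') + a + dist (v $ j') y"
      using m_ex[of x y] m_ex[of x' y] by blast
    have "dist x x' \<le> dist x (u $ i) + dist (u $ i) (u $ i') + dist x' (u $ i')"
      using dist_triangle[of x x' "u $ i"] dist_triangle[of "u $ i" x' "u $ i'"] by (simp add: dist_commute)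
    moreover have "dist (v $ j) (v $ j') \<le> dist (v $ j) y + dist (v $ j') y" by (rule dist_triangle2)
    ultimately show ?thesis using * dis[OF *(1,3)] by linarith
  qed
  have t2: "dist y y' \<le> m x y + m x y'" for y y' x
  proof -
    obtain i j i' j' where *: "(i, j) \<in> R" "m x y = dist x (u $ i) + a + dist (v $ j) y"
      "(i', j') \<in> R" "m x y' = dist x (u $ i') + a + dist (v $ j') y'"
      using m_ex[of x y] m_ex[of x y'] by blast
    have "dist y y' \<le> dist (v $ j) y + dist (v $ j) (v $ j') + dist (v $ j') y'"
      using dist_triangle[of y y' "v $ j"] dist_triangle[of "v $ j" y' "v $ j'"] by (simp add: dist_commute)
    moreover have "dist (u $ i) (u $ i') \<le> dist x (u $ i) + dist x (u $ i')" by (rule dist_triangle3)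
    ultimately show ?thesis using * dis[OF *(1,3)] by linarith
  qed
  have t3: "m x y \<le> dist x x' + m x' y" for x x' y
  proof -
    obtain i j where *: "(i, j) \<in> R" "m x' y = dist x' (u $ i) + a + dist (v $ j) y" using m_ex by blast
    show ?thesis using m_le[OF *(1), of x y] *(2) dist_triangle[of x "u $ i" x'] by linarith
  qed
  have t4: "m x y \<le> m x y' + dist y' y" for x y y'
  proof -
    obtain i j where *: "(i, j) \<in> R" "m x y' = dist x (u $ i) + a + dist (v $ j) y'" using m_ex by blast
    show ?thesis using m_le[OF *(1), of x y] *(2) dist_triangle[of "v $ j" y y'] by linarith
  qed
  define d where "d p q = (case p of Inl x \<Rightarrow> (case q of Inl x' \<Rightarrow> dist x x' | Inr y \<Rightarrow> m x y)
      | Inr y \<Rightarrow> (case q of Inl x \<Rightarrow> m x y | Inr y' \<Rightarrow> dist y y'))" for p q :: "real^'l + real^'l"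
  have "Metric_space UNIV d"
  proof
    fix p q s :: "real^'l + real^'l"
    show "0 \<le> d p q" using m_pos by (auto simp: d_def less_imp_le split: sum.splits)
    show "d p q = d q p" by (auto simp: d_def dist_commute split: sum.splits)
    show "d p q = 0 \<longleftrightarrow> p = q" using m_pos by (cases p; cases q) (auto simp: d_def less_imp_neq[symmetric])
    show "d p s \<le> d p q + d q s"
    proof (cases p)
      case p: (Inl x)
      show ?thesis
      proof (cases q)
        case q: (Inl x')
        show ?thesis using t3 by (cases s) (auto simp: p q d_def dist_triangle)
      next
        case q: (Inr y')
        show ?thesis using t1 t4 by (cases s) (auto simp: p q d_def)
      qed
    next
      case p: (Inr y)
      show ?thesis
      proof (cases q)
        case q: (Inl x')
        show ?thesis using t2 t3 by (cases s) (auto simp: p q d_def add.commute[of "m x' y"] dist_commute)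
      next
        case q: (Inr y')
        show ?thesis
        proof (cases s)
          case (Inl x)
          then show ?thesis using t4[of x y y'] dist_commute[of y y'] by (simp add: p q d_def)
        qed (simp add: p q d_def dist_triangle)
      qed
    qed
  qed
  then have "ambient u v UNIV d Inl Inr"
    by (simp add: ambient_def isometric_embedding_def d_def)
  moreover have "d (Inl (u $ i)) (Inr (v $ j)) \<le> a" if "(i, j) \<in> R" for i j
    using m_le[OF that, of "u $ i" "v $ j"] by (simp add: d_def)
  ultimately show ?thesis by blast
qed

lemma gromov_hausdorff_dist_eq:
  fixes u v :: "('l::finite, 'm::finite) config"
  shows "gromov_hausdorff_dist (cloud u) (cloud v) = Inf {hausdorff_dist d (\<phi> ` cloud u) (\<psi> ` cloud v) |
     (S :: (real^'l + real^'l) set) d \<phi> \<psi>. ambient u v S d \<phi> \<psi>}"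
  by (simp add: gromov_hausdorff_dist_def ambient_def)

lemma gromov_hausdorff_ambient:
  fixes u v :: "('l::finite, 'm::finite) config"
  assumes "gromov_hausdorff_dist (cloud u) (cloud v) < \<epsilon>"
  shows "\<exists>S d \<phi> \<psi>. ambient u v (S :: (real^'l + real^'l) set) d \<phi> \<psi> \<and>
    (\<forall>i. \<exists>j. d (\<phi> (u $ i)) (\<psi> (v $ j)) < \<epsilon>) \<and> (\<forall>j. \<exists>i. d (\<phi> (u $ i)) (\<psi> (v $ j)) < \<epsilon>)"
proof -
  let ?H = "{hausdorff_dist d (\<phi> ` cloud u) (\<psi> ` cloud v) |(S :: (real^'l + real^'l) set) d \<phi> \<psi>. ambient u v S d \<phi> \<psi>}"
  \<comment> \<open>The full relation has some finite distortion bound \<open>D\<close>, so gluing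
    with bridges of length \<open>D + 1\<close> gives at least one ambient space. The infimum is
    thus over a nonempty set and an element below \<open>\<epsilon>\<close> exists.\<close>
  define D where "D = Max (range (\<lambda>(i, i', j, j'). \<bar>dist (u $ i) (u $ i') - dist (v $ j) (v $ j')\<bar>))"
  have D: "\<bar>dist (u $ i) (u $ i') - dist (v $ j) (v $ j')\<bar> \<le> D" for i i' j j'
    unfolding D_def by (intro Max_ge) (auto intro: rev_image_eqI[of "(i, i', j, j')"])
  then have "0 \<le> D" using abs_ge_zero order_trans by blast
  have "\<bar>dist (u $ i) (u $ i') - dist (v $ j) (v $ j')\<bar> \<le> 2 * (D + 1)" for i i' j j'
    by (rule order_trans[OF D]) (use \<open>0 \<le> D\<close> in simp)
  then have "\<exists>d. ambient u v UNIV d (Inl :: _ \<Rightarrow> real^'l + real^'l) Inr"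
    using gluing_metric[of "D + 1" UNIV u v] \<open>0 \<le> D\<close> by auto
  then have ne: "?H \<noteq> {}" by blast
  have "Inf ?H < \<epsilon>" using assms by (simp only: gromov_hausdorff_dist_eq)
  from cInf_lessD[OF ne this] obtain h where "h \<in> ?H" "h < \<epsilon>" by blast
  then obtain S d \<phi> \<psi> where *: "ambient u v (S :: (real^'l + real^'l) set) d \<phi> \<psi>"
      "hausdorff_dist d (\<phi> ` cloud u) (\<psi> ` cloud v) < \<epsilon>"
    by blast
  have "(\<forall>x\<in>\<phi> ` cloud u. \<exists>y\<in>\<psi> ` cloud v. d x y < \<epsilon>) \<and> (\<forall>y\<in>\<psi> ` cloud v. \<exists>x\<in>\<phi> ` cloud u. d x y < \<epsilon>)"
    using *(2) by (subst (asm) hausdorff_dist_less_iff) auto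
  then show ?thesis using *(1) by (auto simp: cloud_def)
qed

lemma ambientD:
  assumes "ambient u v S d \<phi> \<psi>"
  shows "d (\<phi> (u $ i)) (\<phi> (u $ i')) = dist (u $ i) (u $ i')" "d (\<psi> (v $ j)) (\<psi> (v $ j')) = dist (v $ j) (v $ j')"
    "\<phi> (u $ i) \<in> S" "\<psi> (v $ j) \<in> S" "Metric_space S d"
  using assms by (auto simp: ambient_def isometric_embedding_def cloud_def)

lemma gromov_hausdorff_less_iff:
  fixes u v :: "('l::finite, 'm::finite) config"
  shows "gromov_hausdorff_dist (cloud u) (cloud v) < \<epsilon> \<longleftrightarrow> (\<exists>R. correspondence u v \<epsilon> R)"
proof
  assume "gromov_hausdorff_dist (cloud u) (cloud v) < \<epsilon>"
  then obtain S d \<phi> \<psi> where amb: "ambient u v (S :: (real^'l + real^'l) set) d \<phi> \<psi>"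
    and ex: "\<And>i. \<exists>j. d (\<phi> (u $ i)) (\<psi> (v $ j)) < \<epsilon>" "\<And>j. \<exists>i. d (\<phi> (u $ i)) (\<psi> (v $ j)) < \<epsilon>"
    using gromov_hausdorff_ambient by blast
  interpret Metric_space S d by (rule ambientD(5)[OF amb])
  have "correspondence u v \<epsilon> {(i, j). d (\<phi> (u $ i)) (\<psi> (v $ j)) < \<epsilon>}"
    unfolding correspondence_def
  proof (intro conjI ballI; (clarify)?)
    show "\<exists>j. (i, j) \<in> {(i, j). d (\<phi> (u $ i)) (\<psi> (v $ j)) < \<epsilon>}" for i using ex by simp
    show "\<exists>i. (i, j) \<in> {(i, j). d (\<phi> (u $ i)) (\<psi> (v $ j)) < \<epsilon>}" for j using ex by simp
    fix i j i' j'
    assume c: "d (\<phi> (u $ i)) (\<psi> (v $ j)) < \<epsilon>" "d (\<phi> (u $ i')) (\<psi> (v $ j')) < \<epsilon>"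
    have P: "\<phi> (u $ i) \<in> S" and Q: "\<psi> (v $ i) \<in> S" for i using ambientD(3,4)[OF amb] by auto
    have "d (\<phi> (u $ i)) (\<phi> (u $ i')) \<le> d (\<phi> (u $ i)) (\<psi> (v $ j)) + (d (\<psi> (v $ j)) (\<psi> (v $ j')) + d (\<psi> (v $ j')) (\<phi> (u $ i')))"
      using triangle[OF P[of i] Q[of j] P[of i']] triangle[OF Q[of j] Q[of j'] P[of i']] by linarith
    moreover have "d (\<psi> (v $ j)) (\<psi> (v $ j')) \<le> d (\<psi> (v $ j)) (\<phi> (u $ i)) + (d (\<phi> (u $ i)) (\<phi> (u $ i')) + d (\<phi> (u $ i')) (\<psi> (v $ j')))"
      using triangle[OF Q[of j] P[of i] Q[of j']] triangle[OF P[of i] P[of i'] Q[of j']] by linarith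
    ultimately show "\<bar>dist (u $ i) (u $ i') - dist (v $ j) (v $ j')\<bar> < 2 * \<epsilon>"
      using c commute[of "\<psi> (v $ j')" "\<phi> (u $ i')"] commute[of "\<psi> (v $ j)" "\<phi> (u $ i)"]
      unfolding ambientD(1,2)[OF amb] by linarith
  qed
  then show "\<exists>R. correspondence u v \<epsilon> R" by blast
next
  assume "\<exists>R. correspondence u v \<epsilon> R"
  then obtain R where c: "correspondence u v \<epsilon> R" by blast
  have R: "\<And>i. \<exists>j. (i, j) \<in> R" "\<And>j. \<exists>i. (i, j) \<in> R"
    using c by (auto simp: correspondence_def)
  have dis: "\<bar>dist (u $ i) (u $ i') - dist (v $ j) (v $ j')\<bar> < 2 * \<epsilon>" if "(i, j) \<in> R" "(i', j') \<in> R" for i j i' j'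
  proof -
    have "\<forall>p\<in>R. \<forall>q\<in>R. \<bar>dist (u $ fst p) (u $ fst q) - dist (v $ snd p) (v $ snd q)\<bar> < 2 * \<epsilon>"
      using c by (simp add: correspondence_def case_prod_beta)
    from this[rule_format, OF that] show ?thesis by simp
  qed
  \<comment> \<open>The distortion is a maximum over a finite set, so it stays strictly below
    \<open>2 * \<epsilon>\<close> and leaves room for a positive bridge length
    \<open>a < \<epsilon>\<close> with distortion at most \<open>2 * a\<close>.\<close>
  define D where "D = Max ((\<lambda>((i, j), (i', j')). \<bar>dist (u $ i) (u $ i') - dist (v $ j) (v $ j')\<bar>) ` (R \<times> R))"
  have ne: "R \<times> R \<noteq> {}" using R(1) by fastforce
  have D_ge: "\<bar>dist (u $ i) (u $ i') - dist (v $ j) (v $ j')\<bar> \<le> D" if "(i, j) \<in> R" "(i', j') \<in> R" for i j i' j'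
    unfolding D_def using that by (intro Max_ge) (auto intro: rev_image_eqI[of "((i, j), (i', j'))"])
  have "D < 2 * \<epsilon>" unfolding D_def using ne dis by (subst Max_less_iff) auto
  moreover obtain i j where "(i, j) \<in> R" using R(1) by blast
  then have "0 \<le> D" using D_ge[of i j i j] by simp
  ultimately obtain a where a: "D / 2 < a" "a < \<epsilon>" "0 < a"
    using dense[of "D / 2" \<epsilon>] by force
  obtain d where d: "ambient u v UNIV d (Inl :: _ \<Rightarrow> real^'l + real^'l) Inr"
      "\<And>i j. (i, j) \<in> R \<Longrightarrow> d (Inl (u $ i)) (Inr (v $ j)) \<le> a"
  proof -
    have "\<exists>d. ambient u v UNIV d (Inl :: _ \<Rightarrow> real^'l + real^'l) Inr \<and> (\<forall>i j. (i, j) \<in> R \<longrightarrow> d (Inl (u $ i)) (Inr (v $ j)) \<le> a)"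
    proof (rule gluing_metric[OF a(3) R])
      fix i j i' j' assume "(i, j) \<in> R" "(i', j') \<in> R"
      from D_ge[OF this] show "\<bar>dist (u $ i) (u $ i') - dist (v $ j) (v $ j')\<bar> \<le> 2 * a" using a(1) by simp
    qed
    then show thesis using that by blast
  qed
  let ?H = "{hausdorff_dist d (\<phi> ` cloud u) (\<psi> ` cloud v) |(S :: (real^'l + real^'l) set) d \<phi> \<psi>. ambient u v S d \<phi> \<psi>}"
  have "bdd_below ?H"
  proof (rule bdd_belowI[of _ 0])
    fix h assume "h \<in> ?H"
    then obtain S d \<phi> \<psi> where *: "ambient u v (S :: (real^'l + real^'l) set) d \<phi> \<psi>"
      "h = hausdorff_dist d (\<phi> ` cloud u) (\<psi> ` cloud v)" by blast
    interpret Metric_space S d by (rule ambientD(5)[OF *(1)])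
    show "0 \<le> h" unfolding *(2) by (intro hausdorff_dist_nonneg) auto
  qed
  then have "Inf ?H \<le> hausdorff_dist d (Inl ` cloud u) (Inr ` cloud v)"
    using d(1) by (intro cInf_lower) blast+
  also have "\<dots> < \<epsilon>"
  proof (subst hausdorff_dist_less_iff, simp_all, intro conjI ballI)
    fix x assume "x \<in> cloud u"
    then obtain i where "x = u $ i" by (auto simp: cloud_def)
    moreover obtain j where "(i, j) \<in> R" using R by blast
    ultimately show "\<exists>y\<in>cloud v. d (Inl x) (Inr y) < \<epsilon>"
      using d(2)[of i j] a(2) by (intro bexI[of _ "v $ j"]) (auto simp: cloud_def)
  next
    fix y assume "y \<in> cloud v"
    then obtain j where "y = v $ j" by (auto simp: cloud_def)
    moreover obtain i where "(i, j) \<in> R" using R by blast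
    ultimately show "\<exists>x\<in>cloud u. d (Inl x) (Inr y) < \<epsilon>"
      using d(2)[of i j] a(2) by (intro bexI[of _ "u $ i"]) (auto simp: cloud_def)
  qed
  finally show "gromov_hausdorff_dist (cloud u) (cloud v) < \<epsilon>" by (simp only: gromov_hausdorff_dist_eq)
qed

text \<open>A union over relations \<open>R\<close>. For fixed \<open>R\<close> totality does not
  involve \<open>v\<close>, and the distortion bounds are finitely many strict inequalities between
  continuous functions.\<close>

lemma open_gromov_hausdorff_ball:
  fixes u :: "('l::finite, 'm::finite) config"
  shows "open {v :: ('l, 'm) config. gromov_hausdorff_dist (cloud u) (cloud v) < \<epsilon>}"
proof -
  have eq: "{v :: ('l, 'm) config. gromov_hausdorff_dist (cloud u) (cloud v) < \<epsilon>} = (\<Union>R. {v. correspondence u v \<epsilon> R})"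
    by (auto simp: gromov_hausdorff_less_iff)
  show ?thesis unfolding eq
  proof (intro open_UN ballI)
    fix R :: "('m \<times> 'm) set"
    show "open {v. correspondence u v \<epsilon> R}"
    proof (cases "(\<forall>i. \<exists>j. (i, j) \<in> R) \<and> (\<forall>j. \<exists>i. (i, j) \<in> R)")
      case True
      then have "{v. correspondence u v \<epsilon> R} = (\<Inter>p\<in>R. \<Inter>q\<in>R.
          {v. \<bar>dist (u $ fst p) (u $ fst q) - dist (v $ snd p) (v $ snd q)\<bar> < 2 * \<epsilon>})"
        by (simp add: correspondence_def case_prod_beta Collect_ball_eq)
      also have "open \<dots>"
        by (intro open_INT finite ballI open_Collect_less continuous_intros)
      finally show ?thesis .
    next
      case False
      then have "{v. correspondence u v \<epsilon> R} = {}" unfolding correspondence_def by blast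
      then show ?thesis by simp
    qed
  qed
qed

section \<open>Stability of the Vietoris-Rips filtration\<close>

lemma ball_Int_ball_nonempty_iff:
  fixes x y :: "'a::euclidean_space"
  shows "ball x r \<inter> ball y r \<noteq> {} \<longleftrightarrow> dist x y < 2 * r"
proof
  assume "ball x r \<inter> ball y r \<noteq> {}"
  then obtain z where "dist x z < r" "dist y z < r" by auto
  then show "dist x y < 2 * r" using dist_triangle2[of x y z] by linarith
next
  assume "dist x y < 2 * r"
  then have "midpoint x y \<in> ball x r \<inter> ball y r"
    by (simp add: dist_midpoint)
  then show "ball x r \<inter> ball y r \<noteq> {}" by blast
qed

lemma in_VR_iff: "\<sigma> \<in> VR u t \<longleftrightarrow> \<sigma> \<noteq> {} \<and> (\<forall>i\<in>\<sigma>. \<forall>j\<in>\<sigma>. dist (u $ i) (u $ j) < 2 * t)"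
  by (simp add: VR_def ball_Int_ball_nonempty_iff)

lemma VR_birth_eq: "VR_birth u \<sigma> = Max ((\<lambda>(i, j). dist (u $ i) (u $ j)) ` (\<sigma> \<times> \<sigma>)) / 2"
proof -
  have "{dist (u $ i) (u $ j) |i j. i \<in> \<sigma> \<and> j \<in> \<sigma>} = (\<lambda>(i, j). dist (u $ i) (u $ j)) ` (\<sigma> \<times> \<sigma>)"
    by auto
  then show ?thesis by (simp add: VR_birth_def)
qed

lemma VR_birth_less_iff:
  "\<sigma> \<noteq> {} \<Longrightarrow> VR_birth u \<sigma> < t \<longleftrightarrow> (\<forall>i\<in>\<sigma>. \<forall>j\<in>\<sigma>. dist (u $ i) (u $ j) < 2 * t)"
  by (simp add: VR_birth_eq divide_less_eq mult.commute)

lemma VR_sublevel: "VR u t = {\<sigma> \<in> {\<sigma>. \<sigma> \<noteq> {}}. VR_birth u \<sigma> < t}"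
  by (rule set_eqI) (simp add: in_VR_iff VR_birth_less_iff cong: conj_cong)

lemma VR_birth_ge: "i \<in> \<sigma> \<Longrightarrow> j \<in> \<sigma> \<Longrightarrow> dist (u $ i) (u $ j) / 2 \<le> VR_birth u \<sigma>"
  unfolding VR_birth_eq by (intro divide_right_mono Max_ge) auto

lemma VR_birth_attained:
  assumes "\<sigma> \<noteq> {}"
  shows "\<exists>i\<in>\<sigma>. \<exists>j\<in>\<sigma>. VR_birth u \<sigma> = dist (u $ i) (u $ j) / 2"
proof -
  have "Max ((\<lambda>(i, j). dist (u $ i) (u $ j)) ` (\<sigma> \<times> \<sigma>)) \<in> (\<lambda>(i, j). dist (u $ i) (u $ j)) ` (\<sigma> \<times> \<sigma>)"
    using assms by (intro Max_in) auto
  then show ?thesis by (auto simp: VR_birth_eq)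
qed

lemma VR_birth_nonneg: "\<sigma> \<noteq> {} \<Longrightarrow> 0 \<le> VR_birth u \<sigma>"
  using VR_birth_attained[of \<sigma> u] zero_le_dist by (metis divide_nonneg_pos zero_less_numeral)

lemma VR_birth_mono: "\<tau> \<noteq> {} \<Longrightarrow> \<tau> \<subseteq> \<sigma> \<Longrightarrow> VR_birth u \<tau> \<le> VR_birth u \<sigma>"
  using VR_birth_attained[of \<tau> u] VR_birth_ge[of _ \<sigma> _ u] by (metis subsetD)

text \<open>Finitely many strict bounds leave a common shift \<open>a\<close> strictly below
  \<open>\<epsilon>\<close>, as \<open>stable_bar_counts\<close> requires.\<close>

lemma nearest_point_map:
  fixes D :: "'m::finite \<Rightarrow> 'm \<Rightarrow> real"
  assumes "\<And>i. \<exists>j. D i j < \<epsilon>" "\<And>j. \<exists>i. D i j < \<epsilon>" "\<And>i j. 0 \<le> D i j"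
  shows "\<exists>a f g. 0 \<le> a \<and> a < \<epsilon> \<and> (\<forall>i. D i (f i) \<le> a) \<and> (\<forall>j. D (g j) j \<le> a)"
proof -
  obtain f where f: "\<And>i. D i (f i) < \<epsilon>" using assms(1) by metis
  obtain g where g: "\<And>j. D (g j) j < \<epsilon>" using assms(2) by metis
  define A where "A = range (\<lambda>i. D i (f i)) \<union> range (\<lambda>j. D (g j) j)"
  have A: "finite A" "A \<noteq> {}" by (auto simp: A_def)
  have "Max A < \<epsilon>" using A f g by (auto simp: A_def)
  moreover have "D i (f i) \<le> Max A" "D (g j) j \<le> Max A" for i j
    using A by (auto simp: A_def intro!: Max_ge)
  moreover have "0 \<le> Max A" using calculation(2) assms(3) order_trans by blast
  ultimately show ?thesis by blast
qed

lemma Collect_left_simplices: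
  assumes "\<And>\<tau>. Inl ` \<tau> \<in> J \<longleftrightarrow> \<tau> \<in> X"
  shows "{\<sigma> \<in> J. \<sigma> \<inter> range Inr = {}} = (`) Inl ` X"
proof (intro set_eqI iffI)
  fix \<sigma> assume \<sigma>: "\<sigma> \<in> {\<sigma> \<in> J. \<sigma> \<inter> range Inr = {}}"
  have "x \<in> Inl ` (Inl -` \<sigma>) \<longleftrightarrow> x \<in> \<sigma>" for x using \<sigma> by (cases x) auto
  then have eq: "\<sigma> = Inl ` (Inl -` \<sigma>)" by blast
  then have "Inl -` \<sigma> \<in> X" using \<sigma> assms[of "Inl -` \<sigma>"] by simp
  with eq show "\<sigma> \<in> (`) Inl ` X" by (rule image_eqI)
qed (use assms in auto)

lemma Collect_right_simplices:
  assumes "\<And>\<tau>. Inr ` \<tau> \<in> J \<longleftrightarrow> \<tau> \<in> X"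
  shows "{\<sigma> \<in> J. \<sigma> \<inter> range Inl = {}} = (`) Inr ` X"
proof (intro set_eqI iffI)
  fix \<sigma> assume \<sigma>: "\<sigma> \<in> {\<sigma> \<in> J. \<sigma> \<inter> range Inl = {}}"
  have "x \<in> Inr ` (Inr -` \<sigma>) \<longleftrightarrow> x \<in> \<sigma>" for x using \<sigma> by (cases x) auto
  then have eq: "\<sigma> = Inr ` (Inr -` \<sigma>)" by blast
  then have "Inr -` \<sigma> \<in> X" using \<sigma> assms[of "Inr -` \<sigma>"] by simp
  with eq show "\<sigma> \<in> (`) Inr ` X" by (rule image_eqI)
qed (use assms in auto)

text \<open>Both clouds are placed in one metric space, and \<open>J p q\<close> is the Rips complex
  of their union with radius \<open>p\<close> at the points of \<open>u\<close> and \<open>q\<close>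
  at those of \<open>v\<close>. A partner at distance at most \<open>a\<close>, with a radius larger
  by \<open>a\<close>, reaches by the triangle inequality everything the point itself reaches; this
  is the domination.\<close>

lemma VR_long_bars:
  fixes u v :: "('l::finite, 'm::{finite, linorder}) config"
    and e g :: "nat \<Rightarrow> real \<Rightarrow> 'm set \<Rightarrow> 'k::field"
  assumes gh: "gromov_hausdorff_dist (cloud u) (cloud v) < \<epsilon>"
    and ps: "interval_decomposition l (VR u) ps e" and qs: "interval_decomposition l (VR v) qs g"
  shows "\<exists>a. 0 \<le> a \<and> a < \<epsilon> \<and> (\<forall>h\<ge>0. card (long_bars (2 * a + h) ps) \<le> card (long_bars h qs) \<and>
    card (long_bars (2 * a + h) qs) \<le> card (long_bars h ps))"
proof -
  obtain S d \<phi> \<psi> where amb: "ambient u v (S :: (real^'l + real^'l) set) d \<phi> \<psi>"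
    and ex: "\<And>i. \<exists>j. d (\<phi> (u $ i)) (\<psi> (v $ j)) < \<epsilon>" "\<And>j. \<exists>i. d (\<phi> (u $ i)) (\<psi> (v $ j)) < \<epsilon>"
    using gromov_hausdorff_ambient[OF gh] by blast
  interpret Metric_space S d by (rule ambientD(5)[OF amb])
  obtain a f f' where a: "0 \<le> a" "a < \<epsilon>" and f: "\<And>i. d (\<phi> (u $ i)) (\<psi> (v $ (f i))) \<le> a"
    and f': "\<And>j. d (\<phi> (u $ (f' j))) (\<psi> (v $ j)) \<le> a"
    using nearest_point_map[OF ex nonneg] by blast
  define pt where "pt = case_sum (\<lambda>i. \<phi> (u $ i)) (\<lambda>j. \<psi> (v $ j))"
  define w :: "real \<Rightarrow> real \<Rightarrow> 'm + 'm \<Rightarrow> real" where "w p q = case_sum (\<lambda>_. p) (\<lambda>_. q)" for p q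
  define J where "J p q = {\<sigma>. \<sigma> \<noteq> {} \<and> (\<forall>x\<in>\<sigma>. \<forall>y\<in>\<sigma>. d (pt x) (pt y) < w p q x + w p q y)}" for p q
  have ptS: "pt x \<in> S" for x using ambientD(3,4)[OF amb] by (auto simp: pt_def split: sum.split)
  have J_insert: "insert x0 \<sigma> \<in> J p q"
    if "\<sigma> \<in> J p q" "x \<in> \<sigma>" "d (pt x0) (pt x) \<le> a" "w p q x0 = w p q x + a" "0 < w p q x0" for \<sigma> p q x x0
  proof -
    have "d (pt x0) (pt y) < w p q x0 + w p q y" if y: "y \<in> \<sigma>" for y
    proof -
      have "d (pt x) (pt y) < w p q x + w p q y" using that y \<open>\<sigma> \<in> J p q\<close> \<open>x \<in> \<sigma>\<close> by (auto simp: J_def)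
      then show ?thesis using triangle[OF ptS[of x0] ptS[of x] ptS[of y]] \<open>d (pt x0) (pt x) \<le> a\<close> \<open>w p q x0 = w p q x + a\<close>
        by linarith
    qed
    moreover have "d (pt x0) (pt x0) = 0" using ptS by simp
    ultimately show ?thesis using \<open>\<sigma> \<in> J p q\<close> \<open>0 < w p q x0\<close> commute by (auto simp: J_def add.commute)
  qed
  have J_Inl: "{\<sigma> \<in> J p q. \<sigma> \<inter> range Inr = {}} = (`) Inl ` VR u p" for p q
    by (rule Collect_left_simplices) (simp add: J_def in_VR_iff pt_def w_def ambientD(1)[OF amb])
  have J_Inr: "{\<sigma> \<in> J p q. \<sigma> \<inter> range Inl = {}} = (`) Inr ` VR v q" for p q
    by (rule Collect_right_simplices) (simp add: J_def in_VR_iff pt_def w_def ambientD(2)[OF amb])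
  have closed: "face_closed (J p q)" for p q by (auto simp: face_closed_def J_def)
  have w_mono: "w p q x \<le> w p' q' x" if "p \<le> p'" "q \<le> q'" for p q p' q' x
    using that by (cases x) (auto simp: w_def)
  have mono: "J p q \<subseteq> J p' q'" if "p \<le> p'" "q \<le> q'" for p q p' q'
  proof
    fix \<sigma> assume "\<sigma> \<in> J p q"
    moreover have "w p q x + w p q y \<le> w p' q' x + w p' q' y" for x y
      using w_mono[OF that] by (simp add: add_mono)
    ultimately show "\<sigma> \<in> J p' q'" unfolding J_def by (blast intro: order.strict_trans2)
  qed
  have fJ: "insert (Inr (f i)) \<sigma> \<in> J p (p + a)" if "0 < p" "\<sigma> \<in> J p (p + a)" "Inl i \<in> \<sigma>" for p \<sigma> i
    using that a f[of i] commute[of "\<psi> (v $ f i)" "\<phi> (u $ i)"]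
    by (intro J_insert[OF that(2,3)]) (auto simp: w_def pt_def)
  have fJ': "insert (Inl (f' i)) \<sigma> \<in> J (p + a) p" if "0 < p" "\<sigma> \<in> J (p + a) p" "Inr i \<in> \<sigma>" for p \<sigma> i
    using that a f'[of i] by (intro J_insert[OF that(2,3)]) (auto simp: w_def pt_def)
  have "card (long_bars (2 * a + h) ps) \<le> card (long_bars h qs) \<and>
    card (long_bars (2 * a + h) qs) \<le> card (long_bars h ps)" if "0 \<le> h" for h
    using long_bars_le_of_joint_filtration[OF ps qs a(1) that closed mono J_Inl J_Inr fJ fJ'] by simp
  then show ?thesis using a by blast
qed

section \<open>Selective Delaunay complexes\<close>

text \<open>With \<open>R\<close> as squared radius, \<open>(dist p c)\<^sup>2 - R\<close> is the
  power of \<open>p\<close> with respect to a sphere. Powers interpolate linearly along the pencil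
  of two spheres. For \<open>\<theta>\<close> between 0 and 1 the quadratic correction keeps the
  squared radius at or below the convex combination.\<close>

lemma pencil_identity:
  fixes p c c' :: "'a::real_inner"
  shows "(dist p ((1 - \<theta>) *\<^sub>R c' + \<theta> *\<^sub>R c))\<^sup>2 - ((1 - \<theta>) * R' + \<theta> * R - \<theta> * (1 - \<theta>) * (dist c c')\<^sup>2)
    = (1 - \<theta>) * ((dist p c')\<^sup>2 - R') + \<theta> * ((dist p c)\<^sup>2 - R)"
  unfolding dist_norm power2_norm_eq_inner
  by (simp add: inner_diff_left inner_diff_right inner_add_left inner_add_right inner_commute)
    (simp add: algebra_simps power2_eq_square)

text \<open>The simplices with a sphere of radius less than \<open>t\<close> enclosing their vertices and no point of
  \<open>E\<close> in its interior; \<open>E = {}\<close> is the Cech complex and \<open>E = UNIV\<close> the alpha complex.\<close>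

definition selective :: "('l::finite, 'm::finite) config \<Rightarrow> 'm set \<Rightarrow> real \<Rightarrow> 'm set set" where
  "selective u E t = {Q. Q \<noteq> {} \<and> (\<exists>c R. R < t\<^sup>2 \<and> (\<forall>q\<in>Q. (dist (u $ q) c)\<^sup>2 \<le> R) \<and>
     (\<forall>e\<in>E. R \<le> (dist (u $ e) c)\<^sup>2))}"

lemma selectiveI:
  "Q \<noteq> {} \<Longrightarrow> R < t\<^sup>2 \<Longrightarrow> (\<And>q. q \<in> Q \<Longrightarrow> (dist (u $ q) c)\<^sup>2 \<le> R) \<Longrightarrow>
    (\<And>e. e \<in> E \<Longrightarrow> R \<le> (dist (u $ e) c)\<^sup>2) \<Longrightarrow> Q \<in> selective u E t"
  unfolding selective_def by blast

lemma selective_face_closed: "face_closed (selective u E t)"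
  unfolding face_closed_def selective_def by blast

lemma selective_antimono: "E \<subseteq> F \<Longrightarrow> selective u F t \<subseteq> selective u E t"
  unfolding selective_def by blast

text \<open>The simplices lost when \<open>x\<close> is added to \<open>E\<close> are exactly those for which \<open>x\<close> can be forced into
  the open ball; inserting or deleting \<open>x\<close> does not affect this, by moving along the pencil of two spheres
  until \<open>x\<close> lies on the sphere.\<close>

lemma homology_iso_selective_insert:
  fixes u :: "('l::finite, 'm::{finite, linorder}) config"
  assumes t: "0 < t"
  shows "homology_iso k (selective u (insert x E) t) (selective u E t)"
proof (rule homology_iso_toggle[where x = x])
  show "selective u (insert x E) t \<subseteq> selective u E t" by (rule selective_antimono) auto
  fix Q assume Q: "Q \<in> selective u E t - selective u (insert x E) t"
  then obtain c R where c: "R < t\<^sup>2" "\<And>q. q \<in> Q \<Longrightarrow> (dist (u $ q) c)\<^sup>2 \<le> R" "\<And>e. e \<in> E \<Longrightarrow> R \<le> (dist (u $ e) c)\<^sup>2"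
    and Q_ne: "Q \<noteq> {}"
    by (auto simp: selective_def)
  \<comment> \<open>Otherwise the same sphere would also serve for
    \<open>insert x E\<close>.\<close>
  have x_in: "(dist (u $ x) c)\<^sup>2 < R"
  proof (rule ccontr)
    assume "\<not> (dist (u $ x) c)\<^sup>2 < R"
    then have "Q \<in> selective u (insert x E) t" using c by (intro selectiveI[OF Q_ne c(1,2)]) auto
    then show False using Q by blast
  qed
  have "insert x Q \<in> selective u E t" 
    using c(2) x_in by (intro selectiveI[OF _ c(1) _ c(3)]) auto
  moreover have "insert x Q \<notin> selective u (insert x E) t"
  proof
    assume "insert x Q \<in> selective u (insert x E) t"
    then have "Q \<in> selective u (insert x E) t"
      using face_closedD[OF selective_face_closed _ subset_insertI Q_ne] by blast
    then show False using Q by blast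
  qed
  ultimately show "insert x Q \<in> selective u E t - selective u (insert x E) t" by blast
  show "Q - {x} \<in> selective u E t - selective u (insert x E) t"
  proof (cases "x \<in> Q")
    case False
    then show ?thesis using Q by simp
  next
    case True
    have ne: "Q - {x} \<noteq> {}"
    proof
      assume "Q - {x} = {}"
      then have "Q = {x}" using True by blast
      moreover have "{x} \<in> selective u (insert x E) t"
        using t by (intro selectiveI[where c = "u $ x" and R = 0]) auto
      ultimately show False using Q by blast
    qed
    have "Q - {x} \<notin> selective u (insert x E) t"
    proof
      assume "Q - {x} \<in> selective u (insert x E) t"
      then obtain c' R' where c': "R' < t\<^sup>2" "\<And>q. q \<in> Q - {x} \<Longrightarrow> (dist (u $ q) c')\<^sup>2 \<le> R'"
        "\<And>e. e \<in> insert x E \<Longrightarrow> R' \<le> (dist (u $ e) c')\<^sup>2"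
        unfolding selective_def by auto
      define \<alpha> where "\<alpha> = (dist (u $ x) c')\<^sup>2 - R'"
      define \<beta> where "\<beta> = (dist (u $ x) c)\<^sup>2 - R"
      have ab: "0 \<le> \<alpha>" "\<beta> < 0" using c'(3)[of x] x_in by (auto simp: \<alpha>_def \<beta>_def)
      \<comment> \<open>The parameter of the pencil at which the power of \<open>x\<close>,
        nonnegative for \<open>c'\<close> and negative for \<open>c\<close>, vanishes. Both spheres
        enclose \<open>Q - {x}\<close> and have \<open>E\<close> outside or on them, so the
        interpolated one does too.\<close>
      define \<theta> where "\<theta> = \<alpha> / (\<alpha> - \<beta>)"
      have \<theta>: "0 \<le> \<theta>" "\<theta> \<le> 1" and zero: "(1 - \<theta>) * \<alpha> + \<theta> * \<beta> = 0"
        using ab by (auto simp: \<theta>_def field_simps)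
      define c'' where "c'' = (1 - \<theta>) *\<^sub>R c' + \<theta> *\<^sub>R c"
      define R'' where "R'' = (1 - \<theta>) * R' + \<theta> * R - \<theta> * (1 - \<theta>) * (dist c c')\<^sup>2"
      have pen: "(dist p c'')\<^sup>2 - R'' = (1 - \<theta>) * ((dist p c')\<^sup>2 - R') + \<theta> * ((dist p c)\<^sup>2 - R)" for p
        unfolding c''_def R''_def by (rule pencil_identity)
      have "R'' \<le> (1 - \<theta>) * R' + \<theta> * R" using \<theta> by (simp add: R''_def)
      also have "\<dots> < t\<^sup>2"
        using convex_bound_lt[OF c'(1) c(1), of "1 - \<theta>" \<theta>] \<theta> by simp
      finally have "R'' < t\<^sup>2" .
      moreover have x_on: "(dist (u $ x) c'')\<^sup>2 = R''" using pen[of "u $ x"] zero by (simp add: \<alpha>_def \<beta>_def)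
      moreover have "(dist (u $ q) c'')\<^sup>2 \<le> R''" if "q \<in> Q" for q
      proof (cases "q = x")
        case False
        have "(1 - \<theta>) * ((dist (u $ q) c')\<^sup>2 - R') \<le> 0" "\<theta> * ((dist (u $ q) c)\<^sup>2 - R) \<le> 0"
          using c(2)[OF that] c'(2)[of q] that False \<theta> by (auto intro!: mult_nonneg_nonpos)
        then show ?thesis using pen[of "u $ q"] by linarith
      qed (use x_on in simp)
      moreover have "R'' \<le> (dist (u $ e) c'')\<^sup>2" if "e \<in> insert x E" for e
      proof (cases "e = x")
        case False
        have "0 \<le> (1 - \<theta>) * ((dist (u $ e) c')\<^sup>2 - R')" "0 \<le> \<theta> * ((dist (u $ e) c)\<^sup>2 - R)"
          using c(3)[of e] c'(3)[of e] that False \<theta> by auto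
        then show ?thesis using pen[of "u $ e"] by linarith
      qed (use x_on in simp)
      ultimately have "Q \<in> selective u (insert x E) t" by (intro selectiveI[OF Q_ne])
      then show False using Q by blast
    qed
    moreover have "Q - {x} \<in> selective u E t"
      by (rule face_closedD[OF selective_face_closed, of Q]) (use Q ne in auto)
    ultimately show ?thesis by blast
  qed
qed (rule selective_face_closed)+

lemma homology_iso_selective:
  fixes u :: "('l::finite, 'm::{finite, linorder}) config"
  assumes "0 < t"
  shows "homology_iso k (selective u E t) (selective u {} t)"
  using finite[of E]
proof (induction E rule: finite_induct)
  case empty
  show ?case by (rule homology_iso_refl)
next
  case (insert x E)
  then show ?case using homology_iso_trans[OF homology_iso_selective_insert[OF assms]] by blast
qed

lemma selective_empty:
  assumes "0 < t"
  shows "selective u {} t = {Q. Q \<noteq> {} \<and> (\<exists>c. \<forall>q\<in>Q. dist (u $ q) c < t)}"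
proof -
  have "(\<exists>R<t\<^sup>2. \<forall>q\<in>Q. (dist (u $ q) c)\<^sup>2 \<le> R) \<longleftrightarrow> (\<forall>q\<in>Q. dist (u $ q) c < t)" if "Q \<noteq> {}" for Q c
  proof
    assume "\<exists>R<t\<^sup>2. \<forall>q\<in>Q. (dist (u $ q) c)\<^sup>2 \<le> R"
    then have "(dist (u $ q) c)\<^sup>2 < t\<^sup>2" if "q \<in> Q" for q using that by force
    then show "\<forall>q\<in>Q. dist (u $ q) c < t" using assms power2_less_imp_less by (metis less_imp_le)
  next
    assume *: "\<forall>q\<in>Q. dist (u $ q) c < t"
    let ?A = "(\<lambda>q. (dist (u $ q) c)\<^sup>2) ` Q"
    have "Max ?A < t\<^sup>2" using * that by (auto intro!: power_strict_mono)
    then show "\<exists>R<t\<^sup>2. \<forall>q\<in>Q. (dist (u $ q) c)\<^sup>2 \<le> R" by (intro exI[of _ "Max ?A"]) auto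
  qed
  then show ?thesis unfolding selective_def by (simp cong: conj_cong)
qed

text \<open>The same generators serve in \<open>Y\<close>: at each parameter the inclusion carries a
  basis of homology to a basis, and it commutes with the transition maps, which are inclusions as
  well.\<close>

lemma interval_decomposition_homology_iso:
  fixes e :: "nat \<Rightarrow> real \<Rightarrow> 'm::{finite, linorder} set \<Rightarrow> 'k::field"
  assumes ps: "interval_decomposition l X ps e"
    and iso: "\<And>t. 0 < t \<Longrightarrow> homology_iso TYPE('k) (X t) (Y t)"
  shows "interval_decomposition l Y ps e"
  unfolding interval_decomposition_def
proof (intro conjI ballI allI impI)
  fix p assume "p \<in> set ps"
  then show "0 \<le> fst p" "fst p < snd p" using interval_bounds[OF ps] by auto
next
  fix t :: real and j assume t: "0 < t" "j \<in> active ps t"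
  then show "e j t \<in> cycles (Y t) l"
    using generator_cycle[OF ps t] iso[OF t(1)] cycles_mono unfolding homology_iso_def by blast
next
  fix t :: real and z :: "'m set \<Rightarrow> 'k" assume t: "0 < t" and z: "z \<in> cycles (Y t) l"
  obtain z' where z': "z' \<in> cycles (X t) l" "homologous (Y t) l z z'"
    using iso[OF t] z unfolding homology_iso_def by blast
  have sub: "X t \<subseteq> Y t" using iso[OF t] by (simp add: homology_iso_def)
  have iff: "homologous (Y t) l z (\<lambda>\<sigma>. \<Sum>j\<in>active ps t. c j * e j t \<sigma>) \<longleftrightarrow>
     homologous (X t) l z' (\<lambda>\<sigma>. \<Sum>j\<in>active ps t. c j * e j t \<sigma>)" for c
  proof
    assume "homologous (Y t) l z (\<lambda>\<sigma>. \<Sum>j\<in>active ps t. c j * e j t \<sigma>)"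
    then have "homologous (Y t) l z' (\<lambda>\<sigma>. \<Sum>j\<in>active ps t. c j * e j t \<sigma>)"
      by (rule homologous_trans[OF homologous_sym[OF z'(2)]])
    then show "homologous (X t) l z' (\<lambda>\<sigma>. \<Sum>j\<in>active ps t. c j * e j t \<sigma>)"
      by (rule homology_isoD_homologous[OF iso[OF t] z'(1) lincomb_cycle[OF ps t]])
  next
    assume "homologous (X t) l z' (\<lambda>\<sigma>. \<Sum>j\<in>active ps t. c j * e j t \<sigma>)"
    from homologous_mono[OF this sub]
    show "homologous (Y t) l z (\<lambda>\<sigma>. \<Sum>j\<in>active ps t. c j * e j t \<sigma>)"
      by (rule homologous_trans[OF z'(2)])
  qed
  show "\<exists>!c. (\<forall>j. j \<notin> active ps t \<longrightarrow> c j = 0) \<and> homologous (Y t) l z (\<lambda>\<sigma>. \<Sum>j\<in>active ps t. c j * e j t \<sigma>)"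
    unfolding iff using ps t z'(1) unfolding interval_decomposition_def by blast
next
  fix t t' :: real and j assume t: "0 < t" "t \<le> t'" "j \<in> active ps t"
  have "X t' \<subseteq> Y t'" using iso[of t'] t by (simp add: homology_iso_def)
  then show "homologous (Y t') l (e j t) (if j \<in> active ps t' then e j t' else (\<lambda>_. 0))"
    using generator_transition[OF ps t] homologous_mono by blast
qed

text \<open>In \<open>J p q\<close> a simplex needs a common centre within \<open>p\<close> of its
  left and within \<open>q\<close> of its right vertices. A point at distance at most
  \<open>a\<close> from a vertex, with a radius larger by \<open>a\<close>, accepts the same centre,
  which gives the domination.\<close>

lemma Cech_long_bars:
  fixes u v :: "('l::finite, 'm::{finite, linorder}) config"
    and e g :: "nat \<Rightarrow> real \<Rightarrow> 'm set \<Rightarrow> 'k::field"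
  assumes hd: "hausdorff_dist dist (cloud u) (cloud v) < \<epsilon>"
    and ps: "interval_decomposition l (selective u {}) ps e" and qs: "interval_decomposition l (selective v {}) qs g"
  shows "\<exists>a. 0 \<le> a \<and> a < \<epsilon> \<and> (\<forall>h\<ge>0. card (long_bars (2 * a + h) ps) \<le> card (long_bars h qs) \<and>
    card (long_bars (2 * a + h) qs) \<le> card (long_bars h ps))"
proof -
  have "(\<forall>x\<in>cloud u. \<exists>y\<in>cloud v. dist x y < \<epsilon>) \<and> (\<forall>y\<in>cloud v. \<exists>x\<in>cloud u. dist x y < \<epsilon>)"
    using hd by (subst (asm) hausdorff_dist_less_iff) auto
  then have "\<And>i. \<exists>j. dist (u $ i) (v $ j) < \<epsilon>" "\<And>j. \<exists>i. dist (u $ i) (v $ j) < \<epsilon>"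
    by (auto simp: cloud_def)
  from nearest_point_map[OF this zero_le_dist]
  obtain a f f' where a: "0 \<le> a" "a < \<epsilon>" and f: "\<And>i. dist (u $ i) (v $ (f i)) \<le> a"
    and f': "\<And>j. dist (u $ (f' j)) (v $ j) \<le> a"
    by blast
  define pt where "pt = case_sum (\<lambda>i. u $ i) (\<lambda>j. v $ j)"
  define w :: "real \<Rightarrow> real \<Rightarrow> 'm + 'm \<Rightarrow> real" where "w p q = case_sum (\<lambda>_. p) (\<lambda>_. q)" for p q
  define J where "J p q = {\<sigma>. \<sigma> \<noteq> {} \<and> (\<exists>c. \<forall>x\<in>\<sigma>. dist (pt x) c < w p q x)}" for p q
  have J_insert: "insert x0 \<sigma> \<in> J p q"
    if \<sigma>: "\<sigma> \<in> J p q" "x \<in> \<sigma>" and x0: "dist (pt x0) (pt x) \<le> a" "w p q x0 = w p q x + a" for \<sigma> p q x x0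
  proof -
    obtain c where c: "\<And>x. x \<in> \<sigma> \<Longrightarrow> dist (pt x) c < w p q x" using \<sigma> by (auto simp: J_def)
    have "dist (pt x0) c < w p q x0"
      using dist_triangle[of "pt x0" c "pt x"] c[OF \<sigma>(2)] x0 by linarith
    then show ?thesis using c by (auto simp: J_def intro!: exI[of _ c])
  qed
  have J_Inl: "{\<sigma> \<in> J p q. \<sigma> \<inter> range Inr = {}} = (`) Inl ` selective u {} p" if "0 < p" for p q
    by (rule Collect_left_simplices) (simp add: J_def selective_empty[OF that] pt_def w_def)
  have J_Inr: "{\<sigma> \<in> J p q. \<sigma> \<inter> range Inl = {}} = (`) Inr ` selective v {} q" if "0 < q" for p q
    by (rule Collect_right_simplices) (simp add: J_def selective_empty[OF that] pt_def w_def)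
  have closed: "face_closed (J p q)" for p q unfolding face_closed_def J_def by blast
  have w_mono: "w p q x \<le> w p' q' x" if "p \<le> p'" "q \<le> q'" for p q p' q' x
    using that by (cases x) (auto simp: w_def)
  have mono: "J p q \<subseteq> J p' q'" if "p \<le> p'" "q \<le> q'" for p q p' q'
    unfolding J_def by (blast intro: order.strict_trans2 w_mono[OF that])
  have fJ: "insert (Inr (f i)) \<sigma> \<in> J p (p + a)" if "0 < p" "\<sigma> \<in> J p (p + a)" "Inl i \<in> \<sigma>" for p \<sigma> i
    using f[of i] by (intro J_insert[OF that(2,3)]) (auto simp: w_def pt_def dist_commute)
  have fJ': "insert (Inl (f' i)) \<sigma> \<in> J (p + a) p" if "0 < p" "\<sigma> \<in> J (p + a) p" "Inr i \<in> \<sigma>" for p \<sigma> i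
    using f'[of i] by (intro J_insert[OF that(2,3)]) (auto simp: w_def pt_def)
  have "card (long_bars (2 * a + h) ps) \<le> card (long_bars h qs) \<and>
    card (long_bars (2 * a + h) qs) \<le> card (long_bars h ps)" if "0 \<le> h" for h
    using long_bars_le_of_joint_filtration[OF ps qs a(1) that closed mono J_Inl J_Inr fJ fJ'] by simp
  then show ?thesis using a by blast
qed

section \<open>Calculus of smooth functions\<close>

text \<open>Congruence at level \<open>n\<close> is an assumption because \<open>C_on_cong\<close>
  is itself proved by induction with this rule; \<open>C_on_derivI\<close> discharges it
  afterwards.\<close>

lemma C_on_SucI:
  fixes g :: "'a::euclidean_space \<Rightarrow> 'b::real_normed_vector"
  assumes S: "open S" and D: "\<And>x. x \<in> S \<Longrightarrow> (g has_derivative D x) (at x)"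
    and C: "\<And>v. C_on n S (\<lambda>x. D x v)"
    and cong: "\<And>g h :: 'a::euclidean_space \<Rightarrow> 'b::real_normed_vector. (\<And>x. x \<in> S \<Longrightarrow> g x = h x) \<Longrightarrow> C_on n S g \<Longrightarrow> C_on n S h"
  shows "C_on (Suc n) S g"
proof -
  have "frechet_derivative g (at x) = D x" if "x \<in> S" for x
    using frechet_derivative_at[OF D[OF that]] by simp
  then have "C_on n S (\<lambda>x. frechet_derivative g (at x) v)" for v
    using cong[OF _ C[of v]] by simp
  then show ?thesis using D by (auto simp: differentiable_def)
qed

lemma C_on_cong:
  fixes g h :: "'a::euclidean_space \<Rightarrow> 'b::real_normed_vector"
  assumes "open S" "\<And>x. x \<in> S \<Longrightarrow> g x = h x" "C_on n S g"
  shows "C_on n S h"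
  using assms(2,3)
proof (induction n arbitrary: g h)
  case 0
  then show ?case using continuous_on_cong[of S S g h] by simp
next
  case (Suc n)
  have D: "(h has_derivative frechet_derivative g (at x)) (at x)" if x: "x \<in> S" for x
  proof (rule has_derivative_transform_within_open[OF _ assms(1) x])
    show "(g has_derivative frechet_derivative g (at x)) (at x)"
      using Suc.prems(2) x by (simp flip: frechet_derivative_works)
  qed (use Suc.prems(1) in auto)
  show ?case
  proof (rule C_on_SucI[OF assms(1) D])
    show "C_on n S (\<lambda>x. frechet_derivative g (at x) v)" for v using Suc.prems(2) by simp
  qed (use Suc.IH in blast)+
qed

lemmas C_on_derivI = C_on_SucI[OF _ _ _ C_on_cong]

lemma C_on_has_derivative:
  "C_on (Suc n) S g \<Longrightarrow> x \<in> S \<Longrightarrow> (g has_derivative frechet_derivative g (at x)) (at x)"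
  by (simp flip: frechet_derivative_works)

lemma C_on_lower: "C_on (Suc n) S g \<Longrightarrow> C_on n S g"
proof (induction n arbitrary: g)
  case 0
  then show ?case
    by (auto intro!: continuous_at_imp_continuous_on differentiable_imp_continuous_within)
next
  case (Suc n)
  then show ?case by (metis C_on.simps(2))
qed

lemma C_on_local:
  assumes "\<And>x. x \<in> S \<Longrightarrow> \<exists>N. open N \<and> x \<in> N \<and> C_on n N g"
  shows "C_on n S g"
  using assms
proof (induction n arbitrary: g)
  case 0
  have "isCont g x" if "x \<in> S" for x
    using 0[OF that] by (auto simp: continuous_on_eq_continuous_at)
  then show ?case by (simp add: continuous_at_imp_continuous_on)
next
  case (Suc n)
  show ?case
    unfolding C_on.simps
  proof (intro conjI ballI allI)
    fix x assume "x \<in> S"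
    then show "g differentiable at x" using Suc.prems by fastforce
  next
    fix v
    show "C_on n S (\<lambda>x. frechet_derivative g (at x) v)"
    proof (rule Suc.IH)
      fix x assume "x \<in> S"
      then obtain N where "open N" "x \<in> N" "C_on (Suc n) N g" using Suc.prems by blast
      then show "\<exists>N. open N \<and> x \<in> N \<and> C_on n N (\<lambda>x. frechet_derivative g (at x) v)" by auto
    qed
  qed
qed

lemma C_on_subset: "C_on n S g \<Longrightarrow> T \<subseteq> S \<Longrightarrow> C_on n T g"
  by (induction n arbitrary: g) (auto intro: continuous_on_subset)

lemma C_on_const: "C_on n S (\<lambda>_. c)"
  by (induction n arbitrary: c) auto

lemma C_on_linear:
  assumes "open S" "bounded_linear f"
  shows "C_on n S f"
proof (cases n)
  case 0
  then show ?thesis using assms by (simp add: linear_continuous_on)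
next
  case (Suc m)
  show ?thesis unfolding Suc
    by (rule C_on_derivI[OF assms(1) bounded_linear_imp_has_derivative[OF assms(2)] C_on_const assms(1)])
qed

lemma C_on_add:
  assumes "open S"
  shows "C_on n S f \<Longrightarrow> C_on n S g \<Longrightarrow> C_on n S (\<lambda>x. f x + g x)"
proof (induction n arbitrary: f g)
  case 0
  then show ?case by (simp add: continuous_on_add)
next
  case (Suc n)
  show ?case
  proof (rule C_on_derivI[OF assms _ _ assms])
    show "((\<lambda>x. f x + g x) has_derivative
        (\<lambda>v. frechet_derivative f (at x) v + frechet_derivative g (at x) v)) (at x)" if "x \<in> S" for x
      using that Suc.prems by (intro has_derivative_add C_on_has_derivative)
    show "C_on n S (\<lambda>x. frechet_derivative f (at x) v + frechet_derivative g (at x) v)" for v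
      using Suc.prems by (intro Suc.IH) auto
  qed
qed

lemma C_on_bilinear:
  assumes "open S" and B: "bounded_bilinear B"
  shows "C_on n S f \<Longrightarrow> C_on n S g \<Longrightarrow> C_on n S (\<lambda>x. B (f x) (g x))"
proof (induction n arbitrary: f g)
  case 0
  then show ?case using bounded_bilinear.continuous_on[OF B] by simp
next
  case (Suc n)
  show ?case
  proof (rule C_on_derivI[OF assms(1) _ _ assms(1)])
    show "((\<lambda>x. B (f x) (g x)) has_derivative
        (\<lambda>v. B (f x) (frechet_derivative g (at x) v) + B (frechet_derivative f (at x) v) (g x))) (at x)" if "x \<in> S" for x
      using that Suc.prems by (intro bounded_bilinear.FDERIV[OF B] C_on_has_derivative)
    show "C_on n S (\<lambda>x. B (f x) (frechet_derivative g (at x) v) + B (frechet_derivative f (at x) v) (g x))" for v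
      using Suc.prems C_on_lower[OF Suc.prems(1)] C_on_lower[OF Suc.prems(2)]
      by (intro C_on_add assms(1) Suc.IH) auto
  qed
qed

text \<open>The derivative is again a product of the inverse and a derivative of \<open>f\<close>,
  so the induction on the order closes; \<open>C_on_sqrt\<close> works in the same way.\<close>

lemma C_on_inverse:
  fixes f :: "'a::euclidean_space \<Rightarrow> real"
  assumes "open S" and nz: "\<And>x. x \<in> S \<Longrightarrow> f x \<noteq> 0"
  shows "C_on n S f \<Longrightarrow> C_on n S (\<lambda>x. inverse (f x))"
proof (induction n)
  case 0
  then show ?case using nz by (simp add: continuous_on_inverse)
next
  case (Suc n)
  note mult = C_on_bilinear[OF assms(1) bounded_bilinear_mult]
  show ?case
  proof (rule C_on_derivI[OF assms(1) _ _ assms(1)])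
    show "((\<lambda>x. inverse (f x)) has_derivative
        (\<lambda>v. - 1 * (inverse (f x) * frechet_derivative f (at x) v * inverse (f x)))) (at x)" if "x \<in> S" for x
      using Deriv.has_derivative_inverse[OF nz[OF that] C_on_has_derivative[OF Suc.prems that]] by simp
    show "C_on n S (\<lambda>x. - 1 * (inverse (f x) * frechet_derivative f (at x) v * inverse (f x)))" for v
      using Suc.prems Suc.IH C_on_lower[OF Suc.prems] by (intro mult C_on_const) auto
  qed
qed

lemma C_on_sqrt:
  fixes f :: "'a::euclidean_space \<Rightarrow> real"
  assumes "open S" and pos: "\<And>x. x \<in> S \<Longrightarrow> 0 < f x"
  shows "C_on n S f \<Longrightarrow> C_on n S (\<lambda>x. sqrt (f x))"
proof (induction n)
  case 0
  then show ?case by (simp add: continuous_on_real_sqrt)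
next
  case (Suc n)
  note mult = C_on_bilinear[OF assms(1) bounded_bilinear_mult]
  show ?case
  proof (rule C_on_derivI[OF assms(1) _ _ assms(1)])
    show "((\<lambda>x. sqrt (f x)) has_derivative
        (\<lambda>v. frechet_derivative f (at x) v * inverse (2 * sqrt (f x)))) (at x)" if "x \<in> S" for x
    proof -
      have "inverse (2 * sqrt (f x)) = inverse (sqrt (f x)) / 2" by simp
      then show ?thesis
        using has_derivative_real_sqrt[OF pos[OF that] C_on_has_derivative[OF Suc.prems that]] by simp
    qed
    have "2 * sqrt (f x) \<noteq> 0" if "x \<in> S" for x using pos[OF that] by simp
    then have "C_on n S (\<lambda>x. inverse (2 * sqrt (f x)))"
      using Suc.IH[OF C_on_lower[OF Suc.prems]]
      by (intro C_on_inverse[OF assms(1)] mult C_on_const)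
    then show "C_on n S (\<lambda>x. frechet_derivative f (at x) v * inverse (2 * sqrt (f x)))" for v
      using Suc.prems by (intro mult) auto
  qed
qed

lemma smooth_on_local:
  assumes "\<And>x. x \<in> S \<Longrightarrow> \<exists>N. open N \<and> x \<in> N \<and> smooth_on N g"
  shows "smooth_on S g"
  unfolding smooth_on_def
proof (intro allI, rule C_on_local)
  fix n x assume "x \<in> S"
  from assms[OF this] show "\<exists>N. open N \<and> x \<in> N \<and> C_on n N g" by (auto simp: smooth_on_def)
qed

lemma smooth_on_cong:
  assumes "open S" "\<And>x. x \<in> S \<Longrightarrow> g x = h x" "smooth_on S g"
  shows "smooth_on S h"
  unfolding smooth_on_def
  by (intro allI, rule C_on_cong[OF assms(1,2)]) (use assms(3) in \<open>simp_all add: smooth_on_def\<close>)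

lemma smooth_on_subset: "smooth_on S g \<Longrightarrow> T \<subseteq> S \<Longrightarrow> smooth_on T g"
  unfolding smooth_on_def by (blast intro: C_on_subset)

lemma smooth_on_continuous: "smooth_on S g \<Longrightarrow> continuous_on S g"
  unfolding smooth_on_def by (metis C_on.simps(1))

lemma smooth_on_differentiable: "smooth_on S g \<Longrightarrow> x \<in> S \<Longrightarrow> g differentiable (at x)"
  unfolding smooth_on_def by (metis C_on.simps(2))

lemma smooth_on_const: "smooth_on S (\<lambda>_. c)"
  by (simp add: smooth_on_def C_on_const)

lemma smooth_on_linear: "open S \<Longrightarrow> bounded_linear f \<Longrightarrow> smooth_on S f"
  by (simp add: smooth_on_def C_on_linear)

lemma smooth_on_nth: "open S \<Longrightarrow> smooth_on S (\<lambda>v. v $ i)"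
  by (rule smooth_on_linear) (auto intro: bounded_linear_vec_nth)

lemma smooth_on_add: "open S \<Longrightarrow> smooth_on S f \<Longrightarrow> smooth_on S g \<Longrightarrow> smooth_on S (\<lambda>x. f x + g x)"
  by (simp add: smooth_on_def C_on_add)

lemma smooth_on_mult:
  fixes f g :: "_ \<Rightarrow> real"
  shows "open S \<Longrightarrow> smooth_on S f \<Longrightarrow> smooth_on S g \<Longrightarrow> smooth_on S (\<lambda>x. f x * g x)"
  by (simp add: smooth_on_def C_on_bilinear bounded_bilinear_mult)

lemma smooth_on_scaleR:
  "open S \<Longrightarrow> smooth_on S f \<Longrightarrow> smooth_on S g \<Longrightarrow> smooth_on S (\<lambda>x. f x *\<^sub>R g x)"
  by (simp add: smooth_on_def C_on_bilinear bounded_bilinear_scaleR)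

lemma smooth_on_inner:
  fixes f g :: "_ \<Rightarrow> 'b::real_inner"
  shows "open S \<Longrightarrow> smooth_on S f \<Longrightarrow> smooth_on S g \<Longrightarrow> smooth_on S (\<lambda>x. f x \<bullet> g x)"
  by (simp add: smooth_on_def C_on_bilinear bounded_bilinear_inner)

lemma smooth_on_diff:
  assumes "open S" "smooth_on S f" "smooth_on S g"
  shows "smooth_on S (\<lambda>x. f x - g x)"
  using smooth_on_add[OF assms(1,2) smooth_on_scaleR[OF assms(1) smooth_on_const[of S "- 1"] assms(3)]] by simp

lemma smooth_on_divide:
  fixes f g :: "_ \<Rightarrow> real"
  assumes "open S" "smooth_on S f" "smooth_on S g" "\<And>x. x \<in> S \<Longrightarrow> g x \<noteq> 0"
  shows "smooth_on S (\<lambda>x. f x / g x)"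
proof -
  have "smooth_on S (\<lambda>x. inverse (g x))" using assms by (simp add: smooth_on_def C_on_inverse)
  then show ?thesis unfolding divide_inverse using assms by (intro smooth_on_mult)
qed

lemma smooth_on_dist:
  fixes f g :: "_ \<Rightarrow> 'b::real_inner"
  assumes "open S" "smooth_on S f" "smooth_on S g" "\<And>x. x \<in> S \<Longrightarrow> f x \<noteq> g x"
  shows "smooth_on S (\<lambda>x. dist (f x) (g x))"
proof -
  have "smooth_on S (\<lambda>x. (f x - g x) \<bullet> (f x - g x))"
    using assms by (intro smooth_on_inner smooth_on_diff)
  then have "smooth_on S (\<lambda>x. sqrt ((f x - g x) \<bullet> (f x - g x)))"
    using assms by (simp add: smooth_on_def C_on_sqrt)
  then show ?thesis by (simp add: dist_norm norm_eq_sqrt_inner)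
qed

lemmas smooth_on_intros = smooth_on_const smooth_on_nth smooth_on_add smooth_on_mult smooth_on_scaleR
  smooth_on_inner smooth_on_diff smooth_on_divide

section \<open>Circumspheres\<close>

text \<open>Injectivity is included because affine independence of the image would not notice
  repeated points.\<close>

definition indep :: "'m set \<Rightarrow> ('l::finite, 'm::finite) config \<Rightarrow> bool" where
  "indep A v \<longleftrightarrow> inj_on (\<lambda>i. v $ i) A \<and> \<not> affine_dependent ((\<lambda>i. v $ i) ` A)"

lemma indep_insert:
  assumes "i \<notin> A"
  shows "indep (insert i A) v \<longleftrightarrow> indep A v \<and> v $ i \<notin> affine hull ((\<lambda>i. v $ i) ` A)"
proof
  assume L: "indep (insert i A) v"
  then have inj: "inj_on (\<lambda>i. v $ i) A" "v $ i \<notin> (\<lambda>i. v $ i) ` A"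
    and dep: "\<not> affine_dependent (insert (v $ i) ((\<lambda>i. v $ i) ` A))"
    using assms by (auto simp: indep_def)
  have "v $ i \<notin> affine hull ((\<lambda>i. v $ i) ` A)"
  proof
    assume "v $ i \<in> affine hull ((\<lambda>i. v $ i) ` A)"
    then have "affine_dependent (insert (v $ i) ((\<lambda>i. v $ i) ` A))"
      unfolding affine_dependent_def using inj(2) by (intro bexI[of _ "v $ i"]) simp_all
    then show False using dep by blast
  qed
  moreover have "\<not> affine_dependent ((\<lambda>i. v $ i) ` A)"
    by (rule affine_independent_subset[OF dep subset_insertI])
  ultimately show "indep A v \<and> v $ i \<notin> affine hull ((\<lambda>i. v $ i) ` A)" using inj by (simp add: indep_def)
next
  assume R: "indep A v \<and> v $ i \<notin> affine hull ((\<lambda>i. v $ i) ` A)"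
  then have "v $ i \<notin> (\<lambda>i. v $ i) ` A" using hull_inc[of "v $ i" "(\<lambda>i. v $ i) ` A" affine] by blast
  moreover have "\<not> affine_dependent (insert (v $ i) ((\<lambda>i. v $ i) ` A))"
    by (rule affine_independent_insert) (use R in \<open>simp_all add: indep_def\<close>)
  ultimately show "indep (insert i A) v" using R assms by (auto simp: indep_def)
qed

lemma orthogonal_affine_hull:
  fixes w :: "'a::real_inner"
  assumes "\<And>x y. x \<in> S \<Longrightarrow> y \<in> S \<Longrightarrow> w \<bullet> (x - y) = 0" "x \<in> affine hull S" "y \<in> affine hull S"
  shows "w \<bullet> (x - y) = 0"
proof -
  obtain s where s: "s \<in> S" using assms(2) by fastforce
  have "affine hull S \<subseteq> {x. w \<bullet> x = w \<bullet> s}"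
  proof (rule hull_minimal)
    show "S \<subseteq> {x. w \<bullet> x = w \<bullet> s}" using assms(1)[OF _ s] by (auto simp: inner_diff_right)
    show "affine {x. w \<bullet> x = w \<bullet> s}"
      by (auto simp: affine_def inner_add_right simp flip: distrib_right)
  qed
  then have "w \<bullet> x = w \<bullet> s" "w \<bullet> y = w \<bullet> s" using assms(2,3) by blast+
  then show ?thesis by (simp add: inner_diff_right)
qed

text \<open>Gram-Schmidt in affine form: the component \<open>e\<close> of \<open>v $ i\<close>
  normal to the hull of \<open>A\<close> is smooth, it vanishes exactly when independence fails, and
  projecting to the larger hull adds the component along \<open>e\<close>. Openness and smoothness
  share one induction because the new domain is cut out by \<open>e v \<noteq> 0\<close>;
  \<open>T\<close> and \<open>p\<close> are arbitrary because the induction projects both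
  \<open>v $ i\<close> and the given point.\<close>

lemma smooth_projection:
  fixes A :: "'m::finite set"
  assumes "A \<noteq> {}"
  shows "open {v :: ('l::finite, 'm) config. indep A v} \<and>
    (\<forall>T p. open T \<longrightarrow> T \<subseteq> {v :: ('l, 'm) config. indep A v} \<longrightarrow> smooth_on T p \<longrightarrow> (\<exists>q. smooth_on T q \<and>
      (\<forall>v\<in>T. q v \<in> affine hull ((\<lambda>i. v $ i) ` A) \<and> (\<forall>j\<in>A. \<forall>k\<in>A. (p v - q v) \<bullet> (v $ j - v $ k) = 0))))"
  using finite[of A] assms
proof (induction A rule: finite_ne_induct)
  case (singleton i)
  have "indep {i} v" for v :: "('l, 'm) config" by (simp add: indep_def)
  then show ?case by (auto intro!: exI[of _ "\<lambda>v. v $ i"] smooth_on_nth)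
next
  case (insert i A)
  define S where "S = {v :: ('l, 'm) config. indep A v}"
  have S: "open S" using insert.IH by (simp add: S_def)
  have proj: "\<exists>q. smooth_on T q \<and> (\<forall>v\<in>T. q v \<in> affine hull ((\<lambda>i. v $ i) ` A) \<and>
        (\<forall>j\<in>A. \<forall>k\<in>A. (p v - q v) \<bullet> (v $ j - v $ k) = 0))" if "open T" "T \<subseteq> S" "smooth_on T p" for T p
    using insert.IH that unfolding S_def by blast
  obtain qi where qi: "smooth_on S qi" "\<And>v. v \<in> S \<Longrightarrow> qi v \<in> affine hull ((\<lambda>i. v $ i) ` A)"
    "\<And>v j k. v \<in> S \<Longrightarrow> j \<in> A \<Longrightarrow> k \<in> A \<Longrightarrow> (v $ i - qi v) \<bullet> (v $ j - v $ k) = 0"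
    using proj[OF S order_refl smooth_on_nth[OF S, of i]] by blast
  define e where "e v = v $ i - qi v" for v
  have e_smooth: "smooth_on S e" unfolding e_def using S qi(1) by (intro smooth_on_intros)
  have e_orth: "e v \<bullet> (x - y) = 0"
    if "v \<in> S" "x \<in> affine hull ((\<lambda>i. v $ i) ` A)" "y \<in> affine hull ((\<lambda>i. v $ i) ` A)" for v x y
    using qi(3)[OF that(1)] by (intro orthogonal_affine_hull[OF _ that(2,3)]) (auto simp: e_def)
  have e_nz: "e v \<noteq> 0 \<longleftrightarrow> v $ i \<notin> affine hull ((\<lambda>i. v $ i) ` A)" if v: "v \<in> S" for v
  proof
    assume "e v \<noteq> 0"
    show "v $ i \<notin> affine hull ((\<lambda>i. v $ i) ` A)"
    proof
      assume "v $ i \<in> affine hull ((\<lambda>i. v $ i) ` A)"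
      from e_orth[OF v this qi(2)[OF v]] have "e v \<bullet> e v = 0" by (simp add: e_def)
      then show False using \<open>e v \<noteq> 0\<close> by simp
    qed
  next
    assume "v $ i \<notin> affine hull ((\<lambda>i. v $ i) ` A)"
    then show "e v \<noteq> 0" using qi(2)[OF v] by (auto simp: e_def)
  qed
  define S' where "S' = {v :: ('l, 'm) config. indep (insert i A) v}"
  have S'_eq: "S' = {v \<in> S. e v \<noteq> 0}"
    using e_nz by (auto simp: S'_def S_def indep_insert[OF insert.hyps(3)])
  have "open (S \<inter> e -` (- {0}))"
    using smooth_on_continuous[OF e_smooth] S by (intro continuous_open_preimage) auto
  then have S': "open S'" "S' \<subseteq> S" by (auto simp: S'_eq Int_def vimage_def)
  show ?case unfolding S'_def[symmetric]
  proof (intro conjI allI impI)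
    show "open S'" by (rule S')
    fix T and p :: "('l, 'm) config \<Rightarrow> real^'l" assume T: "open T" "T \<subseteq> S'" and p: "smooth_on T p"
    have TS: "T \<subseteq> S" using T S' by blast
    obtain qp where qp: "smooth_on T qp" "\<And>v. v \<in> T \<Longrightarrow> qp v \<in> affine hull ((\<lambda>i. v $ i) ` A)"
      "\<And>v j k. v \<in> T \<Longrightarrow> j \<in> A \<Longrightarrow> k \<in> A \<Longrightarrow> (p v - qp v) \<bullet> (v $ j - v $ k) = 0"
      using proj[OF T(1) TS p] by blast
    define c where "c v = ((p v - qp v) \<bullet> e v) / (e v \<bullet> e v)" for v
    define q where "q v = qp v + c v *\<^sub>R e v" for v
    have eT: "smooth_on T e" using e_smooth TS by (rule smooth_on_subset)
    have e0: "e v \<bullet> e v \<noteq> 0" if "v \<in> T" for v using that T(2) by (auto simp: S'_eq)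
    have "smooth_on T q" unfolding q_def c_def using T(1) p qp(1) eT e0 by (intro smooth_on_intros)
    moreover have "q v \<in> affine hull ((\<lambda>i. v $ i) ` insert i A) \<and>
        (\<forall>j\<in>insert i A. \<forall>k\<in>insert i A. (p v - q v) \<bullet> (v $ j - v $ k) = 0)" if v: "v \<in> T" for v
    proof
      let ?H = "affine hull ((\<lambda>i. v $ i) ` A)" and ?H' = "affine hull ((\<lambda>i. v $ i) ` insert i A)"
      have vS: "v \<in> S" using v TS by blast
      have HH': "?H \<subseteq> ?H'" by (intro hull_mono) auto
      have "v $ i \<in> ?H'" by (intro hull_inc) auto
      then show "q v \<in> ?H'"
        unfolding q_def e_def using qp(2)[OF v] qi(2)[OF vS] HH'
        by (intro mem_affine_3_minus affine_affine_hull) auto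
      have pe: "(p v - q v) \<bullet> e v = 0"
        using e0[OF v] by (simp add: q_def c_def inner_diff_left inner_add_left)
      have pA: "(p v - q v) \<bullet> (x - y) = 0" if "x \<in> ?H" "y \<in> ?H" for x y
      proof -
        have "(p v - qp v) \<bullet> (x - y) = 0"
          using qp(3)[OF v] by (intro orthogonal_affine_hull[OF _ that]) auto
        then show ?thesis using e_orth[OF vS that] by (simp add: q_def inner_diff_left inner_add_left)
      qed
      have pi: "(p v - q v) \<bullet> (v $ i - x) = 0" if "x \<in> ?H" for x
      proof -
        have "(p v - q v) \<bullet> (v $ i - x) = (p v - q v) \<bullet> e v + (p v - q v) \<bullet> (qi v - x)"
          by (simp add: e_def flip: inner_add_right)
        then show ?thesis using pe pA[OF qi(2)[OF vS] that] by simp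
      qed
      have pi': "(p v - q v) \<bullet> (x - v $ i) = 0" if "x \<in> ?H" for x
        using pi[OF that] by (simp add: inner_diff_right)
      have inH: "v $ j \<in> ?H" if "j \<in> A" for j using that by (intro hull_inc) auto
      show "\<forall>j\<in>insert i A. \<forall>k\<in>insert i A. (p v - q v) \<bullet> (v $ j - v $ k) = 0"
        using pA pi pi' inH by auto
    qed
    ultimately show "\<exists>q. smooth_on T q \<and> (\<forall>v\<in>T. q v \<in> affine hull ((\<lambda>i. v $ i) ` insert i A) \<and>
        (\<forall>j\<in>insert i A. \<forall>k\<in>insert i A. (p v - q v) \<bullet> (v $ j - v $ k) = 0))"
      by blast
  qed
qed

lemma open_indep: "open {v :: ('l::finite, 'm::finite) config. indep A v}"
  by (cases "A = {}") (use smooth_projection[of A] in \<open>auto simp: indep_def\<close>)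

text \<open>The centre for \<open>insert i A\<close> is sought on the line through the centre for
  \<open>A\<close> in the normal direction \<open>e\<close>, along which the points of
  \<open>A\<close> remain equidistant. Equidistance of \<open>v $ i\<close> is then a linear
  equation in the parameter, and \<open>y\<close> is its solution.\<close>

lemma smooth_circumcentre:
  fixes A :: "'m::finite set"
  assumes "A \<noteq> {}"
  shows "\<exists>c. smooth_on {v :: ('l::finite, 'm) config. indep A v} c \<and> (\<forall>v. indep A v \<longrightarrow>
    c v \<in> affine hull ((\<lambda>i. v $ i) ` A) \<and> (\<forall>j\<in>A. \<forall>k\<in>A. dist (c v) (v $ j) = dist (c v) (v $ k)))"
  using finite[of A] assms
proof (induction A rule: finite_ne_induct)
  case (singleton i)
  have "indep {i} v" for v :: "('l, 'm) config" by (simp add: indep_def)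
  then show ?case by (auto intro!: exI[of _ "\<lambda>v. v $ i"] smooth_on_nth)
next
  case (insert i A)
  define S where "S = {v :: ('l, 'm) config. indep A v}"
  define S' where "S' = {v :: ('l, 'm) config. indep (insert i A) v}"
  have S': "open S'" unfolding S'_def by (rule open_indep)
  have S'S: "S' \<subseteq> S" by (auto simp: S'_def S_def indep_insert[OF insert.hyps(3)])
  from insert.IH obtain cA where cA0: "smooth_on S cA \<and> (\<forall>v. indep A v \<longrightarrow>
    cA v \<in> affine hull ((\<lambda>i. v $ i) ` A) \<and> (\<forall>j\<in>A. \<forall>k\<in>A. dist (cA v) (v $ j) = dist (cA v) (v $ k)))"
    unfolding S_def ..
  then have cA: "smooth_on S cA" "\<And>v. v \<in> S \<Longrightarrow> cA v \<in> affine hull ((\<lambda>i. v $ i) ` A)"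
    "\<And>v j k. v \<in> S \<Longrightarrow> j \<in> A \<Longrightarrow> k \<in> A \<Longrightarrow> dist (cA v) (v $ j) = dist (cA v) (v $ k)"
    unfolding S_def by blast+
  from smooth_projection[OF insert.hyps(2), where ?'l = 'l] S' S'S smooth_on_nth[OF S', of i]
  obtain qi where qi0: "smooth_on S' qi \<and> (\<forall>v\<in>S'. qi v \<in> affine hull ((\<lambda>i. v $ i) ` A) \<and>
      (\<forall>j\<in>A. \<forall>k\<in>A. (v $ i - qi v) \<bullet> (v $ j - v $ k) = 0))"
    unfolding S_def[symmetric] by meson
  then have qi: "smooth_on S' qi" "\<And>v. v \<in> S' \<Longrightarrow> qi v \<in> affine hull ((\<lambda>i. v $ i) ` A)"
    "\<And>v j k. v \<in> S' \<Longrightarrow> j \<in> A \<Longrightarrow> k \<in> A \<Longrightarrow> (v $ i - qi v) \<bullet> (v $ j - v $ k) = 0"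
    by blast+
  obtain k0 where k0: "k0 \<in> A" using insert.hyps(2) by blast
  define e where "e v = v $ i - qi v" for v
  define y where "y v = ((cA v - v $ i) \<bullet> (cA v - v $ i) - (cA v - v $ k0) \<bullet> (cA v - v $ k0)) / (2 * (e v \<bullet> e v))" for v
  define c where "c v = cA v + y v *\<^sub>R e v" for v
  have e0: "e v \<bullet> e v \<noteq> 0" if v: "v \<in> S'" for v
  proof -
    have "v $ i \<notin> affine hull ((\<lambda>i. v $ i) ` A)" using v by (simp add: S'_def indep_insert[OF insert.hyps(3)])
    then show ?thesis using qi(2)[OF v] by (auto simp: e_def)
  qed
  have cA': "smooth_on S' cA" using cA(1) S'S by (rule smooth_on_subset)
  have e_smooth: "smooth_on S' e" unfolding e_def using S' qi(1) by (intro smooth_on_intros)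
  have "smooth_on S' c" unfolding c_def y_def using S' cA' e_smooth e0
    by (intro smooth_on_intros) auto
  moreover have "c v \<in> affine hull ((\<lambda>i. v $ i) ` insert i A) \<and>
      (\<forall>j\<in>insert i A. \<forall>k\<in>insert i A. dist (c v) (v $ j) = dist (c v) (v $ k))" if v: "v \<in> S'" for v
  proof
    let ?H = "affine hull ((\<lambda>i. v $ i) ` A)" and ?H' = "affine hull ((\<lambda>i. v $ i) ` insert i A)"
    have vS: "v \<in> S" using v S'S by blast
    have HH': "?H \<subseteq> ?H'" by (intro hull_mono) auto
    have "v $ i \<in> ?H'" by (intro hull_inc) auto
    then show "c v \<in> ?H'"
      unfolding c_def e_def using cA(2)[OF vS] qi(2)[OF v] HH'
      by (intro mem_affine_3_minus affine_affine_hull) auto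
    have e_orth: "e v \<bullet> (x - z) = 0" if "x \<in> ?H" "z \<in> ?H" for x z
      using qi(3)[OF v] by (intro orthogonal_affine_hull[OF _ that]) (auto simp: e_def)
    have expand: "(c v - p) \<bullet> (c v - p) = (cA v - p) \<bullet> (cA v - p) + 2 * y v * (e v \<bullet> (cA v - p)) + (y v)\<^sup>2 * (e v \<bullet> e v)" for p
      by (simp add: c_def inner_diff_left inner_diff_right inner_add_left inner_add_right
          inner_commute power2_eq_square algebra_simps)
    have j: "(c v - v $ j) \<bullet> (c v - v $ j) = (c v - v $ k0) \<bullet> (c v - v $ k0)" if "j \<in> A" for j
    proof -
      have "e v \<bullet> (cA v - v $ j) = 0" "e v \<bullet> (cA v - v $ k0) = 0"
        using that k0 by (auto intro!: e_orth cA(2)[OF vS] hull_inc)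
      moreover have "(cA v - v $ j) \<bullet> (cA v - v $ j) = (cA v - v $ k0) \<bullet> (cA v - v $ k0)"
        using cA(3)[OF vS that k0] by (simp add: dist_norm norm_eq_sqrt_inner)
      ultimately show ?thesis unfolding expand by simp
    qed
    have i: "(c v - v $ i) \<bullet> (c v - v $ i) = (c v - v $ k0) \<bullet> (c v - v $ k0)"
    proof -
      have "e v \<bullet> (cA v - v $ k0) = 0" using k0 by (auto intro!: e_orth cA(2)[OF vS] hull_inc)
      moreover have "e v \<bullet> (cA v - v $ i) = e v \<bullet> (cA v - qi v) - e v \<bullet> e v"
        by (simp add: e_def inner_diff_right)
      then have "e v \<bullet> (cA v - v $ i) = - (e v \<bullet> e v)" using e_orth[OF cA(2)[OF vS] qi(2)[OF v]] by simp
      moreover have "2 * y v * (e v \<bullet> e v) = (cA v - v $ i) \<bullet> (cA v - v $ i) - (cA v - v $ k0) \<bullet> (cA v - v $ k0)"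
        using e0[OF v] by (simp add: y_def)
      ultimately show ?thesis unfolding expand by simp
    qed
    have "dist (c v) (v $ j) = dist (c v) (v $ k0)" if "j \<in> insert i A" for j
      using that i j by (auto simp: dist_norm norm_eq_sqrt_inner)
    then show "\<forall>j\<in>insert i A. \<forall>k\<in>insert i A. dist (c v) (v $ j) = dist (c v) (v $ k)" by simp
  qed
  ultimately show ?case unfolding S'_def by blast
qed

text \<open>Both centres are equidistant from the points of \<open>A\<close>, so their difference is
  orthogonal to the affine hull, in which \<open>c\<close> and the points lie.\<close>

lemma circumscribed_pythagoras:
  fixes v :: "('l::finite, 'm::finite) config"
  assumes c: "c \<in> affine hull ((\<lambda>i. v $ i) ` A)" "\<And>i. i \<in> A \<Longrightarrow> dist (v $ i) c = \<rho>"
    and c': "\<And>i. i \<in> A \<Longrightarrow> dist (v $ i) c' = \<rho>'" and k: "k \<in> A"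
  shows "\<rho>'\<^sup>2 = \<rho>\<^sup>2 + (dist c c')\<^sup>2"
proof -
  have expand: "(dist p c')\<^sup>2 = (dist p c)\<^sup>2 + 2 * ((c - c') \<bullet> (p - c)) + (dist c c')\<^sup>2" for p
    unfolding dist_norm power2_norm_eq_inner
    by (simp add: inner_diff_left inner_diff_right inner_commute algebra_simps)
  have "(c - c') \<bullet> (v $ k - c) = 0"
  proof (rule orthogonal_affine_hull)
    fix x y assume "x \<in> (\<lambda>i. v $ i) ` A" "y \<in> (\<lambda>i. v $ i) ` A"
    then obtain i j where ij: "i \<in> A" "x = v $ i" "j \<in> A" "y = v $ j" by blast
    have "(c - c') \<bullet> (x - c) = (c - c') \<bullet> (y - c)"
      using expand[of x] expand[of y] c(2)[OF ij(1)] c(2)[OF ij(3)] c'[OF ij(1)] c'[OF ij(3)]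
      by (simp add: ij(2,4))
    then show "(c - c') \<bullet> (x - y) = 0" by (simp add: inner_diff_right)
  qed (use c(1) k hull_inc[of "v $ k" "(\<lambda>i. v $ i) ` A" affine] in auto)
  then show ?thesis using expand[of "v $ k"] c(2)[OF k] c'[OF k] by simp
qed

text \<open>By \<open>circumscribed_pythagoras\<close> any other centre \<open>c'\<close> adds the
  square of \<open>dist c c'\<close> to the squared radius, so the centre in the affine hull is the
  unique minimiser that the definite description asks for.\<close>

lemma min_circumball_eq:
  fixes v :: "('l::finite, 'm::finite) config"
  assumes A: "A \<noteq> {}" and \<rho>: "0 < \<rho>"
    and c: "c \<in> affine hull ((\<lambda>i. v $ i) ` A)" "\<And>i. i \<in> A \<Longrightarrow> dist (v $ i) c = \<rho>"
  shows "min_circumball v A = (c, \<rho>)"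
proof -
  obtain k where k: "k \<in> A" using A by blast
  have pyth: "\<rho>'\<^sup>2 = \<rho>\<^sup>2 + (dist c c')\<^sup>2" if "\<forall>i\<in>A. v $ i \<in> sphere c' \<rho>'" for c' \<rho>'
    using that by (intro circumscribed_pythagoras[OF c _ k]) (auto simp: dist_commute)
  have le: "\<rho> \<le> \<rho>'" if "0 < \<rho>'" "\<forall>i\<in>A. v $ i \<in> sphere c' \<rho>'" for c' \<rho>'
    by (rule power2_le_imp_le) (use pyth[OF that(2)] that(1) in auto)
  have on: "\<forall>i\<in>A. v $ i \<in> sphere c \<rho>" using c(2) by (simp add: dist_commute)
  show ?thesis
    unfolding min_circumball_def
  proof (rule the_equality)
    show "case (c, \<rho>) of (c, \<rho>) \<Rightarrow> \<rho> > 0 \<and> (\<forall>i\<in>A. v $ i \<in> sphere c \<rho>) \<and>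
     (\<forall>c' \<rho>'. \<rho>' > 0 \<and> (\<forall>i\<in>A. v $ i \<in> sphere c' \<rho>') \<longrightarrow> \<rho> \<le> \<rho>')"
      using \<rho> on le by auto
    fix p assume p: "case p of (c, \<rho>) \<Rightarrow> \<rho> > 0 \<and> (\<forall>i\<in>A. v $ i \<in> sphere c \<rho>) \<and>
     (\<forall>c' \<rho>'. \<rho>' > 0 \<and> (\<forall>i\<in>A. v $ i \<in> sphere c' \<rho>') \<longrightarrow> \<rho> \<le> \<rho>')"
    obtain c' \<rho>' where p_eq: "p = (c', \<rho>')" by (cases p)
    have p': "0 < \<rho>'" "\<forall>i\<in>A. v $ i \<in> sphere c' \<rho>'" "\<rho>' \<le> \<rho>" using p \<rho> on unfolding p_eq by auto
    have "\<rho>' = \<rho>" using le[OF p'(1,2)] p'(3) by simp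
    then have "dist c c' = 0" using pyth[OF p'(2)] by simp
    then show "p = (c, \<rho>)" using p_eq \<open>\<rho>' = \<rho>\<close> by simp
  qed
qed

definition circumcentre :: "('l::finite, 'm::finite) config \<Rightarrow> 'm set \<Rightarrow> real^'l" where
  "circumcentre v A = fst (min_circumball v A)"

lemma circumball_eq: "circumball v A = ball (circumcentre v A) (circumradius v A)"
  by (simp add: circumball_def circumcentre_def)

lemma two_le_cardE:
  assumes "2 \<le> card A"
  obtains i j where "i \<in> A" "j \<in> A" "i \<noteq> j"
  using assms by (metis One_nat_def Suc_1 card.infinite card_le_Suc0_iff_eq not_less_eq_eq zero_le)

text \<open>Two distinct points on the sphere force a positive radius, as
  \<open>min_circumball\<close> demands.\<close>

lemma circumsphere:
  fixes v :: "('l::finite, 'm::finite) config"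
  assumes ind: "indep A v" and card: "2 \<le> card A"
  shows "circumcentre v A \<in> affine hull ((\<lambda>i. v $ i) ` A)"
    and "i \<in> A \<Longrightarrow> dist (v $ i) (circumcentre v A) = circumradius v A"
    and "0 < circumradius v A"
proof -
  have A: "A \<noteq> {}" using card by auto
  obtain c where c: "\<forall>v::('l, 'm) config. indep A v \<longrightarrow> c v \<in> affine hull ((\<lambda>i. v $ i) ` A) \<and>
      (\<forall>j\<in>A. \<forall>k\<in>A. dist (c v) (v $ j) = dist (c v) (v $ k))"
    using smooth_circumcentre[OF A] by blast
  obtain i0 j0 where ij: "i0 \<in> A" "j0 \<in> A" "i0 \<noteq> j0" using card by (rule two_le_cardE)
  define \<rho> where "\<rho> = dist (v $ i0) (c v)"
  have eq: "dist (v $ i) (c v) = \<rho>" if "i \<in> A" for i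
    using c ind that ij by (metis \<rho>_def dist_commute)
  have "v $ i0 \<noteq> v $ j0" using ind ij by (auto simp: indep_def inj_on_def)
  then have "0 < \<rho>" using eq[OF ij(2)] unfolding \<rho>_def by (metis dist_pos_lt zero_less_dist_iff)
  then have "min_circumball v A = (c v, \<rho>)" using c ind eq by (intro min_circumball_eq A) auto
  then have "circumcentre v A = c v" "circumradius v A = \<rho>" by (simp_all add: circumcentre_def circumradius_def)
  then show "circumcentre v A \<in> affine hull ((\<lambda>i. v $ i) ` A)"
    "i \<in> A \<Longrightarrow> dist (v $ i) (circumcentre v A) = circumradius v A" "0 < circumradius v A"
    using c ind eq \<open>0 < \<rho>\<close> by auto
qed

lemma circumradius_minimal:
  assumes ind: "indep A v" and card: "2 \<le> card A"
    and c': "\<And>i. i \<in> A \<Longrightarrow> dist (v $ i) c' = \<rho>'"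
  shows "circumradius v A \<le> \<rho>'" "\<rho>'\<^sup>2 = (circumradius v A)\<^sup>2 + (dist (circumcentre v A) c')\<^sup>2"
proof -
  obtain k where k: "k \<in> A" using card by fastforce
  show eq: "\<rho>'\<^sup>2 = (circumradius v A)\<^sup>2 + (dist (circumcentre v A) c')\<^sup>2"
    by (rule circumscribed_pythagoras[OF circumsphere(1,2)[OF ind card] c' k])
  have "0 \<le> \<rho>'" using c'[OF k] by (metis zero_le_dist)
  then show "circumradius v A \<le> \<rho>'" by (rule power2_le_imp_le[rotated]) (simp add: eq)
qed

text \<open>\<open>smooth_circumcentre\<close> supplies some smooth centre in the hull; Pythagoras
  applied in both directions leaves no distance between it and \<open>circumcentre\<close>. The
  radius is then a smooth distance that never vanishes.\<close>

lemma smooth_circumcentre_circumradius: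
  assumes card: "2 \<le> card (A :: 'm::finite set)"
  shows "smooth_on {v :: ('l::finite, 'm) config. indep A v} (\<lambda>v. circumcentre v A)"
    and "smooth_on {v :: ('l, 'm) config. indep A v} (\<lambda>v. circumradius v A)"
proof -
  have A: "A \<noteq> {}" using card by auto
  let ?S = "{v :: ('l, 'm) config. indep A v}"
  obtain k where k: "k \<in> A" using A by blast
  from smooth_circumcentre[OF A] obtain c where c: "smooth_on ?S c \<and> (\<forall>v::('l, 'm) config. indep A v \<longrightarrow>
      c v \<in> affine hull ((\<lambda>i. v $ i) ` A) \<and> (\<forall>j\<in>A. \<forall>k\<in>A. dist (c v) (v $ j) = dist (c v) (v $ k)))"
    by blast
  have eq: "c v = circumcentre v A" if "v \<in> ?S" for v
  proof -
    have ind: "indep A v" using that by simp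
    have d: "dist (v $ i) (c v) = dist (v $ k) (c v)" if "i \<in> A" for i
      using c ind that k by (metis dist_commute)
    have "(dist (v $ k) (c v))\<^sup>2 = (circumradius v A)\<^sup>2 + (dist (circumcentre v A) (c v))\<^sup>2"
      by (rule circumradius_minimal(2)[OF ind card d])
    moreover have "(circumradius v A)\<^sup>2 = (dist (v $ k) (c v))\<^sup>2 + (dist (c v) (circumcentre v A))\<^sup>2"
      using circumscribed_pythagoras[OF _ d circumsphere(2)[OF ind card] k] c ind by blast
    ultimately show ?thesis by (simp add: dist_commute)
  qed
  have S: "open ?S" by (rule open_indep)
  show ctr: "smooth_on ?S (\<lambda>v. circumcentre v A)"
    by (rule smooth_on_cong[OF S eq]) (use c in auto)
  have "smooth_on ?S (\<lambda>v. dist (v $ k) (circumcentre v A))"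
  proof (rule smooth_on_dist[OF S smooth_on_nth[OF S] ctr])
    fix v :: "('l, 'm) config" assume "v \<in> ?S"
    then show "v $ k \<noteq> circumcentre v A" using circumsphere(2)[of A v k] circumsphere(3)[of A v] card k by auto
  qed
  then show "smooth_on ?S (\<lambda>v. circumradius v A)"
    by (rule smooth_on_cong[OF S, rotated]) (use circumsphere(2)[OF _ card k] in auto)
qed

section \<open>The alpha filtration\<close>

text \<open>The position part of \<open>U_Alp\<close>, without the condition on radii. Coplanarity
  and collinearity are recast as \<open>indep\<close> of small subsets, which is an open condition
  and the hypothesis of the circumsphere lemmas.\<close>

definition general_position :: "('l::finite, 'm::finite) config \<Rightarrow> bool" where
  "general_position u \<longleftrightarrow> distinct_points u \<and>
     (\<forall>A. A \<noteq> {} \<longrightarrow> card A \<le> 4 \<longrightarrow> indep A u) \<and>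
     (\<forall>S. card S = 5 \<longrightarrow> \<not> (\<exists>c \<rho>. (\<lambda>i. u $ i) ` S \<subseteq> sphere c \<rho>))"

text \<open>Four independent points have too large an affine dimension for the hull of three points;
  conversely a dependent point lies in the hull of the other three.\<close>

lemma coplanar_iff_not_indep:
  fixes u :: "('l::finite, 'm::finite) config"
  assumes inj: "distinct_points u" and card: "card S = 4"
  shows "coplanar ((\<lambda>i. u $ i) ` S) \<longleftrightarrow> \<not> indep S u"
proof -
  let ?P = "(\<lambda>i. u $ i) ` S"
  have inj: "inj_on (\<lambda>i. u $ i) S" using inj by (auto simp: distinct_points_def intro: inj_on_subset)
  then have cP: "card ?P = 4" "finite ?P" using card by (simp_all add: card_image)
  have "coplanar ?P \<longleftrightarrow> affine_dependent ?P"
  proof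
    assume "coplanar ?P"
    then obtain a b c where "?P \<subseteq> affine hull {a, b, c}" by (auto simp: coplanar_def)
    then have "aff_dim ?P \<le> aff_dim (affine hull {a, b, c})" by (rule aff_dim_subset)
    also have "\<dots> \<le> int (card {a, b, c}) - 1" using aff_dim_le_card[of "{a, b, c}"] by simp
    also have "\<dots> \<le> 2" by (simp add: card_insert_if)
    finally show "affine_dependent ?P" using cP affine_independent_iff_card[of ?P] by linarith
  next
    assume "affine_dependent ?P"
    then obtain x where x: "x \<in> ?P" "x \<in> affine hull (?P - {x})" by (auto simp: affine_dependent_def)
    have "card (?P - {x}) = 3" using x cP by simp
    then obtain a b c where abc: "?P - {x} = {a, b, c}" by (auto simp: card_3_iff)
    have "?P \<subseteq> affine hull {a, b, c}"
    proof
      fix y assume "y \<in> ?P"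
      then have "y = x \<or> y \<in> {a, b, c}" using abc by blast
      then show "y \<in> affine hull {a, b, c}" using x(2) abc by (auto intro: hull_inc)
    qed
    then show "coplanar ?P" unfolding coplanar_def by blast
  qed
  then show ?thesis using inj by (simp add: indep_def)
qed

lemma collinear_iff_not_indep:
  fixes u :: "('l::finite, 'm::finite) config"
  assumes inj: "distinct_points u" and card: "card S = 3"
  shows "collinear ((\<lambda>i. u $ i) ` S) \<longleftrightarrow> \<not> indep S u"
proof -
  obtain i j k where S: "S = {i, j, k}" "i \<noteq> j" "i \<noteq> k" "j \<noteq> k" using card by (auto simp: card_3_iff)
  have inj: "inj (\<lambda>i. u $ i)" using inj by (simp add: distinct_points_def)
  then have "u $ i \<noteq> u $ j" "u $ i \<noteq> u $ k" "u $ j \<noteq> u $ k" using S by (auto dest: injD)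
  then have "collinear ((\<lambda>i. u $ i) ` S) \<longleftrightarrow> affine_dependent ((\<lambda>i. u $ i) ` S)"
    unfolding S(1) using collinear_3_eq_affine_dependent[of "u $ i" "u $ j" "u $ k"] by simp
  then show ?thesis using inj by (auto simp: indep_def intro: inj_on_subset)
qed

lemma general_position_iff:
  "general_position u \<longleftrightarrow> distinct_points u \<and>
     (\<forall>S. card S = 4 \<longrightarrow> \<not> coplanar ((\<lambda>i. u $ i) ` S)) \<and>
     (\<forall>S. card S = 3 \<longrightarrow> \<not> collinear ((\<lambda>i. u $ i) ` S)) \<and>
     (\<forall>S. card S = 5 \<longrightarrow> \<not> (\<exists>c \<rho>. (\<lambda>i. u $ i) ` S \<subseteq> sphere c \<rho>))"
proof (cases "distinct_points u")
  case True
  have small: "indep A u" if "card A = 1 \<or> card A = 2" for A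
  proof -
    have "inj_on (\<lambda>i. u $ i) A" using True by (auto simp: distinct_points_def intro: inj_on_subset)
    moreover have "\<not> affine_dependent ((\<lambda>i. u $ i) ` A)" using that by (auto simp: card_1_singleton_iff card_2_iff)
    ultimately show ?thesis by (simp add: indep_def)
  qed
  have "(\<forall>A. A \<noteq> {} \<longrightarrow> card A \<le> 4 \<longrightarrow> indep A u) \<longleftrightarrow>
     (\<forall>S. card S = 4 \<longrightarrow> indep S u) \<and> (\<forall>S. card S = 3 \<longrightarrow> indep S u)" (is "?L \<longleftrightarrow> ?R")
  proof
    assume L: ?L
    have "indep S u" if "card S = 3 \<or> card S = 4" for S
    proof -
      have "S \<noteq> {}" "card S \<le> 4" using that by auto
      then show ?thesis using L by blast
    qed
    then show ?R by blast
  next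
    assume R: ?R
    show ?L
    proof (intro allI impI)
      fix A :: "'b set" assume A: "A \<noteq> {}" "card A \<le> 4"
      have "card A = 1 \<or> card A = 2 \<or> card A = 3 \<or> card A = 4"
        using A card_gt_0_iff[of A] by simp linarith
      then show "indep A u" using R small by blast
    qed
  qed
  then show ?thesis
    using True by (simp add: general_position_def coplanar_iff_not_indep collinear_iff_not_indep conj_assoc)
qed (simp add: general_position_def)

lemma U_Alp_iff: "u \<in> U_Alp \<longleftrightarrow> general_position u \<and>
     (\<forall>\<tau> \<tau>'. attaching_simplex u \<tau> \<longrightarrow> attaching_simplex u \<tau>' \<longrightarrow>
        card \<tau> \<noteq> 1 \<longrightarrow> card \<tau>' \<noteq> 1 \<longrightarrow> \<tau> \<noteq> \<tau>' \<longrightarrow> Alp_birth u \<tau> \<noteq> Alp_birth u \<tau>')"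
  unfolding U_Alp_def general_position_iff mem_Collect_eq by (simp only: conj_assoc)

section \<open>The Delaunay complex and its attaching simplices\<close>

lemma in_Del_iff: "\<sigma> \<in> Del u \<longleftrightarrow> 1 \<le> card \<sigma> \<and> card \<sigma> \<le> 4 \<and>
    (\<exists>c \<rho>. 0 < \<rho> \<and> (\<forall>i\<in>\<sigma>. dist (u $ i) c = \<rho>) \<and> (\<forall>i. i \<notin> \<sigma> \<longrightarrow> \<rho> < dist (u $ i) c))"
proof -
  have "ball c \<rho> \<inter> cloud u = {} \<and> {i. u $ i \<in> sphere c \<rho>} = \<sigma> \<longleftrightarrow>
      (\<forall>i\<in>\<sigma>. dist (u $ i) c = \<rho>) \<and> (\<forall>i. i \<notin> \<sigma> \<longrightarrow> \<rho> < dist (u $ i) c)" for c \<rho>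
  proof -
    have "ball c \<rho> \<inter> cloud u = {} \<longleftrightarrow> (\<forall>i. \<not> dist (u $ i) c < \<rho>)"
      by (auto simp: cloud_def dist_commute)
    moreover have "{i. u $ i \<in> sphere c \<rho>} = \<sigma> \<longleftrightarrow> (\<forall>i. i \<in> \<sigma> \<longleftrightarrow> dist (u $ i) c = \<rho>)"
      by (auto simp: dist_commute)
    ultimately show ?thesis unfolding not_less by (metis less_eq_real_def order_less_irrefl)
  qed
  then show ?thesis by (simp add: Del_def)
qed

lemma ball_disjoint_cloud_iff: "ball c \<rho> \<inter> cloud u = {} \<longleftrightarrow> (\<forall>i. \<rho> \<le> dist (u $ i) c)"
proof -
  have "ball c \<rho> \<inter> cloud u = {} \<longleftrightarrow> (\<forall>i. \<not> dist (u $ i) c < \<rho>)"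
    by (auto simp: cloud_def dist_commute)
  then show ?thesis by (simp add: not_less)
qed

lemma attaching_simplex_iff:
  assumes "card \<tau> \<noteq> 1"
  shows "attaching_simplex u \<tau> \<longleftrightarrow> \<tau> \<in> Del u \<and> (\<forall>i. circumradius u \<tau> \<le> dist (u $ i) (circumcentre u \<tau>))"
  using assms by (simp add: attaching_simplex_def circumball_eq ball_disjoint_cloud_iff)

lemma Del_indep:
  assumes "general_position u" "\<tau> \<in> Del u"
  shows "indep \<tau> u"
proof -
  have "\<tau> \<noteq> {}" "card \<tau> \<le> 4" using assms(2) by (auto simp: in_Del_iff)
  then show ?thesis using assms(1) by (simp add: general_position_def)
qed

text \<open>The vector is the component of \<open>u $ j\<close> normal to the affine hull of
  \<open>A\<close>; \<open>Del_remove\<close> uses it as a direction for moving centres.\<close>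

lemma separating_normal:
  fixes u :: "('l::finite, 'm::finite) config"
  assumes ind: "indep (insert j A) u" and j: "j \<notin> A" and A: "A \<noteq> {}"
  shows "\<exists>e. (\<forall>i\<in>A. \<forall>k\<in>A. e \<bullet> (u $ i - u $ k) = 0) \<and> (\<forall>i\<in>A. 0 < e \<bullet> (u $ j - u $ i))"
proof -
  let ?S = "{v :: ('l, 'm) config. indep A v}" and ?H = "affine hull ((\<lambda>i. u $ i) ` A)"
  have S: "open ?S" by (rule open_indep)
  have u: "u \<in> ?S" "u $ j \<notin> ?H" using ind by (auto simp: indep_insert[OF j])
  from smooth_projection[OF A] S smooth_on_nth[OF S, of j]
  obtain q where "\<forall>v\<in>?S. q v \<in> affine hull ((\<lambda>i. v $ i) ` A) \<and> (\<forall>i\<in>A. \<forall>k\<in>A. (v $ j - q v) \<bullet> (v $ i - v $ k) = 0)"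
    by (metis (no_types, lifting) order_refl)
  then have q: "q u \<in> ?H" "\<And>i k. i \<in> A \<Longrightarrow> k \<in> A \<Longrightarrow> (u $ j - q u) \<bullet> (u $ i - u $ k) = 0"
    using u(1) by blast+
  define e where "e = u $ j - q u"
  have e: "e \<noteq> 0" using q(1) u(2) by (auto simp: e_def)
  have "0 < e \<bullet> (u $ j - u $ i)" if i: "i \<in> A" for i
  proof -
    have "e \<bullet> (q u - u $ i) = 0"
      by (rule orthogonal_affine_hull[where S = "(\<lambda>i. u $ i) ` A"]) (use q i in \<open>auto simp: e_def intro: hull_inc\<close>)
    moreover have "e \<bullet> (u $ j - u $ i) = e \<bullet> e + e \<bullet> (q u - u $ i)"
      by (simp add: e_def flip: inner_add_right)
    ultimately show ?thesis using e by simp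
  qed
  then show ?thesis using q(2) by (intro exI[of _ e]) (auto simp: e_def)
qed

text \<open>Moving the centre slightly against the normal \<open>e\<close> keeps
  \<open>\<tau> - {j}\<close> on a common sphere and puts \<open>j\<close> strictly outside; the
  points that were outside stay there by continuity.\<close>

lemma Del_remove:
  fixes u :: "('l::finite, 'm::finite) config"
  assumes gp: "general_position u" and \<tau>: "\<tau> \<in> Del u" and j: "j \<in> \<tau>" and ne: "\<tau> - {j} \<noteq> {}"
  shows "\<tau> - {j} \<in> Del u"
proof -
  define A where "A = \<tau> - {j}"
  have A: "A \<noteq> {}" "j \<notin> A" "insert j A = \<tau>" using j ne by (auto simp: A_def)
  obtain e where e: "\<And>i k. i \<in> A \<Longrightarrow> k \<in> A \<Longrightarrow> e \<bullet> (u $ i - u $ k) = 0" "\<And>i. i \<in> A \<Longrightarrow> 0 < e \<bullet> (u $ j - u $ i)"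
    using separating_normal[of j A u] A Del_indep[OF gp \<tau>] by blast
  obtain c \<rho> where c: "0 < \<rho>" "\<And>i. i \<in> \<tau> \<Longrightarrow> dist (u $ i) c = \<rho>" "\<And>i. i \<notin> \<tau> \<Longrightarrow> \<rho> < dist (u $ i) c"
    using \<tau> unfolding in_Del_iff by blast
  obtain i0 where i0: "i0 \<in> A" using A by blast
  have i0\<tau>: "i0 \<in> \<tau>" using i0 by (simp add: A_def)
  define d where "d i t = dist (u $ i) (c - t *\<^sub>R e)" for i t
  have d_sq: "(d i t)\<^sup>2 = (dist (u $ i) c)\<^sup>2 + 2 * t * (e \<bullet> (u $ i - c)) + t\<^sup>2 * (e \<bullet> e)" for i t
    unfolding d_def dist_norm power2_norm_eq_inner
    by (simp add: inner_diff_left inner_diff_right inner_commute power2_eq_square algebra_simps)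
  have lim: "(d i \<longlongrightarrow> dist (u $ i) c) (at_right 0)" for i
  proof -
    have "((\<lambda>t. dist (u $ i) (c - t *\<^sub>R e)) \<longlongrightarrow> dist (u $ i) (c - 0 *\<^sub>R e)) (at_right 0)"
      by (intro tendsto_intros)
    then show ?thesis by (simp add: d_def[abs_def])
  qed
  have "\<forall>\<^sub>F t in at_right 0. 0 < d i0 t"
    using order_tendstoD(1)[OF lim, of 0 i0] c(1,2) i0\<tau> by simp
  moreover have "\<forall>\<^sub>F t in at_right 0. k \<notin> \<tau> \<longrightarrow> d i0 t < d k t" for k
  proof (cases "k \<in> \<tau>")
    case False
    have "((\<lambda>t. d k t - d i0 t) \<longlongrightarrow> dist (u $ k) c - dist (u $ i0) c) (at_right 0)"
      by (intro tendsto_diff lim)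
    then have "\<forall>\<^sub>F t in at_right 0. 0 < d k t - d i0 t"
      by (rule order_tendstoD(1)) (use c False i0\<tau> in simp)
    then show ?thesis by eventually_elim simp
  qed simp
  then have "\<forall>\<^sub>F t in at_right 0. \<forall>k. k \<notin> \<tau> \<longrightarrow> d i0 t < d k t" by (rule eventually_all_finite)
  moreover have "\<forall>\<^sub>F t in at_right 0. (0::real) < t" by (rule eventually_at_right_less)
  ultimately have "\<forall>\<^sub>F t in at_right 0. 0 < d i0 t \<and> (\<forall>k. k \<notin> \<tau> \<longrightarrow> d i0 t < d k t) \<and> 0 < t"
    by (intro eventually_conj)
  from eventually_happens'[OF trivial_limit_at_right_real this]
  obtain t where t: "0 < d i0 t" "\<And>k. k \<notin> \<tau> \<Longrightarrow> d i0 t < d k t" "0 < t" by blast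
  have d0: "0 \<le> d i t" for i by (simp add: d_def)
  have on: "d i t = d i0 t" if i: "i \<in> A" for i
  proof -
    have "e \<bullet> (u $ i - c) = e \<bullet> (u $ i0 - c)" using e(1)[OF i i0] by (simp add: inner_diff_right)
    then have "(d i t)\<^sup>2 = (d i0 t)\<^sup>2" using d_sq c(2)[of i] c(2)[OF i0\<tau>] i by (simp add: A_def)
    then show ?thesis using d0 by simp
  qed
  have "d i0 t < d j t"
  proof -
    have "e \<bullet> (u $ i0 - c) < e \<bullet> (u $ j - c)" using e(2)[OF i0] by (simp add: inner_diff_right)
    then have "(d i0 t)\<^sup>2 < (d j t)\<^sup>2" using d_sq c(2)[OF j] c(2)[OF i0\<tau>] t(3) by simp
    then show ?thesis using d0 power2_less_imp_less by blast
  qed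
  then have "d i0 t < d i t" if "i \<notin> A" for i using that t(2) by (cases "i = j") (auto simp: A_def)
  moreover have "1 \<le> card A" "card A \<le> 4"
    using A \<tau> card_mono[of \<tau> A] by (auto simp: A_def in_Del_iff Suc_le_eq card_gt_0_iff)
  ultimately show ?thesis
    using on t(1) unfolding A_def[symmetric] in_Del_iff d_def by blast
qed

lemma face_closed_Del:
  assumes gp: "general_position u"
  shows "face_closed (Del u)"
  unfolding face_closed_def
proof (intro conjI ballI allI impI)
  show "{} \<notin> Del u" by (simp add: in_Del_iff)
  fix \<tau> \<sigma> assume "\<tau> \<in> Del u" "\<sigma> \<subseteq> \<tau>" "\<sigma> \<noteq> {}"
  then show "\<sigma> \<in> Del u"
  proof (induction "card (\<tau> - \<sigma>)" arbitrary: \<tau>)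
    case 0
    then have "\<tau> = \<sigma>" by simp
    then show ?case using 0 by simp
  next
    case (Suc n)
    then obtain j where j: "j \<in> \<tau> - \<sigma>" by (metis card.empty ex_in_conv nat.distinct(1))
    have "\<tau> - {j} \<in> Del u" using j Suc.prems by (intro Del_remove[OF gp]) auto
    moreover have "(\<tau> - {j}) - \<sigma> = (\<tau> - \<sigma>) - {j}" by auto
    then have "n = card ((\<tau> - {j}) - \<sigma>)" using Suc.hyps(2) j by simp
    ultimately show ?case using Suc.hyps(1)[of "\<tau> - {j}"] Suc.prems j by blast
  qed
qed

text \<open>A sphere through \<open>u $ i\<close> whose diameter is below the distance to every
  other point has no further point on or inside it.\<close>

lemma singleton_in_Del:
  fixes u :: "('l::finite, 'm::finite) config"
  assumes "distinct_points u"
  shows "{i} \<in> Del u"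
proof -
  have "\<forall>\<^sub>F \<rho> in at_right 0. j \<noteq> i \<longrightarrow> 2 * \<rho> < dist (u $ j) (u $ i)" for j
  proof (cases "j = i")
    case False
    then have "0 < dist (u $ j) (u $ i) / 2" using assms by (auto simp: distinct_points_def dest: injD)
    from eventually_at_right_real[OF this] show ?thesis by eventually_elim simp
  qed simp
  then have "\<forall>\<^sub>F \<rho> in at_right 0. \<forall>j. j \<noteq> i \<longrightarrow> 2 * \<rho> < dist (u $ j) (u $ i)" by (rule eventually_all_finite)
  then have "\<forall>\<^sub>F \<rho> in at_right 0. (\<forall>j. j \<noteq> i \<longrightarrow> 2 * \<rho> < dist (u $ j) (u $ i)) \<and> (0::real) < \<rho>"
    by (intro eventually_conj eventually_at_right_less)
  from eventually_happens'[OF trivial_limit_at_right_real this]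
  obtain \<rho> where \<rho>: "\<And>j. j \<noteq> i \<Longrightarrow> 2 * \<rho> < dist (u $ j) (u $ i)" "0 < \<rho>" by blast
  obtain b :: "real^'l" where b: "b \<in> Basis" using nonempty_Basis by blast
  define c where "c = u $ i + \<rho> *\<^sub>R b"
  have ci: "dist (u $ i) c = \<rho>" using b \<rho>(2) by (simp add: c_def dist_norm)
  have "\<rho> < dist (u $ j) c" if "j \<noteq> i" for j
    using dist_triangle[of "u $ j" "u $ i" c] \<rho>(1)[OF that] ci by (simp add: dist_commute)
  then show ?thesis using ci \<rho>(2) unfolding in_Del_iff by auto
qed

text \<open>The smallest empty sphere through \<open>Q\<close> is the circumsphere of the set of all points on it:
  otherwise its centre could be moved towards that of the smaller circumsphere.\<close>

lemma attaching_exists: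
  fixes u :: "('l::finite, 'm::finite) config"
  assumes gp: "general_position u" and t: "0 < t" and Q: "Q \<in> selective u UNIV t" and card: "2 \<le> card Q"
  shows "\<exists>\<tau>. Q \<subseteq> \<tau> \<and> 2 \<le> card \<tau> \<and> attaching_simplex u \<tau> \<and> circumradius u \<tau> < t"
proof -
  obtain c0 R0 where c0: "R0 < t\<^sup>2" "\<And>q. q \<in> Q \<Longrightarrow> (dist (u $ q) c0)\<^sup>2 \<le> R0" "\<And>p. R0 \<le> (dist (u $ p) c0)\<^sup>2"
    using Q by (auto simp: selective_def)
  obtain q0 q1 where q01: "q0 \<in> Q" "q1 \<in> Q" "q0 \<noteq> q1" using card by (rule two_le_cardE)
  \<comment> \<open>The centres for which all points of \<open>Q\<close> are nearest in the cloud,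
    that is, the centres of empty spheres through \<open>Q\<close>. The set is closed, so one with
    least radius exists.\<close>
  define F where "F = {c. \<forall>q\<in>Q. \<forall>p. dist (u $ q) c \<le> dist (u $ p) c}"
  have "closed F"
    unfolding F_def Collect_ball_eq Collect_all_eq
    by (intro closed_INT ballI closed_Collect_le continuous_intros)
  moreover have c0F: "c0 \<in> F"
  proof -
    have "dist (u $ q) c0 \<le> dist (u $ p) c0" if "q \<in> Q" for q p
      by (rule power2_le_imp_le[OF order_trans[OF c0(2)[OF that] c0(3)]]) simp
    then show ?thesis by (simp add: F_def)
  qed
  ultimately obtain c where cF: "c \<in> F" and c_min: "\<And>c'. c' \<in> F \<Longrightarrow> dist (u $ q0) c \<le> dist (u $ q0) c'"
    using distance_attains_inf[of F "u $ q0"] by blast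
  define \<rho> where "\<rho> = dist (u $ q0) c"
  have le: "\<rho> \<le> dist (u $ p) c" for p using cF q01(1) by (simp add: F_def \<rho>_def)
  have onQ: "dist (u $ q) c = \<rho>" if "q \<in> Q" for q
    using cF that q01(1) by (auto simp: F_def \<rho>_def intro: antisym)
  have "u $ q0 \<noteq> u $ q1" using gp q01 by (auto simp: general_position_def distinct_points_def dest: injD)
  then have \<rho>: "0 < \<rho>" using onQ[OF q01(1)] onQ[OF q01(2)] by (metis dist_eq_0_iff zero_le_dist less_eq_real_def)
  define \<tau> where "\<tau> = {i. dist (u $ i) c = \<rho>}"
  have Q\<tau>: "Q \<subseteq> \<tau>" using onQ by (auto simp: \<tau>_def)
  have card2: "2 \<le> card \<tau>" using card card_mono[OF _ Q\<tau>] by simp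
  have card4: "card \<tau> \<le> 4"
  proof (rule ccontr)
    assume "\<not> card \<tau> \<le> 4"
    then obtain S where S: "S \<subseteq> \<tau>" "card S = 5" using obtain_subset_with_card_n[of 5 \<tau>] by auto
    then have "(\<lambda>i. u $ i) ` S \<subseteq> sphere c \<rho>" by (auto simp: \<tau>_def dist_commute)
    then show False using gp S(2) unfolding general_position_def by blast
  qed
  have lt: "\<rho> < dist (u $ i) c" if "i \<notin> \<tau>" for i using le[of i] that by (simp add: \<tau>_def)
  have Del: "\<tau> \<in> Del u"
    unfolding in_Del_iff using card2 card4 \<rho> lt by (auto simp: \<tau>_def)
  have ind: "indep \<tau> u" by (rule Del_indep[OF gp Del])
  define c1 \<rho>1 where "c1 = circumcentre u \<tau>" and "\<rho>1 = circumradius u \<tau>"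
  have pyth: "\<rho>\<^sup>2 = \<rho>1\<^sup>2 + (dist c1 c)\<^sup>2"
    unfolding c1_def \<rho>1_def by (rule circumradius_minimal(2)[OF ind card2]) (simp add: \<tau>_def)
  have on1: "dist (u $ i) c1 = \<rho>1" if "i \<in> \<tau>" for i
    using circumsphere(2)[OF ind card2 that] by (simp add: c1_def \<rho>1_def)
  have "c1 = c"
  proof (rule ccontr)
    assume ne: "c1 \<noteq> c"
    then have "\<rho>1\<^sup>2 < \<rho>\<^sup>2" using pyth by simp
    \<comment> \<open>Along the pencil from \<open>c\<close> to \<open>c1\<close> the points of
      \<open>\<tau>\<close> stay on the sphere, the others stay outside for small
      \<open>\<theta>\<close>, and the squared radius \<open>R \<theta>\<close> drops below
      \<open>\<rho>\<^sup>2\<close>, against minimality.\<close>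
    define R where "R \<theta> = (1 - \<theta>) * \<rho>\<^sup>2 + \<theta> * \<rho>1\<^sup>2 - \<theta> * (1 - \<theta>) * (dist c1 c)\<^sup>2" for \<theta>
    define cc where "cc \<theta> = (1 - \<theta>) *\<^sub>R c + \<theta> *\<^sub>R c1" for \<theta>
    have pen: "(dist p (cc \<theta>))\<^sup>2 - R \<theta> = (1 - \<theta>) * ((dist p c)\<^sup>2 - \<rho>\<^sup>2) + \<theta> * ((dist p c1)\<^sup>2 - \<rho>1\<^sup>2)" for p \<theta>
      unfolding cc_def R_def by (rule pencil_identity)
    have "\<forall>\<^sub>F \<theta> in at_right 0. i \<notin> \<tau> \<longrightarrow> 0 < (1 - \<theta>) * ((dist (u $ i) c)\<^sup>2 - \<rho>\<^sup>2) + \<theta> * ((dist (u $ i) c1)\<^sup>2 - \<rho>1\<^sup>2)" for i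
    proof (cases "i \<in> \<tau>")
      case False
      have "((\<lambda>\<theta>. (1 - \<theta>) * ((dist (u $ i) c)\<^sup>2 - \<rho>\<^sup>2) + \<theta> * ((dist (u $ i) c1)\<^sup>2 - \<rho>1\<^sup>2)) \<longlongrightarrow>
         (1 - 0) * ((dist (u $ i) c)\<^sup>2 - \<rho>\<^sup>2) + 0 * ((dist (u $ i) c1)\<^sup>2 - \<rho>1\<^sup>2)) (at_right 0)"
        by (intro tendsto_intros)
      moreover have "\<rho>\<^sup>2 < (dist (u $ i) c)\<^sup>2" using lt[OF False] \<rho> by (intro power_strict_mono) auto
      ultimately have "\<forall>\<^sub>F \<theta> in at_right 0. 0 < (1 - \<theta>) * ((dist (u $ i) c)\<^sup>2 - \<rho>\<^sup>2) + \<theta> * ((dist (u $ i) c1)\<^sup>2 - \<rho>1\<^sup>2)"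
        by (intro order_tendstoD(1)) auto
      then show ?thesis by eventually_elim simp
    qed simp
    then have "\<forall>\<^sub>F \<theta> in at_right 0. \<forall>i. i \<notin> \<tau> \<longrightarrow> 0 < (1 - \<theta>) * ((dist (u $ i) c)\<^sup>2 - \<rho>\<^sup>2) + \<theta> * ((dist (u $ i) c1)\<^sup>2 - \<rho>1\<^sup>2)"
      by (rule eventually_all_finite)
    then have "\<forall>\<^sub>F \<theta> in at_right 0. (\<forall>i. i \<notin> \<tau> \<longrightarrow> 0 < (1 - \<theta>) * ((dist (u $ i) c)\<^sup>2 - \<rho>\<^sup>2) + \<theta> * ((dist (u $ i) c1)\<^sup>2 - \<rho>1\<^sup>2))
       \<and> \<theta> \<in> {0<..<1}"
      by (intro eventually_conj eventually_at_right_real) auto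
    from eventually_happens'[OF trivial_limit_at_right_real this] obtain \<theta> where \<theta>: "0 < \<theta>" "\<theta> < 1"
      and pos: "\<And>i. i \<notin> \<tau> \<Longrightarrow> 0 < (1 - \<theta>) * ((dist (u $ i) c)\<^sup>2 - \<rho>\<^sup>2) + \<theta> * ((dist (u $ i) c1)\<^sup>2 - \<rho>1\<^sup>2)"
      by auto
    have on: "(dist (u $ i) (cc \<theta>))\<^sup>2 = R \<theta>" if "i \<in> \<tau>" for i
      using pen[of "u $ i" \<theta>] on1[OF that] that by (simp add: \<tau>_def)
    have off: "R \<theta> \<le> (dist (u $ i) (cc \<theta>))\<^sup>2" for i
      using on[of i] pos[of i] pen[of "u $ i" \<theta>] by (cases "i \<in> \<tau>") auto
    have "dist (u $ q) (cc \<theta>) \<le> dist (u $ p) (cc \<theta>)" if "q \<in> Q" for q p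
    proof (rule power2_le_imp_le)
      have "q \<in> \<tau>" using that Q\<tau> by blast
      then show "(dist (u $ q) (cc \<theta>))\<^sup>2 \<le> (dist (u $ p) (cc \<theta>))\<^sup>2" using off[of p] by (simp only: on)
    qed simp
    then have "cc \<theta> \<in> F" by (simp add: F_def)
    then have "\<rho> \<le> dist (u $ q0) (cc \<theta>)" using c_min by (simp add: \<rho>_def)
    then have "\<rho>\<^sup>2 \<le> R \<theta>" using on[of q0] q01(1) Q\<tau> \<rho> by (metis less_imp_le power_mono subsetD)
    moreover have "R \<theta> \<le> (1 - \<theta>) * \<rho>\<^sup>2 + \<theta> * \<rho>1\<^sup>2" using \<theta> by (simp add: R_def)
    moreover have "\<theta> * \<rho>1\<^sup>2 < \<theta> * \<rho>\<^sup>2" using \<theta>(1) \<open>\<rho>1\<^sup>2 < \<rho>\<^sup>2\<close> by simp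
    ultimately show False by (simp add: left_diff_distrib)
  qed
  moreover have "\<rho>1 = \<rho>" using pyth \<open>c1 = c\<close> \<rho> circumsphere(3)[OF ind card2] by (simp add: \<rho>1_def)
  ultimately have "attaching_simplex u \<tau>"
    using card2 Del le by (subst attaching_simplex_iff) (auto simp: c1_def \<rho>1_def)
  moreover have "\<rho> < t"
  proof -
    have "\<rho>\<^sup>2 \<le> (dist (u $ q0) c0)\<^sup>2" using c_min[OF c0F] \<rho> by (intro power_mono) (auto simp: \<rho>_def)
    also have "\<dots> < t\<^sup>2" using c0(1,2) q01(1) by (meson le_less_trans)
    finally show ?thesis using t by (auto intro: power2_less_imp_less)
  qed
  ultimately show ?thesis using Q\<tau> card2 \<open>\<rho>1 = \<rho>\<close> by (auto simp: \<rho>1_def)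
qed

lemma attaching_subset_selective:
  assumes gp: "general_position u" and \<tau>: "attaching_simplex u \<tau>" "2 \<le> card \<tau>" "circumradius u \<tau> < t"
  shows "\<tau> \<in> selective u UNIV t"
proof -
  have Del: "\<tau> \<in> Del u" and le: "\<And>i. circumradius u \<tau> \<le> dist (u $ i) (circumcentre u \<tau>)"
    using \<tau>(1,2) by (auto simp: attaching_simplex_iff)
  note cs = circumsphere[OF Del_indep[OF gp Del] \<tau>(2)]
  show ?thesis
  proof (rule selectiveI[where c = "circumcentre u \<tau>" and R = "(circumradius u \<tau>)\<^sup>2"])
    show "\<tau> \<noteq> {}" using \<tau>(2) by auto
    show "(circumradius u \<tau>)\<^sup>2 < t\<^sup>2" using \<tau>(3) cs(3) by (intro power_strict_mono) auto
    show "(dist (u $ q) (circumcentre u \<tau>))\<^sup>2 \<le> (circumradius u \<tau>)\<^sup>2" if "q \<in> \<tau>" for q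
      using cs(2)[OF that] by simp
    show "(circumradius u \<tau>)\<^sup>2 \<le> (dist (u $ e) (circumcentre u \<tau>))\<^sup>2" for e
      using le[of e] cs(3) by (intro power_mono) auto
  qed
qed

text \<open>Circumspheres of attaching simplices are empty; conversely
  \<open>attaching_exists\<close> replaces an empty sphere through a simplex by the circumsphere of
  an attaching coface.\<close>

lemma Alp_eq_selective:
  assumes gp: "general_position u" and t: "0 < t"
  shows "Alp u t = selective u UNIV t"
proof (intro set_eqI iffI)
  fix \<sigma> assume "\<sigma> \<in> Alp u t"
  then consider i where "\<sigma> = {i}" | \<tau> where "\<sigma> \<noteq> {}" "\<sigma> \<subseteq> \<tau>" "2 \<le> card \<tau>" "attaching_simplex u \<tau>" "circumradius u \<tau> < t"
    by (auto simp: Alp_def)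
  then show "\<sigma> \<in> selective u UNIV t"
  proof cases
    case 1
    then show ?thesis using t by (intro selectiveI[where c = "u $ i" and R = 0]) auto
  next
    case 2
    then show ?thesis
      using face_closedD[OF selective_face_closed attaching_subset_selective[OF gp]] by blast
  qed
next
  fix \<sigma> assume \<sigma>: "\<sigma> \<in> selective u UNIV t"
  then have "\<sigma> \<noteq> {}" by (simp add: selective_def)
  then have "0 < card \<sigma>" by (simp add: card_gt_0_iff)
  then consider "card \<sigma> = 1" | "2 \<le> card \<sigma>" by linarith
  then show "\<sigma> \<in> Alp u t"
  proof cases
    case 1
    then show ?thesis by (auto simp: card_1_singleton_iff Alp_def)
  next
    case 2
    then show ?thesis using attaching_exists[OF gp t \<sigma> 2] \<open>\<sigma> \<noteq> {}\<close> by (auto simp: Alp_def)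
  qed
qed

text \<open>The candidates for attaching \<open>\<sigma>\<close>; \<open>Alp_birth_eq\<close>
  identifies its birth radius with the least circumradius among them.\<close>

definition cofaces :: "('l::finite, 'm::finite) config \<Rightarrow> 'm set \<Rightarrow> 'm set set" where
  "cofaces u \<sigma> = {\<tau>. \<sigma> \<subseteq> \<tau> \<and> 2 \<le> card \<tau> \<and> attaching_simplex u \<tau>}"

lemma in_Alp_iff:
  assumes "\<sigma> \<noteq> {}" "card \<sigma> \<noteq> 1"
  shows "\<sigma> \<in> Alp u t \<longleftrightarrow> (\<exists>\<tau>\<in>cofaces u \<sigma>. circumradius u \<tau> < t)"
proof -
  have "\<sigma> \<notin> {{i} |i. True}" using assms(2) by auto
  then show ?thesis using assms(1) unfolding Alp_def cofaces_def by blast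
qed

lemma cofaces_nonempty:
  assumes gp: "general_position u" and \<sigma>: "\<sigma> \<in> Del u" "card \<sigma> \<noteq> 1"
  shows "cofaces u \<sigma> \<noteq> {}"
proof -
  have card: "2 \<le> card \<sigma>" using \<sigma> by (simp add: in_Del_iff)
  obtain c \<rho> where c: "0 < \<rho>" "\<And>i. i \<in> \<sigma> \<Longrightarrow> dist (u $ i) c = \<rho>" "\<And>i. i \<notin> \<sigma> \<Longrightarrow> \<rho> < dist (u $ i) c"
    using \<sigma>(1) unfolding in_Del_iff by blast
  have "\<sigma> \<in> selective u UNIV (\<rho> + 1)"
  proof (rule selectiveI[where c = c and R = "\<rho>\<^sup>2"])
    show "\<sigma> \<noteq> {}" using card by auto
    show "\<rho>\<^sup>2 < (\<rho> + 1)\<^sup>2" using c(1) by (intro power_strict_mono) auto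
    show "\<rho>\<^sup>2 \<le> (dist (u $ e) c)\<^sup>2" for e
      using c(1) c(2)[of e] c(3)[of e] by (cases "e \<in> \<sigma>") (auto intro!: power_mono)
  qed (use c in simp)
  from attaching_exists[OF gp _ this card] c(1) show ?thesis unfolding cofaces_def by auto
qed

lemma Alp_birth_vertex: "card \<sigma> = 1 \<Longrightarrow> Alp_birth u \<sigma> = 0"
  by (auto simp: card_1_singleton_iff Alp_birth_def Alp_def greaterThan_def[symmetric])

lemma Alp_birth_eq:
  assumes gp: "general_position u" and \<sigma>: "\<sigma> \<in> Del u" "card \<sigma> \<noteq> 1"
  shows "Alp_birth u \<sigma> = Min (circumradius u ` cofaces u \<sigma>)"
proof -
  have fin: "finite (circumradius u ` cofaces u \<sigma>)" "circumradius u ` cofaces u \<sigma> \<noteq> {}"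
    using cofaces_nonempty[OF assms] by auto
  have pos: "0 < circumradius u \<tau>" if "\<tau> \<in> cofaces u \<sigma>" for \<tau>
  proof -
    have "\<tau> \<in> Del u" "2 \<le> card \<tau>" using that by (auto simp: cofaces_def attaching_simplex_def)
    then show ?thesis using circumsphere(3)[OF Del_indep[OF gp]] by blast
  qed
  have "\<sigma> \<noteq> {}" using \<sigma>(1) by (auto simp: in_Del_iff)
  note in_Alp = in_Alp_iff[OF this \<sigma>(2), of u]
  define m where "m = Min (circumradius u ` cofaces u \<sigma>)"
  have "m < \<alpha> \<longleftrightarrow> \<sigma> \<in> Alp u \<alpha>" for \<alpha>
    unfolding m_def in_Alp Min_less_iff[OF fin] by simp
  moreover have "0 < m" unfolding m_def Min_gr_iff[OF fin] using pos by simp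
  ultimately have "{\<alpha>. \<alpha> > 0 \<and> \<sigma> \<in> Alp u \<alpha>} = {m<..}"
    by (metis (no_types, lifting) Collect_cong greaterThan_def order.strict_trans)
  then show ?thesis by (simp add: Alp_birth_def m_def)
qed

lemma Alp_birth_attained:
  assumes gp: "general_position u" and \<sigma>: "\<sigma> \<in> Del u" "card \<sigma> \<noteq> 1"
  shows "\<exists>\<tau>\<in>cofaces u \<sigma>. Alp_birth u \<sigma> = circumradius u \<tau> \<and> (\<forall>\<tau>'\<in>cofaces u \<sigma>. circumradius u \<tau> \<le> circumradius u \<tau>')"
proof -
  have "Min (circumradius u ` cofaces u \<sigma>) \<in> circumradius u ` cofaces u \<sigma>"
    using cofaces_nonempty[OF assms] by (intro Min_in) auto
  then obtain \<tau> where \<tau>: "\<tau> \<in> cofaces u \<sigma>" "Min (circumradius u ` cofaces u \<sigma>) = circumradius u \<tau>" by blast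
  have "circumradius u \<tau> \<le> circumradius u \<tau>'" if "\<tau>' \<in> cofaces u \<sigma>" for \<tau>'
    unfolding \<tau>(2)[symmetric] using that by (intro Min_le) auto
  then show ?thesis using Alp_birth_eq[OF assms] \<tau> by auto
qed

text \<open>The circumsphere of a coface passes through the points of \<open>\<tau>\<close>, so its
  radius is at least the circumradius of \<open>\<tau>\<close>.\<close>

lemma Alp_birth_attaching:
  assumes gp: "general_position u" and \<tau>: "attaching_simplex u \<tau>" "card \<tau> \<noteq> 1"
  shows "Alp_birth u \<tau> = circumradius u \<tau>"
proof -
  have Del: "\<tau> \<in> Del u" using \<tau>(1) by (simp add: attaching_simplex_def)
  then have card: "2 \<le> card \<tau>" using \<tau>(2) by (simp add: in_Del_iff)
  have "\<tau> \<in> cofaces u \<tau>" using \<tau> card by (simp add: cofaces_def)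
  moreover have "circumradius u \<tau> \<le> circumradius u \<tau>'" if \<tau>': "\<tau>' \<in> cofaces u \<tau>" for \<tau>'
  proof -
    have "\<tau>' \<in> Del u" "2 \<le> card \<tau>'" "\<tau> \<subseteq> \<tau>'" using \<tau>' by (auto simp: cofaces_def attaching_simplex_def)
    note cs = circumsphere(2)[OF Del_indep[OF gp this(1)] this(2)]
    show ?thesis
      by (rule circumradius_minimal(1)[OF Del_indep[OF gp Del] card, of "circumcentre u \<tau>'"])
        (use cs \<open>\<tau> \<subseteq> \<tau>'\<close> in blast)
  qed
  ultimately show ?thesis
    using Alp_birth_attained[OF gp Del \<tau>(2)] by (metis order_antisym)
qed

lemma Alp_birth_nonneg:
  assumes gp: "general_position u" and \<sigma>: "\<sigma> \<in> Del u"
  shows "0 \<le> Alp_birth u \<sigma>" and "card \<sigma> \<noteq> 1 \<Longrightarrow> 0 < Alp_birth u \<sigma>"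
proof -
  have *: "0 < Alp_birth u \<sigma>" if card: "card \<sigma> \<noteq> 1"
  proof -
    obtain \<tau> where \<tau>: "\<tau> \<in> cofaces u \<sigma>" "Alp_birth u \<sigma> = circumradius u \<tau>"
      using Alp_birth_attained[OF gp \<sigma> card] by blast
    then have "\<tau> \<in> Del u" "2 \<le> card \<tau>" by (auto simp: cofaces_def attaching_simplex_def)
    then show ?thesis using \<tau>(2) circumsphere(3)[OF Del_indep[OF gp]] by simp
  qed
  then show "card \<sigma> \<noteq> 1 \<Longrightarrow> 0 < Alp_birth u \<sigma>" .
  show "0 \<le> Alp_birth u \<sigma>" using * Alp_birth_vertex[of \<sigma> u] by (cases "card \<sigma> = 1") auto
qed

lemma Alp_sublevel:
  assumes gp: "general_position u" and t: "0 < t"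
  shows "Alp u t = {\<sigma> \<in> Del u. Alp_birth u \<sigma> < t}"
proof (intro set_eqI iffI)
  fix \<sigma> assume \<sigma>: "\<sigma> \<in> Alp u t"
  show "\<sigma> \<in> {\<sigma> \<in> Del u. Alp_birth u \<sigma> < t}"
  proof (cases "card \<sigma> = 1")
    case True
    then show ?thesis using Alp_birth_vertex[of \<sigma> u] t singleton_in_Del gp
      by (auto simp: card_1_singleton_iff general_position_def)
  next
    case False
    have ne: "\<sigma> \<noteq> {}" using \<sigma> by (auto simp: Alp_def)
    obtain \<tau> where \<tau>: "\<tau> \<in> cofaces u \<sigma>" "circumradius u \<tau> < t" using \<sigma> in_Alp_iff[OF ne False] by blast
    then have "\<tau> \<in> Del u" "\<sigma> \<subseteq> \<tau>" by (auto simp: cofaces_def attaching_simplex_def)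
    then have Del: "\<sigma> \<in> Del u" using face_closedD[OF face_closed_Del[OF gp]] ne by blast
    have "Alp_birth u \<sigma> \<le> circumradius u \<tau>"
      unfolding Alp_birth_eq[OF gp Del False] using \<tau>(1) by (intro Min_le) auto
    then show ?thesis using Del \<tau>(2) by simp
  qed
next
  fix \<sigma> assume \<sigma>: "\<sigma> \<in> {\<sigma> \<in> Del u. Alp_birth u \<sigma> < t}"
  show "\<sigma> \<in> Alp u t"
  proof (cases "card \<sigma> = 1")
    case True
    then show ?thesis by (auto simp: card_1_singleton_iff Alp_def)
  next
    case False
    have ne: "\<sigma> \<noteq> {}" using \<sigma> by (auto simp: in_Del_iff)
    show ?thesis using Alp_birth_attained[of u \<sigma>] \<sigma> False gp by (auto simp: in_Alp_iff[OF ne False])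
  qed
qed

text \<open>If \<open>\<sigma>\<close> were born earlier, it would belong to the complex at the
  birth radius of \<open>\<tau>\<close>. That complex is closed under faces, so it would contain
  \<open>\<tau>\<close>, which enters only at larger parameters.\<close>

lemma Alp_birth_mono:
  assumes gp: "general_position u" and "\<sigma> \<in> Del u" "\<tau> \<in> Del u" "\<tau> \<subset> \<sigma>"
  shows "Alp_birth u \<tau> \<le> Alp_birth u \<sigma>"
proof (rule ccontr)
  assume "\<not> Alp_birth u \<tau> \<le> Alp_birth u \<sigma>"
  then have less: "Alp_birth u \<sigma> < Alp_birth u \<tau>" by simp
  then have pos: "0 < Alp_birth u \<tau>" using Alp_birth_nonneg(1)[OF gp assms(2)] by simp
  have "\<sigma> \<in> Alp u (Alp_birth u \<tau>)" using Alp_sublevel[OF gp pos] assms(2) less by simp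
  then have "\<tau> \<in> Alp u (Alp_birth u \<tau>)"
    unfolding Alp_eq_selective[OF gp pos]
    using face_closedD[OF selective_face_closed] assms(3,4) by (metis in_Del_iff card.empty not_one_le_zero psubset_imp_subset)
  then show False using Alp_sublevel[OF gp pos] by simp
qed

section \<open>Local structure of the birth radii\<close>

lemma eventually_less_of_tendsto:
  fixes f g :: "'a \<Rightarrow> real"
  assumes "(f \<longlongrightarrow> a) F" "(g \<longlongrightarrow> b) F" "a < b"
  shows "\<forall>\<^sub>F x in F. f x < g x"
proof -
  have "((\<lambda>x. g x - f x) \<longlongrightarrow> b - a) F" by (intro tendsto_diff assms)
  then have "\<forall>\<^sub>F x in F. 0 < g x - f x" by (rule order_tendstoD(1)) (use assms(3) in simp)
  then show ?thesis by eventually_elim simp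
qed

lemma eventually_neq_of_tendsto:
  fixes f g :: "'a \<Rightarrow> real"
  assumes "(f \<longlongrightarrow> a) F" "(g \<longlongrightarrow> b) F" "a \<noteq> b"
  shows "\<forall>\<^sub>F x in F. f x \<noteq> g x"
proof (cases "a < b")
  case True
  from eventually_less_of_tendsto[OF assms(1,2) this] show ?thesis by eventually_elim simp
next
  case False
  then have "b < a" using assms(3) by simp
  from eventually_less_of_tendsto[OF assms(2,1) this] show ?thesis by eventually_elim simp
qed

lemma tendsto_nth_nhds: "((\<lambda>v. v $ i) \<longlongrightarrow> u $ i) (nhds u)"
  by (intro tendsto_vec_nth filterlim_ident)

lemma smooth_on_tendsto_nhds:
  assumes "smooth_on S f" "open S" "u \<in> S"
  shows "(f \<longlongrightarrow> f u) (nhds u)"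
proof -
  have "isCont f u" using smooth_on_continuous[OF assms(1)] assms(2,3) continuous_on_eq_continuous_at by blast
  then show ?thesis by (simp add: continuous_at tendsto_at_iff_tendsto_nhds)
qed

lemma eventually_indep: "indep A u \<Longrightarrow> \<forall>\<^sub>F v in nhds u. indep A v"
  using open_indep[of A] by (auto simp: eventually_nhds)

lemma tendsto_circumsphere:
  fixes u :: "('l::finite, 'm::finite) config"
  assumes "indep A u" "2 \<le> card A"
  shows "((\<lambda>v. circumcentre v A) \<longlongrightarrow> circumcentre u A) (nhds u)"
    and "((\<lambda>v. circumradius v A) \<longlongrightarrow> circumradius u A) (nhds u)"
  using smooth_circumcentre_circumradius[OF assms(2), where ?'l = 'l] open_indep assms(1)
  by (auto intro: smooth_on_tendsto_nhds)

text \<open>In dimension three, four independent points span the space, so the centre of any sphere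
  through them is their circumcentre. This trades the quantifier over spheres for one equation
  between continuous functions, which makes non-cosphericity an open condition.\<close>

lemma circumsphere_unique:
  fixes v :: "('l::finite, 'm::finite) config"
  assumes l: "CARD('l) = 3" and ind: "indep A v" and card: "card A = 4"
    and sub: "A \<subseteq> S" "i \<in> S" "(\<lambda>i. v $ i) ` S \<subseteq> sphere c \<rho>"
  shows "dist (v $ i) (circumcentre v A) = circumradius v A"
proof -
  have on: "dist (v $ k) c = \<rho>" if "k \<in> S" for k using sub(3) that by (auto simp: dist_commute)
  have "card ((\<lambda>i. v $ i) ` A) = Suc (DIM(real^'l))"
    using ind card l by (simp add: indep_def card_image)
  then have "affine hull ((\<lambda>i. v $ i) ` A) = UNIV"
    using ind by (intro affine_independent_span_eq) (simp_all add: indep_def)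
  then have c: "c \<in> affine hull ((\<lambda>i. v $ i) ` A)" by simp
  have card2: "2 \<le> card A" using card by simp
  then obtain k where k: "k \<in> A" by fastforce
  have 1: "\<rho>\<^sup>2 = (circumradius v A)\<^sup>2 + (dist (circumcentre v A) c)\<^sup>2"
    by (rule circumradius_minimal(2)[OF ind card2]) (use on sub in blast)
  have 2: "(circumradius v A)\<^sup>2 = \<rho>\<^sup>2 + (dist c (circumcentre v A))\<^sup>2"
    by (rule circumscribed_pythagoras[OF c _ circumsphere(2)[OF ind card2] k]) (use on sub in blast)+
  have eq: "c = circumcentre v A" using 1 2 by (simp add: dist_commute)
  then have "\<rho>\<^sup>2 = (circumradius v A)\<^sup>2" using 1 by simp
  moreover have "0 \<le> \<rho>" using on[OF sub(2)] zero_le_dist by metis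
  ultimately have "\<rho> = circumradius v A" using circumsphere(3)[OF ind card2] by simp
  then show ?thesis using on[OF sub(2)] eq by simp
qed

text \<open>With a further point on the circumsphere, all cloud points on that sphere would form a
  second attaching simplex of the same circumradius, against the distinctness of radii in
  \<open>U_Alp\<close>.\<close>

lemma attaching_simplex_strict:
  assumes u: "u \<in> U_Alp" and \<tau>: "attaching_simplex u \<tau>" "card \<tau> \<noteq> 1" and i: "i \<notin> \<tau>"
  shows "circumradius u \<tau> < dist (u $ i) (circumcentre u \<tau>)"
proof (rule ccontr)
  have gp: "general_position u" using u by (simp add: U_Alp_iff)
  have Del: "\<tau> \<in> Del u" and le: "\<And>i. circumradius u \<tau> \<le> dist (u $ i) (circumcentre u \<tau>)"
    using \<tau> by (auto simp: attaching_simplex_iff)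
  have card2: "2 \<le> card \<tau>" using Del \<tau>(2) by (simp add: in_Del_iff)
  define c \<rho> where "c = circumcentre u \<tau>" and "\<rho> = circumradius u \<tau>"
  note cs = circumsphere[OF Del_indep[OF gp Del] card2, folded c_def \<rho>_def]
  assume "\<not> circumradius u \<tau> < dist (u $ i) (circumcentre u \<tau>)"
  then have i_on: "dist (u $ i) c = \<rho>" using le[of i] by (simp add: c_def \<rho>_def)
  define \<tau>' where "\<tau>' = {k. dist (u $ k) c = \<rho>}"
  have sub: "\<tau> \<subseteq> \<tau>'" "i \<in> \<tau>'" using cs(2) i_on by (auto simp: \<tau>'_def)
  have card2': "2 \<le> card \<tau>'" using card2 card_mono[OF _ sub(1)] by simp
  have card4: "card \<tau>' \<le> 4"
  proof (rule ccontr)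
    assume "\<not> card \<tau>' \<le> 4"
    then obtain S where S: "S \<subseteq> \<tau>'" "card S = 5" using obtain_subset_with_card_n[of 5 \<tau>'] by auto
    then have "(\<lambda>i. u $ i) ` S \<subseteq> sphere c \<rho>" by (auto simp: \<tau>'_def dist_commute)
    then show False using gp S(2) unfolding general_position_def by blast
  qed
  have lt: "\<rho> < dist (u $ k) c" if "k \<notin> \<tau>'" for k
    using le[of k] that by (simp add: \<tau>'_def c_def \<rho>_def)
  have Del': "\<tau>' \<in> Del u"
    unfolding in_Del_iff using card2' card4 cs(3) lt by (auto simp: \<tau>'_def)
  have "c \<in> affine hull ((\<lambda>i. u $ i) ` \<tau>')"
    using cs(1) hull_mono[OF image_mono[OF sub(1)], of affine "\<lambda>i. u $ i"] by blast
  then have "min_circumball u \<tau>' = (c, \<rho>)"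
    using sub cs(3) by (intro min_circumball_eq) (auto simp: \<tau>'_def)
  then have eq: "circumcentre u \<tau>' = c" "circumradius u \<tau>' = \<rho>" by (simp_all add: circumcentre_def circumradius_def)
  have att': "attaching_simplex u \<tau>'"
    using card2' Del' le by (subst attaching_simplex_iff) (auto simp: eq c_def \<rho>_def)
  have "Alp_birth u \<tau>' = Alp_birth u \<tau>"
    using Alp_birth_attaching[OF gp att'] Alp_birth_attaching[OF gp \<tau>] card2' eq(2) by (simp add: \<rho>_def)
  moreover have "\<tau>' \<noteq> \<tau>" using i sub by blast
  ultimately show False using u att' \<tau> card2' by (auto simp: U_Alp_iff)
qed

lemma eventually_general_position:
  fixes u :: "('l::finite, 'm::finite) config"
  assumes l: "CARD('l) = 3" and gp: "general_position u"
  shows "\<forall>\<^sub>F v in nhds u. general_position v"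
proof -
  have ev_ind: "\<forall>\<^sub>F v in nhds u. \<forall>A. A \<noteq> {} \<longrightarrow> card A \<le> 4 \<longrightarrow> indep A v"
  proof (rule eventually_all_finite)
    fix A :: "'m set"
    show "\<forall>\<^sub>F v in nhds u. A \<noteq> {} \<longrightarrow> card A \<le> 4 \<longrightarrow> indep A v"
    proof (cases "A \<noteq> {} \<and> card A \<le> 4")
      case True
      then have "indep A u" using gp by (simp add: general_position_def)
      from eventually_indep[OF this] show ?thesis by eventually_elim simp
    qed auto
  qed
  \<comment> \<open>Five points contain an independent quadruple whose circumsphere misses one of
    the five; this inequality persists near \<open>u\<close>.\<close>
  have ev_sph: "\<forall>\<^sub>F v in nhds u. \<forall>S. card S = 5 \<longrightarrow> (\<exists>A i. A \<subseteq> S \<and> card A = 4 \<and> i \<in> S \<and>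
      dist (v $ i) (circumcentre v A) \<noteq> circumradius v A)"
  proof (rule eventually_all_finite)
    fix S :: "'m set"
    show "\<forall>\<^sub>F v in nhds u. card S = 5 \<longrightarrow> (\<exists>A i. A \<subseteq> S \<and> card A = 4 \<and> i \<in> S \<and>
      dist (v $ i) (circumcentre v A) \<noteq> circumradius v A)"
    proof (cases "card S = 5")
      case True
      then obtain A where A: "A \<subseteq> S" "card A = 4" using obtain_subset_with_card_n[of 4 S] by auto
      then have "A \<noteq> {}" by auto
      then have ind: "indep A u" using gp A(2) by (simp add: general_position_def)
      have card2: "2 \<le> card A" using A(2) by simp
      have "\<exists>i\<in>S. dist (u $ i) (circumcentre u A) \<noteq> circumradius u A"
      proof (rule ccontr)
        assume "\<not> ?thesis"
        then have "(\<lambda>i. u $ i) ` S \<subseteq> sphere (circumcentre u A) (circumradius u A)" by (auto simp: dist_commute)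
        then show False using gp True unfolding general_position_def by blast
      qed
      then obtain i where i: "i \<in> S" "dist (u $ i) (circumcentre u A) \<noteq> circumradius u A" by blast
      have "\<forall>\<^sub>F v in nhds u. dist (v $ i) (circumcentre v A) \<noteq> circumradius v A"
        by (rule eventually_neq_of_tendsto[OF tendsto_dist[OF tendsto_nth_nhds tendsto_circumsphere(1)[OF ind card2]]
            tendsto_circumsphere(2)[OF ind card2] i(2)])
      then show ?thesis by eventually_elim (use A i(1) in blast)
    qed simp
  qed
  from ev_ind ev_sph show ?thesis
  proof eventually_elim
    case (elim v)
    have ind: "indep A v" if "A \<noteq> {}" "card A \<le> 4" for A using elim(1) that by simp
    have "distinct_points v"
      unfolding distinct_points_def
    proof (rule injI)
      fix i j assume eq: "v $ i = v $ j"
      have "card {i, j} \<le> 4" by (simp add: card_insert_if)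
      from ind[OF _ this] have "indep {i, j} v" by simp
      then have "inj_on (\<lambda>i. v $ i) {i, j}" by (simp only: indep_def)
      from inj_onD[OF this eq] show "i = j" by simp
    qed
    moreover have "\<not> (\<exists>c \<rho>. (\<lambda>i. v $ i) ` S \<subseteq> sphere c \<rho>)" if S: "card S = 5" for S
    proof
      assume "\<exists>c \<rho>. (\<lambda>i. v $ i) ` S \<subseteq> sphere c \<rho>"
      then obtain c \<rho> where sph: "(\<lambda>i. v $ i) ` S \<subseteq> sphere c \<rho>" by blast
      obtain A i where A: "A \<subseteq> S" "card A = 4" "i \<in> S" "dist (v $ i) (circumcentre v A) \<noteq> circumradius v A"
        using elim(2) S by blast
      have "A \<noteq> {}" "card A \<le> 4" using A(2) by auto
      from circumsphere_unique[OF l ind[OF this] A(2,1,3) sph] show False using A(4) by simp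
    qed
    ultimately show ?case using elim(1) by (simp add: general_position_def)
  qed
qed

text \<open>Persistence of emptiness comes from the strict inequalities of
  \<open>attaching_simplex_strict\<close>, while the points of \<open>\<tau>\<close> stay on the
  sphere identically. If \<open>\<tau>\<close> is not attaching, some point is strictly inside, and
  it stays there.\<close>

lemma eventually_attaching_iff:
  fixes u :: "('l::finite, 'm::finite) config"
  assumes u: "u \<in> U_Alp" and Ot: "open Ot" "u \<in> Ot" "\<forall>v\<in>Ot. Del v = Del u"
  shows "\<forall>\<^sub>F v in nhds u. \<forall>\<tau>. attaching_simplex v \<tau> \<longleftrightarrow> attaching_simplex u \<tau>"
proof (rule eventually_all_finite)
  fix \<tau> :: "'m set"
  have gp: "general_position u" using u by (simp add: U_Alp_iff)
  have Del: "\<forall>\<^sub>F v in nhds u. Del v = Del u"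
    using Ot unfolding eventually_nhds by blast
  show "\<forall>\<^sub>F v in nhds u. attaching_simplex v \<tau> \<longleftrightarrow> attaching_simplex u \<tau>"
  proof (cases "\<tau> \<in> Del u \<and> card \<tau> \<noteq> 1")
    case False
    from Del show ?thesis by eventually_elim (use False in \<open>auto simp: attaching_simplex_def\<close>)
  next
    case True
    then have card2: "2 \<le> card \<tau>" by (simp add: in_Del_iff)
    have ind: "indep \<tau> u" using True by (intro Del_indep[OF gp]) simp
    note lim = tendsto_circumsphere[OF ind card2]
    have lim_d: "((\<lambda>v. dist (v $ i) (circumcentre v \<tau>)) \<longlongrightarrow> dist (u $ i) (circumcentre u \<tau>)) (nhds u)" for i
      by (intro tendsto_dist tendsto_nth_nhds lim)
    show ?thesis
    proof (cases "attaching_simplex u \<tau>")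
      case att: True
      have "\<forall>\<^sub>F v in nhds u. \<forall>i. i \<notin> \<tau> \<longrightarrow> circumradius v \<tau> < dist (v $ i) (circumcentre v \<tau>)"
      proof (rule eventually_all_finite)
        fix i
        show "\<forall>\<^sub>F v in nhds u. i \<notin> \<tau> \<longrightarrow> circumradius v \<tau> < dist (v $ i) (circumcentre v \<tau>)"
        proof (cases "i \<in> \<tau>")
          case False
          from eventually_less_of_tendsto[OF lim(2) lim_d attaching_simplex_strict[OF u att _ False]] True
          have "\<forall>\<^sub>F v in nhds u. circumradius v \<tau> < dist (v $ i) (circumcentre v \<tau>)" by simp
          then show ?thesis by eventually_elim simp
        qed simp
      qed
      with Del eventually_indep[OF ind] show ?thesis
      proof eventually_elim
        case (elim v)
        have "circumradius v \<tau> \<le> dist (v $ i) (circumcentre v \<tau>)" for i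
          using elim(3) circumsphere(2)[OF elim(2) card2, of i] by (cases "i \<in> \<tau>") (auto simp: less_imp_le)
        then have "attaching_simplex v \<tau>" using True elim(1) by (simp add: attaching_simplex_iff)
        then show ?case using att by simp
      qed
    next
      case natt: False
      then obtain i where i: "dist (u $ i) (circumcentre u \<tau>) < circumradius u \<tau>"
        using True by (auto simp: attaching_simplex_iff not_le)
      from eventually_less_of_tendsto[OF lim_d lim(2) i] show ?thesis
      proof eventually_elim
        case (elim v)
        then have "\<not> attaching_simplex v \<tau>" using True by (auto simp: attaching_simplex_iff not_le)
        then show ?case using natt by simp
      qed
    qed
  qed
qed

lemma eventually_U_Alp:
  fixes u :: "('l::finite, 'm::finite) config"
  assumes l: "CARD('l) = 3" and u: "u \<in> U_Alp"
    and Ot: "open Ot" "u \<in> Ot" "\<forall>v\<in>Ot. Del v = Del u"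
  shows "\<forall>\<^sub>F v in nhds u. v \<in> U_Alp"
proof -
  have gp: "general_position u" using u by (simp add: U_Alp_iff)
  have "\<forall>\<^sub>F v in nhds u. \<forall>\<tau> \<tau>'. attaching_simplex u \<tau> \<longrightarrow> attaching_simplex u \<tau>' \<longrightarrow>
        card \<tau> \<noteq> 1 \<longrightarrow> card \<tau>' \<noteq> 1 \<longrightarrow> \<tau> \<noteq> \<tau>' \<longrightarrow> circumradius v \<tau> \<noteq> circumradius v \<tau>'"
  proof (intro eventually_all_finite)
    fix \<tau> \<tau>' :: "'m set"
    show "\<forall>\<^sub>F v in nhds u. attaching_simplex u \<tau> \<longrightarrow> attaching_simplex u \<tau>' \<longrightarrow>
        card \<tau> \<noteq> 1 \<longrightarrow> card \<tau>' \<noteq> 1 \<longrightarrow> \<tau> \<noteq> \<tau>' \<longrightarrow> circumradius v \<tau> \<noteq> circumradius v \<tau>'"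
    proof (cases "attaching_simplex u \<tau> \<and> attaching_simplex u \<tau>' \<and> card \<tau> \<noteq> 1 \<and> card \<tau>' \<noteq> 1 \<and> \<tau> \<noteq> \<tau>'")
      case True
      then have Del: "\<tau> \<in> Del u" "\<tau>' \<in> Del u" by (auto simp: attaching_simplex_def)
      then have card2: "2 \<le> card \<tau>" "2 \<le> card \<tau>'" using True by (auto simp: in_Del_iff)
      have "Alp_birth u \<tau> \<noteq> Alp_birth u \<tau>'" using u True by (simp add: U_Alp_iff)
      then have "circumradius u \<tau> \<noteq> circumradius u \<tau>'" using True Alp_birth_attaching[OF gp] by simp
      from eventually_neq_of_tendsto[OF tendsto_circumsphere(2)[OF Del_indep[OF gp Del(1)] card2(1)]
          tendsto_circumsphere(2)[OF Del_indep[OF gp Del(2)] card2(2)] this]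
      show ?thesis by eventually_elim simp
    next
      case False
      then show ?thesis by (intro always_eventually) blast
    qed
  qed
  with eventually_general_position[OF l gp] eventually_attaching_iff[OF u Ot] show ?thesis
  proof eventually_elim
    case (elim v)
    then show ?case unfolding U_Alp_iff using Alp_birth_attaching[OF elim(1)] by metis
  qed
qed

text \<open>\<open>\<rho> \<sigma>\<close> is meant as the radius of the simplex that attaches
  \<open>\<sigma>\<close> at \<open>u\<close>, taken as a function of the configuration. Equality of
  these functions, and not only of their values at \<open>u\<close>, makes ties persist nearby and
  derivatives coincide.\<close>

definition locally_smooth_births ::
    "'m set set \<Rightarrow> (('l, 'm) config \<Rightarrow> 'm set \<Rightarrow> real) \<Rightarrow> ('l::finite, 'm::finite) config \<Rightarrow> bool" where
  "locally_smooth_births W r u \<longleftrightarrow> (\<exists>\<rho>.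
     (\<forall>\<sigma>\<in>W. \<exists>N. open N \<and> u \<in> N \<and> smooth_on N (\<rho> \<sigma>) \<and> (\<forall>v\<in>N. r v \<sigma> = \<rho> \<sigma> v)) \<and>
     (\<forall>\<sigma>\<in>W. \<forall>\<sigma>'\<in>W. r u \<sigma> = r u \<sigma>' \<longrightarrow> \<rho> \<sigma> = \<rho> \<sigma>'))"

text \<open>\<open>T \<sigma>\<close> is the attaching coface of least circumradius at
  \<open>u\<close>. Distinctness of radii makes it unique, so it stays least nearby, and equal radii
  mean equal \<open>T\<close>. Vertices have radius zero and all other simplices a positive one, so
  these never tie.\<close>

lemma locally_smooth_Alp_birth:
  fixes u :: "('l::finite, 'm::finite) config"
  assumes l: "CARD('l) = 3" and u: "u \<in> U_Alp"
    and Ot: "open Ot" "u \<in> Ot" "\<forall>v\<in>Ot. Del v = Del u"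
  shows "locally_smooth_births (Del u) Alp_birth u"
proof -
  have gp: "general_position u" using u by (simp add: U_Alp_iff)
  have "\<forall>\<sigma>\<in>{\<sigma> \<in> Del u. card \<sigma> \<noteq> 1}. \<exists>\<tau>. \<tau> \<in> cofaces u \<sigma> \<and> Alp_birth u \<sigma> = circumradius u \<tau> \<and>
      (\<forall>\<tau>'\<in>cofaces u \<sigma>. circumradius u \<tau> \<le> circumradius u \<tau>')"
    using Alp_birth_attained[OF gp] by blast
  from bchoice[OF this] obtain T where T: "\<And>\<sigma>. \<sigma> \<in> Del u \<Longrightarrow> card \<sigma> \<noteq> 1 \<Longrightarrow> T \<sigma> \<in> cofaces u \<sigma>"
    "\<And>\<sigma>. \<sigma> \<in> Del u \<Longrightarrow> card \<sigma> \<noteq> 1 \<Longrightarrow> Alp_birth u \<sigma> = circumradius u (T \<sigma>)"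
    "\<And>\<sigma> \<tau>'. \<sigma> \<in> Del u \<Longrightarrow> card \<sigma> \<noteq> 1 \<Longrightarrow> \<tau>' \<in> cofaces u \<sigma> \<Longrightarrow> circumradius u (T \<sigma>) \<le> circumradius u \<tau>'"
    by blast
  have cof: "\<tau> \<in> Del u" "2 \<le> card \<tau>" "attaching_simplex u \<tau>" "card \<tau> \<noteq> 1" if "\<tau> \<in> cofaces u \<sigma>" for \<tau> \<sigma>
    using that by (auto simp: cofaces_def attaching_simplex_def)
  have radius_inj: "\<tau> = \<tau>'"
    if "\<tau> \<in> cofaces u \<sigma>" "\<tau>' \<in> cofaces u \<sigma>'" "circumradius u \<tau> = circumradius u \<tau>'" for \<tau> \<tau>' \<sigma> \<sigma>'
    using u cof[OF that(1)] cof[OF that(2)] that(3) Alp_birth_attaching[OF gp] unfolding U_Alp_iff by metis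
  define \<rho> where "\<rho> \<sigma> = (if card \<sigma> = 1 then (\<lambda>_. 0) else (\<lambda>v::('l, 'm) config. circumradius v (T \<sigma>)))" for \<sigma>
  show ?thesis
    unfolding locally_smooth_births_def
  proof (intro exI[of _ \<rho>] conjI ballI impI)
    fix \<sigma> assume \<sigma>: "\<sigma> \<in> Del u"
    show "\<exists>N. open N \<and> u \<in> N \<and> smooth_on N (\<rho> \<sigma>) \<and> (\<forall>v\<in>N. Alp_birth v \<sigma> = \<rho> \<sigma> v)"
    proof (cases "card \<sigma> = 1")
      case True
      then show ?thesis by (intro exI[of _ UNIV]) (simp add: \<rho>_def smooth_on_const Alp_birth_vertex)
    next
      case False
      note T\<sigma> = T(1)[OF \<sigma> False]
      note ind = Del_indep[OF gp cof(1)]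
      have "\<forall>\<^sub>F v in nhds u. \<forall>\<tau>'. \<tau>' \<in> cofaces u \<sigma> \<longrightarrow> circumradius v (T \<sigma>) \<le> circumradius v \<tau>'"
      proof (rule eventually_all_finite)
        fix \<tau>'
        show "\<forall>\<^sub>F v in nhds u. \<tau>' \<in> cofaces u \<sigma> \<longrightarrow> circumradius v (T \<sigma>) \<le> circumradius v \<tau>'"
        proof (cases "\<tau>' \<in> cofaces u \<sigma> \<and> \<tau>' \<noteq> T \<sigma>")
          case True
          then have "circumradius u (T \<sigma>) < circumradius u \<tau>'"
            using T(3)[OF \<sigma> False, of \<tau>'] radius_inj[OF T\<sigma>, of \<tau>' \<sigma>] by (auto simp: less_le)
          from eventually_less_of_tendsto[OF tendsto_circumsphere(2)[OF ind[OF T\<sigma>] cof(2)[OF T\<sigma>]]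
              tendsto_circumsphere(2)[OF ind cof(2)] this] True
          have "\<forall>\<^sub>F v in nhds u. circumradius v (T \<sigma>) < circumradius v \<tau>'" by blast
          then show ?thesis by eventually_elim simp
        qed auto
      qed
      moreover have "\<forall>\<^sub>F v in nhds u. v \<in> Ot" using Ot by (auto simp: eventually_nhds)
      ultimately have "\<forall>\<^sub>F v in nhds u. indep (T \<sigma>) v \<and> Alp_birth v \<sigma> = circumradius v (T \<sigma>)"
        using eventually_indep[OF ind[OF T\<sigma>]] eventually_attaching_iff[OF u Ot] eventually_U_Alp[OF l u Ot]
      proof eventually_elim
        case (elim v)
        have cof_eq: "cofaces v \<sigma> = cofaces u \<sigma>" using elim(4) by (simp add: cofaces_def)
        have gpv: "general_position v" using elim(5) by (simp add: U_Alp_iff)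
        have "\<sigma> \<in> Del v" using Ot(3) elim(2) \<sigma> by blast
        then have "Alp_birth v \<sigma> = Min (circumradius v ` cofaces v \<sigma>)" using Alp_birth_eq[OF gpv _ False] by blast
        also have "\<dots> = circumradius v (T \<sigma>)"
          unfolding cof_eq using elim(1) T\<sigma> by (intro Min_eqI) auto
        finally show ?case using elim(3) by blast
      qed
      then obtain N where N: "open N" "u \<in> N" "\<And>v. v \<in> N \<Longrightarrow> indep (T \<sigma>) v \<and> Alp_birth v \<sigma> = circumradius v (T \<sigma>)"
        unfolding eventually_nhds by blast
      have "smooth_on N (\<lambda>v. circumradius v (T \<sigma>))"
        by (rule smooth_on_subset[OF smooth_circumcentre_circumradius(2)[OF cof(2)[OF T\<sigma>]]]) (use N(3) in blast)
      then show ?thesis using N False by (intro exI[of _ N]) (simp add: \<rho>_def)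
    qed
  next
    fix \<sigma> \<sigma>' assume \<sigma>: "\<sigma> \<in> Del u" "\<sigma>' \<in> Del u" and eq: "Alp_birth u \<sigma> = Alp_birth u \<sigma>'"
    have "card \<sigma> = 1 \<longleftrightarrow> card \<sigma>' = 1"
      using eq Alp_birth_vertex[of \<sigma> u] Alp_birth_vertex[of \<sigma>' u] Alp_birth_nonneg(2)[OF gp \<sigma>(1)] Alp_birth_nonneg(2)[OF gp \<sigma>(2)]
      by force
    moreover have "T \<sigma> = T \<sigma>'" if "card \<sigma> \<noteq> 1" "card \<sigma>' \<noteq> 1"
      using radius_inj[OF T(1)[OF \<sigma>(1) that(1)] T(1)[OF \<sigma>(2) that(2)]] eq T(2)[OF \<sigma>(1) that(1)] T(2)[OF \<sigma>(2) that(2)] by simp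
    ultimately show "\<rho> \<sigma> = \<rho> \<sigma>'" by (auto simp: \<rho>_def)
  qed
qed

section \<open>Vietoris-Rips birth radii near a configuration\<close>

lemma VR_birth_edge: "VR_birth v {i, j} = dist (v $ i) (v $ j) / 2"
proof (rule antisym)
  obtain a b where "a \<in> {i, j}" "b \<in> {i, j}" "VR_birth v {i, j} = dist (v $ a) (v $ b) / 2"
    using VR_birth_attained[of "{i, j}" v] by blast
  then show "VR_birth v {i, j} \<le> dist (v $ i) (v $ j) / 2" by (auto simp: dist_commute)
qed (rule VR_birth_ge; simp)

lemma VR_birth_vertex: "card \<sigma> = 1 \<Longrightarrow> VR_birth v \<sigma> = 0"
  using VR_birth_edge[of v x x for x] by (auto simp: card_1_singleton_iff)

text \<open>Every edge attaches itself, so the second condition compares all pairs of edges.\<close>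

lemma U_VR_iff: "u \<in> U_VR \<longleftrightarrow> distinct_points u \<and>
    (\<forall>\<tau> \<tau>'. card \<tau> = 2 \<longrightarrow> card \<tau>' = 2 \<longrightarrow> \<tau> \<noteq> \<tau>' \<longrightarrow> VR_birth u \<tau> \<noteq> VR_birth u \<tau>')"
proof -
  have "(\<exists>\<sigma>. attaching_edge u \<sigma> \<tau>) \<longleftrightarrow> card \<tau> = 2" for \<tau>
    by (auto simp: attaching_edge_def intro!: exI[of _ \<tau>])
  then show ?thesis by (simp add: U_VR_def)
qed

lemma tendsto_VR_birth_edge:
  assumes "card \<tau> = 2"
  shows "((\<lambda>v. VR_birth v \<tau>) \<longlongrightarrow> VR_birth u \<tau>) (nhds u)"
proof -
  obtain i j where eq: "\<tau> = {i, j}" using assms by (auto simp: card_2_iff)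
  have "((\<lambda>v. dist (v $ i) (v $ j) / 2) \<longlongrightarrow> dist (u $ i) (u $ j) / 2) (nhds u)"
    by (intro tendsto_divide tendsto_dist tendsto_nth_nhds tendsto_const) auto
  then show ?thesis unfolding eq VR_birth_edge .
qed

lemma eventually_U_VR:
  fixes u :: "('l::finite, 'm::finite) config"
  assumes u: "u \<in> U_VR"
  shows "\<forall>\<^sub>F v in nhds u. v \<in> U_VR"
proof -
  have "\<forall>\<^sub>F v in nhds u. \<forall>i j. i \<noteq> j \<longrightarrow> v $ i \<noteq> v $ j"
  proof (intro eventually_all_finite)
    fix i j
    show "\<forall>\<^sub>F v in nhds u. i \<noteq> j \<longrightarrow> v $ i \<noteq> v $ j"
    proof (cases "i = j")
      case False
      then have ne: "dist (u $ i) (u $ j) \<noteq> 0" using u by (auto simp: U_VR_iff distinct_points_def dest: injD)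
      have "\<forall>\<^sub>F v in nhds u. dist (v $ i) (v $ j) \<noteq> 0"
        by (rule eventually_neq_of_tendsto[OF tendsto_dist[OF tendsto_nth_nhds tendsto_nth_nhds] tendsto_const ne])
      then show ?thesis by eventually_elim auto
    qed simp
  qed
  moreover have "\<forall>\<^sub>F v in nhds u. \<forall>\<tau> \<tau>'. card \<tau> = 2 \<longrightarrow> card \<tau>' = 2 \<longrightarrow> \<tau> \<noteq> \<tau>' \<longrightarrow> VR_birth v \<tau> \<noteq> VR_birth v \<tau>'"
  proof (intro eventually_all_finite)
    fix \<tau> \<tau>' :: "'m set"
    show "\<forall>\<^sub>F v in nhds u. card \<tau> = 2 \<longrightarrow> card \<tau>' = 2 \<longrightarrow> \<tau> \<noteq> \<tau>' \<longrightarrow> VR_birth v \<tau> \<noteq> VR_birth v \<tau>'"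
    proof (cases "card \<tau> = 2 \<and> card \<tau>' = 2 \<and> \<tau> \<noteq> \<tau>'")
      case True
      then have "VR_birth u \<tau> \<noteq> VR_birth u \<tau>'" using u by (simp add: U_VR_iff)
      from eventually_neq_of_tendsto[OF tendsto_VR_birth_edge tendsto_VR_birth_edge this] True
      have "\<forall>\<^sub>F v in nhds u. VR_birth v \<tau> \<noteq> VR_birth v \<tau>'" by blast
      then show ?thesis by eventually_elim simp
    next
      case False
      then show ?thesis by (intro always_eventually) blast
    qed
  qed
  ultimately show ?thesis
  proof eventually_elim
    case (elim v)
    have "inj (\<lambda>i. v $ i)" using elim(1) by (intro injI) blast
    then show ?case using elim(2) by (simp add: U_VR_iff distinct_points_def)
  qed
qed

text \<open>\<open>P \<sigma>\<close> picks the endpoints of a longest edge. Distinct edge lengths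
  make this edge unique and keep it longest nearby, and half its length is smooth where the
  endpoints differ.\<close>

lemma locally_smooth_VR_birth:
  fixes u :: "('l::finite, 'm::finite) config"
  assumes u: "u \<in> U_VR"
  shows "locally_smooth_births {\<sigma>. \<sigma> \<noteq> {}} VR_birth u"
proof -
  have dp: "\<And>i j. i \<noteq> j \<Longrightarrow> u $ i \<noteq> u $ j" using u by (auto simp: U_VR_iff distinct_points_def dest: injD)
  have "\<exists>p. fst p \<in> \<sigma> \<and> snd p \<in> \<sigma> \<and> fst p \<noteq> snd p \<and> VR_birth u \<sigma> = VR_birth u {fst p, snd p} \<and> 0 < VR_birth u \<sigma>"
    if \<sigma>: "\<sigma> \<noteq> {}" "card \<sigma> \<noteq> 1" for \<sigma>
  proof -
    have "2 \<le> card \<sigma>" using \<sigma> card_gt_0_iff[of \<sigma>] by simp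
    then obtain a b where ab: "a \<in> \<sigma>" "b \<in> \<sigma>" "a \<noteq> b" by (rule two_le_cardE)
    have pos: "0 < VR_birth u \<sigma>" using VR_birth_ge[OF ab(1,2), of u] dp[OF ab(3)]
      by (meson half_gt_zero order_less_le_trans zero_less_dist_iff)
    obtain i j where ij: "i \<in> \<sigma>" "j \<in> \<sigma>" "VR_birth u \<sigma> = dist (u $ i) (u $ j) / 2"
      using VR_birth_attained[OF \<sigma>(1), of u] by blast
    then have "i \<noteq> j" using pos by auto
    then show ?thesis using ij pos by (intro exI[of _ "(i, j)"]) (simp add: VR_birth_edge)
  qed
  then have "\<forall>\<sigma>\<in>{\<sigma>. \<sigma> \<noteq> {} \<and> card \<sigma> \<noteq> 1}. \<exists>p. fst p \<in> \<sigma> \<and> snd p \<in> \<sigma> \<and> fst p \<noteq> snd p \<and>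
      VR_birth u \<sigma> = VR_birth u {fst p, snd p} \<and> 0 < VR_birth u \<sigma>" by blast
  from bchoice[OF this] obtain P where P: "\<And>\<sigma>. \<sigma> \<noteq> {} \<Longrightarrow> card \<sigma> \<noteq> 1 \<Longrightarrow>
      fst (P \<sigma>) \<in> \<sigma> \<and> snd (P \<sigma>) \<in> \<sigma> \<and> fst (P \<sigma>) \<noteq> snd (P \<sigma>) \<and>
      VR_birth u \<sigma> = VR_birth u {fst (P \<sigma>), snd (P \<sigma>)} \<and> 0 < VR_birth u \<sigma>" by blast
  define T where "T \<sigma> = {fst (P \<sigma>), snd (P \<sigma>)}" for \<sigma>
  define \<rho> where "\<rho> \<sigma> = (if card \<sigma> = 1 then (\<lambda>_. 0) else (\<lambda>v::('l, 'm) config. VR_birth v (T \<sigma>)))" for \<sigma>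
  show ?thesis
    unfolding locally_smooth_births_def
  proof (intro exI[of _ \<rho>] conjI ballI impI)
    fix \<sigma> :: "'m set" assume "\<sigma> \<in> {\<sigma>. \<sigma> \<noteq> {}}"
    then have \<sigma>: "\<sigma> \<noteq> {}" by simp
    show "\<exists>N. open N \<and> u \<in> N \<and> smooth_on N (\<rho> \<sigma>) \<and> (\<forall>v\<in>N. VR_birth v \<sigma> = \<rho> \<sigma> v)"
    proof (cases "card \<sigma> = 1")
      case True
      then show ?thesis by (intro exI[of _ UNIV]) (simp add: \<rho>_def smooth_on_const VR_birth_vertex)
    next
      case False
      obtain i j where Pij: "P \<sigma> = (i, j)" by (cases "P \<sigma>")
      have ij: "i \<in> \<sigma>" "j \<in> \<sigma>" "i \<noteq> j" "VR_birth u \<sigma> = dist (u $ i) (u $ j) / 2"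
        using P[OF \<sigma> False] by (simp_all add: Pij VR_birth_edge)
      have T: "T \<sigma> = {i, j}" by (simp add: T_def Pij)
      have "\<forall>\<^sub>F v in nhds u. \<forall>k m. k \<in> \<sigma> \<longrightarrow> m \<in> \<sigma> \<longrightarrow> dist (v $ k) (v $ m) \<le> dist (v $ i) (v $ j)"
      proof (intro eventually_all_finite)
        fix k m
        show "\<forall>\<^sub>F v in nhds u. k \<in> \<sigma> \<longrightarrow> m \<in> \<sigma> \<longrightarrow> dist (v $ k) (v $ m) \<le> dist (v $ i) (v $ j)"
        proof (cases "k \<in> \<sigma> \<and> m \<in> \<sigma> \<and> k \<noteq> m \<and> {k, m} \<noteq> {i, j}")
          case True
          then have "VR_birth u {k, m} \<noteq> VR_birth u {i, j}" using u ij(3) by (simp add: U_VR_iff)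
          moreover have "dist (u $ k) (u $ m) / 2 \<le> VR_birth u \<sigma>" using True by (intro VR_birth_ge) auto
          ultimately have "dist (u $ k) (u $ m) < dist (u $ i) (u $ j)" using ij(4) by (simp add: VR_birth_edge)
          from eventually_less_of_tendsto[OF tendsto_dist[OF tendsto_nth_nhds tendsto_nth_nhds]
              tendsto_dist[OF tendsto_nth_nhds tendsto_nth_nhds] this]
          show ?thesis by eventually_elim simp
        next
          case False
          then have "k \<in> \<sigma> \<longrightarrow> m \<in> \<sigma> \<longrightarrow> dist (v $ k) (v $ m) \<le> dist (v $ i) (v $ j)" for v :: "('l, 'm) config"
            by (auto simp: doubleton_eq_iff dist_commute)
          then show ?thesis by (intro always_eventually) blast
        qed
      qed
      moreover have "\<forall>\<^sub>F v in nhds u. dist (v $ i) (v $ j) \<noteq> 0"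
        by (rule eventually_neq_of_tendsto[OF tendsto_dist[OF tendsto_nth_nhds tendsto_nth_nhds] tendsto_const])
          (use dp[OF ij(3)] in simp)
      ultimately have "\<forall>\<^sub>F v in nhds u. v $ i \<noteq> v $ j \<and> VR_birth v \<sigma> = dist (v $ i) (v $ j) / 2"
      proof eventually_elim
        case (elim v)
        have "VR_birth v \<sigma> \<le> dist (v $ i) (v $ j) / 2"
          using VR_birth_attained[OF \<sigma>, of v] elim(1) by force
        then show ?case using VR_birth_ge[OF ij(1,2), of v] elim(2) by auto
      qed
      then obtain N where N: "open N" "u \<in> N" "\<And>v. v \<in> N \<Longrightarrow> v $ i \<noteq> v $ j \<and> VR_birth v \<sigma> = dist (v $ i) (v $ j) / 2"
        unfolding eventually_nhds by blast
      have "smooth_on N (\<lambda>v. dist (v $ i) (v $ j))"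
        using N by (intro smooth_on_dist smooth_on_nth) auto
      then have "smooth_on N (\<lambda>v. 1 / 2 * dist (v $ i) (v $ j))"
        by (intro smooth_on_mult[OF N(1)] smooth_on_const)
      then have "smooth_on N (\<rho> \<sigma>)" using False by (simp add: \<rho>_def T VR_birth_edge)
      then show ?thesis using N False by (intro exI[of _ N]) (simp add: \<rho>_def T VR_birth_edge)
    qed
  next
    fix \<sigma> \<sigma>' :: "'m set" assume "\<sigma> \<in> {\<sigma>. \<sigma> \<noteq> {}}" "\<sigma>' \<in> {\<sigma>. \<sigma> \<noteq> {}}" and eq: "VR_birth u \<sigma> = VR_birth u \<sigma>'"
    then have \<sigma>: "\<sigma> \<noteq> {}" "\<sigma>' \<noteq> {}" by simp_all
    have "card \<sigma> = 1 \<longleftrightarrow> card \<sigma>' = 1"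
      using eq VR_birth_vertex[of \<sigma> u] VR_birth_vertex[of \<sigma>' u] P[OF \<sigma>(1)] P[OF \<sigma>(2)] by force
    moreover have "T \<sigma> = T \<sigma>'" if "card \<sigma> \<noteq> 1" "card \<sigma>' \<noteq> 1"
    proof (rule ccontr)
      assume "T \<sigma> \<noteq> T \<sigma>'"
      moreover have "card (T \<sigma>) = 2" "card (T \<sigma>') = 2"
        using P[OF \<sigma>(1) that(1)] P[OF \<sigma>(2) that(2)] by (simp_all add: T_def)
      ultimately have "VR_birth u (T \<sigma>) \<noteq> VR_birth u (T \<sigma>')" using u by (simp add: U_VR_iff)
      then show False using eq P[OF \<sigma>(1) that(1)] P[OF \<sigma>(2) that(2)] by (simp add: T_def)
    qed
    ultimately show "\<rho> \<sigma> = \<rho> \<sigma>'" by (auto simp: \<rho>_def)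
  qed
qed

section \<open>The persistence map\<close>

definition monotone_births :: "'m set set \<Rightarrow> ('m set \<Rightarrow> real) \<Rightarrow> bool" where
  "monotone_births W r \<longleftrightarrow> face_closed W \<and> (\<forall>\<sigma>\<in>W. 0 \<le> r \<sigma>) \<and>
     (\<forall>\<sigma>\<in>W. \<forall>\<tau>\<in>W. \<tau> \<subset> \<sigma> \<longrightarrow> r \<tau> \<le> r \<sigma>)"

lemma ordered_complex_of_monotone_births:
  fixes W :: "'m::{finite, linorder} set set"
  assumes "monotone_births W r" "linear_order_on W tie" "set xs = W" "sorted_wrt (simplex_less r tie) xs"
  shows "ordered_complex W r xs"
  by (rule ordered_complexI[OF _ _ _ assms(2-4)]) (use assms(1) in \<open>auto simp: monotone_births_def\<close>)

lemma diag_dist_of_diagram_diag_dist: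
  assumes "ereal \<epsilon> < diagram_diag_dist D / 2" "p \<in># D"
  shows "ereal (2 * \<epsilon>) < diag_dist p"
proof -
  have "diagram_diag_dist D \<le> diag_dist p"
    unfolding diagram_diag_dist_def by (rule INF_lower) (rule assms(2))
  moreover have "ereal (2 * \<epsilon>) < diagram_diag_dist D"
    using assms(1) by (cases "diagram_diag_dist D") auto
  ultimately show ?thesis by simp
qed

text \<open>Existence of bars, uniqueness of diagrams and stability combine to express the index
  counts at \<open>r'\<close> by the diagram of \<open>X\<close>; with \<open>X\<close> taken at the
  base configuration they become constants on the domain.\<close>

lemma stable_index_counts:
  fixes W :: "'m::{finite, linorder} set set"
  assumes mb: "monotone_births W r" "monotone_births W r'" and tie: "linear_order_on W tie"
    and X: "\<And>t. 0 < t \<Longrightarrow> X t = {\<sigma> \<in> W. r \<sigma> < t}" and X': "\<And>t. 0 < t \<Longrightarrow> X' t = {\<sigma> \<in> W. r' \<sigma> < t}"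
    and bars: "\<And>ps (e :: nat \<Rightarrow> real \<Rightarrow> 'm set \<Rightarrow> 'k::field) qs (g :: nat \<Rightarrow> real \<Rightarrow> 'm set \<Rightarrow> 'k).
      interval_decomposition l X ps e \<Longrightarrow> interval_decomposition l X' qs g \<Longrightarrow>
      \<exists>a. 0 \<le> a \<and> a < \<epsilon> \<and> (\<forall>h\<ge>0. card (long_bars (2 * a + h) ps) \<le> card (long_bars h qs) \<and>
        card (long_bars (2 * a + h) qs) \<le> card (long_bars h ps))"
    and eps: "0 < \<epsilon>" "ereal \<epsilon> < diagram_diag_dist (dgm TYPE('k) l X) / 2"
    and xs: "set xs = W" "sorted_wrt (simplex_less r' tie) xs"
  shows "card (ordered_complex.long_pairs r' xs TYPE('k) l \<epsilon>) = n_finite (dgm TYPE('k) l X)"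
    and "card (ordered_complex.essentials xs TYPE('k) l) = n_infinite (dgm TYPE('k) l X)"
proof -
  obtain xs0 where xs0: "set xs0 = W" "sorted_wrt (simplex_less r tie) xs0"
    using exists_simplex_order[OF tie] by blast
  obtain ps and e :: "nat \<Rightarrow> real \<Rightarrow> 'm set \<Rightarrow> 'k" where ps: "interval_decomposition l X ps e"
    by (rule ordered_complex.barcode[OF ordered_complex_of_monotone_births[OF mb(1) tie xs0] X])
  have oc: "ordered_complex W r' xs" by (rule ordered_complex_of_monotone_births[OF mb(2) tie xs])
  obtain qs and g :: "nat \<Rightarrow> real \<Rightarrow> 'm set \<Rightarrow> 'k" where qs: "interval_decomposition l X' qs g"
    by (rule ordered_complex.barcode[OF oc X'])
  have dgm: "dgm TYPE('k) l X = mset ps"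
    by (rule dgm_eq[OF ps]) (use X in auto)
  obtain a where a: "0 \<le> a" "a < \<epsilon>" and le: "\<And>h. 0 \<le> h \<Longrightarrow> card (long_bars (2 * a + h) ps) \<le> card (long_bars h qs)"
      "\<And>h. 0 \<le> h \<Longrightarrow> card (long_bars (2 * a + h) qs) \<le> card (long_bars h ps)"
    using bars[OF ps qs] by blast
  have long: "ereal (2 * \<epsilon>) < diag_dist p" if "p \<in> set ps" for p
    using diag_dist_of_diagram_diag_dist[OF eps(2), of p] that by (simp add: dgm)
  show "card (ordered_complex.long_pairs r' xs TYPE('k) l \<epsilon>) = n_finite (dgm TYPE('k) l X)"
    using ordered_complex.barcode_counts(1)[OF oc X' qs eps(1)] stable_bar_counts(1)[OF ps qs a le long]
    by (simp add: dgm)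
  show "card (ordered_complex.essentials xs TYPE('k) l) = n_infinite (dgm TYPE('k) l X)"
    using ordered_complex.barcode_counts(2)[OF oc X' qs] stable_bar_counts(2)[OF ps qs a le long]
    by (simp add: dgm)
qed

lemma length_concat_pairs: "length (concat (map (\<lambda>(i, j). [x i j, y i j]) ps)) = 2 * length ps"
  by (induction ps) auto

section \<open>Local constancy of the selected simplices\<close>

lemma locally_smooth_births_tendsto:
  assumes "locally_smooth_births W r u" "\<sigma> \<in> W"
  shows "((\<lambda>v. r v \<sigma>) \<longlongrightarrow> r u \<sigma>) (nhds u)"
proof -
  obtain g N where N: "open N" "u \<in> N" "smooth_on N g" "\<And>v. v \<in> N \<Longrightarrow> r v \<sigma> = g v"
    using assms unfolding locally_smooth_births_def by blast
  have "(g \<longlongrightarrow> g u) (nhds u)" using N by (intro smooth_on_tendsto_nhds)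
  moreover have "\<forall>\<^sub>F v in nhds u. g v = r v \<sigma>"
    unfolding eventually_nhds using N(1,2,4) by (intro exI[of _ N]) simp
  ultimately have "((\<lambda>v. r v \<sigma>) \<longlongrightarrow> g u) (nhds u)" by (rule Lim_transform_eventually)
  then show ?thesis using N(4)[OF N(2)] by simp
qed

lemma locally_smooth_births_eq:
  assumes ls: "locally_smooth_births W r u" and W: "\<sigma> \<in> W" "\<sigma>' \<in> W" and eq: "r u \<sigma> = r u \<sigma>'"
  shows "\<forall>\<^sub>F v in nhds u. r v \<sigma> = r v \<sigma>'" and "same_derivative_at u (\<lambda>v. r v \<sigma>) (\<lambda>v. r v \<sigma>')"
proof -
  obtain g N N' where N: "open N" "u \<in> N" "smooth_on N g" "\<And>v. v \<in> N \<Longrightarrow> g v = r v \<sigma>"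
    and N': "open N'" "u \<in> N'" "\<And>v. v \<in> N' \<Longrightarrow> g v = r v \<sigma>'"
  proof -
    obtain \<rho> where \<rho>: "\<forall>\<sigma>\<in>W. \<exists>N. open N \<and> u \<in> N \<and> smooth_on N (\<rho> \<sigma>) \<and> (\<forall>v\<in>N. r v \<sigma> = \<rho> \<sigma> v)"
        "\<forall>\<sigma>\<in>W. \<forall>\<sigma>'\<in>W. r u \<sigma> = r u \<sigma>' \<longrightarrow> \<rho> \<sigma> = \<rho> \<sigma>'"
      using ls unfolding locally_smooth_births_def by blast
    obtain N where N: "open N" "u \<in> N" "smooth_on N (\<rho> \<sigma>)" "\<forall>v\<in>N. r v \<sigma> = \<rho> \<sigma> v"
      using \<rho>(1) W(1) by blast
    moreover obtain N' where N': "open N'" "u \<in> N'" "\<forall>v\<in>N'. r v \<sigma>' = \<rho> \<sigma>' v" using \<rho>(1) W(2) by blast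
    moreover have "\<rho> \<sigma>' = \<rho> \<sigma>" by (rule sym) (rule \<rho>(2)[rule_format, OF W eq])
    ultimately show thesis by (intro that[of N "\<rho> \<sigma>" N']) simp_all
  qed
  show "\<forall>\<^sub>F v in nhds u. r v \<sigma> = r v \<sigma>'"
    unfolding eventually_nhds using N(1,2) N'(1,2) by (intro exI[of _ "N \<inter> N'"]) (simp add: open_Int flip: N(4) N'(3))
  obtain D where D: "(g has_derivative D) (at u)"
    using smooth_on_differentiable[OF N(3,2)] unfolding differentiable_def by blast
  show "same_derivative_at u (\<lambda>v. r v \<sigma>) (\<lambda>v. r v \<sigma>')"
    unfolding same_derivative_at_def
    using has_derivative_transform_within_open[OF D N(1,2,4)] has_derivative_transform_within_open[OF D N'] by blast
qed

text \<open>Strict comparisons of radii persist by continuity, ties persist by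
  \<open>locally_smooth_births_eq\<close>, and their resolution by dimension and \<open>tie\<close>
  does not involve the configuration.\<close>

lemma eventually_simplex_less:
  fixes W :: "'m::finite set set"
  assumes ls: "locally_smooth_births W r u"
  shows "\<forall>\<^sub>F v in nhds u. \<forall>\<sigma>\<in>W. \<forall>\<tau>\<in>W. simplex_less (r v) tie \<sigma> \<tau> \<longleftrightarrow> simplex_less (r u) tie \<sigma> \<tau>"
proof (intro eventually_ball_finite ballI)
  fix \<sigma> \<tau> assume W: "\<sigma> \<in> W" "\<tau> \<in> W"
  note lim = locally_smooth_births_tendsto[OF ls]
  consider "r u \<sigma> < r u \<tau>" | "r u \<tau> < r u \<sigma>" | "r u \<sigma> = r u \<tau>" by linarith
  then show "\<forall>\<^sub>F v in nhds u. simplex_less (r v) tie \<sigma> \<tau> \<longleftrightarrow> simplex_less (r u) tie \<sigma> \<tau>"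
  proof cases
    case 1
    from eventually_less_of_tendsto[OF lim[OF W(1)] lim[OF W(2)] 1] show ?thesis
      by eventually_elim (simp add: simplex_less_def 1)
  next
    case 2
    from eventually_less_of_tendsto[OF lim[OF W(2)] lim[OF W(1)] 2] show ?thesis
      by eventually_elim (use 2 in \<open>auto simp: simplex_less_def\<close>)
  next
    case 3
    from locally_smooth_births_eq(1)[OF ls W 3] show ?thesis
      by eventually_elim (simp add: simplex_less_def 3)
  qed
qed simp_all

text \<open>Being short is an open condition, so no pair that is short at \<open>u\<close> becomes
  long nearby.\<close>

lemma eventually_not_long:
  fixes W :: "'m::finite set set"
  assumes ls: "locally_smooth_births W r u"
  shows "\<forall>\<^sub>F v in nhds u. \<forall>\<sigma>\<in>W. \<forall>\<tau>\<in>W. r u \<tau> - r u \<sigma> < c \<longrightarrow> r v \<tau> - r v \<sigma> < c"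
proof (intro eventually_ball_finite ballI)
  fix \<sigma> \<tau> assume W: "\<sigma> \<in> W" "\<tau> \<in> W"
  show "\<forall>\<^sub>F v in nhds u. r u \<tau> - r u \<sigma> < c \<longrightarrow> r v \<tau> - r v \<sigma> < c"
  proof (cases "r u \<tau> - r u \<sigma> < c")
    case True
    from eventually_less_of_tendsto[OF tendsto_diff[OF locally_smooth_births_tendsto[OF ls W(2)]
      locally_smooth_births_tendsto[OF ls W(1)]] tendsto_const True]
    show ?thesis by eventually_elim simp
  qed simp
qed simp_all

lemma (in ordered_complex) long_pairs_iff:
  "(i, j) \<in> long_pairs k l \<epsilon> \<longleftrightarrow> j < length xs \<and> i \<in> lows k (Suc j) - lows k j \<and> card (xs ! i) = Suc l \<and>
     2 * \<epsilon> \<le> r (xs ! j) - r (xs ! i)"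
proof -
  have "ereal \<epsilon> \<le> diag_dist (ereal (r (xs ! i)), ereal (r (xs ! j))) \<longleftrightarrow> 2 * \<epsilon> \<le> r (xs ! j) - r (xs ! i)"
    if "j < length xs" "i \<in> lows k (Suc j)"
  proof -
    have "r (xs ! i) \<le> r (xs ! j)" using low_less[OF that(2)] r_nth_mono that(1) by blast
    then show ?thesis by (simp add: diag_dist_finite field_simps)
  qed
  then show ?thesis unfolding long_pairs_def by auto
qed

lemma (in ordered_complex) finite_long_pairs: "finite (long_pairs k l \<epsilon>)"
proof (rule finite_subset)
  show "long_pairs k l \<epsilon> \<subseteq> {..<length xs} \<times> {..<length xs}"
    unfolding long_pairs_def using low_less by auto
qed simp

lemma persistence_vector_locally:
  fixes W :: "'m::{finite, linorder} set set" and Ob :: "('l::finite, 'm) config set"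
  assumes Ob: "open Ob" "u \<in> Ob" and ls: "locally_smooth_births W r u" and tie: "linear_order_on W tie"
    and mb: "\<And>v. v \<in> Ob \<Longrightarrow> monotone_births W (r v)"
    and f: "\<And>v. v \<in> Ob \<Longrightarrow> persistence_vector TYPE('k::field) l \<epsilon> tie W (r v) (f v)"
    and counts: "\<And>v xs. v \<in> Ob \<Longrightarrow> set xs = W \<Longrightarrow> sorted_wrt (simplex_less (r v) tie) xs \<Longrightarrow>
      card (ordered_complex.long_pairs (r v) xs TYPE('k) l \<epsilon>) = s \<and>
      card (ordered_complex.essentials xs TYPE('k) l) = t"
  shows "\<exists>N \<sigma>s. open N \<and> u \<in> N \<and> length \<sigma>s = 2 * s + t \<and> set \<sigma>s \<subseteq> W \<and> (\<forall>v\<in>N. f v = map (r v) \<sigma>s)"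
proof -
  have unfold: "\<exists>xs ps es. set xs = W \<and> sorted_wrt (simplex_less (r v) tie) xs \<and> ordered_complex W (r v) xs \<and>
    set ps = ordered_complex.long_pairs (r v) xs TYPE('k) l \<epsilon> \<and> sorted_wrt (\<lambda>p q. fst p < fst q) ps \<and>
    set es = ordered_complex.essentials xs TYPE('k) l \<and> sorted_wrt (<) es \<and>
    f v = map (r v) (concat (map (\<lambda>(i, j). [xs ! i, xs ! j]) ps) @ map ((!) xs) es)" if v: "v \<in> Ob" for v
  proof -
    have W: "face_closed W" "\<And>\<sigma>. \<sigma> \<in> W \<Longrightarrow> 0 \<le> r v \<sigma>"
      "\<And>\<sigma> \<tau>. \<sigma> \<in> W \<Longrightarrow> \<tau> \<in> W \<Longrightarrow> \<tau> \<subset> \<sigma> \<Longrightarrow> r v \<tau> \<le> r v \<sigma>"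
      using mb[OF v] unfolding monotone_births_def by blast+
    show ?thesis by (rule persistence_vector_unfold[OF f[OF v] W tie]) blast+
  qed
  from unfold[OF Ob(2)] obtain xs ps es where xs: "set xs = W" "sorted_wrt (simplex_less (r u) tie) xs"
    and oc: "ordered_complex W (r u) xs"
    and ps: "set ps = ordered_complex.long_pairs (r u) xs TYPE('k) l \<epsilon>" "sorted_wrt (\<lambda>p q. fst p < fst q) ps"
    and es: "set es = ordered_complex.essentials xs TYPE('k) l" "sorted_wrt (<) es"
    by (elim exE conjE) (rule that)
  interpret ordered_complex W "r u" xs by (rule oc)
  define \<sigma>s where "\<sigma>s = concat (map (\<lambda>(i, j). [xs ! i, xs ! j]) ps) @ map ((!) xs) es"
  have "sorted_wrt (\<noteq>) ps" by (rule sorted_wrt_mono_rel[OF _ ps(2)]) auto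
  then have "distinct ps" by (induction ps) auto
  then have "length ps = s" using counts[OF Ob(2) xs] ps(1) distinct_card[of ps] by simp
  moreover have "distinct es" using es(2) by (simp add: strict_sorted_iff)
  then have "length es = t" using counts[OF Ob(2) xs] es(1) distinct_card[of es] by simp
  ultimately have len: "length \<sigma>s = 2 * s + t" by (simp add: \<sigma>s_def length_concat_pairs)
  have "i < length xs \<and> j < length xs" if "(i, j) \<in> set ps" for i j
    using that unfolding ps(1) long_pairs_def using low_less by auto
  moreover have "i < length xs" if "i \<in> set es" for i
    using that unfolding es(1) essentials_def by simp
  ultimately have sub: "set \<sigma>s \<subseteq> W" unfolding \<sigma>s_def xs(1)[symmetric] by fastforce
  have "\<forall>\<^sub>F v in nhds u. v \<in> Ob" using Ob by (rule eventually_nhds_in_open)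
  then have "\<forall>\<^sub>F v in nhds u. f v = map (r v) \<sigma>s"
    using eventually_simplex_less[OF ls, of tie] eventually_not_long[OF ls, of "2 * \<epsilon>"]
  proof eventually_elim
    case (elim v)
    from unfold[OF elim(1)] obtain xs' ps' es' where xs': "set xs' = W" "sorted_wrt (simplex_less (r v) tie) xs'"
      and oc': "ordered_complex W (r v) xs'"
      and ps': "set ps' = ordered_complex.long_pairs (r v) xs' TYPE('k) l \<epsilon>" "sorted_wrt (\<lambda>p q. fst p < fst q) ps'"
      and es': "set es' = ordered_complex.essentials xs' TYPE('k) l" "sorted_wrt (<) es'"
      and fv: "f v = map (r v) (concat (map (\<lambda>(i, j). [xs' ! i, xs' ! j]) ps') @ map ((!) xs') es')"
      by (elim exE conjE) (rule that)
    have "sorted_wrt (simplex_less (r u) tie) xs'"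
      by (rule sorted_wrt_mono_rel[OF _ xs'(2)]) (use elim(2) xs'(1) in auto)
    then have eq: "xs' = xs"
      by (intro sorted_wrt_unique[of xs' "simplex_less (r u) tie" xs] simplex_less_asym[OF tie]) (use xs xs' in auto)
    \<comment> \<open>\<open>lows\<close> depends on the list of simplices only, so with
      \<open>xs' = xs\<close> the two index sets can differ in the length condition alone. Equal
      cardinality then turns the inclusion into an equality.\<close>
    have "ordered_complex.long_pairs (r v) xs TYPE('k) l \<epsilon> \<subseteq> long_pairs TYPE('k) l \<epsilon>"
    proof
      fix p assume p: "p \<in> ordered_complex.long_pairs (r v) xs TYPE('k) l \<epsilon>"
      obtain i j where ij: "p = (i, j)" by (cases p)
      have *: "j < length xs" "i \<in> lows TYPE('k) (Suc j) - lows TYPE('k) j" "card (xs ! i) = Suc l"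
        "2 * \<epsilon> \<le> r v (xs ! j) - r v (xs ! i)"
        using p ordered_complex.long_pairs_iff[OF oc'[unfolded eq], of i j] unfolding ij by auto
      then have "xs ! i \<in> W" "xs ! j \<in> W" using low_less[of i "TYPE('k)" j] xs(1) nth_mem by blast+
      then have "2 * \<epsilon> \<le> r u (xs ! j) - r u (xs ! i)" using elim(3) *(4) by (meson not_less)
      then show "p \<in> long_pairs TYPE('k) l \<epsilon>" using * by (simp add: ij long_pairs_iff)
    qed
    then have "ordered_complex.long_pairs (r v) xs TYPE('k) l \<epsilon> = long_pairs TYPE('k) l \<epsilon>"
      using card_subset_eq[OF finite_long_pairs] counts[OF Ob(2) xs] counts[OF elim(1) xs'] eq by metis
    then have "ps' = ps"
      by (intro sorted_wrt_unique[of ps' "\<lambda>p q. fst p < fst q" ps]) (use ps ps' eq in auto)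
    moreover have "es' = es"
      by (intro sorted_wrt_unique[of es' "(<)" es]) (use es es' eq in auto)
    ultimately show ?case using fv by (simp add: eq \<sigma>s_def)
  qed
  then show ?thesis using len sub unfolding eventually_nhds by blast
qed

lemma persistence_vector_smooth:
  fixes W :: "'m::{finite, linorder} set set" and Ob :: "('l::finite, 'm) config set"
  assumes loc: "\<And>u. u \<in> Ob \<Longrightarrow>
      \<exists>N \<sigma>s. open N \<and> u \<in> N \<and> length \<sigma>s = n \<and> set \<sigma>s \<subseteq> W \<and> (\<forall>v\<in>N. f v = map (r v) \<sigma>s)"
    and ls: "\<And>u. u \<in> Ob \<Longrightarrow> locally_smooth_births W r u"
  shows "k < n \<Longrightarrow> smooth_on Ob (\<lambda>u. f u ! k)"
proof (rule smooth_on_local)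
  fix u assume k: "k < n" and u: "u \<in> Ob"
  obtain N \<sigma>s where N: "open N" "u \<in> N" "length \<sigma>s = n" "set \<sigma>s \<subseteq> W" "\<And>v. v \<in> N \<Longrightarrow> f v = map (r v) \<sigma>s"
    using loc[OF u] by blast
  then have "\<sigma>s ! k \<in> W" using k nth_mem by blast
  then obtain g N' where N': "open N'" "u \<in> N'" "smooth_on N' g" "\<And>v. v \<in> N' \<Longrightarrow> r v (\<sigma>s ! k) = g v"
    using ls[OF u] unfolding locally_smooth_births_def by blast
  have "smooth_on (N \<inter> N') (\<lambda>u. f u ! k)"
  proof (rule smooth_on_cong)
    show "open (N \<inter> N')" using N(1) N'(1) by blast
    show "g x = f x ! k" if "x \<in> N \<inter> N'" for x using that N N' k by simp
    show "smooth_on (N \<inter> N') g" by (rule smooth_on_subset[OF N'(3)]) blast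
  qed
  then show "\<exists>N. open N \<and> u \<in> N \<and> smooth_on N (\<lambda>u. f u ! k)"
    using N(1,2) N'(1,2) by (intro exI[of _ "N \<inter> N'"]) (simp add: open_Int)
qed

lemma mset_map_eq_permutation:
  assumes "mset (map g xs) = mset (map g ys)" "length xs = n" "length ys = n"
  shows "\<exists>p. p permutes {..<n} \<and> (\<forall>k<n. g (xs ! k) = g (ys ! p k))"
proof -
  obtain p where p: "p permutes {..<length (map g ys)}" "permute_list p (map g ys) = map g xs"
    using mset_eq_permutation[OF assms(1)] .
  have "g (xs ! k) = g (ys ! p k)" if "k < n" for k
  proof -
    have "p k < n" using permutes_in_image[OF p(1), of k] assms(3) that by simp
    then show ?thesis using arg_cong[OF p(2), of "\<lambda>zs. zs ! k"] permute_list_nth[OF p(1), of k] that assms(2,3) by simp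
  qed
  then show ?thesis using p(1) assms(3) by auto
qed

text \<open>Selecting the points with infinite death separates the two parts of the multiset
  equation. Each part yields a permutation that matches simplices of equal radius at
  \<open>u\<close>, and these have equal derivatives by
  \<open>locally_smooth_births_eq\<close>.\<close>

lemma same_diagram_same_derivatives:
  assumes ls: "locally_smooth_births W r u"
    and W: "\<forall>(\<sigma>, \<tau>) \<in> set ps \<union> set ps'. \<sigma> \<in> W \<and> \<tau> \<in> W" "set es \<union> set es' \<subseteq> W"
    and len: "length ps = s" "length ps' = s" "length es = t" "length es' = t"
    and eq: "mset (map (\<lambda>(\<sigma>, \<tau>). (ereal (r u \<sigma>), ereal (r u \<tau>))) ps) + mset (map (\<lambda>\<sigma>. (ereal (r u \<sigma>), \<infinity>)) es) =
      mset (map (\<lambda>(\<sigma>, \<tau>). (ereal (r u \<sigma>), ereal (r u \<tau>))) ps') + mset (map (\<lambda>\<sigma>. (ereal (r u \<sigma>), \<infinity>)) es')"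
  shows "\<exists>\<pi> \<rho>. \<pi> permutes {..<s} \<and> \<rho> permutes {..<t} \<and>
    (\<forall>k<s. same_derivative_at u (\<lambda>v. r v (fst (ps ! k))) (\<lambda>v. r v (fst (ps' ! \<pi> k))) \<and>
           same_derivative_at u (\<lambda>v. r v (snd (ps ! k))) (\<lambda>v. r v (snd (ps' ! \<pi> k)))) \<and>
    (\<forall>k<t. same_derivative_at u (\<lambda>v. r v (es ! k)) (\<lambda>v. r v (es' ! \<rho> k)))"
proof -
  define F where "F = (\<lambda>(\<sigma>, \<tau>). (ereal (r u \<sigma>), ereal (r u \<tau>)))"
  define G where "G = (\<lambda>\<sigma>. (ereal (r u \<sigma>), \<infinity> :: ereal))"
  have finF: "filter_mset (\<lambda>p. snd p = \<infinity>) (mset (map F zs)) = {#}"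
    "filter_mset (\<lambda>p. snd p \<noteq> \<infinity>) (mset (map F zs)) = mset (map F zs)" for zs
    by (induction zs) (auto simp: F_def)
  have finG: "filter_mset (\<lambda>p. snd p = \<infinity>) (mset (map G zs)) = mset (map G zs)"
    "filter_mset (\<lambda>p. snd p \<noteq> \<infinity>) (mset (map G zs)) = {#}" for zs
    by (induction zs) (auto simp: G_def)
  have eq': "mset (map F ps) + mset (map G es) = mset (map F ps') + mset (map G es')"
    using eq unfolding F_def G_def .
  have "mset (map F ps) = mset (map F ps')"
    using arg_cong[OF eq', of "filter_mset (\<lambda>p. snd p \<noteq> \<infinity>)"] unfolding filter_union_mset finF finG by simp
  from mset_map_eq_permutation[OF this len(1,2)]
  obtain \<pi> where \<pi>: "\<pi> permutes {..<s}" "\<And>k. k < s \<Longrightarrow> F (ps ! k) = F (ps' ! \<pi> k)" by blast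
  have "mset (map G es) = mset (map G es')"
    using arg_cong[OF eq', of "filter_mset (\<lambda>p. snd p = \<infinity>)"] unfolding filter_union_mset finF finG by simp
  from mset_map_eq_permutation[OF this len(3,4)]
  obtain \<rho> where \<rho>: "\<rho> permutes {..<t}" "\<And>k. k < t \<Longrightarrow> G (es ! k) = G (es' ! \<rho> k)" by blast
  have "same_derivative_at u (\<lambda>v. r v (fst (ps ! k))) (\<lambda>v. r v (fst (ps' ! \<pi> k))) \<and>
    same_derivative_at u (\<lambda>v. r v (snd (ps ! k))) (\<lambda>v. r v (snd (ps' ! \<pi> k)))" if k: "k < s" for k
  proof -
    have "ps ! k \<in> set ps" "ps' ! \<pi> k \<in> set ps'" using k len permutes_in_image[OF \<pi>(1), of k] by simp_all
    then have "fst (ps ! k) \<in> W" "snd (ps ! k) \<in> W" "fst (ps' ! \<pi> k) \<in> W" "snd (ps' ! \<pi> k) \<in> W"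
      using W(1) by (auto simp: split_beta)
    moreover have "r u (fst (ps ! k)) = r u (fst (ps' ! \<pi> k))" "r u (snd (ps ! k)) = r u (snd (ps' ! \<pi> k))"
      using \<pi>(2)[OF k] by (simp_all add: F_def split_beta)
    ultimately show ?thesis by (intro conjI locally_smooth_births_eq(2)[OF ls])
  qed
  moreover have "same_derivative_at u (\<lambda>v. r v (es ! k)) (\<lambda>v. r v (es' ! \<rho> k))" if k: "k < t" for k
  proof (rule locally_smooth_births_eq(2)[OF ls])
    have "es ! k \<in> set es" "es' ! \<rho> k \<in> set es'" using k len permutes_in_image[OF \<rho>(1), of k] by simp_all
    then show "es ! k \<in> W" "es' ! \<rho> k \<in> W" using W(2) by blast+
    show "r u (es ! k) = r u (es' ! \<rho> k)" using \<rho>(2)[OF k] by (simp add: G_def)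
  qed
  ultimately show ?thesis using \<pi>(1) \<rho>(1) by blast
qed

lemma open_hausdorff_ball:
  fixes u :: "('l::finite, 'm::finite) config"
  shows "open {v :: ('l, 'm) config. hausdorff_dist dist (cloud u) (cloud v) < \<epsilon>}"
proof -
  have eq: "{v :: ('l, 'm) config. hausdorff_dist dist (cloud u) (cloud v) < \<epsilon>} =
    (\<Inter>i. \<Union>j. {v. dist (u $ i) (v $ j) < \<epsilon>}) \<inter> (\<Inter>j. \<Union>i. {v. dist (u $ i) (v $ j) < \<epsilon>})"
    by (subst hausdorff_dist_less_iff) (auto simp: cloud_def)
  have "open {v :: ('l, 'm) config. dist (u $ i) (v $ j) < \<epsilon>}" for i j
    by (intro open_Collect_less continuous_intros)
  then show ?thesis unfolding eq by (intro open_Int open_INT open_UN) auto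
qed

lemma monotone_births_VR: "monotone_births {\<sigma>. \<sigma> \<noteq> {}} (VR_birth u)"
  by (simp add: monotone_births_def face_closed_def VR_birth_nonneg VR_birth_mono psubset_eq)

lemma monotone_births_Alp: "general_position u \<Longrightarrow> monotone_births (Del u) (Alp_birth u)"
  unfolding monotone_births_def using face_closed_Del Alp_birth_nonneg(1) Alp_birth_mono by blast

lemma Alp_long_bars:
  fixes u v :: "('l::finite, 'm::{finite, linorder}) config"
    and e g :: "nat \<Rightarrow> real \<Rightarrow> 'm set \<Rightarrow> 'k::field"
  assumes gp: "general_position u" "general_position v"
    and hd: "hausdorff_dist dist (cloud u) (cloud v) < \<epsilon>"
    and ps: "interval_decomposition l (Alp u) ps e" and qs: "interval_decomposition l (Alp v) qs g"
  shows "\<exists>a. 0 \<le> a \<and> a < \<epsilon> \<and> (\<forall>h\<ge>0. card (long_bars (2 * a + h) ps) \<le> card (long_bars h qs) \<and>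
    card (long_bars (2 * a + h) qs) \<le> card (long_bars h ps))"
proof (rule Cech_long_bars[OF hd])
  show "interval_decomposition l (selective u {}) ps e"
    by (rule interval_decomposition_homology_iso[OF ps]) (simp add: Alp_eq_selective[OF gp(1)] homology_iso_selective)
  show "interval_decomposition l (selective v {}) qs g"
    by (rule interval_decomposition_homology_iso[OF qs]) (simp add: Alp_eq_selective[OF gp(2)] homology_iso_selective)
qed

theorem proposition3p11:
  fixes ubar :: "('l::finite, 'm::{finite, linorder}) config"
    and X :: "('l, 'm) config \<Rightarrow> real \<Rightarrow> 'm set set"
    and r :: "('l, 'm) config \<Rightarrow> 'm set \<Rightarrow> real"
    and W :: "'m set set"
    and Ob Ot :: "('l, 'm) config set"
    and l s t :: nat
    and \<epsilon> :: real
    and Dbar :: diagram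
    and tie :: "'m set rel"
    and f :: "('l, 'm) config \<Rightarrow> real list"
  assumes setting:
    "(X = VR \<and> r = VR_birth \<and> W = {\<sigma>. \<sigma> \<noteq> {}} \<and> distinct_points ubar \<and>
        Ob = {u. gromov_hausdorff_dist (cloud ubar) (cloud u) < \<epsilon>} \<inter> U_VR)
     \<or>
     (X = Alp \<and> r = Alp_birth \<and> W = Del ubar \<and> CARD('l) = 3 \<and> ubar \<in> U_Alp \<and>
        open Ot \<and> ubar \<in> Ot \<and> (\<forall>u\<in>Ot. Del u = Del ubar) \<and>
        Ob = {u. hausdorff_dist dist (cloud ubar) (cloud u) < \<epsilon>} \<inter> Ot \<inter> U_Alp)"
    and Dbar: "Dbar = dgm TYPE('k::field) l (X ubar)"
    and eps: "0 < \<epsilon>" "ereal \<epsilon> < diagram_diag_dist Dbar / 2"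
    and s: "s = n_finite Dbar"
    and t: "t = n_infinite Dbar"
    and tie: "linear_order_on W tie"
    and f: "\<And>u. u \<in> Ob \<Longrightarrow> persistence_vector TYPE('k) l \<epsilon> tie W (r u) (f u)"
  shows "(\<forall>u\<in>Ob. length (f u) = 2 * s + t) \<and>
    (\<forall>k < 2 * s + t. smooth_on Ob (\<lambda>u. f u ! k)) \<and>
    (\<forall>u\<in>Ob. \<forall>ps ps' :: ('m set \<times> 'm set) list. \<forall>es es' :: 'm set list.
       (\<forall>(\<sigma>, \<tau>) \<in> set ps \<union> set ps'. \<sigma> \<in> W \<and> \<tau> \<in> W) \<longrightarrow>
       set es \<union> set es' \<subseteq> W \<longrightarrow>
       length ps = s \<longrightarrow> length ps' = s \<longrightarrow> length es = t \<longrightarrow> length es' = t \<longrightarrow>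
       truncate \<epsilon> (dgm TYPE('k) l (X u)) =
         mset (map (\<lambda>(\<sigma>, \<tau>). (ereal (r u \<sigma>), ereal (r u \<tau>))) ps) +
         mset (map (\<lambda>\<sigma>. (ereal (r u \<sigma>), \<infinity>)) es) \<longrightarrow>
       truncate \<epsilon> (dgm TYPE('k) l (X u)) =
         mset (map (\<lambda>(\<sigma>, \<tau>). (ereal (r u \<sigma>), ereal (r u \<tau>))) ps') +
         mset (map (\<lambda>\<sigma>. (ereal (r u \<sigma>), \<infinity>)) es') \<longrightarrow>
       (\<exists>\<pi> \<rho>. \<pi> permutes {..<s} \<and> \<rho> permutes {..<t} \<and>
          (\<forall>k<s. same_derivative_at u (\<lambda>v. r v (fst (ps ! k))) (\<lambda>v. r v (fst (ps' ! \<pi> k))) \<and>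
                 same_derivative_at u (\<lambda>v. r v (snd (ps ! k))) (\<lambda>v. r v (snd (ps' ! \<pi> k)))) \<and>
          (\<forall>k<t. same_derivative_at u (\<lambda>v. r v (es ! k)) (\<lambda>v. r v (es' ! \<rho> k)))))"
proof -
  let ?bars = "\<lambda>u. \<forall>ps (e :: nat \<Rightarrow> real \<Rightarrow> 'm set \<Rightarrow> 'k) qs (g :: nat \<Rightarrow> real \<Rightarrow> 'm set \<Rightarrow> 'k).
    interval_decomposition l (X ubar) ps e \<longrightarrow> interval_decomposition l (X u) qs g \<longrightarrow>
    (\<exists>a. 0 \<le> a \<and> a < \<epsilon> \<and> (\<forall>h\<ge>0. card (long_bars (2 * a + h) ps) \<le> card (long_bars h qs) \<and>
      card (long_bars (2 * a + h) qs) \<le> card (long_bars h ps)))"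
  \<comment> \<open>Everything that distinguishes the two cases is collected here.
    \<open>ubar\<close> is inserted because the Vietoris-Rips case does not put it in general
    position, so it need not belong to \<open>Ob\<close>.\<close>
  have props: "open Ob \<and> (\<forall>u\<in>insert ubar Ob. monotone_births W (r u) \<and> (\<forall>t>0. X u t = {\<sigma> \<in> W. r u \<sigma> < t})) \<and>
      (\<forall>u\<in>Ob. locally_smooth_births W r u \<and> ?bars u)"
    using setting
  proof (elim disjE conjE)
    assume eqs: "X = VR" "r = VR_birth" "W = {\<sigma>. \<sigma> \<noteq> {}}"
      and Ob: "Ob = {u. gromov_hausdorff_dist (cloud ubar) (cloud u) < \<epsilon>} \<inter> U_VR"
    have "open U_VR"
      using eventually_U_VR unfolding eventually_nhds by (subst open_subopen) (fastforce simp: subset_iff)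
    then have "open Ob" unfolding Ob by (intro open_Int open_gromov_hausdorff_ball)
    moreover have "?bars u" if "u \<in> Ob" for u
      by (intro allI impI, rule VR_long_bars) (use that in \<open>simp_all add: Ob eqs\<close>)
    moreover have "locally_smooth_births W r u" if "u \<in> Ob" for u
      using locally_smooth_VR_birth[of u] that by (simp add: Ob eqs)
    moreover have "monotone_births W (r u) \<and> (\<forall>t>0. X u t = {\<sigma> \<in> W. r u \<sigma> < t})" for u
      unfolding eqs using monotone_births_VR VR_sublevel by auto
    ultimately show ?thesis by simp
  next
    assume eqs: "X = Alp" "r = Alp_birth" "W = Del ubar" and l3: "CARD('l) = 3" and ubar: "ubar \<in> U_Alp" "ubar \<in> Ot"
      and Ot: "open Ot" "\<forall>u\<in>Ot. Del u = Del ubar"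
      and Ob: "Ob = {u. hausdorff_dist dist (cloud ubar) (cloud u) < \<epsilon>} \<inter> Ot \<inter> U_Alp"
    have Ot': "\<forall>v\<in>Ot. Del v = Del u" if "u \<in> Ot" for u using Ot(2) that by simp
    have gp: "general_position u" if "u \<in> U_Alp" for u using that by (simp add: U_Alp_iff)
    \<comment> \<open>Openness is proved for \<open>Ot \<inter> U_Alp\<close>, because the stability
      of attaching simplices uses that \<open>Del\<close> is constant on \<open>Ot\<close>.\<close>
    have "\<exists>T. open T \<and> u \<in> T \<and> T \<subseteq> Ot \<inter> U_Alp" if u: "u \<in> Ot \<inter> U_Alp" for u
    proof -
      have "\<forall>\<^sub>F v in nhds u. v \<in> U_Alp" using eventually_U_Alp[OF l3 _ Ot(1) _ Ot'] u by blast
      then obtain T where "open T" "u \<in> T" "\<forall>v\<in>T. v \<in> U_Alp" unfolding eventually_nhds by blast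
      then show ?thesis using Ot(1) u by (intro exI[of _ "T \<inter> Ot"]) (auto intro: open_Int)
    qed
    then have "open (Ot \<inter> U_Alp)" by (subst open_subopen) blast
    then have "open Ob" unfolding Ob Int_assoc by (rule open_Int[OF open_hausdorff_ball])
    moreover have "?bars u" if "u \<in> Ob" for u
      by (intro allI impI, rule Alp_long_bars[OF gp[OF ubar(1)] gp]) (use that in \<open>simp_all add: Ob eqs\<close>)
    moreover have "locally_smooth_births W r u" if "u \<in> Ob" for u
    proof -
      have u: "u \<in> U_Alp" "u \<in> Ot" using that unfolding Ob by simp_all
      show ?thesis
        unfolding eqs bspec[OF Ot(2) u(2), symmetric]
        by (rule locally_smooth_Alp_birth[OF l3 u(1) Ot(1) u(2) Ot'[OF u(2)]])
    qed
    moreover have "monotone_births W (r u) \<and> (\<forall>t>0. X u t = {\<sigma> \<in> W. r u \<sigma> < t})"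
      if "u \<in> insert ubar Ob" for u
    proof -
      have "u \<in> Ot" and u: "u \<in> U_Alp" using that ubar unfolding Ob by blast+
      have "Del u = Del ubar" by (rule bspec[OF Ot(2) \<open>u \<in> Ot\<close>])
      then show ?thesis
        unfolding eqs using monotone_births_Alp[OF gp[OF u]] Alp_sublevel[OF gp[OF u]] by simp
    qed
    ultimately show ?thesis by simp
  qed
  note Ob = conjunct1[OF props]
  have mb: "monotone_births W (r u)" and X: "\<And>t. 0 < t \<Longrightarrow> X u t = {\<sigma> \<in> W. r u \<sigma> < t}"
    if "u \<in> insert ubar Ob" for u
    using bspec[OF conjunct1[OF conjunct2[OF props]] that] by simp_all
  have ls: "locally_smooth_births W r u" and bars: "?bars u" if "u \<in> Ob" for u
    using bspec[OF conjunct2[OF conjunct2[OF props]] that] by (rule conjunct1, rule conjunct2)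
  have counts: "card (ordered_complex.long_pairs (r u) xs TYPE('k) l \<epsilon>) = s \<and>
      card (ordered_complex.essentials xs TYPE('k) l) = t"
    if u: "u \<in> Ob" and xs: "set xs = W" "sorted_wrt (simplex_less (r u) tie) xs" for u xs
  proof -
    have u': "ubar \<in> insert ubar Ob" "u \<in> insert ubar Ob" using u by simp_all
    note stable = stable_index_counts[OF mb[OF u'(1)] mb[OF u'(2)] tie X[OF u'(1)] X[OF u'(2)]
        bars[OF u, rule_format] eps(1) eps(2)[unfolded Dbar] xs]
    show ?thesis unfolding s t Dbar by (rule conjI[OF stable])
  qed
  have loc: "\<exists>N \<sigma>s. open N \<and> u \<in> N \<and> length \<sigma>s = 2 * s + t \<and> set \<sigma>s \<subseteq> W \<and> (\<forall>v\<in>N. f v = map (r v) \<sigma>s)"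
    if "u \<in> Ob" for u
    by (rule persistence_vector_locally[OF Ob that ls[OF that] tie mb f counts]) auto
  show ?thesis
  proof (intro conjI ballI allI impI)
    fix u assume "u \<in> Ob"
    from loc[OF this] show "length (f u) = 2 * s + t" by auto
  next
    fix k assume k: "k < 2 * s + t"
    from loc ls k show "smooth_on Ob (\<lambda>u. f u ! k)" by (rule persistence_vector_smooth)
  next
    fix u ps ps' es es'
    assume "u \<in> Ob" and W: "\<forall>(\<sigma>, \<tau>) \<in> set ps \<union> set ps'. \<sigma> \<in> W \<and> \<tau> \<in> W" "set es \<union> set es' \<subseteq> W"
      and len: "length ps = s" "length ps' = s" "length es = t" "length es' = t"
      and T: "truncate \<epsilon> (dgm TYPE('k) l (X u)) =
         mset (map (\<lambda>(\<sigma>, \<tau>). (ereal (r u \<sigma>), ereal (r u \<tau>))) ps) +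
         mset (map (\<lambda>\<sigma>. (ereal (r u \<sigma>), \<infinity>)) es)"
        "truncate \<epsilon> (dgm TYPE('k) l (X u)) =
         mset (map (\<lambda>(\<sigma>, \<tau>). (ereal (r u \<sigma>), ereal (r u \<tau>))) ps') +
         mset (map (\<lambda>\<sigma>. (ereal (r u \<sigma>), \<infinity>)) es')"
    show "\<exists>\<pi> \<rho>. \<pi> permutes {..<s} \<and> \<rho> permutes {..<t} \<and>
      (\<forall>k<s. same_derivative_at u (\<lambda>v. r v (fst (ps ! k))) (\<lambda>v. r v (fst (ps' ! \<pi> k))) \<and>
             same_derivative_at u (\<lambda>v. r v (snd (ps ! k))) (\<lambda>v. r v (snd (ps' ! \<pi> k)))) \<and>
      (\<forall>k<t. same_derivative_at u (\<lambda>v. r v (es ! k)) (\<lambda>v. r v (es' ! \<rho> k)))"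
      by (rule same_diagram_same_derivatives[OF ls[OF \<open>u \<in> Ob\<close>] W len trans[OF T(1)[symmetric] T(2)]])
  qed
qed

end
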